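(* The tensor functor $T$ from the category of $A_\infty$-algebras over $K$ to the category of differential modules with $\infty$-simplicial faces over $K$, given by $T((A,d,\pi_n))=(T(A),d,\widetilde\partial)$ and $T(f)=\widetilde f$, sends homotopy equivalent $A_\infty$-algebras to homotopy equivalent differential modules with $\infty$-simplicial faces. That is, if $(A,d,\pi_n)$ and $(A',d,\pi_n)$ are homotopy equivalent $A_\infty$-algebras, then $(T(A),d,\widetilde\partial)$ and $(T(A'),d,\widetilde\partial)$ are homotopy equivalent differential modules with $\infty$-simplicial faces.
   Context: **Conventions.** $K$ is a commutative ring with unity; all modules and maps are $K$-modules and $K$-linear maps. Tensor products of graded maps follow the Koszul rule: $(u\otimes v)(a\otimes b)=(-1)^{\deg(v)\deg(a)}u(a)\otimes v(b)$. A differential (bigraded) module $(X,d)$ is a bigraded module $X=\{X_{n,m}\}$, $n,m\ge0$, with $d:X_{*,\bullet}\to X_{*,\bullet-1}$, $d^2=0$. For a map $u$ between differential bigraded modules of bidegree $(a,b)$, $d(u)=du-(-1)^{a+b}ud$. For a permutation, $\mathrm{sign}(\sigma)\in\{0,1\}$ denotes its parity ($0$ for even, $1$ for odd). **Permuted tuples.** For $i_1<\dots<i_k$ nonnegative integers and $\sigma\in\Sigma_k$ (symmetric group), $\sigma$ permutes the components of $(i_1,\dots,i_k)$, giving $(\sigma(i_1),\dots,\sigma(i_k))$. Put $\widehat{\sigma(i_s)}=\sigma(i_s)-\alpha(\sigma(i_s))$, where $\alpha(\sigma(i_s))$ is the number of entries of $(\sigma(i_1),\dots,\sigma(i_k))$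 to the right of $\sigma(i_s)$ that are smaller than $\sigma(i_s)$. Let $I_\sigma$ (resp. $I'_\sigma$) be the set of all partitions of $(\widehat{\sigma(i_1)},\dots,\widehat{\sigma(i_k)})$ into two tuples $(\widehat{\sigma(i_1)},\dots,\widehat{\sigma(i_m)})$ and $(\widehat{\sigma(i_{m+1})},\dots,\widehat{\sigma(i_k)})$ with $1\le m\le k-1$ (resp. $0\le m\le k$), such that both tuples are strictly increasing. **Differential module with $\infty$-simplicial faces** $(X,d,\widetilde\partial)$: a differential module $(X,d)$ with maps $\widetilde\partial=\{\partial_{(i_1,\dots,i_k)}:X_{n,\bullet}\to X_{n-k,\bullet+k-1}\}$, $1\le k\le n$, $0\le i_1<\dots<i_k\le n$, such that $$d(\partial_{(i_1,\dots,i_k)})=\sum_{\sigma\in\Sigma_k}\sum_{I_\sigma}(-1)^{\mathrm{sign}(\sigma)+1}\partial_{(\widehat{\sigma(i_1)},\dots,\widehat{\sigma(i_m)})}\partial_{(\widehat{\sigma(i_{m+1})},\dots,\widehat{\sigma(i_k)})}.$$ **Morphism** $\widetilde f:(X,d,\widetilde\partial)\to(Y,d,\widetilde\partial)$: a family of maps $f_{(i_1,\dots,i_k)}:X_{n,\bullet}\to Y_{n-k,\bullet+k}$, $0\le k\le n$, $0\le i_1<\dots<i_k\le n$ (written $f_{(\,)}$ for $k=0$), such that $d(f_{(\,)})=0$ and for $k\ge1$ $$d(f_{(i_1,\dots,i_k)})=-\partial_{(i_1,\dots,i_k)}f_{(\,)}+f_{(\,)}\partial_{(i_1,\dots,i_k)}+\sum_{\sigma\in\Sigma_k}\sum_{I_\sigma}(-1)^{\mathrm{sign}(\sigma)+1}\Big(\partial_{(\widehat{\sigma(i_1)},\dots,\widehat{\sigma(i_m)})}f_{(\widehat{\sigma(i_{m+1})},\dots,\widehat{\sigma(i_k)})}-f_{(\widehat{\sigma(i_1)},\dots,\widehat{\sigma(i_m)})}\partial_{(\widehat{\sigma(i_{m+1})},\dots,\widehat{\sigma(i_k)})}\Big).$$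 Composition: $(gf)_{(i_1,\dots,i_k)}=\sum_{\sigma\in\Sigma_k}\sum_{I'_\sigma}(-1)^{\mathrm{sign}(\sigma)}g_{(\widehat{\sigma(i_1)},\dots,\widehat{\sigma(i_m)})}f_{(\widehat{\sigma(i_{m+1})},\dots,\widehat{\sigma(i_k)})}$, with $(gf)_{(\,)}=g_{(\,)}f_{(\,)}$. The identity morphism has $(1_X)_{(\,)}=1_X$ and all other components zero. **Homotopy** $\widetilde h:(X,d,\widetilde\partial)\to(Y,d,\widetilde\partial)$ between morphisms $\widetilde f,\widetilde g:(X,d,\widetilde\partial)\to(Y,d,\widetilde\partial)$: a family of maps $h_{(i_1,\dots,i_k)}:X_{n,\bullet}\to Y_{n-k,\bullet+k+1}$, $0\le k\le n$, $0\le i_1<\dots<i_k\le n$, such that $d(h_{(\,)})=f_{(\,)}-g_{(\,)}$ and for $k\ge1$ $$d(h_{(i_1,\dots,i_k)})=f_{(i_1,\dots,i_k)}-g_{(i_1,\dots,i_k)}-\partial_{(i_1,\dots,i_k)}h_{(\,)}-h_{(\,)}\partial_{(i_1,\dots,i_k)}+\sum_{\sigma\in\Sigma_k}\sum_{I_\sigma}(-1)^{\mathrm{sign}(\sigma)+1}\Big(\partial_{(\widehat{\sigma(i_1)},\dots,\widehat{\sigma(i_m)})}h_{(\widehat{\sigma(i_{m+1})},\dots,\widehat{\sigma(i_k)})}+h_{(\widehat{\sigma(i_1)},\dots,\widehat{\sigma(i_m)})}\partial_{(\widehat{\sigma(i_{m+1})},\dots,\widehat{\sigma(i_k)})}\Big).$$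 **$A_\infty$-algebra** $(A,d,\pi_n)$: a graded module $A=\{A_n\}_{n\ge0}$ with differential $d:A_\bullet\to A_{\bullet-1}$ and maps $\pi_n:(A^{\otimes(n+2)})_\bullet\to A_{\bullet+n}$, $n\ge0$, such that for all integers $n\ge-1$ $$d(\pi_{n+1})=\sum_{m=0}^n\sum_{t=1}^{m+2}(-1)^{t(n-m+1)+n+1}\pi_m(1^{\otimes(t-1)}\otimes\pi_{n-m}\otimes1^{\otimes(m-t+2)}),\quad d(\pi_{n+1})=d\pi_{n+1}+(-1)^n\pi_{n+1}d.$$ **Morphism of $A_\infty$-algebras** $f:(A,d,\pi_n)\to(A',d,\pi_n)$: maps $f_n:(A^{\otimes(n+1)})_\bullet\to A'_{\bullet+n}$, $n\ge0$, such that for all integers $n\ge-1$ $$d(f_{n+1})=\sum_{m=0}^n\sum_{t=1}^{m+1}(-1)^{t(n-m+1)+n+1}f_m(1^{\otimes(t-1)}\otimes\pi_{n-m}\otimes1^{\otimes(m-t+1)})-\sum_{m=0}^n\sum_{J_{n-m}}(-1)^{\varepsilon}\pi_m(f_{n_1}\otimes\dots\otimes f_{n_{m+2}}),$$ where $d(f_{n+1})=df_{n+1}+(-1)^nf_{n+1}d$, $J_{n-m}=\{n_1,\dots,n_{m+2}\ge0\mid n_1+\dots+n_{m+2}=n-m\}$, $\varepsilon=\sum_{i=1}^{m+1}(n_i+1)(n_{i+1}+\dots+n_{m+2})$. Composition: $(gf)_n=\sum_{m=0}^n\sum_{n_1,\dots,n_{m+1}\ge0,\ n_1+\dots+n_{m+1}=n-m}(-1)^{\varepsilon}g_m(f_{n_1}\otimes\dots\otimes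 f_{n_{m+1}})$ with $\varepsilon=\sum_{i=1}^m(n_i+1)(n_{i+1}+\dots+n_{m+1})$. The identity morphism has $(1_A)_0=1_A$ and $(1_A)_n=0$ for $n\ge1$. **Homotopy between morphisms of $A_\infty$-algebras** $f,g:(A,d,\pi_n)\to(A',d,\pi_n)$: maps $h_n:(A^{\otimes(n+1)})_\bullet\to A'_{\bullet+n+1}$, $n\ge0$, such that for all integers $n\ge-1$ $$d(h_{n+1})=f_{n+1}-g_{n+1}+\sum_{m=0}^n\sum_{t=1}^{m+1}(-1)^{t(n-m+1)+n}h_m(1^{\otimes(t-1)}\otimes\pi_{n-m}\otimes1^{\otimes(m-t+1)})+\sum_{m=0}^n\sum_{J_{n-m}}\sum_{i=1}^{m+2}(-1)^{\varrho}\pi_m(g_{n_1}\otimes\dots\otimes g_{n_{i-1}}\otimes h_{n_i}\otimes f_{n_{i+1}}\otimes\dots\otimes f_{n_{m+2}}),$$ where $d(h_{n+1})=dh_{n+1}+(-1)^{n+1}h_{n+1}d$, $J_{n-m}=\{n_1,\dots,n_{m+2}\ge0\mid n_1+\dots+n_{m+2}=n-m\}$, and $\varrho=m+\sum_{k=1}^{m+1}(n_k+1)(n_{k+1}+\dots+n_{m+2})+\sum_{s=1}^{i-1}n_s$. **Homotopy equivalence** (in either category, in the usual way): two objects $X,Y$ are homotopy equivalent if there are morphisms $f:X\to Y$ and $g:Y\to X$, a homotopy between $gf$ and $1_X$, and a homotopy between $fg$ and $1_Y$. **The tensor functor on objects.** $T(A)_{n,m}=(A^{\otimes n})_m$, $n,m\ge0$,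 with $d$ the usual tensor product differential, and $\widetilde\partial=\{\partial^n_{(i_1,\dots,i_k)}:T(A)_{n,q}\to T(A)_{n-k,q+k-1}\}$ ($1\le k\le n$, $0\le i_1<\dots<i_k\le n$) given by $\partial^n_{(i_1,\dots,i_k)}=(-1)^{k(q-1)}1^{\otimes(j-1)}\otimes\pi_{k-1}\otimes1^{\otimes(n-k-j)}$ if $(i_1,\dots,i_k)=(j,j+1,\dots,j+k-1)$ with $1\le j\le n-k$, and $\partial^n_{(i_1,\dots,i_k)}=0$ otherwise. $(T(A),d,\widetilde\partial)$ is a differential module with $\infty$-simplicial faces. **The tensor functor on morphisms.** For a morphism $f=\{f_n\}$ of $A_\infty$-algebras, $\widetilde f=\{f^n_{(i_1,\dots,i_k)}:T(A)_{n,q}\to T(A')_{n-k,q+k}\}$ is defined as follows. 1) For $k=0$: $f^n_{(\,)}=f_0^{\otimes n}$. 2) If $k\ge 1$ and $i_1=0$ or $i_k=n$: $f^n_{(i_1,\dots,i_k)}=0$. 3) Otherwise, write $(i_1,\dots,i_k)$ as a concatenation of $s$ maximal blocks of consecutive integers $(j^m_1,\dots,j^m_{n_m})$, $1\le m\le s$, of lengths $n_1,\dots,n_s\ge1$, put $k_1=j^1_1$, $k_i=j^i_1-j^{i-1}_{n_{i-1}}-1$ for $2\le i\le s$, $\gamma=\sum_{i=1}^{s-1}n_i(n_{i+1}+\dots+n_s)$, and $$f^n_{(i_1,\dots,i_k)}=(-1)^{k(q-1)+\gamma}f_0^{\otimes(k_1-1)}\otimes f_{n_1}\otimes f_0^{\otimes(k_2-1)}\otimes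 f_{n_2}\otimes\dots\otimes f_0^{\otimes(k_s-1)}\otimes f_{n_s}\otimes f_0^{\otimes(n-(k_1+\dots+k_s)-k)}.$$ *)

theory Defs
  imports "HOL-Algebra.Module" "HOL-Algebra.AbelCoset" "HOL-Combinatorics.Permutations"
begin

text \<open>
  The ground ring is a HOL-Algebra commutative ring \<open>R\<close>.  A graded module is a family of
  HOL-Algebra modules indexed by the degree, and a graded map is a family of functions indexed by
  the degree of the argument; only the values on carriers matter.  In a record of type
  \<^typ>\<open>('k, 'a) module\<close> the ring fields \<open>mult\<close> and \<open>one\<close> carry no information.
\<close>


section \<open>Linear maps, signs, differential modules\<close>

definition lin_maps ::
  "('k, 'r) ring_scheme \<Rightarrow> ('k, 'a) module \<Rightarrow> ('k, 'b) module \<Rightarrow> ('a \<Rightarrow> 'b) set" where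
  "lin_maps R M N = {u. u \<in> hom (add_monoid M) (add_monoid N) \<and>
     (\<forall>r\<in>carrier R. \<forall>x\<in>carrier M. u (r \<odot>\<^bsub>M\<^esub> x) = r \<odot>\<^bsub>N\<^esub> u x)}"

text \<open>\<open>signed M e x\<close> is $(-1)^e x$.\<close>

definition signed :: "('k, 'a) module \<Rightarrow> int \<Rightarrow> 'a \<Rightarrow> 'a" where
  "signed M e x = (if even e then x else \<ominus>\<^bsub>M\<^esub> x)"

text \<open>
  Degrees are natural numbers.  The map $d : A_0 \to A_{-1} = 0$ is represented by the zero map
  \<open>A 0 \<rightarrow> A (0 - 1) = A 0\<close>.
\<close>

definition diff_module ::
  "('k, 'r) ring_scheme \<Rightarrow> (nat \<Rightarrow> ('k, 'a) module) \<Rightarrow> (nat \<Rightarrow> 'a \<Rightarrow> 'a) \<Rightarrow> bool" where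
  "diff_module R A d \<longleftrightarrow>
     (\<forall>q. module R (A q)) \<and>
     (\<forall>q. d q \<in> lin_maps R (A q) (A (q - 1))) \<and>
     (\<forall>x\<in>carrier (A 0). d 0 x = \<zero>\<^bsub>A 0\<^esub>) \<and>
     (\<forall>q. \<forall>x\<in>carrier (A q). d (q - 1) (d q x) = \<zero>\<^bsub>A (q - 1 - 1)\<^esub>)"

text \<open>
  \<open>hom_diff M e dY u dX q x\<close> is $d(u)(x) = d(u(x)) - (-1)^e u(d(x))$ for \<open>u\<close> of total degree \<open>e\<close>
  and \<open>x\<close> of degree \<open>q\<close>.  Here \<open>dY\<close> is the differential at the degree of \<open>u q x\<close>, and \<open>M\<close> is the
  module containing the result.  For \<open>q = 0\<close> the second summand vanishes because $d(x) = 0$.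
\<close>

definition hom_diff ::
  "('k, 'y) module \<Rightarrow> int \<Rightarrow> ('y \<Rightarrow> 'y) \<Rightarrow> (nat \<Rightarrow> 'x \<Rightarrow> 'y) \<Rightarrow> (nat \<Rightarrow> 'x \<Rightarrow> 'x) \<Rightarrow> nat \<Rightarrow> 'x \<Rightarrow> 'y"
where
  "hom_diff M e dY u dX q x =
     (if q = 0 then dY (u q x) else dY (u q x) \<ominus>\<^bsub>M\<^esub> signed M e (u (q - 1) (dX q x)))"


section \<open>Tensor powers of a graded module\<close>

definition quot_module :: "('k, 'a) module \<Rightarrow> 'a set \<Rightarrow> ('k, 'a set) module" where
  "quot_module M N =
     \<lparr>carrier = a_rcosets\<^bsub>M\<^esub> N, monoid.mult = undefined, one = undefined, zero = N,
      add = set_add M, smult = (\<lambda>r C. \<Union>c\<in>C. N +>\<^bsub>M\<^esub> (r \<odot>\<^bsub>M\<^esub> c))\<rparr>"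

definition free_module :: "('k, 'r) ring_scheme \<Rightarrow> 'w set \<Rightarrow> ('k, 'w \<Rightarrow> 'k) module" where
  "free_module R W =
     \<lparr>carrier = {c. (\<forall>w. c w \<in> carrier R) \<and> (\<forall>w. w \<notin> W \<longrightarrow> c w = \<zero>\<^bsub>R\<^esub>) \<and>
                    finite {w. c w \<noteq> \<zero>\<^bsub>R\<^esub>}},
      monoid.mult = undefined, one = undefined, zero = (\<lambda>w. \<zero>\<^bsub>R\<^esub>),
      add = (\<lambda>c c' w. c w \<oplus>\<^bsub>R\<^esub> c' w), smult = (\<lambda>r c w. r \<otimes>\<^bsub>R\<^esub> c w)\<rparr>"

definition free_gen :: "('k, 'r) ring_scheme \<Rightarrow> 'w \<Rightarrow> 'w \<Rightarrow> 'k" where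
  "free_gen R w = (\<lambda>v. if v = w then \<one>\<^bsub>R\<^esub> else \<zero>\<^bsub>R\<^esub>)"

definition submodule_gen ::
  "('k, 'r) ring_scheme \<Rightarrow> ('k, 'a) module \<Rightarrow> 'a set \<Rightarrow> 'a set" where
  "submodule_gen R M S = \<Inter> {N. submodule N R M \<and> S \<subseteq> N}"

text \<open>
  The word \<open>[(q\<^sub>1, x\<^sub>1), \<dots>, (q\<^sub>n, x\<^sub>n)]\<close> with $x_i \in A_{q_i}$ stands for
  $x_1 \otimes \dots \otimes x_n$.  The degrees are recorded because carriers in different degrees
  may overlap.  $(A^{\otimes n})_q = \bigoplus_{q_1 + \dots + q_n = q} A_{q_1} \otimes \dots \otimes
  A_{q_n}$ is the free module on the words of length \<open>n\<close> and total degree \<open>q\<close>, modulo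
  multilinearity; in particular $(A^{\otimes 0})_0$ is the ground ring.
\<close>

type_synonym 'a word = "(nat \<times> 'a) list"

type_synonym ('k, 'a) tensor = "('a word \<Rightarrow> 'k) set"

definition wdeg :: "'a word \<Rightarrow> nat" where
  "wdeg w = sum_list (map fst w)"

definition words :: "(nat \<Rightarrow> ('k, 'a) module) \<Rightarrow> nat \<Rightarrow> nat \<Rightarrow> 'a word set" where
  "words A n q = {w. length w = n \<and> wdeg w = q \<and> (\<forall>(p, x)\<in>set w. x \<in> carrier (A p))}"

definition tensor_relators ::
  "('k, 'r) ring_scheme \<Rightarrow> (nat \<Rightarrow> ('k, 'a) module) \<Rightarrow> nat \<Rightarrow> nat \<Rightarrow> ('a word \<Rightarrow> 'k) set" where
  "tensor_relators R A n q =
     (let F = free_module R (words A n q) in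
       {free_gen R (u @ (p, x \<oplus>\<^bsub>A p\<^esub> y) # v)
          \<ominus>\<^bsub>F\<^esub> free_gen R (u @ (p, x) # v) \<ominus>\<^bsub>F\<^esub> free_gen R (u @ (p, y) # v) | u p x y v.
          u @ (p, x) # v \<in> words A n q \<and> y \<in> carrier (A p)} \<union>
       {free_gen R (u @ (p, r \<odot>\<^bsub>A p\<^esub> x) # v)
          \<ominus>\<^bsub>F\<^esub> r \<odot>\<^bsub>F\<^esub> free_gen R (u @ (p, x) # v) | u p r x v.
          u @ (p, x) # v \<in> words A n q \<and> r \<in> carrier R})"

definition tensor_null ::
  "('k, 'r) ring_scheme \<Rightarrow> (nat \<Rightarrow> ('k, 'a) module) \<Rightarrow> nat \<Rightarrow> nat \<Rightarrow> ('a word \<Rightarrow> 'k) set" where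
  "tensor_null R A n q =
     submodule_gen R (free_module R (words A n q)) (tensor_relators R A n q)"

definition tensor_power ::
  "('k, 'r) ring_scheme \<Rightarrow> (nat \<Rightarrow> ('k, 'a) module) \<Rightarrow> nat \<Rightarrow> nat \<Rightarrow> ('k, ('k, 'a) tensor) module"
where
  "tensor_power R A n q = quot_module (free_module R (words A n q)) (tensor_null R A n q)"

definition pure_tensor ::
  "('k, 'r) ring_scheme \<Rightarrow> (nat \<Rightarrow> ('k, 'a) module) \<Rightarrow> 'a word \<Rightarrow> ('k, 'a) tensor" where
  "pure_tensor R A w =
     tensor_null R A (length w) (wdeg w)
       +>\<^bsub>free_module R (words A (length w) (wdeg w))\<^esub> free_gen R w"

text \<open>
  The linear map $(A^{\otimes n})_q \to M$ with value \<open>\<phi> w\<close> on the pure tensor of each word \<open>w\<close>.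
  If \<open>\<phi>\<close> is multilinear, the chosen representative \<open>c\<close> of the class \<open>z\<close> is irrelevant.
\<close>

definition tensor_lift ::
  "('k, 'r) ring_scheme \<Rightarrow> ('k, 'm) module \<Rightarrow> ('a word \<Rightarrow> 'm) \<Rightarrow> ('k, 'a) tensor \<Rightarrow> 'm" where
  "tensor_lift R M \<phi> z =
     (let c = (SOME c. c \<in> z) in \<Oplus>\<^bsub>M\<^esub>w\<in>{w. c w \<noteq> \<zero>\<^bsub>R\<^esub>}. c w \<odot>\<^bsub>M\<^esub> \<phi> w)"

text \<open>
  $d(x_1 \otimes \dots \otimes x_n) = \sum_i (-1)^{q_1 + \dots + q_{i-1}}
  x_1 \otimes \dots \otimes d(x_i) \otimes \dots \otimes x_n$, where the summands with $q_i = 0$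
  vanish and are left out.
\<close>

definition tensor_diff ::
  "('k, 'r) ring_scheme \<Rightarrow> (nat \<Rightarrow> ('k, 'a) module) \<Rightarrow> (nat \<Rightarrow> 'a \<Rightarrow> 'a) \<Rightarrow>
   nat \<Rightarrow> nat \<Rightarrow> ('k, 'a) tensor \<Rightarrow> ('k, 'a) tensor" where
  "tensor_diff R A d n q =
     (let M = tensor_power R A n (q - 1) in
       tensor_lift R M
         (\<lambda>w. \<Oplus>\<^bsub>M\<^esub>i\<in>{i. i < n \<and> 0 < fst (w ! i)}.
            signed M (int (wdeg (take i w)))
              (pure_tensor R A (w[i := (fst (w ! i) - 1, d (fst (w ! i)) (snd (w ! i)))]))))"

text \<open>
  A triple \<open>(p, e, u)\<close> is a graded map $u : (A^{\otimes p})_\bullet \to B_{\bullet + e}$.  For a list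
  of such triples, \<open>tensor_maps\<close> is $u_1 \otimes \dots \otimes u_r : A^{\otimes (p_1 + \dots + p_r)}
  \to B^{\otimes r}$.  On a pure tensor the word is cut into blocks $w_1, \dots, w_r$ of lengths
  $p_1, \dots, p_r$, and the Koszul rule gives the sign exponent $\sum_{i<j} e_j \deg(w_i)$.
\<close>

type_synonym ('k, 'a, 'b) multi_map = "nat \<times> nat \<times> (nat \<Rightarrow> ('k, 'a) tensor \<Rightarrow> 'b)"

fun apply_maps ::
  "('k, 'r) ring_scheme \<Rightarrow> (nat \<Rightarrow> ('k, 'a) module) \<Rightarrow> ('k, 'a, 'b) multi_map list \<Rightarrow>
   'a word \<Rightarrow> 'b word" where
  "apply_maps R A [] w = []"
| "apply_maps R A ((p, e, u) # us) w =
     (wdeg (take p w) + e, u (wdeg (take p w)) (pure_tensor R A (take p w)))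
       # apply_maps R A us (drop p w)"

fun koszul_exp :: "('k, 'a, 'b) multi_map list \<Rightarrow> 'a word \<Rightarrow> nat" where
  "koszul_exp [] w = 0"
| "koszul_exp ((p, e, u) # us) w =
     wdeg (take p w) * (\<Sum>(p', e', u')\<leftarrow>us. e') + koszul_exp us (drop p w)"

definition tensor_maps ::
  "('k, 'r) ring_scheme \<Rightarrow> (nat \<Rightarrow> ('k, 'a) module) \<Rightarrow> (nat \<Rightarrow> ('k, 'b) module) \<Rightarrow>
   ('k, 'a, 'b) multi_map list \<Rightarrow> nat \<Rightarrow> ('k, 'a) tensor \<Rightarrow> ('k, 'b) tensor" where
  "tensor_maps R A B us q =
     (let M = tensor_power R B (length us) (q + (\<Sum>(p, e, u)\<leftarrow>us. e)) in
       tensor_lift R M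
         (\<lambda>w. signed M (int (koszul_exp us w)) (pure_tensor R B (apply_maps R A us w))))"

text \<open>The canonical isomorphism $A^{\otimes 1} \to A$, which plays the role of $1$ in tensor
  products of maps.\<close>

definition unit_map ::
  "('k, 'r) ring_scheme \<Rightarrow> (nat \<Rightarrow> ('k, 'a) module) \<Rightarrow> nat \<Rightarrow> ('k, 'a) tensor \<Rightarrow> 'a" where
  "unit_map R A q = tensor_lift R (A q) (\<lambda>w. snd (hd w))"

definition one_m ::
  "('k, 'r) ring_scheme \<Rightarrow> (nat \<Rightarrow> ('k, 'a) module) \<Rightarrow> ('k, 'a, 'a) multi_map" where
  "one_m R A = (1, 0, unit_map R A)"


section \<open>$A_\infty$-algebras\<close>

text \<open>\<open>a_op A n q\<close> is $\pi_n : (A^{\otimes (n+2)})_q \to A_{q+n}$.\<close>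

record ('k, 'a) ainf =
  a_mod :: "nat \<Rightarrow> ('k, 'a) module"
  a_diff :: "nat \<Rightarrow> 'a \<Rightarrow> 'a"
  a_op :: "nat \<Rightarrow> nat \<Rightarrow> ('k, 'a) tensor \<Rightarrow> 'a"

definition op_m :: "('k, 'a) ainf \<Rightarrow> nat \<Rightarrow> ('k, 'a, 'a) multi_map" where
  "op_m A n = (n + 2, n, a_op A n)"

text \<open>
  The components $f_n : (A^{\otimes (n+1)})_\bullet \to A'_{\bullet+n}$ of a morphism and
  $h_n : (A^{\otimes (n+1)})_\bullet \to A'_{\bullet+n+1}$ of a homotopy, as factors of tensor products.
\<close>

definition mor_m :: "(nat \<Rightarrow> nat \<Rightarrow> ('k, 'a) tensor \<Rightarrow> 'b) \<Rightarrow> nat \<Rightarrow> ('k, 'a, 'b) multi_map" where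
  "mor_m f n = (n + 1, n, f n)"

definition hty_m :: "(nat \<Rightarrow> nat \<Rightarrow> ('k, 'a) tensor \<Rightarrow> 'b) \<Rightarrow> nat \<Rightarrow> ('k, 'a, 'b) multi_map" where
  "hty_m h n = (n + 1, n + 1, h n)"

text \<open>The Stasheff-type relations for $d(\pi_{n+1})$, $d(f_{n+1})$, $d(h_{n+1})$ with $n \ge -1$ are
  written with \<open>N = n + 1 \<ge> 0\<close>, so \<open>m = 0, \<dots>, n\<close> becomes \<open>m < N\<close> and $n - m$ becomes \<open>N - 1 - m\<close>.
  The signs in $d(\pi_{n+1}) = d\pi_{n+1} + (-1)^n \pi_{n+1}d$ and its analogues are those of
  \<open>hom_diff\<close>, since $-(-1)^N = (-1)^n$.\<close>

definition is_ainf :: "('k, 'r) ring_scheme \<Rightarrow> ('k, 'a) ainf \<Rightarrow> bool" where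
  "is_ainf R A \<longleftrightarrow>
     diff_module R (a_mod A) (a_diff A) \<and>
     (\<forall>n q. a_op A n q \<in> lin_maps R (tensor_power R (a_mod A) (n + 2) q) (a_mod A (q + n))) \<and>
     (\<forall>N q. \<forall>x\<in>carrier (tensor_power R (a_mod A) (N + 2) q).
        (let M = a_mod A (q + N - 1) in
          hom_diff M (int N) (a_diff A (q + N)) (a_op A N)
              (tensor_diff R (a_mod A) (a_diff A) (N + 2)) q x =
            (\<Oplus>\<^bsub>M\<^esub>m\<in>{..<N}. \<Oplus>\<^bsub>M\<^esub>t\<in>{1..m + 2}.
               signed M (int (t * (N - m) + N))
                 (a_op A m (q + (N - 1 - m))
                   (tensor_maps R (a_mod A) (a_mod A)
                     (replicate (t - 1) (one_m R (a_mod A)) @ [op_m A (N - 1 - m)] @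
                      replicate (m + 2 - t) (one_m R (a_mod A))) q x)))))"

definition sum_tuples :: "nat \<Rightarrow> nat \<Rightarrow> nat list set" where
  "sum_tuples r s = {ns. length ns = r \<and> sum_list ns = s}"

text \<open>$\varepsilon = \sum_{i=1}^{r-1} (n_i + 1)(n_{i+1} + \dots + n_r)$ for a tuple of length $r$.\<close>

definition eps :: "nat list \<Rightarrow> nat" where
  "eps ns = (\<Sum>i<length ns - 1. (ns ! i + 1) * sum_list (drop (i + 1) ns))"

definition ainf_morphism ::
  "('k, 'r) ring_scheme \<Rightarrow> ('k, 'a) ainf \<Rightarrow> ('k, 'b) ainf \<Rightarrow>
   (nat \<Rightarrow> nat \<Rightarrow> ('k, 'a) tensor \<Rightarrow> 'b) \<Rightarrow> bool" where
  "ainf_morphism R A B f \<longleftrightarrow>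
     (\<forall>n q. f n q \<in> lin_maps R (tensor_power R (a_mod A) (n + 1) q) (a_mod B (q + n))) \<and>
     (\<forall>N q. \<forall>x\<in>carrier (tensor_power R (a_mod A) (N + 1) q).
        (let M = a_mod B (q + N - 1) in
          hom_diff M (int N) (a_diff B (q + N)) (f N)
              (tensor_diff R (a_mod A) (a_diff A) (N + 1)) q x =
            (\<Oplus>\<^bsub>M\<^esub>m\<in>{..<N}. \<Oplus>\<^bsub>M\<^esub>t\<in>{1..m + 1}.
               signed M (int (t * (N - m) + N))
                 (f m (q + (N - 1 - m))
                   (tensor_maps R (a_mod A) (a_mod A)
                     (replicate (t - 1) (one_m R (a_mod A)) @ [op_m A (N - 1 - m)] @
                      replicate (m + 1 - t) (one_m R (a_mod A))) q x)))
            \<ominus>\<^bsub>M\<^esub>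
            (\<Oplus>\<^bsub>M\<^esub>m\<in>{..<N}. \<Oplus>\<^bsub>M\<^esub>ns\<in>sum_tuples (m + 2) (N - 1 - m).
               signed M (int (eps ns))
                 (a_op B m (q + (N - 1 - m))
                   (tensor_maps R (a_mod A) (a_mod B) (map (mor_m f) ns) q x)))))"

definition ainf_comp ::
  "('k, 'r) ring_scheme \<Rightarrow> ('k, 'a) ainf \<Rightarrow> ('k, 'b) ainf \<Rightarrow> ('k, 'c) ainf \<Rightarrow>
   (nat \<Rightarrow> nat \<Rightarrow> ('k, 'b) tensor \<Rightarrow> 'c) \<Rightarrow> (nat \<Rightarrow> nat \<Rightarrow> ('k, 'a) tensor \<Rightarrow> 'b) \<Rightarrow>
   nat \<Rightarrow> nat \<Rightarrow> ('k, 'a) tensor \<Rightarrow> 'c" where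
  "ainf_comp R A B C g f n q x =
     (let M = a_mod C (q + n) in
       \<Oplus>\<^bsub>M\<^esub>m\<in>{..n}. \<Oplus>\<^bsub>M\<^esub>ns\<in>sum_tuples (m + 1) (n - m).
         signed M (int (eps ns))
           (g m (q + (n - m)) (tensor_maps R (a_mod A) (a_mod B) (map (mor_m f) ns) q x)))"

definition ainf_id ::
  "('k, 'r) ring_scheme \<Rightarrow> ('k, 'a) ainf \<Rightarrow> nat \<Rightarrow> nat \<Rightarrow> ('k, 'a) tensor \<Rightarrow> 'a" where
  "ainf_id R A n q x = (if n = 0 then unit_map R (a_mod A) q x else \<zero>\<^bsub>a_mod A (q + n)\<^esub>)"

definition ainf_homotopy ::
  "('k, 'r) ring_scheme \<Rightarrow> ('k, 'a) ainf \<Rightarrow> ('k, 'b) ainf \<Rightarrow>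
   (nat \<Rightarrow> nat \<Rightarrow> ('k, 'a) tensor \<Rightarrow> 'b) \<Rightarrow> (nat \<Rightarrow> nat \<Rightarrow> ('k, 'a) tensor \<Rightarrow> 'b) \<Rightarrow>
   (nat \<Rightarrow> nat \<Rightarrow> ('k, 'a) tensor \<Rightarrow> 'b) \<Rightarrow> bool" where
  "ainf_homotopy R A B f g h \<longleftrightarrow>
     (\<forall>n q. h n q \<in> lin_maps R (tensor_power R (a_mod A) (n + 1) q) (a_mod B (q + n + 1))) \<and>
     (\<forall>N q. \<forall>x\<in>carrier (tensor_power R (a_mod A) (N + 1) q).
        (let M = a_mod B (q + N) in
          hom_diff M (int N + 1) (a_diff B (q + N + 1)) (h N)
              (tensor_diff R (a_mod A) (a_diff A) (N + 1)) q x =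
            (f N q x \<ominus>\<^bsub>M\<^esub> g N q x)
            \<oplus>\<^bsub>M\<^esub>
            (\<Oplus>\<^bsub>M\<^esub>m\<in>{..<N}. \<Oplus>\<^bsub>M\<^esub>t\<in>{1..m + 1}.
               signed M (int (t * (N - m)) + int N - 1)
                 (h m (q + (N - 1 - m))
                   (tensor_maps R (a_mod A) (a_mod A)
                     (replicate (t - 1) (one_m R (a_mod A)) @ [op_m A (N - 1 - m)] @
                      replicate (m + 1 - t) (one_m R (a_mod A))) q x)))
            \<oplus>\<^bsub>M\<^esub>
            (\<Oplus>\<^bsub>M\<^esub>m\<in>{..<N}. \<Oplus>\<^bsub>M\<^esub>ns\<in>sum_tuples (m + 2) (N - 1 - m). \<Oplus>\<^bsub>M\<^esub>i\<in>{1..m + 2}.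
               signed M (int (m + eps ns + sum_list (take (i - 1) ns)))
                 (a_op B m (q + (N - 1 - m) + 1)
                   (tensor_maps R (a_mod A) (a_mod B)
                     (map (mor_m g) (take (i - 1) ns) @ [hty_m h (ns ! (i - 1))] @
                      map (mor_m f) (drop i ns)) q x)))))"

definition ainf_homotopy_equivalent ::
  "('k, 'r) ring_scheme \<Rightarrow> ('k, 'a) ainf \<Rightarrow> ('k, 'b) ainf \<Rightarrow> bool" where
  "ainf_homotopy_equivalent R A B \<longleftrightarrow>
     (\<exists>f g. ainf_morphism R A B f \<and> ainf_morphism R B A g \<and>
        (\<exists>h. ainf_homotopy R A A (ainf_comp R A B A g f) (ainf_id R A) h) \<and>
        (\<exists>h. ainf_homotopy R B B (ainf_comp R B A B f g) (ainf_id R B) h))"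


section \<open>Differential modules with $\infty$-simplicial faces\<close>

text \<open>\<open>s_face X I n q\<close> is $\partial_I : X_{n,q} \to X_{n-k,q+k-1}$ with $k$ the length of $I$.\<close>

record ('k, 'x) isf =
  s_mod :: "nat \<Rightarrow> nat \<Rightarrow> ('k, 'x) module"
  s_diff :: "nat \<Rightarrow> nat \<Rightarrow> 'x \<Rightarrow> 'x"
  s_face :: "nat list \<Rightarrow> nat \<Rightarrow> nat \<Rightarrow> 'x \<Rightarrow> 'x"

text \<open>The tuples $0 \le i_1 < \dots < i_k \le n$ with $0 \le k \le n$.  Note that $k = n + 1$ is
  excluded.\<close>

definition index_tuples :: "nat \<Rightarrow> nat list set" where
  "index_tuples n = {I. sorted_wrt (<) I \<and> set I \<subseteq> {0..n} \<and> length I \<le> n}"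

definition hats :: "nat list \<Rightarrow> nat list" where
  "hats J = map (\<lambda>s. J ! s - card {t. s < t \<and> t < length J \<and> J ! t < J ! s}) [0..<length J]"

text \<open>
  Pairs of a permutation $\sigma$ and a cut $m$ giving an element of $I_\sigma$
  (\<open>inner_splits\<close>, both parts nonempty) or of $I'_\sigma$ (\<open>all_splits\<close>).
\<close>

definition all_splits :: "nat list \<Rightarrow> ((nat \<Rightarrow> nat) \<times> nat) set" where
  "all_splits I = {(\<sigma>, m). \<sigma> permutes {..<length I} \<and> m \<le> length I \<and>
     sorted_wrt (<) (take m (hats (permute_list \<sigma> I))) \<and>
     sorted_wrt (<) (drop m (hats (permute_list \<sigma> I)))}"

definition inner_splits :: "nat list \<Rightarrow> ((nat \<Rightarrow> nat) \<times> nat) set" where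
  "inner_splits I = {(\<sigma>, m) \<in> all_splits I. 1 \<le> m \<and> m < length I}"

text \<open>
  $\sum_\sigma \sum (-1)^{\mathrm{sign}(\sigma) + e} \phi(J, L)$ over a set \<open>S\<close> of splittings into
  a left tuple \<open>J\<close> and a right tuple \<open>L\<close>.
\<close>

definition split_sum ::
  "('k, 'x) module \<Rightarrow> int \<Rightarrow> ((nat \<Rightarrow> nat) \<times> nat) set \<Rightarrow> nat list \<Rightarrow>
   (nat list \<Rightarrow> nat list \<Rightarrow> 'x) \<Rightarrow> 'x" where
  "split_sum M e S I \<phi> =
     finsum M (\<lambda>(\<sigma>, m). signed M ((if evenperm \<sigma> then 0 else 1) + e)
       (\<phi> (take m (hats (permute_list \<sigma> I))) (drop m (hats (permute_list \<sigma> I))))) S"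

definition is_isf :: "('k, 'r) ring_scheme \<Rightarrow> ('k, 'x) isf \<Rightarrow> bool" where
  "is_isf R X \<longleftrightarrow>
     (\<forall>n. diff_module R (s_mod X n) (s_diff X n)) \<and>
     (\<forall>n q. \<forall>I\<in>index_tuples n. I \<noteq> [] \<longrightarrow>
        s_face X I n q \<in> lin_maps R (s_mod X n q) (s_mod X (n - length I) (q + length I - 1))) \<and>
     (\<forall>n q. \<forall>I\<in>index_tuples n. I \<noteq> [] \<longrightarrow> (\<forall>x\<in>carrier (s_mod X n q).
        (let k = length I; M = s_mod X (n - k) (q + k - 2) in
          hom_diff M (- 1) (s_diff X (n - k) (q + k - 1)) (s_face X I n) (s_diff X n) q x =
            split_sum M 1 (inner_splits I) I
              (\<lambda>J L. s_face X J (n - length L) (q + length L - 1) (s_face X L n q x)))))"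

definition isf_morphism ::
  "('k, 'r) ring_scheme \<Rightarrow> ('k, 'x) isf \<Rightarrow> ('k, 'y) isf \<Rightarrow>
   (nat list \<Rightarrow> nat \<Rightarrow> nat \<Rightarrow> 'x \<Rightarrow> 'y) \<Rightarrow> bool" where
  "isf_morphism R X Y f \<longleftrightarrow>
     (\<forall>n q. \<forall>I\<in>index_tuples n.
        f I n q \<in> lin_maps R (s_mod X n q) (s_mod Y (n - length I) (q + length I))) \<and>
     (\<forall>n q. \<forall>x\<in>carrier (s_mod X n q).
        hom_diff (s_mod Y n (q - 1)) 0 (s_diff Y n q) (f [] n) (s_diff X n) q x =
          \<zero>\<^bsub>s_mod Y n (q - 1)\<^esub>) \<and>
     (\<forall>n q. \<forall>I\<in>index_tuples n. I \<noteq> [] \<longrightarrow> (\<forall>x\<in>carrier (s_mod X n q).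
        (let k = length I; M = s_mod Y (n - k) (q + k - 1) in
          hom_diff M 0 (s_diff Y (n - k) (q + k)) (f I n) (s_diff X n) q x =
            (\<ominus>\<^bsub>M\<^esub> (s_face Y I n q (f [] n q x)))
            \<oplus>\<^bsub>M\<^esub> f [] (n - k) (q + k - 1) (s_face X I n q x)
            \<oplus>\<^bsub>M\<^esub> split_sum M 1 (inner_splits I) I
              (\<lambda>J L. s_face Y J (n - length L) (q + length L) (f L n q x)
                 \<ominus>\<^bsub>M\<^esub> f J (n - length L) (q + length L - 1) (s_face X L n q x)))))"

text \<open>For the empty tuple the only splitting is the trivial one, so this also gives
  $(gf)_{()} = g_{()} f_{()}$.\<close>

definition isf_comp ::
  "('k, 'z) isf \<Rightarrow> (nat list \<Rightarrow> nat \<Rightarrow> nat \<Rightarrow> 'y \<Rightarrow> 'z) \<Rightarrow> (nat list \<Rightarrow> nat \<Rightarrow> nat \<Rightarrow> 'x \<Rightarrow> 'y) \<Rightarrow>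
   nat list \<Rightarrow> nat \<Rightarrow> nat \<Rightarrow> 'x \<Rightarrow> 'z" where
  "isf_comp Z g f I n q x =
     split_sum (s_mod Z (n - length I) (q + length I)) 0 (all_splits I) I
       (\<lambda>J L. g J (n - length L) (q + length L) (f L n q x))"

definition isf_id :: "('k, 'x) isf \<Rightarrow> nat list \<Rightarrow> nat \<Rightarrow> nat \<Rightarrow> 'x \<Rightarrow> 'x" where
  "isf_id X I n q x = (if I = [] then x else \<zero>\<^bsub>s_mod X (n - length I) (q + length I)\<^esub>)"

definition isf_homotopy ::
  "('k, 'r) ring_scheme \<Rightarrow> ('k, 'x) isf \<Rightarrow> ('k, 'y) isf \<Rightarrow>
   (nat list \<Rightarrow> nat \<Rightarrow> nat \<Rightarrow> 'x \<Rightarrow> 'y) \<Rightarrow> (nat list \<Rightarrow> nat \<Rightarrow> nat \<Rightarrow> 'x \<Rightarrow> 'y) \<Rightarrow>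
   (nat list \<Rightarrow> nat \<Rightarrow> nat \<Rightarrow> 'x \<Rightarrow> 'y) \<Rightarrow> bool" where
  "isf_homotopy R X Y f g h \<longleftrightarrow>
     (\<forall>n q. \<forall>I\<in>index_tuples n.
        h I n q \<in> lin_maps R (s_mod X n q) (s_mod Y (n - length I) (q + length I + 1))) \<and>
     (\<forall>n q. \<forall>x\<in>carrier (s_mod X n q).
        hom_diff (s_mod Y n q) 1 (s_diff Y n (q + 1)) (h [] n) (s_diff X n) q x =
          f [] n q x \<ominus>\<^bsub>s_mod Y n q\<^esub> g [] n q x) \<and>
     (\<forall>n q. \<forall>I\<in>index_tuples n. I \<noteq> [] \<longrightarrow> (\<forall>x\<in>carrier (s_mod X n q).
        (let k = length I; M = s_mod Y (n - k) (q + k) in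
          hom_diff M 1 (s_diff Y (n - k) (q + k + 1)) (h I n) (s_diff X n) q x =
            (f I n q x \<ominus>\<^bsub>M\<^esub> g I n q x
              \<ominus>\<^bsub>M\<^esub> s_face Y I n (q + 1) (h [] n q x)
              \<ominus>\<^bsub>M\<^esub> h [] (n - k) (q + k - 1) (s_face X I n q x))
            \<oplus>\<^bsub>M\<^esub> split_sum M 1 (inner_splits I) I
              (\<lambda>J L. s_face Y J (n - length L) (q + length L + 1) (h L n q x)
                 \<oplus>\<^bsub>M\<^esub> h J (n - length L) (q + length L - 1) (s_face X L n q x)))))"

definition isf_homotopy_equivalent ::
  "('k, 'r) ring_scheme \<Rightarrow> ('k, 'x) isf \<Rightarrow> ('k, 'y) isf \<Rightarrow> bool" where
  "isf_homotopy_equivalent R X Y \<longleftrightarrow>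
     (\<exists>f g. isf_morphism R X Y f \<and> isf_morphism R Y X g \<and>
        (\<exists>h. isf_homotopy R X X (isf_comp X g f) (isf_id X) h) \<and>
        (\<exists>h. isf_homotopy R Y Y (isf_comp Y f g) (isf_id Y) h))"


section \<open>The tensor functor\<close>

text \<open>The list \<open>[j..<j + k]\<close> is $(j, j+1, \dots, j+k-1)$.\<close>

definition tensor_face ::
  "('k, 'r) ring_scheme \<Rightarrow> ('k, 'a) ainf \<Rightarrow> nat list \<Rightarrow> nat \<Rightarrow> nat \<Rightarrow>
   ('k, 'a) tensor \<Rightarrow> ('k, 'a) tensor" where
  "tensor_face R A I n q x =
     (let k = length I; j = hd I; M = tensor_power R (a_mod A) (n - k) (q + k - 1) in
       if I \<noteq> [] \<and> I = [j..<j + k] \<and> 1 \<le> j \<and> j \<le> n - k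
       then signed M (int k * (int q - 1))
              (tensor_maps R (a_mod A) (a_mod A)
                (replicate (j - 1) (one_m R (a_mod A)) @ [op_m A (k - 1)] @
                 replicate (n - k - j) (one_m R (a_mod A))) q x)
       else \<zero>\<^bsub>M\<^esub>)"

definition tensor_functor ::
  "('k, 'r) ring_scheme \<Rightarrow> ('k, 'a) ainf \<Rightarrow> ('k, ('k, 'a) tensor) isf" where
  "tensor_functor R A =
     \<lparr>s_mod = tensor_power R (a_mod A),
      s_diff = tensor_diff R (a_mod A) (a_diff A),
      s_face = tensor_face R A\<rparr>"

text \<open>
  The action on morphisms.  For the maximal blocks of consecutive integers of \<open>I\<close>, the pairs
  \<open>(k\<^sub>i, n\<^sub>i)\<close> are computed by \<open>block_data\<close>, whose first argument is \<open>l + 1\<close> with \<open>l\<close> the last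
  entry of the preceding block, and \<open>0\<close> for the first block.
\<close>

fun blocks :: "nat list \<Rightarrow> nat list list" where
  "blocks [] = []"
| "blocks [i] = [[i]]"
| "blocks (i # j # I) =
     (if j = Suc i then (i # hd (blocks (j # I))) # tl (blocks (j # I))
      else [i] # blocks (j # I))"

fun block_data :: "nat \<Rightarrow> nat list list \<Rightarrow> (nat \<times> nat) list" where
  "block_data l [] = []"
| "block_data l (b # bs) = (hd b - l, length b) # block_data (last b + 1) bs"

definition tensor_functor_mor ::
  "('k, 'r) ring_scheme \<Rightarrow> ('k, 'a) ainf \<Rightarrow> ('k, 'b) ainf \<Rightarrow>
   (nat \<Rightarrow> nat \<Rightarrow> ('k, 'a) tensor \<Rightarrow> 'b) \<Rightarrow>
   nat list \<Rightarrow> nat \<Rightarrow> nat \<Rightarrow> ('k, 'a) tensor \<Rightarrow> ('k, 'b) tensor" where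
  "tensor_functor_mor R A B f I n q x =
     (let k = length I; M = tensor_power R (a_mod B) (n - k) (q + k);
          kns = block_data 0 (blocks I); ns = map snd kns;
          gam = (\<Sum>i<length ns - 1. ns ! i * sum_list (drop (i + 1) ns)) in
       if I \<noteq> [] \<and> (hd I = 0 \<or> last I = n) then \<zero>\<^bsub>M\<^esub>
       else signed M (int k * (int q - 1) + int gam)
              (tensor_maps R (a_mod A) (a_mod B)
                (concat (map (\<lambda>(ki, ni). replicate (ki - 1) (mor_m f 0) @ [mor_m f ni]) kns) @
                 replicate (n - (sum_list (map fst kns) + k)) (mor_m f 0)) q x))"

end

theory Submission
  imports Defs "HOL-Algebra.Free_Abelian_Groups"
begin

text \<open>
  Shifting all degrees by one turns the structure maps of an $A_\infty$-algebra, the components of a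
  morphism and those of a homotopy into cochains $b$, $F$, $H$ on words, and the defining relations
  become $b \circ b = 0$, $b \circ F = F \circ b$ and $b \circ H + H \circ b = F - G$ with Koszul
  signs only.  These are relations in the free abelian group on words modulo additivity in each
  letter, so that no linear algebra is needed to manipulate them.

  A tuple $I$ with entries in $\{1, \dots, n - 1\}$ is the set of gaps inside the blocks of a
  decomposition of a word of length $n$ into blocks; for any other $I$ all maps of the tensor functor
  vanish.  The map with index $I$ applies the cochains blockwise: $F$ to every block in the case of a
  morphism, and $H$ to one block, $G$ to the blocks before it and $F$ to the blocks after it in the
  case of a homotopy; the faces and the differential are the case $H = b$, $F = G = 1$.
  A splitting of a permutation of $I$ is determined by the set of entries of its right tuple, an
  arbitrary subset of $I$, and subsets of $I$ are the gap sets of the refinements of the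
  decomposition.  The parity of the permutation is
  the parity of the difference between the sums of the entries before and after the renumbering,
  which is also what the shift of degrees contributes.  Hence every sum over splittings is a
  composition of blockwise maps over all refinements, and its relations follow from those of
  $b$, $F$, $H$ by induction on the number of blocks.
\<close>

section \<open>Linear maps\<close>

text \<open>Behind the blockwise maps stands the tensor coalgebra of the bar construction:
  \<open>Fs F\<close> is one component of the coalgebra map generated by F, and
  \<open>Hs F G H\<close> one component of the coderivation along G and F generated by H. The
  required relations are finer than the coalgebra identities, because they hold for every block
  decomposition separately; hence decompositions are kept as lists \<open>ns\<close>, and
  \<open>conv\<close> composes over the refinements of one fixed \<open>ns\<close>. The differential
  is treated as the face with the empty tuple. The inner splittings together with the two trivial
  ones then form all subsets of I, and every equation for d of a component becomes an equation
  between full subset sums. Two obstacles shape the bookkeeping. The signs of the definitions look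
  unrelated; each is a product of \<open>theta\<close> signs, Koszul signs and a remainder depending
  only on shapes, recorded by \<open>kexp\<close> for one tensor product of maps and by
  \<open>rsign\<close> for a whole family. And degrees are natural numbers with 0 - 1 = 0, so a
  composite through degree -1 has no meaningful value and is set to zero
  (\<open>opc\<close>).\<close>

lemma lin_mapsI:
  assumes "\<And>x. x \<in> carrier M \<Longrightarrow> u x \<in> carrier N"
    and "\<And>x y. x \<in> carrier M \<Longrightarrow> y \<in> carrier M \<Longrightarrow> u (x \<oplus>\<^bsub>M\<^esub> y) = u x \<oplus>\<^bsub>N\<^esub> u y"
    and "\<And>r x. r \<in> carrier R \<Longrightarrow> x \<in> carrier M \<Longrightarrow> u (r \<odot>\<^bsub>M\<^esub> x) = r \<odot>\<^bsub>N\<^esub> u x"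
  shows "u \<in> lin_maps R M N"
  using assms by (auto simp: lin_maps_def hom_def)

lemma lin_maps_closed: "u \<in> lin_maps R M N \<Longrightarrow> x \<in> carrier M \<Longrightarrow> u x \<in> carrier N"
  and lin_maps_add: "u \<in> lin_maps R M N \<Longrightarrow> x \<in> carrier M \<Longrightarrow> y \<in> carrier M \<Longrightarrow>
    u (x \<oplus>\<^bsub>M\<^esub> y) = u x \<oplus>\<^bsub>N\<^esub> u y"
  and lin_maps_smult: "u \<in> lin_maps R M N \<Longrightarrow> r \<in> carrier R \<Longrightarrow> x \<in> carrier M \<Longrightarrow>
    u (r \<odot>\<^bsub>M\<^esub> x) = r \<odot>\<^bsub>N\<^esub> u x"
  by (auto simp: lin_maps_def hom_def)

lemma lin_maps_cong:
  "u \<in> lin_maps R M N \<Longrightarrow> module R M \<Longrightarrow> (\<And>x. x \<in> carrier M \<Longrightarrow> v x = u x) \<Longrightarrow>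
    v \<in> lin_maps R M N"
proof -
  assume *: "u \<in> lin_maps R M N" "module R M" "\<And>x. x \<in> carrier M \<Longrightarrow> v x = u x"
  then interpret module R M by simp
  show ?thesis
    by (rule lin_mapsI) (use * in \<open>auto simp: lin_maps_closed lin_maps_add lin_maps_smult\<close>)
qed

lemma lin_maps_group_hom:
  assumes "u \<in> lin_maps R M N" "module R M" "module R N"
  shows "abelian_group_hom M N u"
proof -
  interpret M: module R M by fact
  interpret N: module R N by fact
  show ?thesis
    by (intro abelian_group_homI group_hom.intro group_hom_axioms.intro)
      (use assms(1) in \<open>auto simp: lin_maps_def M.abelian_group_axioms N.abelian_group_axioms
        M.add.is_group N.add.is_group\<close>)
qed

lemma lin_maps_zero:
  "u \<in> lin_maps R M N \<Longrightarrow> module R M \<Longrightarrow> module R N \<Longrightarrow> u \<zero>\<^bsub>M\<^esub> = \<zero>\<^bsub>N\<^esub>"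
  by (rule abelian_group_hom.hom_zero[OF lin_maps_group_hom])

lemma lin_maps_minus:
  "u \<in> lin_maps R M N \<Longrightarrow> module R M \<Longrightarrow> module R N \<Longrightarrow> x \<in> carrier M \<Longrightarrow>
    u (\<ominus>\<^bsub>M\<^esub> x) = \<ominus>\<^bsub>N\<^esub> u x"
  by (rule abelian_group_hom.hom_a_inv[OF lin_maps_group_hom])

lemma lin_maps_signed:
  "u \<in> lin_maps R M N \<Longrightarrow> module R M \<Longrightarrow> module R N \<Longrightarrow> x \<in> carrier M \<Longrightarrow>
    u (signed M e x) = signed N e (u x)"
  by (simp add: signed_def lin_maps_minus)

lemma lin_maps_compose:
  "u \<in> lin_maps R M N \<Longrightarrow> v \<in> lin_maps R L M \<Longrightarrow> (\<lambda>x. u (v x)) \<in> lin_maps R L N"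
  by (auto simp: lin_maps_def hom_def Pi_def)

lemma lin_maps_id: "(\<lambda>x. x) \<in> lin_maps R M M"
  by (auto simp: lin_maps_def hom_def)

lemma lin_maps_const_zero: "module R N \<Longrightarrow> (\<lambda>x. \<zero>\<^bsub>N\<^esub>) \<in> lin_maps R M N"
proof -
  assume "module R N"
  then interpret module R N .
  show ?thesis by (rule lin_mapsI) auto
qed

lemma lin_maps_plus:
  assumes "module R N" "u \<in> lin_maps R M N" "v \<in> lin_maps R M N"
  shows "(\<lambda>x. u x \<oplus>\<^bsub>N\<^esub> v x) \<in> lin_maps R M N"
proof -
  interpret module R N by fact
  show ?thesis
    by (rule lin_mapsI)
      (use assms(2,3) in \<open>auto simp: lin_maps_closed lin_maps_add lin_maps_smult
        smult_r_distr M.a_ac\<close>)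
qed

lemma lin_maps_uminus:
  assumes "module R N" "u \<in> lin_maps R M N"
  shows "(\<lambda>x. \<ominus>\<^bsub>N\<^esub> u x) \<in> lin_maps R M N"
proof -
  interpret module R N by fact
  show ?thesis
    by (rule lin_mapsI)
      (use assms(2) in \<open>auto simp: lin_maps_closed lin_maps_add lin_maps_smult
        smult_r_minus M.minus_add\<close>)
qed

lemma lin_maps_diff:
  assumes "module R N" "u \<in> lin_maps R M N" "v \<in> lin_maps R M N"
  shows "(\<lambda>x. u x \<ominus>\<^bsub>N\<^esub> v x) \<in> lin_maps R M N"
  unfolding a_minus_def by (intro lin_maps_plus lin_maps_uminus assms)

lemma lin_maps_signed_fun:
  assumes "module R N" "u \<in> lin_maps R M N"
  shows "(\<lambda>x. signed N e (u x)) \<in> lin_maps R M N"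
  by (cases "even e") (simp_all add: signed_def assms lin_maps_uminus)

lemma lin_maps_finsum:
  assumes "module R N" "module R M" "\<And>i. i \<in> S \<Longrightarrow> u i \<in> lin_maps R M N"
  shows "(\<lambda>x. \<Oplus>\<^bsub>N\<^esub>i\<in>S. u i x) \<in> lin_maps R M N"
proof -
  interpret module R N by fact
  show ?thesis
    using assms(3)
  proof (induction S rule: infinite_finite_induct)
    case (insert i S)
    have closed: "u j x \<in> carrier N" if "j \<in> insert i S" "x \<in> carrier M" for j x
      by (rule lin_maps_closed[OF insert.prems[OF that(1)] that(2)])
    have "(\<lambda>x. u i x \<oplus>\<^bsub>N\<^esub> (\<Oplus>\<^bsub>N\<^esub>i\<in>S. u i x)) \<in> lin_maps R M N"
      using insert by (intro lin_maps_plus[OF assms(1)]) auto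
    \<comment> \<open>Splitting off an index requires values in the carrier, so the two functions
      agree on the carrier of M only; \<open>lin_maps_cong\<close> accepts that.\<close>
    moreover have "(\<Oplus>\<^bsub>N\<^esub>i\<in>insert i S. u i x) = u i x \<oplus>\<^bsub>N\<^esub> (\<Oplus>\<^bsub>N\<^esub>i\<in>S. u i x)"
      if "x \<in> carrier M" for x
      using insert that by (subst M.finsum_insert) (auto simp: closed)
    ultimately show ?case
      by (auto intro: lin_maps_cong[OF _ assms(2)])
  qed (auto simp: lin_maps_const_zero[OF assms(1)])
qed

section \<open>Quotient modules and free modules\<close>

lemma quot_module_simps:
  "carrier (quot_module M N) = a_rcosets\<^bsub>M\<^esub> N"
  "\<zero>\<^bsub>quot_module M N\<^esub> = N"
  "X \<oplus>\<^bsub>quot_module M N\<^esub> Y = X <+>\<^bsub>M\<^esub> Y"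
  "r \<odot>\<^bsub>quot_module M N\<^esub> X = (\<Union>c\<in>X. N +>\<^bsub>M\<^esub> (r \<odot>\<^bsub>M\<^esub> c))"
  by (simp_all add: quot_module_def)

context
  fixes R :: "('k, 'r) ring_scheme" and M :: "('k, 'a) module" and N
  assumes module: "module R M" and submodule: "submodule N R M"
begin

interpretation module R M by (fact module)

interpretation abelian_subgroup N M
  using submodule.axioms(1)[OF submodule]
  by (intro abelian_subgroupI3 additive_subgroupI M.abelian_group_axioms)

text \<open>All representatives c of the coset give the same coset of r c, so the union in the
  definition of \<open>quot_module\<close> runs over a constant family; it is nonempty because x
  lies in its own coset.\<close>

lemma quot_module_smult:
  assumes "r \<in> carrier R" "x \<in> carrier M"
  shows "r \<odot>\<^bsub>quot_module M N\<^esub> (N +>\<^bsub>M\<^esub> x) = N +>\<^bsub>M\<^esub> (r \<odot>\<^bsub>M\<^esub> x)"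
proof -
  have "N +>\<^bsub>M\<^esub> (r \<odot>\<^bsub>M\<^esub> c) = N +>\<^bsub>M\<^esub> (r \<odot>\<^bsub>M\<^esub> x)" if c: "c \<in> N +>\<^bsub>M\<^esub> x" for c
  proof -
    obtain h where h: "h \<in> N" "c = h \<oplus>\<^bsub>M\<^esub> x"
      using c by (auto simp: a_r_coset_def')
    have "r \<odot>\<^bsub>M\<^esub> h \<in> N"
      using submodule.smult_closed[OF submodule] h assms by auto
    then have "r \<odot>\<^bsub>M\<^esub> c \<in> N +>\<^bsub>M\<^esub> (r \<odot>\<^bsub>M\<^esub> x)"
      using h assms by (auto simp: a_r_coset_def' smult_r_distr)
    then show ?thesis
      using a_repr_independence' assms a_subgroup by (metis smult_closed)
  qed
  moreover have "x \<in> N +>\<^bsub>M\<^esub> x"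
    using assms a_rcos_self by auto
  ultimately show ?thesis
    unfolding quot_module_simps(4) by (intro SUP_eq_const) blast+
qed

lemma quot_module_add:
  "x \<in> carrier M \<Longrightarrow> y \<in> carrier M \<Longrightarrow>
    (N +>\<^bsub>M\<^esub> x) \<oplus>\<^bsub>quot_module M N\<^esub> (N +>\<^bsub>M\<^esub> y) = N +>\<^bsub>M\<^esub> (x \<oplus>\<^bsub>M\<^esub> y)"
  by (simp add: quot_module_simps a_rcos_sum)

lemma quot_module_carrierE:
  assumes "X \<in> carrier (quot_module M N)"
  obtains x where "x \<in> carrier M" "X = N +>\<^bsub>M\<^esub> x"
  using assms by (auto simp: quot_module_simps A_RCOSETS_def')

lemma quot_module_carrierI: "x \<in> carrier M \<Longrightarrow> N +>\<^bsub>M\<^esub> x \<in> carrier (quot_module M N)"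
  by (auto simp: quot_module_simps A_RCOSETS_def')

lemma quot_module_module: "module R (quot_module M N)"
proof (rule moduleI)
  show "cring R" by (rule R.is_cring)
  show "abelian_group (quot_module M N)"
  proof (rule abelian_groupI)
    show "\<zero>\<^bsub>quot_module M N\<^esub> \<in> carrier (quot_module M N)"
      by (simp add: quot_module_simps a_subgroup_in_rcosets)
  next
    fix X assume "X \<in> carrier (quot_module M N)"
    then show "\<zero>\<^bsub>quot_module M N\<^esub> \<oplus>\<^bsub>quot_module M N\<^esub> X = X"
      by (simp add: quot_module_simps rcosets_add_eq)
    from \<open>X \<in> _\<close> show "\<exists>Y\<in>carrier (quot_module M N).
        Y \<oplus>\<^bsub>quot_module M N\<^esub> X = \<zero>\<^bsub>quot_module M N\<^esub>"
      by (intro bexI[of _ "a_set_inv\<^bsub>M\<^esub> X"])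
        (simp_all add: quot_module_simps a_setinv_closed a_rcosets_inv_mult_group_eq)
  qed (auto simp: quot_module_add quot_module_carrierI M.a_ac elim!: quot_module_carrierE)
next
  fix a X assume a: "a \<in> carrier R" and "X \<in> carrier (quot_module M N)"
  then obtain x where X: "X = N +>\<^bsub>M\<^esub> x" "x \<in> carrier M"
    by (auto elim: quot_module_carrierE)
  then show "a \<odot>\<^bsub>quot_module M N\<^esub> X \<in> carrier (quot_module M N)"
    by (simp add: a quot_module_smult quot_module_carrierI)
next
  fix a b X assume a: "a \<in> carrier R" and b: "b \<in> carrier R" and "X \<in> carrier (quot_module M N)"
  then obtain x where X: "X = N +>\<^bsub>M\<^esub> x" "x \<in> carrier M"
    by (auto elim: quot_module_carrierE)
  show "(a \<oplus>\<^bsub>R\<^esub> b) \<odot>\<^bsub>quot_module M N\<^esub> X =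
      a \<odot>\<^bsub>quot_module M N\<^esub> X \<oplus>\<^bsub>quot_module M N\<^esub> b \<odot>\<^bsub>quot_module M N\<^esub> X"
    using a b X(2) by (simp add: X(1) quot_module_smult quot_module_add smult_l_distr)
  show "(a \<otimes>\<^bsub>R\<^esub> b) \<odot>\<^bsub>quot_module M N\<^esub> X =
      a \<odot>\<^bsub>quot_module M N\<^esub> (b \<odot>\<^bsub>quot_module M N\<^esub> X)"
    using a b X(2) by (simp add: X(1) quot_module_smult smult_assoc1)
next
  fix a X Y
  assume a: "a \<in> carrier R" and "X \<in> carrier (quot_module M N)" "Y \<in> carrier (quot_module M N)"
  then obtain x y where X: "X = N +>\<^bsub>M\<^esub> x" "x \<in> carrier M" "Y = N +>\<^bsub>M\<^esub> y" "y \<in> carrier M"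
    by (auto elim!: quot_module_carrierE)
  show "a \<odot>\<^bsub>quot_module M N\<^esub> (X \<oplus>\<^bsub>quot_module M N\<^esub> Y) =
      a \<odot>\<^bsub>quot_module M N\<^esub> X \<oplus>\<^bsub>quot_module M N\<^esub> a \<odot>\<^bsub>quot_module M N\<^esub> Y"
    using a X by (simp add: quot_module_smult quot_module_add smult_r_distr)
next
  fix X assume "X \<in> carrier (quot_module M N)"
  then obtain x where X: "X = N +>\<^bsub>M\<^esub> x" "x \<in> carrier M"
    by (auto elim: quot_module_carrierE)
  show "\<one>\<^bsub>R\<^esub> \<odot>\<^bsub>quot_module M N\<^esub> X = X"
    using X(2) by (simp add: X(1) quot_module_smult)
qed

lemma quot_module_proj: "(\<lambda>x. N +>\<^bsub>M\<^esub> x) \<in> lin_maps R M (quot_module M N)"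
  by (rule lin_mapsI) (simp_all add: quot_module_carrierI quot_module_add quot_module_smult)

lemma quot_module_rep:
  assumes "x \<in> carrier M" "c \<in> N +>\<^bsub>M\<^esub> x"
  shows "c \<in> carrier M" "c \<ominus>\<^bsub>M\<^esub> x \<in> N"
  using assms a_elemrcos_carrier a_rcos_module_imp by (auto simp: a_minus_def)

lemma quot_module_self: "x \<in> carrier M \<Longrightarrow> x \<in> N +>\<^bsub>M\<^esub> x"
  by (rule a_rcos_self)

lemma quot_module_zero_iff: "x \<in> N \<Longrightarrow> N +>\<^bsub>M\<^esub> x = \<zero>\<^bsub>quot_module M N\<^esub>"
  by (simp add: quot_module_simps a_rcos_const)

end

lemma free_module_simps:
  "carrier (free_module R W) = {c. (\<forall>w. c w \<in> carrier R) \<and> (\<forall>w. w \<notin> W \<longrightarrow> c w = \<zero>\<^bsub>R\<^esub>) \<and>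
                    finite {w. c w \<noteq> \<zero>\<^bsub>R\<^esub>}}"
  "\<zero>\<^bsub>free_module R W\<^esub> = (\<lambda>w. \<zero>\<^bsub>R\<^esub>)"
  "c \<oplus>\<^bsub>free_module R W\<^esub> c' = (\<lambda>w. c w \<oplus>\<^bsub>R\<^esub> c' w)"
  "r \<odot>\<^bsub>free_module R W\<^esub> c = (\<lambda>w. r \<otimes>\<^bsub>R\<^esub> c w)"
  by (simp_all add: free_module_def)

lemma free_module_module:
  fixes R (structure)
  assumes "cring R"
  shows "module R (free_module R W)"
proof -
  interpret cring R by fact
  show ?thesis
  proof (rule moduleI)
    show "abelian_group (free_module R W)"
    proof (rule abelian_groupI)
      fix c assume c: "c \<in> carrier (free_module R W)"
      have fin: "finite {w. \<ominus> c w \<noteq> \<zero>}"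
        by (rule finite_subset[of _ "{w. c w \<noteq> \<zero>}"]) (use c in \<open>auto simp: free_module_simps\<close>)
      show "\<exists>c'\<in>carrier (free_module R W). c' \<oplus>\<^bsub>free_module R W\<^esub> c = \<zero>\<^bsub>free_module R W\<^esub>"
        by (rule bexI[of _ "\<lambda>w. \<ominus> c w"]) (use c fin in \<open>auto simp: free_module_simps l_neg\<close>)
    next
      fix c c' assume c: "c \<in> carrier (free_module R W)" "c' \<in> carrier (free_module R W)"
      have "finite {w. c w \<oplus> c' w \<noteq> \<zero>}"
        by (rule finite_subset[of _ "{w. c w \<noteq> \<zero>} \<union> {w. c' w \<noteq> \<zero>}"])
          (use c in \<open>auto simp: free_module_simps\<close>)
      then show "c \<oplus>\<^bsub>free_module R W\<^esub> c' \<in> carrier (free_module R W)"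
        using c by (auto simp: free_module_simps)
    qed (auto simp: free_module_simps a_ac)
  next
    fix a c assume c: "a \<in> carrier R" "c \<in> carrier (free_module R W)"
    have "finite {w. a \<otimes> c w \<noteq> \<zero>}"
      by (rule finite_subset[of _ "{w. c w \<noteq> \<zero>}"]) (use c in \<open>auto simp: free_module_simps\<close>)
    then show "a \<odot>\<^bsub>free_module R W\<^esub> c \<in> carrier (free_module R W)"
      using c by (auto simp: free_module_simps)
  qed (auto simp: free_module_simps l_distr r_distr m_assoc is_cring)
qed

lemma free_gen_closed:
  fixes R (structure)
  shows "cring R \<Longrightarrow> w \<in> W \<Longrightarrow> free_gen R w \<in> carrier (free_module R W)"
proof -
  assume "cring R" "w \<in> W"
  then interpret cring R by simp
  have "finite {v. free_gen R w v \<noteq> \<zero>}"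
    by (rule finite_subset[of _ "{w}"]) (auto simp: free_gen_def)
  then show ?thesis
    using \<open>w \<in> W\<close> by (auto simp: free_module_simps free_gen_def)
qed

text \<open>The sum in \<^const>\<open>tensor_lift\<close>, for a fixed representative of the class.\<close>

definition free_lift ::
  "('k, 'r) ring_scheme \<Rightarrow> ('k, 'm) module \<Rightarrow> ('w \<Rightarrow> 'm) \<Rightarrow> ('w \<Rightarrow> 'k) \<Rightarrow> 'm" where
  "free_lift R M \<phi> c = (\<Oplus>\<^bsub>M\<^esub>w\<in>{w. c w \<noteq> \<zero>\<^bsub>R\<^esub>}. c w \<odot>\<^bsub>M\<^esub> \<phi> w)"

lemma free_lift_superset:
  assumes "module R M" "c \<in> carrier (free_module R W)" "\<phi> \<in> W \<rightarrow> carrier M"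
    and "finite S" "{w. c w \<noteq> \<zero>\<^bsub>R\<^esub>} \<subseteq> S" "S \<subseteq> W"
  shows "free_lift R M \<phi> c = (\<Oplus>\<^bsub>M\<^esub>w\<in>S. c w \<odot>\<^bsub>M\<^esub> \<phi> w)"
proof -
  interpret module R M by fact
  show ?thesis
    unfolding free_lift_def using assms
    by (intro M.add.finprod_mono_neutral_cong_left) (auto simp: free_module_simps Pi_def)
qed

lemma free_lift_lin:
  fixes R (structure)
  assumes "module R M" "\<phi> \<in> W \<rightarrow> carrier M"
  shows "free_lift R M \<phi> \<in> lin_maps R (free_module R W) M"
proof (rule lin_mapsI)
  interpret module R M by fact
  interpret F: module R "free_module R W" by (rule free_module_module) (rule R.is_cring)
  have sub: "w \<in> W" if "c \<in> carrier (free_module R W)" "c w \<noteq> \<zero>" for c w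
    using that by (auto simp: free_module_simps)
  have cR: "c w \<in> carrier R" and fin: "finite {w. c w \<noteq> \<zero>}"
    if "c \<in> carrier (free_module R W)" for c w
    using that by (auto simp: free_module_simps)
  have phi: "\<phi> w \<in> carrier M" if "w \<in> W" for w
    using assms(2) that by blast
  note sup = free_lift_superset[OF assms(1) _ assms(2)]
  fix c assume c: "c \<in> carrier (free_module R W)"
  note cW = sub[OF c]
  show "free_lift R M \<phi> c \<in> carrier M"
    unfolding free_lift_def
    by (intro M.finsum_closed Pi_I smult_closed cR[OF c] phi cW) simp
  {
    fix c' assume c': "c' \<in> carrier (free_module R W)"
    let ?S = "{w. c w \<noteq> \<zero>} \<union> {w. c' w \<noteq> \<zero>}"
    have S: "finite ?S" "?S \<subseteq> W" "{w. (c \<oplus>\<^bsub>free_module R W\<^esub> c') w \<noteq> \<zero>} \<subseteq> ?S"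
      using fin[OF c] fin[OF c'] cW sub[OF c'] by (auto simp: free_module_simps(3))
    have phiS: "\<phi> w \<in> carrier M" if "w \<in> ?S" for w
      using that S(2) phi by blast
    have "free_lift R M \<phi> (c \<oplus>\<^bsub>free_module R W\<^esub> c')
        = (\<Oplus>\<^bsub>M\<^esub>w\<in>?S. (c \<oplus>\<^bsub>free_module R W\<^esub> c') w \<odot>\<^bsub>M\<^esub> \<phi> w)"
      by (rule sup[OF F.M.a_closed[OF c c'] S(1,3,2)])
    also have "\<dots> = (\<Oplus>\<^bsub>M\<^esub>w\<in>?S. c w \<odot>\<^bsub>M\<^esub> \<phi> w \<oplus>\<^bsub>M\<^esub> c' w \<odot>\<^bsub>M\<^esub> \<phi> w)"
      using phiS cR[OF c] cR[OF c']
      by (intro M.finsum_cong') (auto simp: free_module_simps(3) smult_l_distr)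
    also have "\<dots> = (\<Oplus>\<^bsub>M\<^esub>w\<in>?S. c w \<odot>\<^bsub>M\<^esub> \<phi> w) \<oplus>\<^bsub>M\<^esub> (\<Oplus>\<^bsub>M\<^esub>w\<in>?S. c' w \<odot>\<^bsub>M\<^esub> \<phi> w)"
      by (intro M.finsum_addf Pi_I smult_closed cR[OF c] cR[OF c'] phiS)
    also have "(\<Oplus>\<^bsub>M\<^esub>w\<in>?S. c w \<odot>\<^bsub>M\<^esub> \<phi> w) = free_lift R M \<phi> c"
      by (rule sup[symmetric, OF c S(1) _ S(2)]) simp
    also have "(\<Oplus>\<^bsub>M\<^esub>w\<in>?S. c' w \<odot>\<^bsub>M\<^esub> \<phi> w) = free_lift R M \<phi> c'"
      by (rule sup[symmetric, OF c' S(1) _ S(2)]) simp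
    finally show "free_lift R M \<phi> (c \<oplus>\<^bsub>free_module R W\<^esub> c') =
      free_lift R M \<phi> c \<oplus>\<^bsub>M\<^esub> free_lift R M \<phi> c'" .
  }
  fix r assume r: "r \<in> carrier R"
  let ?S = "{w. c w \<noteq> \<zero>}"
  have S: "finite ?S" "?S \<subseteq> W" "{w. (r \<odot>\<^bsub>free_module R W\<^esub> c) w \<noteq> \<zero>} \<subseteq> ?S"
    using fin[OF c] r cW by (auto simp: free_module_simps(4))
  have phiS: "\<phi> w \<in> carrier M" if "w \<in> ?S" for w
    using that S(2) phi by blast
  have "free_lift R M \<phi> (r \<odot>\<^bsub>free_module R W\<^esub> c)
      = (\<Oplus>\<^bsub>M\<^esub>w\<in>?S. (r \<odot>\<^bsub>free_module R W\<^esub> c) w \<odot>\<^bsub>M\<^esub> \<phi> w)"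
    by (rule sup[OF F.smult_closed[OF r c] S(1,3,2)])
  also have "\<dots> = (\<Oplus>\<^bsub>M\<^esub>w\<in>?S. r \<odot>\<^bsub>M\<^esub> (c w \<odot>\<^bsub>M\<^esub> \<phi> w))"
    using phiS cR[OF c] r
    by (intro M.finsum_cong') (auto simp: free_module_simps(4) smult_assoc1)
  also have "\<dots> = r \<odot>\<^bsub>M\<^esub> free_lift R M \<phi> c"
    unfolding free_lift_def
    by (intro finsum_smult_ldistr[symmetric] S(1) r Pi_I smult_closed cR[OF c] phiS)
  finally show "free_lift R M \<phi> (r \<odot>\<^bsub>free_module R W\<^esub> c) = r \<odot>\<^bsub>M\<^esub> free_lift R M \<phi> c" .
qed

lemma free_lift_gen:
  assumes "module R M" "w \<in> W" "\<phi> w \<in> carrier M"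
  shows "free_lift R M \<phi> (free_gen R w) = \<phi> w"
proof -
  interpret module R M by fact
  \<comment> \<open>Over the zero ring the generator has empty support and the sum is empty, so the
    value at w has to be zero as well.\<close>
  have "\<phi> w = \<zero>\<^bsub>M\<^esub>" if "\<one>\<^bsub>R\<^esub> = \<zero>\<^bsub>R\<^esub>"
    using assms(3) that by (metis smult_l_null smult_one)
  then have "free_lift R M \<phi> (free_gen R w) = (\<Oplus>\<^bsub>M\<^esub>v\<in>{w}. free_gen R w v \<odot>\<^bsub>M\<^esub> \<phi> v)"
    unfolding free_lift_def using assms(3)
    by (intro M.add.finprod_mono_neutral_cong_left)
      (auto simp: free_gen_def)
  also have "\<dots> = \<phi> w"
    using assms(3) by (simp add: free_gen_def)
  finally show ?thesis .
qed

section \<open>Tensor powers\<close>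

text \<open>Additivity and homogeneity are merged into one condition on r x + y, so that each proof
  of multilinearity treats a changed letter once. The choices r = 1 and y = 0 give them back
  separately.\<close>

definition multilinear ::
  "('k, 'r) ring_scheme \<Rightarrow> (nat \<Rightarrow> ('k, 'a) module) \<Rightarrow> nat \<Rightarrow> nat \<Rightarrow> ('k, 'm) module \<Rightarrow>
   ('a word \<Rightarrow> 'm) \<Rightarrow> bool" where
  "multilinear R A n q M \<phi> \<longleftrightarrow>
     (\<forall>w\<in>words A n q. \<phi> w \<in> carrier M) \<and>
     (\<forall>u p x y v. \<forall>r\<in>carrier R. u @ (p, x) # v \<in> words A n q \<longrightarrow> y \<in> carrier (A p) \<longrightarrow>
        \<phi> (u @ (p, (r \<odot>\<^bsub>A p\<^esub> x) \<oplus>\<^bsub>A p\<^esub> y) # v) =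
          r \<odot>\<^bsub>M\<^esub> \<phi> (u @ (p, x) # v) \<oplus>\<^bsub>M\<^esub> \<phi> (u @ (p, y) # v))"

lemma multilinear_closed: "multilinear R A n q M \<phi> \<Longrightarrow> w \<in> words A n q \<Longrightarrow> \<phi> w \<in> carrier M"
  and multilinear_comb: "multilinear R A n q M \<phi> \<Longrightarrow> u @ (p, x) # v \<in> words A n q \<Longrightarrow>
    y \<in> carrier (A p) \<Longrightarrow> r \<in> carrier R \<Longrightarrow>
    \<phi> (u @ (p, (r \<odot>\<^bsub>A p\<^esub> x) \<oplus>\<^bsub>A p\<^esub> y) # v) =
      r \<odot>\<^bsub>M\<^esub> \<phi> (u @ (p, x) # v) \<oplus>\<^bsub>M\<^esub> \<phi> (u @ (p, y) # v)"
  by (auto simp: multilinear_def)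

lemma words_letter: "u @ (p, x) # v \<in> words A n q \<Longrightarrow> x \<in> carrier (A p)"
  and words_replace: "u @ (p, x) # v \<in> words A n q \<Longrightarrow> y \<in> carrier (A p) \<Longrightarrow>
    u @ (p, y) # v \<in> words A n q"
  by (auto simp: words_def wdeg_def)

lemma words_length: "w \<in> words A n q \<Longrightarrow> length w = n"
  and words_wdeg: "w \<in> words A n q \<Longrightarrow> wdeg w = q"
  by (auto simp: words_def)

lemma wdeg_simps [simp]:
  "wdeg [] = 0" "wdeg (a # w) = fst a + wdeg w" "wdeg (v @ w) = wdeg v + wdeg w"
  by (simp_all add: wdeg_def)

lemma (in abelian_group) minus_eq_zero_iff:
  "x \<in> carrier G \<Longrightarrow> y \<in> carrier G \<Longrightarrow> x \<ominus> y = \<zero> \<longleftrightarrow> x = y"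
  by (metis a_minus_def add.inv_solve_right' l_zero zero_closed)

lemma (in abelian_group) minus_minus_eq_zero_iff:
  assumes "x \<in> carrier G" "y \<in> carrier G" "z \<in> carrier G"
  shows "x \<ominus> y \<ominus> z = \<zero> \<longleftrightarrow> x = y \<oplus> z"
proof -
  have "x \<ominus> y \<ominus> z = x \<ominus> (y \<oplus> z)"
    using assms by (simp add: a_minus_def minus_add a_assoc)
  then show ?thesis using assms by (simp add: minus_eq_zero_iff)
qed

locale graded_module =
  fixes R (structure) and A :: "nat \<Rightarrow> ('k, 'a) module"
  assumes cring: "cring R" and module: "module R (A p)"
begin

sublocale R: cring R by (fact cring)

abbreviation T where "T n q \<equiv> tensor_power R A n q"

abbreviation pure where "pure \<equiv> pure_tensor R A"

abbreviation F where "F n q \<equiv> free_module R (words A n q)"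

lemma F_module: "module R (F n q)"
  by (rule free_module_module[OF cring])

lemma gen_closed: "w \<in> words A n q \<Longrightarrow> free_gen R w \<in> carrier (F n q)"
  by (rule free_gen_closed[OF cring])

lemma letter_closed:
  "x \<in> carrier (A p) \<Longrightarrow> y \<in> carrier (A p) \<Longrightarrow> x \<oplus>\<^bsub>A p\<^esub> y \<in> carrier (A p)"
  "x \<in> carrier (A p) \<Longrightarrow> r \<in> carrier R \<Longrightarrow> r \<odot>\<^bsub>A p\<^esub> x \<in> carrier (A p)"
  "\<zero>\<^bsub>A p\<^esub> \<in> carrier (A p)"
proof -
  interpret module R "A p" by (rule module)
  show "x \<in> carrier (A p) \<Longrightarrow> y \<in> carrier (A p) \<Longrightarrow> x \<oplus>\<^bsub>A p\<^esub> y \<in> carrier (A p)"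
    "x \<in> carrier (A p) \<Longrightarrow> r \<in> carrier R \<Longrightarrow> r \<odot>\<^bsub>A p\<^esub> x \<in> carrier (A p)"
    "\<zero>\<^bsub>A p\<^esub> \<in> carrier (A p)" by auto
qed

lemma tensor_relators_carrier: "tensor_relators R A n q \<subseteq> carrier (F n q)"
proof -
  interpret F: module R "F n q" by (rule F_module)
  show ?thesis
    unfolding tensor_relators_def Let_def
    by (auto intro!: F.M.minus_closed F.smult_closed gen_closed
        intro: words_replace letter_closed words_letter)
qed

lemma tensor_null_submodule: "submodule (tensor_null R A n q) R (F n q)"
proof -
  interpret F: module R "F n q" by (rule F_module)
  let ?S = "{N. submodule N R (F n q) \<and> tensor_relators R A n q \<subseteq> N}"
  have carr: "carrier (F n q) \<in> ?S"
    using F.carrier_is_submodule tensor_relators_carrier by auto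
  note E = F.submoduleE
  show ?thesis
    unfolding tensor_null_def submodule_gen_def
  proof (rule F.submoduleI)
    show "\<Inter> ?S \<subseteq> carrier (F n q)" using carr by blast
    show "\<zero>\<^bsub>F n q\<^esub> \<in> \<Inter> ?S"
      using subgroup.one_closed[OF submodule.axioms(1)] by fastforce
    show "\<ominus>\<^bsub>F n q\<^esub> a \<in> \<Inter> ?S" if "a \<in> \<Inter> ?S" for a
      using that E(3) by blast
    show "a \<oplus>\<^bsub>F n q\<^esub> b \<in> \<Inter> ?S" if "a \<in> \<Inter> ?S" "b \<in> \<Inter> ?S" for a b
      using that E(5) by blast
    show "r \<odot>\<^bsub>F n q\<^esub> b \<in> \<Inter> ?S" if "r \<in> carrier R" "b \<in> \<Inter> ?S" for r b
      using that E(4) by blast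
  qed
qed

lemma tensor_relators_null: "c \<in> tensor_relators R A n q \<Longrightarrow> c \<in> tensor_null R A n q"
  by (auto simp: tensor_null_def submodule_gen_def)

lemma tensor_null_subset:
  "submodule N R (F n q) \<Longrightarrow> tensor_relators R A n q \<subseteq> N \<Longrightarrow> tensor_null R A n q \<subseteq> N"
  by (auto simp: tensor_null_def submodule_gen_def)

lemma T_module: "module R (T n q)"
  unfolding tensor_power_def by (rule quot_module_module[OF F_module tensor_null_submodule])

abbreviation proj where "proj n q c \<equiv> tensor_null R A n q +>\<^bsub>F n q\<^esub> c"

lemma proj_lin: "proj n q \<in> lin_maps R (F n q) (T n q)"
  unfolding tensor_power_def by (rule quot_module_proj[OF F_module tensor_null_submodule])

lemma pure_eq_proj: "w \<in> words A n q \<Longrightarrow> pure w = proj n q (free_gen R w)"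
  by (simp add: pure_tensor_def words_length words_wdeg)

lemma pure_closed: "w \<in> words A n q \<Longrightarrow> pure w \<in> carrier (T n q)"
  by (simp add: pure_eq_proj lin_maps_closed[OF proj_lin] gen_closed)

lemma proj_relator_zero: "c \<in> tensor_relators R A n q \<Longrightarrow> proj n q c = \<zero>\<^bsub>T n q\<^esub>"
  unfolding tensor_power_def
  by (rule quot_module_zero_iff[OF F_module tensor_null_submodule tensor_relators_null])

lemma proj_minus:
  assumes "c \<in> carrier (F n q)" "c' \<in> carrier (F n q)"
  shows "proj n q (c \<ominus>\<^bsub>F n q\<^esub> c') = proj n q c \<ominus>\<^bsub>T n q\<^esub> proj n q c'"
proof -
  interpret F: module R "F n q" by (rule F_module)
  show ?thesis
    using assms by (simp add: a_minus_def lin_maps_add[OF proj_lin]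
        lin_maps_minus[OF proj_lin F_module T_module])
qed

lemma pure_multilinear: "multilinear R A n q (T n q) pure"
  unfolding multilinear_def
proof (intro conjI ballI allI impI)
  interpret F: module R "F n q" by (rule F_module)
  interpret T: module R "T n q" by (rule T_module)
  fix u p x y v r
  assume r: "r \<in> carrier R" and w: "u @ (p, x) # v \<in> words A n q" and y: "y \<in> carrier (A p)"
  have x: "x \<in> carrier (A p)" using w by (rule words_letter)
  note repl = words_replace[OF w]
  have in_words: "u @ (p, r \<odot>\<^bsub>A p\<^esub> x) # v \<in> words A n q" "u @ (p, y) # v \<in> words A n q"
    "u @ (p, (r \<odot>\<^bsub>A p\<^esub> x) \<oplus>\<^bsub>A p\<^esub> y) # v \<in> words A n q"
    by (intro repl letter_closed r x y)+
  note cl = pure_closed[OF w] in_words[THEN pure_closed]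
  let ?g = "\<lambda>z. free_gen R (u @ (p, z) # v)"
  have g: "?g x \<in> carrier (F n q)" "?g y \<in> carrier (F n q)" "?g (r \<odot>\<^bsub>A p\<^esub> x) \<in> carrier (F n q)"
    "?g ((r \<odot>\<^bsub>A p\<^esub> x) \<oplus>\<^bsub>A p\<^esub> y) \<in> carrier (F n q)"
    using w in_words by (auto intro: gen_closed)
  have "?g ((r \<odot>\<^bsub>A p\<^esub> x) \<oplus>\<^bsub>A p\<^esub> y) \<ominus>\<^bsub>F n q\<^esub> ?g (r \<odot>\<^bsub>A p\<^esub> x) \<ominus>\<^bsub>F n q\<^esub> ?g y
      \<in> tensor_relators R A n q"
    unfolding tensor_relators_def Let_def using in_words y by blast
  from proj_relator_zero[OF this]
  have 1: "pure (u @ (p, (r \<odot>\<^bsub>A p\<^esub> x) \<oplus>\<^bsub>A p\<^esub> y) # v) \<ominus>\<^bsub>T n q\<^esub> pure (u @ (p, r \<odot>\<^bsub>A p\<^esub> x) # v)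
      \<ominus>\<^bsub>T n q\<^esub> pure (u @ (p, y) # v) = \<zero>\<^bsub>T n q\<^esub>"
    using g F.M.minus_closed by (simp add: proj_minus pure_eq_proj[where n = n and q = q] in_words)
  have "?g (r \<odot>\<^bsub>A p\<^esub> x) \<ominus>\<^bsub>F n q\<^esub> r \<odot>\<^bsub>F n q\<^esub> ?g x \<in> tensor_relators R A n q"
    unfolding tensor_relators_def Let_def using w r by blast
  from proj_relator_zero[OF this]
  have 2: "pure (u @ (p, r \<odot>\<^bsub>A p\<^esub> x) # v) \<ominus>\<^bsub>T n q\<^esub> r \<odot>\<^bsub>T n q\<^esub> pure (u @ (p, x) # v) = \<zero>\<^bsub>T n q\<^esub>"
    using g r w by (simp add: proj_minus pure_eq_proj[where n = n and q = q] in_words lin_maps_smult[OF proj_lin])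
  have "pure (u @ (p, r \<odot>\<^bsub>A p\<^esub> x) # v) = r \<odot>\<^bsub>T n q\<^esub> pure (u @ (p, x) # v)"
    using 2 cl r by (simp add: T.M.minus_eq_zero_iff)
  moreover have "pure (u @ (p, (r \<odot>\<^bsub>A p\<^esub> x) \<oplus>\<^bsub>A p\<^esub> y) # v) =
      pure (u @ (p, r \<odot>\<^bsub>A p\<^esub> x) # v) \<oplus>\<^bsub>T n q\<^esub> pure (u @ (p, y) # v)"
    using 1 cl by (simp add: T.M.minus_minus_eq_zero_iff)
  ultimately show "pure (u @ (p, (r \<odot>\<^bsub>A p\<^esub> x) \<oplus>\<^bsub>A p\<^esub> y) # v) =
      r \<odot>\<^bsub>T n q\<^esub> pure (u @ (p, x) # v) \<oplus>\<^bsub>T n q\<^esub> pure (u @ (p, y) # v)"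
    by simp
qed (rule pure_closed)

lemma multilinear_zero:
  assumes \<phi>: "multilinear R A n q M \<phi>" and M: "module R M" and w: "u @ (p, x) # v \<in> words A n q"
  shows "\<phi> (u @ (p, \<zero>\<^bsub>A p\<^esub>) # v) = \<zero>\<^bsub>M\<^esub>"
proof -
  interpret M: module R M by (fact M)
  interpret A: module R "A p" by (rule module)
  have w0: "u @ (p, \<zero>\<^bsub>A p\<^esub>) # v \<in> words A n q"
    using words_replace[OF w] by simp
  have "\<phi> (u @ (p, (\<one> \<odot>\<^bsub>A p\<^esub> \<zero>\<^bsub>A p\<^esub>) \<oplus>\<^bsub>A p\<^esub> \<zero>\<^bsub>A p\<^esub>) # v) =
      \<one> \<odot>\<^bsub>M\<^esub> \<phi> (u @ (p, \<zero>\<^bsub>A p\<^esub>) # v) \<oplus>\<^bsub>M\<^esub> \<phi> (u @ (p, \<zero>\<^bsub>A p\<^esub>) # v)"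
    by (rule multilinear_comb[OF \<phi> w0]) auto
  then have "\<phi> (u @ (p, \<zero>\<^bsub>A p\<^esub>) # v) = \<phi> (u @ (p, \<zero>\<^bsub>A p\<^esub>) # v) \<oplus>\<^bsub>M\<^esub> \<phi> (u @ (p, \<zero>\<^bsub>A p\<^esub>) # v)"
    using multilinear_closed[OF \<phi> w0] by simp
  then show ?thesis
    using multilinear_closed[OF \<phi> w0] by simp
qed

lemma multilinear_smult:
  assumes \<phi>: "multilinear R A n q M \<phi>" and M: "module R M" and w: "u @ (p, x) # v \<in> words A n q"
    and r: "r \<in> carrier R"
  shows "\<phi> (u @ (p, r \<odot>\<^bsub>A p\<^esub> x) # v) = r \<odot>\<^bsub>M\<^esub> \<phi> (u @ (p, x) # v)"
proof -
  interpret M: module R M by (fact M)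
  interpret A: module R "A p" by (rule module)
  have x: "x \<in> carrier (A p)" using w by (rule words_letter)
  have "\<phi> (u @ (p, (r \<odot>\<^bsub>A p\<^esub> x) \<oplus>\<^bsub>A p\<^esub> \<zero>\<^bsub>A p\<^esub>) # v) =
      r \<odot>\<^bsub>M\<^esub> \<phi> (u @ (p, x) # v) \<oplus>\<^bsub>M\<^esub> \<phi> (u @ (p, \<zero>\<^bsub>A p\<^esub>) # v)"
    by (rule multilinear_comb[OF \<phi> w]) (auto simp: r)
  then show ?thesis
    using multilinear_closed[OF \<phi> w] x r by (simp add: multilinear_zero[OF \<phi> M w])
qed

lemma multilinear_add:
  assumes \<phi>: "multilinear R A n q M \<phi>" and M: "module R M" and w: "u @ (p, x) # v \<in> words A n q"
    and y: "y \<in> carrier (A p)"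
  shows "\<phi> (u @ (p, x \<oplus>\<^bsub>A p\<^esub> y) # v) = \<phi> (u @ (p, x) # v) \<oplus>\<^bsub>M\<^esub> \<phi> (u @ (p, y) # v)"
proof -
  interpret M: module R M by (fact M)
  interpret A: module R "A p" by (rule module)
  have x: "x \<in> carrier (A p)" using w by (rule words_letter)
  have "\<phi> (u @ (p, (\<one> \<odot>\<^bsub>A p\<^esub> x) \<oplus>\<^bsub>A p\<^esub> y) # v) =
      \<one> \<odot>\<^bsub>M\<^esub> \<phi> (u @ (p, x) # v) \<oplus>\<^bsub>M\<^esub> \<phi> (u @ (p, y) # v)"
    by (rule multilinear_comb[OF \<phi> w]) (auto simp: y)
  then show ?thesis
    using multilinear_closed[OF \<phi> w] x by simp
qed

text \<open>The kernel of the linear extension is a submodule that contains the relators, hence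
  contains the submodule they generate.\<close>

lemma free_lift_null:
  assumes \<phi>: "multilinear R A n q M \<phi>" and M: "module R M" and c: "c \<in> tensor_null R A n q"
  shows "free_lift R M \<phi> c = \<zero>\<^bsub>M\<^esub>"
proof -
  interpret M: module R M by (fact M)
  interpret F: module R "F n q" by (rule F_module)
  have phi: "\<phi> \<in> words A n q \<rightarrow> carrier M"
    using \<phi> by (auto simp: multilinear_def)
  note lin = free_lift_lin[OF M phi]
  note minus = lin_maps_minus[OF lin F_module M]
  have gen: "free_lift R M \<phi> (free_gen R w) = \<phi> w" if "w \<in> words A n q" for w
    using free_lift_gen[OF M that, of \<phi>] multilinear_closed[OF \<phi> that] by simp
  let ?N = "{c \<in> carrier (F n q). free_lift R M \<phi> c = \<zero>\<^bsub>M\<^esub>}"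
  have "submodule ?N R (F n q)"
    by (rule F.submoduleI)
      (auto simp: lin_maps_zero[OF lin F_module M] minus lin_maps_add[OF lin] lin_maps_smult[OF lin])
  moreover have "tensor_relators R A n q \<subseteq> ?N"
  proof
    fix c assume c: "c \<in> tensor_relators R A n q"
    have lift_minus: "free_lift R M \<phi> (c \<ominus>\<^bsub>F n q\<^esub> c') = free_lift R M \<phi> c \<ominus>\<^bsub>M\<^esub> free_lift R M \<phi> c'"
      if "c \<in> carrier (F n q)" "c' \<in> carrier (F n q)" for c c'
      using that by (simp add: a_minus_def lin_maps_add[OF lin] minus)
    have "free_lift R M \<phi> c = \<zero>\<^bsub>M\<^esub>"
      using c[unfolded tensor_relators_def Let_def]
    proof (elim UnE CollectE exE conjE)
      fix u p x y v
      assume c: "c = free_gen R (u @ (p, x \<oplus>\<^bsub>A p\<^esub> y) # v) \<ominus>\<^bsub>F n q\<^esub> free_gen R (u @ (p, x) # v)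
          \<ominus>\<^bsub>F n q\<^esub> free_gen R (u @ (p, y) # v)"
        and w: "u @ (p, x) # v \<in> words A n q" and y: "y \<in> carrier (A p)"
      have in_words: "u @ (p, y) # v \<in> words A n q" "u @ (p, x \<oplus>\<^bsub>A p\<^esub> y) # v \<in> words A n q"
        by (intro words_replace[OF w] letter_closed words_letter[OF w] y)+
      note cl = multilinear_closed[OF \<phi> w] multilinear_closed[OF \<phi> in_words(1)]
      show ?thesis
        unfolding c using cl
        by (simp add: lift_minus F.M.minus_closed gen_closed gen in_words w
            multilinear_add[OF \<phi> M w y] M.M.minus_minus_eq_zero_iff)
    next
      fix u p r x v
      assume c: "c = free_gen R (u @ (p, r \<odot>\<^bsub>A p\<^esub> x) # v) \<ominus>\<^bsub>F n q\<^esub> r \<odot>\<^bsub>F n q\<^esub> free_gen R (u @ (p, x) # v)"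
        and w: "u @ (p, x) # v \<in> words A n q" and r: "r \<in> carrier R"
      have in_words: "u @ (p, r \<odot>\<^bsub>A p\<^esub> x) # v \<in> words A n q"
        by (intro words_replace[OF w] letter_closed words_letter[OF w] r)
      show ?thesis
        unfolding c using multilinear_closed[OF \<phi> w] r
        by (simp add: lift_minus gen_closed gen in_words w lin_maps_smult[OF lin]
            multilinear_smult[OF \<phi> M w r] M.M.minus_eq_zero_iff)
    qed
    then show "c \<in> ?N" using c tensor_relators_carrier by auto
  qed
  ultimately show ?thesis
    using tensor_null_subset c by blast
qed

text \<open>The representative picked by \<open>SOME\<close> differs from c by an element of
  \<open>tensor_null\<close>, on which the linear extension vanishes.\<close>

lemma tensor_lift_proj:
  assumes \<phi>: "multilinear R A n q M \<phi>" and M: "module R M" and c: "c \<in> carrier (F n q)"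
  shows "tensor_lift R M \<phi> (proj n q c) = free_lift R M \<phi> c"
proof -
  interpret M: module R M by (fact M)
  interpret F: module R "F n q" by (rule F_module)
  have phi: "\<phi> \<in> words A n q \<rightarrow> carrier M"
    using \<phi> by (auto simp: multilinear_def)
  note lin = free_lift_lin[OF M phi]
  define c' where "c' = (SOME c'. c' \<in> proj n q c)"
  have "c \<in> proj n q c"
    by (rule quot_module_self[OF F_module tensor_null_submodule c])
  then have c': "c' \<in> proj n q c"
    unfolding c'_def by (rule someI[of "\<lambda>c'. c' \<in> proj n q c"])
  note rep = quot_module_rep[OF F_module tensor_null_submodule c c']
  have "free_lift R M \<phi> (c' \<ominus>\<^bsub>F n q\<^esub> c) = \<zero>\<^bsub>M\<^esub>"
    by (rule free_lift_null[OF \<phi> M rep(2)])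
  then have "free_lift R M \<phi> c' \<ominus>\<^bsub>M\<^esub> free_lift R M \<phi> c = \<zero>\<^bsub>M\<^esub>"
    using c rep(1)
    by (simp add: a_minus_def lin_maps_add[OF lin] lin_maps_minus[OF lin F_module M])
  then have "free_lift R M \<phi> c' = free_lift R M \<phi> c"
    using c rep(1) lin_maps_closed[OF lin] by (simp add: M.M.minus_eq_zero_iff)
  then show ?thesis
    by (simp add: tensor_lift_def free_lift_def c'_def Let_def)
qed

lemma T_carrierE:
  assumes "z \<in> carrier (T n q)"
  obtains c where "c \<in> carrier (F n q)" "z = proj n q c"
  using quot_module_carrierE[OF F_module tensor_null_submodule] assms
  unfolding tensor_power_def by metis

lemma tensor_lift_lin:
  assumes \<phi>: "multilinear R A n q M \<phi>" and M: "module R M"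
  shows "tensor_lift R M \<phi> \<in> lin_maps R (T n q) M"
proof -
  interpret M: module R M by (fact M)
  interpret F: module R "F n q" by (rule F_module)
  have phi: "\<phi> \<in> words A n q \<rightarrow> carrier M"
    using \<phi> by (auto simp: multilinear_def)
  note lin = free_lift_lin[OF M phi]
  note l = tensor_lift_proj[OF \<phi> M]
  show ?thesis
    by (rule lin_mapsI)
      (auto elim!: T_carrierE simp: l lin_maps_closed[OF lin] lin_maps_add[OF lin]
        lin_maps_smult[OF lin] lin_maps_add[OF proj_lin, symmetric]
        lin_maps_smult[OF proj_lin, symmetric])
qed

lemma tensor_lift_pure:
  assumes "multilinear R A n q M \<phi>" "module R M" "w \<in> words A n q"
  shows "tensor_lift R M \<phi> (pure w) = \<phi> w"
  using assms
  by (simp add: pure_eq_proj tensor_lift_proj gen_closed free_lift_gen multilinear_closed)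

text \<open>Induction on a finite set containing the support: the part of c at one word is a
  multiple of its generator, and the remainder has smaller support.\<close>

lemma F_induct [consumes 1, case_names zero add smult gen]:
  assumes "c \<in> carrier (F n q)"
    and "P \<zero>\<^bsub>F n q\<^esub>"
    and "\<And>c c'. c \<in> carrier (F n q) \<Longrightarrow> c' \<in> carrier (F n q) \<Longrightarrow> P c \<Longrightarrow> P c' \<Longrightarrow> P (c \<oplus>\<^bsub>F n q\<^esub> c')"
    and "\<And>r c. r \<in> carrier R \<Longrightarrow> c \<in> carrier (F n q) \<Longrightarrow> P c \<Longrightarrow> P (r \<odot>\<^bsub>F n q\<^esub> c)"
    and "\<And>w. w \<in> words A n q \<Longrightarrow> P (free_gen R w)"
  shows "P c"
proof -
  interpret F: module R "F n q" by (rule F_module)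
  have "\<forall>c. c \<in> carrier (F n q) \<longrightarrow> {w. c w \<noteq> \<zero>} \<subseteq> S \<longrightarrow> P c" if "finite S" for S
    using that
  proof (induction S)
    case empty
    have "c = \<zero>\<^bsub>F n q\<^esub>" if "{w. c w \<noteq> \<zero>} \<subseteq> {}" for c
      using that by (auto simp: free_module_simps)
    then show ?case using assms(2) by auto
  next
    case (insert w S)
    show ?case
    proof (intro allI impI)
      fix c assume c: "c \<in> carrier (F n q)" and S: "{w. c w \<noteq> \<zero>} \<subseteq> insert w S"
      show "P c"
      proof (cases "w \<in> words A n q")
        case False
        then have "c w = \<zero>" using c by (auto simp: free_module_simps)
        then show ?thesis using insert.IH c S by blast
      next
        case True
        define c' where "c' = c(w := \<zero>)"
        have cR: "c v \<in> carrier R" for v using c by (auto simp: free_module_simps)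
        have "finite {v. c' v \<noteq> \<zero>}"
          by (rule finite_subset[of _ "{v. c v \<noteq> \<zero>}"]) (use c in \<open>auto simp: c'_def free_module_simps\<close>)
        then have c': "c' \<in> carrier (F n q)"
          using c by (auto simp: c'_def free_module_simps)
        have "{v. c' v \<noteq> \<zero>} \<subseteq> S" using S by (auto simp: c'_def)
        then have "P c'" using insert.IH c' by blast
        have "c = (c w \<odot>\<^bsub>F n q\<^esub> free_gen R w) \<oplus>\<^bsub>F n q\<^esub> c'"
          using cR by (auto simp: free_module_simps(3,4) c'_def free_gen_def fun_eq_iff)
        then show ?thesis
          using assms(3-5) \<open>P c'\<close> c' True cR F.smult_closed gen_closed by metis
      qed
    qed
  qed
  moreover have "finite {w. c w \<noteq> \<zero>}" using assms(1) by (auto simp: free_module_simps)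
  ultimately show ?thesis using assms(1) by blast
qed

text \<open>Through this lemma linear maps on tensor powers are compared on words alone. Scalars are
  then taken care of by \<open>lin_maps\<close> and do not enter the calculus with formal sums of
  words.\<close>

lemma tensor_ext:
  assumes u: "u \<in> lin_maps R (T n q) M" and v: "v \<in> lin_maps R (T n q) M" and M: "module R M"
    and eq: "\<And>w. w \<in> words A n q \<Longrightarrow> u (pure w) = v (pure w)" and z: "z \<in> carrier (T n q)"
  shows "u z = v z"
proof -
  obtain c where c: "c \<in> carrier (F n q)" "z = proj n q c"
    using z by (rule T_carrierE)
  note U = lin_maps_compose[OF u proj_lin]
  note V = lin_maps_compose[OF v proj_lin]
  have "u (proj n q c) = v (proj n q c)"
    using c(1)
  proof (induction c rule: F_induct)
    case zero
    show ?case
      using lin_maps_zero[OF U F_module M] lin_maps_zero[OF V F_module M] by simp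
  next
    case (add c c')
    then show ?case using lin_maps_add[OF U add(1,2)] lin_maps_add[OF V add(1,2)] by simp
  next
    case (smult r c)
    then show ?case using lin_maps_smult[OF U smult(1,2)] lin_maps_smult[OF V smult(1,2)] by simp
  next
    case (gen w)
    then show ?case using eq[OF gen] by (simp add: pure_eq_proj)
  qed
  then show ?thesis by (simp add: c)
qed

end

section \<open>Tensor products of maps and the tensor differential\<close>

definition valid :: "(nat \<Rightarrow> ('k, 'a) module) \<Rightarrow> 'a word \<Rightarrow> bool" where
  "valid A w \<longleftrightarrow> (\<forall>(p, x)\<in>set w. x \<in> carrier (A p))"

lemma valid_simps [simp]:
  "valid A []"
  "valid A (a # w) \<longleftrightarrow> snd a \<in> carrier (A (fst a)) \<and> valid A w"
  "valid A (v @ w) \<longleftrightarrow> valid A v \<and> valid A w"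
  by (auto simp: valid_def)

lemma valid_take: "valid A w \<Longrightarrow> valid A (take n w)"
  and valid_drop: "valid A w \<Longrightarrow> valid A (drop n w)"
  by (auto simp: valid_def dest: in_set_takeD in_set_dropD)

lemma words_iff: "w \<in> words A n q \<longleftrightarrow> length w = n \<and> wdeg w = q \<and> valid A w"
  by (simp add: words_def valid_def)

lemma wdeg_take_drop: "wdeg (take n w) + wdeg (drop n w) = wdeg w"
  by (metis append_take_drop_id wdeg_simps(3))

definition arity :: "('k, 'a, 'b) multi_map list \<Rightarrow> nat" where
  "arity us = (\<Sum>(p, e, u)\<leftarrow>us. p)"

definition degree :: "('k, 'a, 'b) multi_map list \<Rightarrow> nat" where
  "degree us = (\<Sum>(p, e, u)\<leftarrow>us. e)"

lemma arity_simps [simp]: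
  "arity [] = 0" "arity ((p, e, u) # us) = p + arity us" "arity (us @ vs) = arity us + arity vs"
  and degree_simps [simp]:
  "degree [] = 0" "degree ((p, e, u) # us) = e + degree us"
  "degree (us @ vs) = degree us + degree vs"
  by (simp_all add: arity_def degree_def)

lemma koszul_exp_cong: "map fst w = map fst w' \<Longrightarrow> koszul_exp us w = koszul_exp us w'"
proof (induction us arbitrary: w w')
  case (Cons a us)
  obtain p e u where a: "a = (p, e, u)" by (cases a)
  have "map fst (take p w) = map fst (take p w')" "map fst (drop p w) = map fst (drop p w')"
    using Cons.prems by (metis take_map, metis drop_map)
  moreover from this(1) have "wdeg (take p w) = wdeg (take p w')"
    by (simp add: wdeg_def)
  ultimately show ?case
    using Cons.IH[of "drop p w" "drop p w'"] by (simp add: a)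
qed simp

lemma signed_closed: "module R M \<Longrightarrow> x \<in> carrier M \<Longrightarrow> signed M e x \<in> carrier M"
  by (simp add: signed_def module_def abelian_group.a_inv_closed)

lemma signed_comb:
  "module R M \<Longrightarrow> r \<in> carrier R \<Longrightarrow> x \<in> carrier M \<Longrightarrow> y \<in> carrier M \<Longrightarrow>
    signed M e (r \<odot>\<^bsub>M\<^esub> x \<oplus>\<^bsub>M\<^esub> y) = r \<odot>\<^bsub>M\<^esub> signed M e x \<oplus>\<^bsub>M\<^esub> signed M e y"
proof -
  assume *: "module R M" "r \<in> carrier R" "x \<in> carrier M" "y \<in> carrier M"
  interpret module R M by fact
  show ?thesis using * by (simp add: signed_def smult_r_minus M.minus_add)
qed

locale graded_modules = A: graded_module R A + B: graded_module R B
  for R (structure) and A :: "nat \<Rightarrow> ('k, 'a) module" and B :: "nat \<Rightarrow> ('k, 'b) module"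
begin

definition multi_lin :: "('k, 'a, 'b) multi_map \<Rightarrow> bool" where
  "multi_lin = (\<lambda>(p, e, u). \<forall>q. u q \<in> lin_maps R (A.T p q) (B (q + e)))"

lemma apply_maps_words:
  assumes "\<forall>a\<in>set us. multi_lin a" "w \<in> words A (arity us) q"
  shows "apply_maps R A us w \<in> words B (length us) (q + degree us)"
  using assms
proof (induction us arbitrary: w q)
  case (Cons a us)
  obtain p e u where a: "a = (p, e, u)" by (cases a)
  have t: "take p w \<in> words A p (wdeg (take p w))"
    and d: "drop p w \<in> words A (arity us) (wdeg (drop p w))"
    using Cons.prems(2) by (auto simp: a words_iff valid_take valid_drop)
  have "u (wdeg (take p w)) (A.pure (take p w)) \<in> carrier (B (wdeg (take p w) + e))"
    using Cons.prems(1) lin_maps_closed A.pure_closed[OF t] by (fastforce simp: multi_lin_def a)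
  moreover have "apply_maps R A us (drop p w) \<in> words B (length us) (wdeg (drop p w) + degree us)"
    using Cons.IH[OF _ d] Cons.prems(1) by simp
  moreover have "wdeg (take p w) + wdeg (drop p w) = q"
    using Cons.prems(2) by (simp add: wdeg_take_drop words_iff)
  ultimately show ?case
    by (auto simp: a words_iff)
qed (auto simp: words_iff)

text \<open>The prefix \<open>pre\<close> collects the letters already produced by earlier maps. It
  keeps the whole induction inside one fixed tensor power, although the list of remaining maps
  shrinks.\<close>

lemma apply_maps_comb:
  assumes "\<forall>a\<in>set us. multi_lin a" "u @ (d, x) # v \<in> words A (arity us) q"
    and "y \<in> carrier (A d)" "r \<in> carrier R" "valid B pre"
    and "n = length pre + length us" "q' = wdeg pre + q + degree us"
  shows "B.pure (pre @ apply_maps R A us (u @ (d, (r \<odot>\<^bsub>A d\<^esub> x) \<oplus>\<^bsub>A d\<^esub> y) # v)) =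
    r \<odot>\<^bsub>B.T n q'\<^esub> B.pure (pre @ apply_maps R A us (u @ (d, x) # v))
      \<oplus>\<^bsub>B.T n q'\<^esub> B.pure (pre @ apply_maps R A us (u @ (d, y) # v))"
  using assms
proof (induction us arbitrary: u v q pre)
  case Nil
  then show ?case by (auto simp: words_iff)
next
  case (Cons a us)
  obtain p e f where a: "a = (p, e, f)" by (cases a)
  have f: "f q \<in> lin_maps R (A.T p q) (B (q + e))" for q
    using Cons.prems(1) by (auto simp: multi_lin_def a)
  have us: "\<forall>a\<in>set us. multi_lin a" using Cons.prems(1) by simp
  define z where "z = (r \<odot>\<^bsub>A d\<^esub> x) \<oplus>\<^bsub>A d\<^esub> y"
  have x: "x \<in> carrier (A d)" using Cons.prems(2) by (auto simp: words_iff)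
  have z: "z \<in> carrier (A d)"
    unfolding z_def by (intro A.letter_closed Cons.prems x)
  show ?case
  proof (cases "length u < p")
    case True
    \<comment> \<open>The changed letter lies in the first block: linearity of f turns the change of
      its argument into a change of one letter of the output word.\<close>
    define v1 v2 where "v1 = take (p - length u - 1) v" and "v2 = drop (p - length u - 1) v"
    have td: "take p (u @ (d, t) # v) = u @ (d, t) # v1" "drop p (u @ (d, t) # v) = v2" for t
      using True by (simp_all add: v1_def v2_def take_Cons' drop_Cons')
    define q1 where "q1 = wdeg u + d + wdeg v1"
    have w1: "u @ (d, t) # v1 \<in> words A p q1" if "t \<in> carrier (A d)" for t
      using Cons.prems(2) True that
      by (auto simp: words_iff a q1_def v1_def valid_take)
    have v2: "v2 \<in> words A (arity us) (wdeg v2)"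
      using Cons.prems(2) True by (auto simp: words_iff a v2_def valid_drop)
    have q: "q1 + wdeg v2 = q"
      using Cons.prems(2) wdeg_take_drop[of "p - length u - 1" v]
      by (auto simp: words_iff q1_def v1_def v2_def)
    have deg: "wdeg u + (d + wdeg v1) = q1" by (simp add: q1_def)
    have fz: "f q1 (A.pure (u @ (d, z) # v1)) =
      (r \<odot>\<^bsub>B (q1 + e)\<^esub> f q1 (A.pure (u @ (d, x) # v1))) \<oplus>\<^bsub>B (q1 + e)\<^esub> f q1 (A.pure (u @ (d, y) # v1))"
    proof -
      interpret T: module R "A.T p q1" by (rule A.T_module)
      show ?thesis
        unfolding z_def multilinear_comb[OF A.pure_multilinear w1[OF x] Cons.prems(3,4)]
        using A.pure_closed[OF w1[OF x]] A.pure_closed[OF w1[OF Cons.prems(3)]] Cons.prems(4)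
        by (simp add: lin_maps_add[OF f] lin_maps_smult[OF f])
    qed
    have fc: "f q1 (A.pure (u @ (d, t) # v1)) \<in> carrier (B (q1 + e))" if "t \<in> carrier (A d)" for t
      using lin_maps_closed[OF f A.pure_closed[OF w1[OF that]]] .
    have "pre @ (q1 + e, f q1 (A.pure (u @ (d, x) # v1))) # apply_maps R A us v2 \<in> words B n q'"
      using apply_maps_words[OF us v2] Cons.prems(5-7) fc[OF x] q by (auto simp: words_iff a)
    note comb = multilinear_comb[OF B.pure_multilinear this fc[OF Cons.prems(3)] Cons.prems(4)]
    have "apply_maps R A (a # us) (u @ (d, t) # v) =
        (q1 + e, f q1 (A.pure (u @ (d, t) # v1))) # apply_maps R A us v2" for t
      by (simp only: a apply_maps.simps td wdeg_simps fst_conv deg)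
    then show ?thesis
      using comb by (simp only: z_def[symmetric] fz)
  next
    case False
    \<comment> \<open>The changed letter lies beyond the first block, whose image is moved into the
      prefix before the induction hypothesis is applied.\<close>
    define u2 where "u2 = drop p u"
    have td: "take p (u @ w) = take p u" "drop p (u @ w) = u2 @ w" for w
      using False by (simp_all add: u2_def)
    let ?l = "(wdeg (take p u) + e, f (wdeg (take p u)) (A.pure (take p u)))"
    have q: "wdeg (take p u) + wdeg u2 = wdeg u"
      by (simp add: u2_def wdeg_take_drop)
    have t: "take p u \<in> words A p (wdeg (take p u))"
      using Cons.prems(2) False by (auto simp: words_iff valid_take)
    have pre: "valid B (pre @ [?l])"
      using Cons.prems(5) lin_maps_closed[OF f A.pure_closed[OF t]] by simp
    have w2: "u2 @ (d, x) # v \<in> words A (arity us) (wdeg (u2 @ (d, x) # v))"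
      using Cons.prems(2) False by (auto simp: words_iff a u2_def valid_drop)
    have "n = length (pre @ [?l]) + length us"
      "q' = wdeg (pre @ [?l]) + wdeg (u2 @ (d, x) # v) + degree us"
      using Cons.prems(2,6,7) q by (auto simp: words_iff a)
    note comb = Cons.IH[OF us w2 Cons.prems(3,4) pre this]
    have "apply_maps R A (a # us) (u @ w) = ?l # apply_maps R A us (u2 @ w)" for w
      by (simp only: a apply_maps.simps td)
    then show ?thesis
      using comb by simp
  qed
qed

lemma tensor_maps_multilinear:
  assumes us: "\<forall>a\<in>set us. multi_lin a" and n: "n = arity us" and q': "q' = q + degree us"
  shows "multilinear R A n q (B.T (length us) q')
    (\<lambda>w. signed (B.T (length us) q') (int (koszul_exp us w)) (B.pure (apply_maps R A us w)))"
proof -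
  interpret T: module R "B.T (length us) q'" by (rule B.T_module)
  have cl: "B.pure (apply_maps R A us w) \<in> carrier (B.T (length us) q')" if "w \<in> words A n q" for w
    using B.pure_closed[OF apply_maps_words[OF us]] that by (simp add: n q')
  have k: "koszul_exp us (u @ (p, x) # v) = koszul_exp us (u @ (p, y) # v)" for u p x y v
    by (rule koszul_exp_cong) simp
  show ?thesis
    unfolding multilinear_def
  proof (intro conjI ballI allI impI)
    fix u p x y v r
    assume r: "r \<in> carrier R" and w: "u @ (p, x) # v \<in> words A n q" and y: "y \<in> carrier (A p)"
    have "B.pure (apply_maps R A us (u @ (p, (r \<odot>\<^bsub>A p\<^esub> x) \<oplus>\<^bsub>A p\<^esub> y) # v)) =
      r \<odot>\<^bsub>B.T (length us) q'\<^esub> B.pure (apply_maps R A us (u @ (p, x) # v))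
      \<oplus>\<^bsub>B.T (length us) q'\<^esub> B.pure (apply_maps R A us (u @ (p, y) # v))"
      using apply_maps_comb[OF us w[unfolded n] y r, of "[]" "length us" q'] by (simp add: q')
    then show "signed (B.T (length us) q') (int (koszul_exp us (u @ (p, (r \<odot>\<^bsub>A p\<^esub> x) \<oplus>\<^bsub>A p\<^esub> y) # v)))
        (B.pure (apply_maps R A us (u @ (p, (r \<odot>\<^bsub>A p\<^esub> x) \<oplus>\<^bsub>A p\<^esub> y) # v))) =
      r \<odot>\<^bsub>B.T (length us) q'\<^esub> signed (B.T (length us) q') (int (koszul_exp us (u @ (p, x) # v)))
        (B.pure (apply_maps R A us (u @ (p, x) # v)))
      \<oplus>\<^bsub>B.T (length us) q'\<^esub> signed (B.T (length us) q') (int (koszul_exp us (u @ (p, y) # v)))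
        (B.pure (apply_maps R A us (u @ (p, y) # v)))"
      using cl[OF w] cl[OF words_replace[OF w y]] r
      by (simp add: k[of u p "(r \<odot>\<^bsub>A p\<^esub> x) \<oplus>\<^bsub>A p\<^esub> y" v x] k[of u p y v x] signed_comb[OF B.T_module])
  qed (intro signed_closed[OF B.T_module] cl)
qed

lemma tensor_maps_lin:
  assumes us: "\<forall>a\<in>set us. multi_lin a" and "n = arity us" "r = length us" "q' = q + degree us"
  shows "tensor_maps R A B us q \<in> lin_maps R (A.T n q) (B.T r q')"
  using A.tensor_lift_lin[OF tensor_maps_multilinear[OF us assms(2,4)] B.T_module] assms(3,4)
  by (simp add: tensor_maps_def degree_def Let_def)

lemma tensor_maps_pure:
  assumes us: "\<forall>a\<in>set us. multi_lin a" and w: "w \<in> words A (arity us) q" and "q' = q + degree us"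
  shows "tensor_maps R A B us q (A.pure w) =
    signed (B.T (length us) q') (int (koszul_exp us w)) (B.pure (apply_maps R A us w))"
  using A.tensor_lift_pure[OF tensor_maps_multilinear[OF us refl assms(3)] B.T_module w] assms(3)
  by (simp add: tensor_maps_def degree_def Let_def)

end

lemma (in graded_module) unit_map_multilinear: "multilinear R A 1 q (A q) (\<lambda>w. snd (hd w))"
  by (auto simp: multilinear_def words_iff length_Suc_conv Cons_eq_append_conv)

lemma (in graded_module) unit_map_lin: "unit_map R A q \<in> lin_maps R (T 1 q) (A q)"
  unfolding unit_map_def by (rule tensor_lift_lin[OF unit_map_multilinear module])

lemma (in graded_module) unit_map_pure: "x \<in> carrier (A q) \<Longrightarrow> unit_map R A q (pure [(q, x)]) = x"
  unfolding unit_map_def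
  by (subst tensor_lift_pure[OF unit_map_multilinear module]) (auto simp: words_iff)

locale dg_module = graded_module R A
  for R (structure) and A :: "nat \<Rightarrow> ('k, 'a) module" +
  fixes d :: "nat \<Rightarrow> 'a \<Rightarrow> 'a"
  assumes diff_module: "diff_module R A d"
begin

lemma d_lin: "d q \<in> lin_maps R (A q) (A (q - 1))"
  using diff_module by (auto simp: diff_module_def)

definition dterm :: "nat \<Rightarrow> nat \<Rightarrow> nat \<Rightarrow> 'a word \<Rightarrow> ('k, 'a) tensor" where
  "dterm n q i w = signed (T n (q - 1)) (int (wdeg (take i w)))
     (pure (w[i := (fst (w ! i) - 1, d (fst (w ! i)) (snd (w ! i)))]))"

lemma wdeg_update: "i < length w \<Longrightarrow> wdeg (w[i := a]) + fst (w ! i) = wdeg w + fst a"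
  by (induction w arbitrary: i) (auto split: nat.splits simp: nth_Cons')

lemma dterm_word:
  assumes "w \<in> words A n q" "i < n" "0 < fst (w ! i)"
  shows "w[i := (fst (w ! i) - 1, d (fst (w ! i)) (snd (w ! i)))] \<in> words A n (q - 1)"
proof -
  have "valid A (w[i := (fst (w ! i) - 1, d (fst (w ! i)) (snd (w ! i)))])"
    unfolding valid_def
  proof (clarify)
    fix p x assume "(p, x) \<in> set (w[i := (fst (w ! i) - 1, d (fst (w ! i)) (snd (w ! i)))])"
    then have "(p, x) \<in> set w \<or> (p, x) = (fst (w ! i) - 1, d (fst (w ! i)) (snd (w ! i)))"
      using set_update_subset_insert by fast
    moreover have "w ! i \<in> set w" using assms by (auto simp: words_iff)
    ultimately show "x \<in> carrier (A p)"
      using assms(1) lin_maps_closed[OF d_lin] by (auto simp: words_iff valid_def)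
  qed
  then show ?thesis
    using assms wdeg_update[of i w "(fst (w ! i) - 1, d (fst (w ! i)) (snd (w ! i)))"]
    by (auto simp: words_iff)
qed

lemma dterm_closed:
  assumes "w \<in> words A n q" "i < n" "0 < fst (w ! i)"
  shows "dterm n q i w \<in> carrier (T n (q - 1))"
  unfolding dterm_def by (intro signed_closed[OF T_module] pure_closed dterm_word assms)

lemma dterm_comb:
  assumes w: "u @ (p, x) # v \<in> words A n q" and y: "y \<in> carrier (A p)" and r: "r \<in> carrier R"
    and i: "i < n" "0 < fst ((u @ (p, x) # v) ! i)"
  shows "dterm n q i (u @ (p, (r \<odot>\<^bsub>A p\<^esub> x) \<oplus>\<^bsub>A p\<^esub> y) # v) =
    r \<odot>\<^bsub>T n (q - 1)\<^esub> dterm n q i (u @ (p, x) # v) \<oplus>\<^bsub>T n (q - 1)\<^esub> dterm n q i (u @ (p, y) # v)"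
proof -
  have x: "x \<in> carrier (A p)" using w by (rule words_letter)
  define z where "z = (r \<odot>\<^bsub>A p\<^esub> x) \<oplus>\<^bsub>A p\<^esub> y"
  have z: "z \<in> carrier (A p)" unfolding z_def by (intro letter_closed x y r)
  define W where "W t = u @ (p, t) # v" for t
  define W' where "W' t = (W t)[i := (fst (W t ! i) - 1, d (fst (W t ! i)) (snd (W t ! i)))]" for t
  have fst_i: "fst (W t ! i) = fst (W x ! i)" for t
    by (auto simp: W_def nth_append nth_Cons split: nat.splits)
  have pos: "0 < fst (W t ! i)" for t
    using i(2) fst_i[of t] by (simp add: W_def)
  have word: "W' t \<in> words A n (q - 1)" if "t \<in> carrier (A p)" for t
    unfolding W'_def
    by (rule dterm_word[OF _ i(1) pos]) (simp add: W_def words_replace[OF w that])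
  have "pure (W' z) = r \<odot>\<^bsub>T n (q - 1)\<^esub> pure (W' x) \<oplus>\<^bsub>T n (q - 1)\<^esub> pure (W' y)"
  proof (cases "i = length u")
    case True
    then have W': "W' t = u @ (p - 1, d p t) # v" for t
      by (simp add: W'_def W_def)
    have dz: "d p z = (r \<odot>\<^bsub>A (p - 1)\<^esub> d p x) \<oplus>\<^bsub>A (p - 1)\<^esub> d p y"
      using r x y letter_closed(2)[OF x r]
      by (simp add: z_def lin_maps_add[OF d_lin] lin_maps_smult[OF d_lin])
    show ?thesis
      using multilinear_comb[OF pure_multilinear, of u "p - 1" "d p x" v n "q - 1" "d p y" r]
        word[OF x] lin_maps_closed[OF d_lin y] r by (simp add: W' dz)
  next
    case False
    \<comment> \<open>The differential acts on another letter, so the changed letter survives; only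
      the word before or after it is altered, and in the same way for every t.\<close>
    then obtain u' v' where W': "W' t = u' @ (p, t) # v'" for t
    proof (cases "i < length u")
      case True
      then show ?thesis
        by (intro that[of "u[i := (fst (u ! i) - 1, d (fst (u ! i)) (snd (u ! i)))]" v])
          (simp add: W'_def W_def nth_append list_update_append)
    next
      case ge: False
      define j where "j = i - length u - 1"
      have j: "i = length u + Suc j" using ge False by (simp add: j_def)
      show ?thesis
        by (intro that[of u "v[j := (fst (v ! j) - 1, d (fst (v ! j)) (snd (v ! j)))]"])
          (simp add: W'_def W_def j nth_append list_update_append)
    qed
    show ?thesis
      using multilinear_comb[OF pure_multilinear, of u' p x v' n "q - 1" y r]
        word[OF x] y r by (simp add: W' z_def)
  qed
  moreover have "dterm n q i (W t) = signed (T n (q - 1)) (int (wdeg (take i (W x)))) (pure (W' t))" for t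
  proof -
    have "wdeg (take i (W t)) = wdeg (take i (W x))"
      unfolding wdeg_def by (simp add: take_map[symmetric]) (simp add: W_def)
    then show ?thesis by (simp only: dterm_def W'_def)
  qed
  ultimately have "dterm n q i (W z) =
      r \<odot>\<^bsub>T n (q - 1)\<^esub> dterm n q i (W x) \<oplus>\<^bsub>T n (q - 1)\<^esub> dterm n q i (W y)"
    using signed_comb[OF T_module r pure_closed[OF word[OF x]] pure_closed[OF word[OF y]],
        of "int (wdeg (take i (W x)))"] by simp
  then show ?thesis by (simp add: W_def z_def)
qed

abbreviation dword where
  "dword n q w \<equiv> (\<Oplus>\<^bsub>T n (q - 1)\<^esub>i\<in>{i. i < n \<and> 0 < fst (w ! i)}. dterm n q i w)"

lemma dword_multilinear: "multilinear R A n q (T n (q - 1)) (dword n q)"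
  unfolding multilinear_def
proof (intro conjI ballI allI impI)
  interpret M: module R "T n (q - 1)" by (rule T_module)
  fix w assume w: "w \<in> words A n q"
  show "dword n q w \<in> carrier (T n (q - 1))"
    by (intro M.M.finsum_closed Pi_I) (elim CollectE conjE, rule dterm_closed[OF w])
next
  interpret M: module R "T n (q - 1)" by (rule T_module)
  fix u p x y v r
  assume r: "r \<in> carrier R" and w: "u @ (p, x) # v \<in> words A n q" and y: "y \<in> carrier (A p)"
  let ?W = "\<lambda>t. u @ (p, t) # v" and ?z = "(r \<odot>\<^bsub>A p\<^esub> x) \<oplus>\<^bsub>A p\<^esub> y"
  have fst_i: "fst (?W t ! i) = fst (?W x ! i)" for t i
    by (auto simp: nth_append nth_Cons split: nat.splits)
  let ?S = "{i. i < n \<and> 0 < fst (?W x ! i)}"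
  have cx: "dterm n q i (?W x) \<in> carrier (T n (q - 1))"
    and cy: "dterm n q i (?W y) \<in> carrier (T n (q - 1))" if "i \<in> ?S" for i
    using that dterm_closed[OF w] dterm_closed[OF words_replace[OF w y]] by (auto simp: fst_i[of y])
  have "dword n q (?W ?z) = (\<Oplus>\<^bsub>T n (q - 1)\<^esub>i\<in>?S. dterm n q i (?W ?z))"
    by (simp only: fst_i[of ?z])
  also have "\<dots> = (\<Oplus>\<^bsub>T n (q - 1)\<^esub>i\<in>?S. r \<odot>\<^bsub>T n (q - 1)\<^esub> dterm n q i (?W x) \<oplus>\<^bsub>T n (q - 1)\<^esub> dterm n q i (?W y))"
    by (rule M.M.finsum_cong') (auto simp: dterm_comb[OF w y r] cx cy r simp del: One_nat_def)
  also have "\<dots> = (\<Oplus>\<^bsub>T n (q - 1)\<^esub>i\<in>?S. r \<odot>\<^bsub>T n (q - 1)\<^esub> dterm n q i (?W x)) \<oplus>\<^bsub>T n (q - 1)\<^esub>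
      (\<Oplus>\<^bsub>T n (q - 1)\<^esub>i\<in>?S. dterm n q i (?W y))"
    by (rule M.M.finsum_addf) (use cx cy r in \<open>auto simp del: One_nat_def\<close>)
  also have "(\<Oplus>\<^bsub>T n (q - 1)\<^esub>i\<in>?S. r \<odot>\<^bsub>T n (q - 1)\<^esub> dterm n q i (?W x)) = r \<odot>\<^bsub>T n (q - 1)\<^esub> dword n q (?W x)"
    by (rule M.finsum_smult_ldistr[symmetric]) (use cx r in \<open>auto simp del: One_nat_def\<close>)
  also have "(\<Oplus>\<^bsub>T n (q - 1)\<^esub>i\<in>?S. dterm n q i (?W y)) = dword n q (?W y)"
    by (simp only: fst_i[of y])
  finally show "dword n q (?W ?z) =
    r \<odot>\<^bsub>T n (q - 1)\<^esub> dword n q (?W x) \<oplus>\<^bsub>T n (q - 1)\<^esub> dword n q (?W y)" .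
qed

abbreviation dT where "dT \<equiv> tensor_diff R A d"

lemma tensor_diff_lin: "dT n q \<in> lin_maps R (T n q) (T n (q - 1))"
  using tensor_lift_lin[OF dword_multilinear T_module] by (simp add: tensor_diff_def dterm_def Let_def)

lemma tensor_diff_pure: "w \<in> words A n q \<Longrightarrow> dT n q (pure w) = dword n q w"
  using tensor_lift_pure[OF dword_multilinear T_module] by (simp add: tensor_diff_def dterm_def Let_def)

end

section \<open>Multiplicative families on words\<close>

type_synonym 'a frag = "'a word \<Rightarrow>\<^sub>0 int"

text \<open>Compatibility with differences is what \<open>frag_induction\<close> asks for, and it
  already forces the value 0 at 0. Identities in several arguments follow by one application per
  argument.\<close>

lemma frag_ext:
  assumes "\<And>x. f (frag_of x) = g (frag_of x)"
    and "\<And>a b. f (a - b) = f a - f b" "\<And>a b. g (a - b) = g a - (g b :: 'b :: ab_group_add)"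
  shows "f p = g p"
proof -
  have zero: "f 0 = 0" "g 0 = 0"
    using assms(2)[of 0 0] assms(3)[of 0 0] by simp_all
  have "Poly_Mapping.keys p \<subseteq> UNIV" by simp
  then show ?thesis
    by (induction p rule: frag_induction) (simp_all add: assms zero)
qed

lemma frag_extend_fun_add: "frag_extend (\<lambda>x. f x + g x) p = frag_extend f p + frag_extend g p"
  by (rule frag_ext) (simp_all add: frag_extend_diff)

lemma frag_extend_fun_diff: "frag_extend (\<lambda>x. f x - g x) p = frag_extend f p - frag_extend g p"
  by (rule frag_ext) (simp_all add: frag_extend_diff)

lemma frag_extend_fun_minus: "frag_extend (\<lambda>x. - f x) p = - frag_extend f p"
  by (rule frag_ext) (simp_all add: frag_extend_diff)

lemma frag_extend_fun_zero: "frag_extend (\<lambda>x. 0) p = 0"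
  by (rule frag_ext) (simp_all add: frag_extend_diff)

lemma frag_extend_fun_sum: "frag_extend (\<lambda>x. \<Sum>i\<in>S. f i x) p = (\<Sum>i\<in>S. frag_extend (f i) p)"
  by (induction S rule: infinite_finite_induct) (simp_all add: frag_extend_fun_zero frag_extend_fun_add)

definition sg :: "nat \<Rightarrow> 'b :: ab_group_add \<Rightarrow> 'b" where
  "sg e p = (if even e then p else - p)"

lemma sg_sg: "sg a (sg b p) = sg (a + b) p"
  and sg_add: "sg a (p + q) = sg a p + sg a q"
  and sg_diff: "sg a (p - q) = sg a p - sg a q"
  and sg_0 [simp]: "sg 0 p = p" "sg a 0 = 0"
  and sg_Suc: "sg (Suc a) p = - sg a p"
  by (auto simp: sg_def)

lemma sg_sum: "sg a (\<Sum>i\<in>S. f i) = (\<Sum>i\<in>S. sg a (f i))"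
  by (simp add: sg_def sum_negf)

lemma sg_cong: "even (a + b) \<Longrightarrow> sg a p = sg b p"
  by (auto simp: sg_def)

lemma frag_extend_sg: "frag_extend f (sg a p) = sg a (frag_extend f p)"
  by (simp add: sg_def frag_extend_minus)

lemma frag_extend_fun_sg: "frag_extend (\<lambda>x. sg a (f x)) p = sg a (frag_extend f p)"
  by (simp add: sg_def frag_extend_fun_minus)

section \<open>The concatenation product of formal sums of words\<close>

definition cat :: "'a frag \<Rightarrow> 'a frag \<Rightarrow> 'a frag" where
  "cat p q = frag_extend (\<lambda>u. frag_extend (\<lambda>v. frag_of (u @ v)) q) p"

lemma cat_of [simp]: "cat (frag_of u) (frag_of v) = frag_of (u @ v)"
  by (simp add: cat_def)

lemma cat_zero [simp]: "cat 0 q = 0" "cat p 0 = 0"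
  by (simp_all add: cat_def frag_extend_fun_zero)

lemma cat_add: "cat (p + p') q = cat p q + cat p' q" "cat p (q + q') = cat p q + cat p q'"
  by (simp_all add: cat_def frag_extend_add frag_extend_fun_add)

lemma cat_diff: "cat (p - p') q = cat p q - cat p' q" "cat p (q - q') = cat p q - cat p q'"
  by (simp_all add: cat_def frag_extend_diff frag_extend_fun_diff)

lemma cat_minus: "cat (- p) q = - cat p q" "cat p (- q) = - cat p q"
  by (simp_all add: cat_def frag_extend_minus frag_extend_fun_minus)

lemma cat_sg: "cat (sg a p) q = sg a (cat p q)" "cat p (sg a q) = sg a (cat p q)"
  by (simp_all add: sg_def cat_minus)

lemma cat_sum: "cat (\<Sum>i\<in>S. f i) q = (\<Sum>i\<in>S. cat (f i) q)" "cat p (\<Sum>i\<in>S. f i) = (\<Sum>i\<in>S. cat p (f i))"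
  by (induction S rule: infinite_finite_induct) (simp_all add: cat_add)

lemma cat_assoc: "cat (cat p q) r = cat p (cat q r)"
proof (rule frag_ext[where p = p])
  show "cat (cat (frag_of u) q) r = cat (frag_of u) (cat q r)" for u
    by (rule frag_ext[where p = q], rule frag_ext[where p = r])
      (simp_all add: cat_diff)
qed (simp_all add: cat_diff)

lemma cat_Nil [simp]: "cat p (frag_of []) = p" "cat (frag_of []) p = p"
  by (rule frag_ext[where p = p]; simp add: cat_diff)+

lemma keys_cat: "Poly_Mapping.keys (cat p q) \<subseteq> (\<lambda>(u, v). u @ v) ` (Poly_Mapping.keys p \<times> Poly_Mapping.keys q)"
  unfolding cat_def
  by (rule order_trans[OF keys_frag_extend] UN_least)+ (auto simp: image_iff)

lemma keys_catE:
  assumes "w \<in> Poly_Mapping.keys (cat p q)"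
  obtains u v where "w = u @ v" "u \<in> Poly_Mapping.keys p" "v \<in> Poly_Mapping.keys q"
proof -
  have "w \<in> (\<lambda>(u, v). u @ v) ` (Poly_Mapping.keys p \<times> Poly_Mapping.keys q)"
    using assms keys_cat by (rule rev_subsetD)
  then show ?thesis by (auto intro: that)
qed

lemma keys_sg [simp]: "Poly_Mapping.keys (sg a p) = Poly_Mapping.keys p"
  by (simp add: sg_def)

text \<open>Cutting after n letters undoes concatenation once every word of the left factor has
  length n. This is how a blockwise family acts separately on the two factors.\<close>

lemma extend_cat:
  assumes "\<And>w. w \<in> Poly_Mapping.keys X \<Longrightarrow> length w = n"
  shows "frag_extend (\<lambda>w. cat (P (take n w)) (Q (drop n w))) (cat X Y) =
    cat (frag_extend P X) (frag_extend Q Y)"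
proof -
  let ?E = "frag_extend (\<lambda>w. cat (P (take n w)) (Q (drop n w)))"
  have "Poly_Mapping.keys X \<subseteq> {w. length w = n}" using assms by auto
  then show ?thesis
  proof (induction X rule: frag_induction)
    case (one x)
    have "?E (cat (frag_of x) Y) = cat (P x) (frag_extend Q Y)"
      by (rule frag_ext[where p = Y]) (use one in \<open>simp_all add: cat_diff frag_extend_diff\<close>)
    then show ?case by simp
  qed (simp_all add: cat_diff frag_extend_diff)
qed

text \<open>Words are graded by the degree in the bar construction, where every letter is shifted by one.\<close>

definition sdeg :: "'a word \<Rightarrow> nat" where
  "sdeg w = wdeg w + length w"

lemma sdeg_simps [simp]:
  "sdeg [] = 0" "sdeg (a # w) = fst a + 1 + sdeg w" "sdeg (v @ w) = sdeg v + sdeg w"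
  by (simp_all add: sdeg_def)

lemma sdeg_take_drop: "sdeg (take n w) + sdeg (drop n w) = sdeg w"
  by (metis append_take_drop_id sdeg_simps(3))

text \<open>A block of \<open>a + 1\<close> letters is encoded by a. No block is then empty, a zero
  entry is a single letter, and \<open>sum_list\<close> counts the gaps inside blocks, which is the
  length of the corresponding tuple.\<close>

fun Fs :: "('a word \<Rightarrow> 'b frag) \<Rightarrow> nat list \<Rightarrow> 'a word \<Rightarrow> 'b frag" where
  "Fs F [] w = frag_of []"
| "Fs F (a # ns) w = cat (F (take (Suc a) w)) (Fs F ns (drop (Suc a) w))"

text \<open>The sign is the Koszul sign for moving the odd cochain H across the first block; G and F
  are even and cause none.\<close>

fun Hs :: "('a word \<Rightarrow> 'b frag) \<Rightarrow> ('a word \<Rightarrow> 'b frag) \<Rightarrow> ('a word \<Rightarrow> 'b frag) \<Rightarrow> nat list \<Rightarrow>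
    'a word \<Rightarrow> 'b frag" where
  "Hs F G H [] w = 0"
| "Hs F G H (a # ns) w = cat (H (take (Suc a) w)) (Fs F ns (drop (Suc a) w)) +
     sg (sdeg (take (Suc a) w)) (cat (G (take (Suc a) w)) (Hs F G H ns (drop (Suc a) w)))"

section \<open>Compositions and refinements of block decompositions\<close>

definition csum :: "nat list \<Rightarrow> nat" where
  "csum ns = sum_list (map Suc ns)"

lemma csum_simps [simp]:
  "csum [] = 0" "csum (a # ns) = Suc a + csum ns" "csum (ms @ ns) = csum ms + csum ns"
  by (simp_all add: csum_def)

lemma csum_eq: "csum ns = sum_list ns + length ns"
  by (induction ns) simp_all

definition comps :: "nat \<Rightarrow> nat list set" where
  "comps n = {ms. csum ms = n}"

fun refine :: "nat list \<Rightarrow> nat list list set" where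
  "refine [] = {[]}"
| "refine (a # ns) = (\<lambda>(ms, mss). ms # mss) ` (comps (Suc a) \<times> refine ns)"

text \<open>After the right factor every small block has become one letter. A block cut into
  \<open>length ms\<close> pieces is therefore a block of \<open>length ms\<close> letters, encoded
  by one less.\<close>

abbreviation rd :: "nat list list \<Rightarrow> nat list" where
  "rd mss \<equiv> map (\<lambda>ms. length ms - 1) mss"

lemma finite_comps [simp]: "finite (comps n)"
proof -
  have len: "length ms \<le> csum ms" for ms by (induction ms) auto
  have le: "m \<le> csum ms" if "m \<in> set ms" for m ms using that by (induction ms) auto
  have "ms \<in> {ms. set ms \<subseteq> {..n} \<and> length ms \<le> n}" if "ms \<in> comps n" for ms
    using that len[of ms] le[of _ ms] by (auto simp: comps_def)
  then have "comps n \<subseteq> {ms. set ms \<subseteq> {..n} \<and> length ms \<le> n}" by blast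
  then show ?thesis by (rule finite_subset) (simp add: finite_lists_length_le)
qed

lemma finite_refine [simp]: "finite (refine ns)"
  by (induction ns) simp_all

lemma comps_Suc_ne: "ms \<in> comps (Suc a) \<Longrightarrow> ms \<noteq> []"
  by (auto simp: comps_def)

lemma sum_refine_Cons:
  "(\<Sum>mss\<in>refine (a # ns). f mss) = (\<Sum>ms\<in>comps (Suc a). \<Sum>mss\<in>refine ns. f (ms # mss))"
proof -
  have "inj_on (\<lambda>(ms, mss). ms # mss) (comps (Suc a) \<times> refine ns)"
    by (auto simp: inj_on_def)
  then show ?thesis
    by (simp add: sum.reindex sum.cartesian_product case_prod_unfold)
qed

lemma csum_concat_refine: "mss \<in> refine ns \<Longrightarrow> csum (concat mss) = csum ns"
  by (induction ns arbitrary: mss) (auto simp: comps_def)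

text \<open>Each \<open>mss\<close> refines the block decomposition \<open>ns\<close>: the right factor is applied to the small
  blocks \<open>concat mss\<close>, and the left factor joins those that lie in the same block of \<open>ns\<close>.\<close>

definition conv :: "(nat list \<Rightarrow> 'b word \<Rightarrow> 'c frag) \<Rightarrow> (nat list \<Rightarrow> 'a word \<Rightarrow> 'b frag) \<Rightarrow>
    nat list \<Rightarrow> 'a word \<Rightarrow> 'c frag" where
  "conv \<phi> \<psi> ns w = (\<Sum>mss\<in>refine ns. frag_extend (\<phi> (rd mss)) (\<psi> (concat mss) w))"

definition comp :: "('b word \<Rightarrow> 'c frag) \<Rightarrow> (nat list \<Rightarrow> 'a word \<Rightarrow> 'b frag) \<Rightarrow> 'a word \<Rightarrow> 'c frag" where
  "comp G \<psi> u = (\<Sum>ms\<in>comps (length u). frag_extend G (\<psi> ms u))"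

text \<open>Signs depend on parities only, so the exact degree of F is forgotten here;
  \<open>homog\<close> records it where the carriers of the values matter.\<close>

definition shifts :: "nat \<Rightarrow> ('a word \<Rightarrow> 'b frag) \<Rightarrow> bool" where
  "shifts e F \<longleftrightarrow> (\<forall>u. \<forall>w\<in>Poly_Mapping.keys (F u). length w = 1 \<and> even (sdeg w + sdeg u + e))"

section \<open>Families on a concatenation of decompositions\<close>

lemma Fs_append:
  "Fs F (ms @ ns) w = cat (Fs F ms (take (csum ms) w)) (Fs F ns (drop (csum ms) w))"
  by (induction ms arbitrary: w) (simp_all add: cat_assoc min_def add.commute drop_take)

text \<open>The one block hit by H lies either in \<open>ms\<close> or in \<open>ns\<close>; in the
  second case H passes all letters covered by \<open>ms\<close>, and G has been applied to
  them.\<close>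

lemma Hs_append:
  "Hs F G H (ms @ ns) w =
    cat (Hs F G H ms (take (csum ms) w)) (Fs F ns (drop (csum ms) w)) +
    sg (sdeg (take (csum ms) w)) (cat (Fs G ms (take (csum ms) w)) (Hs F G H ns (drop (csum ms) w)))"
proof (induction ms arbitrary: w)
  case (Cons a ms)
  have s: "sdeg (take (Suc a) w) + sdeg (take (csum ms) (drop (Suc a) w)) =
    sdeg (take (Suc (a + csum ms)) w)"
    by (metis add_Suc take_add sdeg_simps(3))
  show ?case
    by (simp add: Cons.IH Fs_append cat_assoc cat_add cat_sg sg_add sg_sg s drop_take min_def
        add.commute[of "csum ms"] add.assoc)
qed simp

lemma Fs_keys:
  assumes "shifts 0 F" "w \<in> Poly_Mapping.keys (Fs F ns u)" "length u = csum ns"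
  shows "length w = length ns \<and> even (sdeg w + sdeg u)"
  using assms(2,3)
proof (induction ns arbitrary: u w)
  case (Cons a ns)
  obtain w1 w2 where w: "w = w1 @ w2" "w1 \<in> Poly_Mapping.keys (F (take (Suc a) u))"
    "w2 \<in> Poly_Mapping.keys (Fs F ns (drop (Suc a) u))"
    using Cons.prems(1) by (auto elim: keys_catE)
  have "length w2 = length ns \<and> even (sdeg w2 + sdeg (drop (Suc a) u))"
    using Cons.IH[OF w(3)] Cons.prems(2) by simp
  moreover have "length w1 = 1 \<and> even (sdeg w1 + sdeg (take (Suc a) u))"
    using assms(1) w(2) by (auto simp: shifts_def)
  moreover note sdeg_take_drop[of "Suc a" u, symmetric]
  ultimately show ?case using w(1) by auto
qed auto

lemma Hs_keys:
  assumes "shifts 0 F" "shifts 0 G" "shifts 1 H"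
    and "w \<in> Poly_Mapping.keys (Hs F G H ns u)" "length u = csum ns"
  shows "length w = length ns \<and> odd (sdeg w + sdeg u)"
  using assms(4,5)
proof (induction ns arbitrary: u w)
  case (Cons a ns)
  let ?u = "take (Suc a) u" and ?v = "drop (Suc a) u"
  note td = sdeg_take_drop[of "Suc a" u, symmetric]
  have "w \<in> Poly_Mapping.keys (cat (H ?u) (Fs F ns ?v)) \<or>
    w \<in> Poly_Mapping.keys (cat (G ?u) (Hs F G H ns ?v))"
    using subsetD[OF keys_add, of w "cat (H ?u) (Fs F ns ?v)" "sg (sdeg ?u) (cat (G ?u) (Hs F G H ns ?v))"]
      Cons.prems(1) by auto
  then show ?case
  proof
    assume "w \<in> Poly_Mapping.keys (cat (H ?u) (Fs F ns ?v))"
    then obtain w1 w2 where w: "w = w1 @ w2" "w1 \<in> Poly_Mapping.keys (H ?u)"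
      "w2 \<in> Poly_Mapping.keys (Fs F ns ?v)"
      by (auto elim: keys_catE)
    have "length w2 = length ns \<and> even (sdeg w2 + sdeg ?v)"
      using Fs_keys[OF assms(1) w(3)] Cons.prems(2) by simp
    moreover have "length w1 = 1 \<and> odd (sdeg w1 + sdeg ?u)"
      using assms(3) w(2) by (auto simp: shifts_def)
    ultimately show ?thesis using w(1) td by auto
  next
    assume "w \<in> Poly_Mapping.keys (cat (G ?u) (Hs F G H ns ?v))"
    then obtain w1 w2 where w: "w = w1 @ w2" "w1 \<in> Poly_Mapping.keys (G ?u)"
      "w2 \<in> Poly_Mapping.keys (Hs F G H ns ?v)"
      by (auto elim: keys_catE)
    have "length w2 = length ns \<and> odd (sdeg w2 + sdeg ?v)"
      using Cons.IH[OF w(3)] Cons.prems(2) by simp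
    moreover have "length w1 = 1 \<and> even (sdeg w1 + sdeg ?u)"
      using assms(2) w(2) by (auto simp: shifts_def)
    ultimately show ?thesis using w(1) td by auto
  qed
qed auto

lemma extend_Fs_cat:
  assumes "\<And>w. w \<in> Poly_Mapping.keys X \<Longrightarrow> length w = Suc b"
  shows "frag_extend (Fs G (b # J)) (cat X Y) = cat (frag_extend G X) (frag_extend (Fs G J) Y)"
proof -
  have "Fs G (b # J) = (\<lambda>w. cat (G (take (Suc b) w)) (Fs G J (drop (Suc b) w)))"
    by (rule ext) simp
  then show ?thesis
    using extend_cat[OF assms, where P = G and Q = "Fs G J"] by simp
qed

lemma extend_Hs_cat:
  assumes "\<And>w. w \<in> Poly_Mapping.keys X \<Longrightarrow> length w = Suc b \<and> even (sdeg w + e)"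
  shows "frag_extend (Hs G G' K (b # J)) (cat X Y) =
    cat (frag_extend K X) (frag_extend (Fs G J) Y) +
    sg e (cat (frag_extend G' X) (frag_extend (Hs G G' K J) Y))"
proof -
  have len: "\<And>w. w \<in> Poly_Mapping.keys X \<Longrightarrow> length w = Suc b"
    using assms by blast
  have "Hs G G' K (b # J) = (\<lambda>w. cat (K (take (Suc b) w)) (Fs G J (drop (Suc b) w)) +
      cat (sg (sdeg (take (Suc b) w)) (G' (take (Suc b) w))) (Hs G G' K J (drop (Suc b) w)))"
    by (rule ext) (simp add: cat_sg)
  then have "frag_extend (Hs G G' K (b # J)) (cat X Y) =
     frag_extend (\<lambda>w. cat (K (take (Suc b) w)) (Fs G J (drop (Suc b) w))) (cat X Y) +
     frag_extend (\<lambda>w. cat (sg (sdeg (take (Suc b) w)) (G' (take (Suc b) w))) (Hs G G' K J (drop (Suc b) w))) (cat X Y)"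
    by (simp add: frag_extend_fun_add)
  also have "\<dots> = cat (frag_extend K X) (frag_extend (Fs G J) Y) +
     cat (frag_extend (\<lambda>u. sg (sdeg u) (G' u)) X) (frag_extend (Hs G G' K J) Y)"
    using extend_cat[OF len, where P = K and Q = "Fs G J"]
      extend_cat[OF len, where P = "\<lambda>u. sg (sdeg u) (G' u)" and Q = "Hs G G' K J"] by simp
  also have "frag_extend (\<lambda>u. sg (sdeg u) (G' u)) X = sg e (frag_extend G' X)"
    unfolding frag_extend_fun_sg[symmetric]
    by (rule frag_extend_eq) (use assms sg_cong in blast)
  finally show ?thesis by (simp only: cat_sg)
qed

section \<open>Peeling the first block off a composition of families\<close>

context
  fixes a :: nat and ns and w :: "'a word"
  assumes len: "length w = csum (a # ns)"
begin

private abbreviation "u \<equiv> take (Suc a) w"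
private abbreviation "v \<equiv> drop (Suc a) w"

lemma comp_take: "comp G \<psi> u = (\<Sum>ms\<in>comps (Suc a). frag_extend G (\<psi> ms u))"
  using len by (simp add: comp_def min_def)

text \<open>A refinement of \<open>a # ns\<close> is a composition of \<open>a + 1\<close> together
  with an independent refinement of \<open>ns\<close>. The facts about lengths are offered to the
  termwise step because they let the words be cut at the right place.\<close>

lemma conv_Cons:
  assumes "\<And>ms mss. ms \<in> comps (Suc a) \<Longrightarrow> mss \<in> refine ns \<Longrightarrow> csum ms = Suc a \<Longrightarrow> length u = csum ms \<Longrightarrow>
    length ms = Suc (length ms - 1) \<Longrightarrow>
    frag_extend (\<phi> ((length ms - 1) # rd mss)) (\<psi> (ms @ concat mss) w) = g ms mss"
  shows "conv \<phi> \<psi> (a # ns) w = (\<Sum>ms\<in>comps (Suc a). \<Sum>mss\<in>refine ns. g ms mss)"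
  unfolding conv_def sum_refine_Cons list.map concat.simps
proof (intro sum.cong refl)
  fix ms mss assume *: "ms \<in> comps (Suc a)" "mss \<in> refine ns"
  then have "csum ms = Suc a" by (simp add: comps_def)
  moreover have "length u = Suc a" using len by simp
  ultimately show "frag_extend (\<phi> ((length ms - 1) # rd mss)) (\<psi> (ms @ concat mss) w) = g ms mss"
    using * comps_Suc_ne[OF *(1)] by (intro assms) auto
qed

lemma sum_cat_cat:
  "(\<Sum>ms\<in>S. \<Sum>mss\<in>S'. cat (f ms) (g mss)) = cat (\<Sum>ms\<in>S. f ms) (\<Sum>mss\<in>S'. g mss)"
  unfolding cat_sum(1) unfolding cat_sum(2) ..

lemma conv_Fs_Fs_Cons:
  assumes "shifts 0 F"
  shows "conv (Fs G) (Fs F) (a # ns) w = cat (comp G (Fs F) u) (conv (Fs G) (Fs F) ns v)"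
proof -
  have "conv (Fs G) (Fs F) (a # ns) w = (\<Sum>ms\<in>comps (Suc a). \<Sum>mss\<in>refine ns.
      cat (frag_extend G (Fs F ms u)) (frag_extend (Fs G (rd mss)) (Fs F (concat mss) v)))"
    by (rule conv_Cons)
      (use Fs_keys[OF assms] in \<open>auto simp only: Fs_append intro!: extend_Fs_cat\<close>)
  then show ?thesis
    by (simp only: sum_cat_cat) (simp add: comp_take conv_def)
qed

lemma conv_Hs_Fs_Cons:
  assumes "shifts 0 F"
  shows "conv (Hs G G' K) (Fs F) (a # ns) w = cat (comp K (Fs F) u) (conv (Fs G) (Fs F) ns v) +
    sg (sdeg u) (cat (comp G' (Fs F) u) (conv (Hs G G' K) (Fs F) ns v))"
proof -
  have "conv (Hs G G' K) (Fs F) (a # ns) w = (\<Sum>ms\<in>comps (Suc a). \<Sum>mss\<in>refine ns.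
      cat (frag_extend K (Fs F ms u)) (frag_extend (Fs G (rd mss)) (Fs F (concat mss) v)) +
      sg (sdeg u) (cat (frag_extend G' (Fs F ms u)) (frag_extend (Hs G G' K (rd mss)) (Fs F (concat mss) v))))"
    by (rule conv_Cons)
      (use Fs_keys[OF assms] in \<open>auto simp only: Fs_append intro!: extend_Hs_cat\<close>)
  then show ?thesis
    by (simp only: sum.distrib sg_sum[symmetric] sum_cat_cat) (simp add: comp_take conv_def)
qed

lemma conv_Fs_Hs_Cons:
  assumes "shifts 0 F" "shifts 0 F'" "shifts 1 H"
  shows "conv (Fs G) (Hs F F' H) (a # ns) w =
    cat (comp G (Hs F F' H) u) (conv (Fs G) (Fs F) ns v) +
    sg (sdeg u) (cat (comp G (Fs F') u) (conv (Fs G) (Hs F F' H) ns v))"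
proof -
  have "conv (Fs G) (Hs F F' H) (a # ns) w = (\<Sum>ms\<in>comps (Suc a). \<Sum>mss\<in>refine ns.
      cat (frag_extend G (Hs F F' H ms u)) (frag_extend (Fs G (rd mss)) (Fs F (concat mss) v)) +
      sg (sdeg u) (cat (frag_extend G (Fs F' ms u)) (frag_extend (Fs G (rd mss)) (Hs F F' H (concat mss) v))))"
  proof (rule conv_Cons)
    fix ms mss assume *: "csum ms = Suc a" "length u = csum ms" "length ms = Suc (length ms - 1)"
    show "frag_extend (Fs G ((length ms - 1) # rd mss)) (Hs F F' H (ms @ concat mss) w) =
      cat (frag_extend G (Hs F F' H ms u)) (frag_extend (Fs G (rd mss)) (Fs F (concat mss) v)) +
      sg (sdeg u) (cat (frag_extend G (Fs F' ms u)) (frag_extend (Fs G (rd mss)) (Hs F F' H (concat mss) v)))"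
      unfolding Hs_append frag_extend_add frag_extend_sg *(1)
      by (intro arg_cong2[where f = "(+)"] arg_cong[where f = "sg _"] extend_Fs_cat)
        (use Fs_keys[OF assms(2)] Hs_keys[OF assms] * in auto)
  qed
  then show ?thesis
    by (simp only: sum.distrib sg_sum[symmetric] sum_cat_cat) (simp add: comp_take conv_def)
qed

text \<open>The four terms say in which of the two parts, first block or rest, each of the odd
  cochains acts. When H acts first on the block and K later on the rest, K crosses a word whose
  parity H has changed, hence the minus sign. When both act on the rest, the two signs from crossing
  the block cancel.\<close>

lemma conv_Hs_Hs_Cons:
  assumes "shifts 0 F" "shifts 0 F'" "shifts 1 H"
  shows "conv (Hs G G' K) (Hs F F' H) (a # ns) w =
    cat (comp K (Hs F F' H) u) (conv (Fs G) (Fs F) ns v)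
    - sg (sdeg u) (cat (comp G' (Hs F F' H) u) (conv (Hs G G' K) (Fs F) ns v))
    + sg (sdeg u) (cat (comp K (Fs F') u) (conv (Fs G) (Hs F F' H) ns v))
    + cat (comp G' (Fs F') u) (conv (Hs G G' K) (Hs F F' H) ns v)"
proof -
  have "conv (Hs G G' K) (Hs F F' H) (a # ns) w = (\<Sum>ms\<in>comps (Suc a). \<Sum>mss\<in>refine ns.
      (cat (frag_extend K (Hs F F' H ms u)) (frag_extend (Fs G (rd mss)) (Fs F (concat mss) v)) +
       sg (Suc (sdeg u)) (cat (frag_extend G' (Hs F F' H ms u)) (frag_extend (Hs G G' K (rd mss)) (Fs F (concat mss) v)))) +
      sg (sdeg u) (cat (frag_extend K (Fs F' ms u)) (frag_extend (Fs G (rd mss)) (Hs F F' H (concat mss) v)) +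
       sg (sdeg u) (cat (frag_extend G' (Fs F' ms u)) (frag_extend (Hs G G' K (rd mss)) (Hs F F' H (concat mss) v)))))"
  proof (rule conv_Cons)
    fix ms mss assume *: "csum ms = Suc a" "length u = csum ms" "length ms = Suc (length ms - 1)"
    show "frag_extend (Hs G G' K ((length ms - 1) # rd mss)) (Hs F F' H (ms @ concat mss) w) =
      (cat (frag_extend K (Hs F F' H ms u)) (frag_extend (Fs G (rd mss)) (Fs F (concat mss) v)) +
       sg (Suc (sdeg u)) (cat (frag_extend G' (Hs F F' H ms u)) (frag_extend (Hs G G' K (rd mss)) (Fs F (concat mss) v)))) +
      sg (sdeg u) (cat (frag_extend K (Fs F' ms u)) (frag_extend (Fs G (rd mss)) (Hs F F' H (concat mss) v)) +
       sg (sdeg u) (cat (frag_extend G' (Fs F' ms u)) (frag_extend (Hs G G' K (rd mss)) (Hs F F' H (concat mss) v))))"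
      unfolding Hs_append frag_extend_add frag_extend_sg *(1)
      by (intro arg_cong2[where f = "(+)"] arg_cong[where f = "sg _"] extend_Hs_cat)
        (use Fs_keys[OF assms(2)] Hs_keys[OF assms] * in auto)
  qed
  also have "\<dots> = (\<Sum>ms\<in>comps (Suc a). \<Sum>mss\<in>refine ns.
      cat (frag_extend K (Hs F F' H ms u)) (frag_extend (Fs G (rd mss)) (Fs F (concat mss) v)))
    + sg (Suc (sdeg u)) (\<Sum>ms\<in>comps (Suc a). \<Sum>mss\<in>refine ns.
       cat (frag_extend G' (Hs F F' H ms u)) (frag_extend (Hs G G' K (rd mss)) (Fs F (concat mss) v)))
    + sg (sdeg u) (\<Sum>ms\<in>comps (Suc a). \<Sum>mss\<in>refine ns.
       cat (frag_extend K (Fs F' ms u)) (frag_extend (Fs G (rd mss)) (Hs F F' H (concat mss) v)))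
    + sg (sdeg u + sdeg u) (\<Sum>ms\<in>comps (Suc a). \<Sum>mss\<in>refine ns.
       cat (frag_extend G' (Fs F' ms u)) (frag_extend (Hs G G' K (rd mss)) (Hs F F' H (concat mss) v)))"
    by (simp only: sg_add sg_sg sum.distrib sg_sum[symmetric] add.assoc)
  finally show ?thesis
    by (simp only: sum_cat_cat) (simp add: comp_take conv_def sg_Suc sg_def)
qed

end

section \<open>Words modulo additivity\<close>

text \<open>Words with a letter outside its carrier count as null, in accordance with
  \<open>ev\<close> and with the cochains built by \<open>lbar\<close>, which send them to 0.
  Additivity in a letter is imposed because sums of elements have to become formal sums of words;
  \<open>cat\<close> preserves the set.\<close>

inductive_set null :: "(nat \<Rightarrow> ('k, 'a) module) \<Rightarrow> 'a frag set" for A where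
  zero: "0 \<in> null A"
| add: "x \<in> carrier (A p) \<Longrightarrow> y \<in> carrier (A p) \<Longrightarrow>
    frag_of (u @ (p, x \<oplus>\<^bsub>A p\<^esub> y) # v) - frag_of (u @ (p, x) # v) - frag_of (u @ (p, y) # v) \<in> null A"
| invalid: "\<not> valid A w \<Longrightarrow> frag_of w \<in> null A"
| diff: "a \<in> null A \<Longrightarrow> b \<in> null A \<Longrightarrow> a - b \<in> null A"

definition eqv :: "(nat \<Rightarrow> ('k, 'a) module) \<Rightarrow> 'a frag \<Rightarrow> 'a frag \<Rightarrow> bool" where
  "eqv A p q \<longleftrightarrow> p - q \<in> null A"

lemma null_minus: "p \<in> null A \<Longrightarrow> - p \<in> null A"
  using null.diff[OF null.zero] by fastforce

lemma null_add: "p \<in> null A \<Longrightarrow> q \<in> null A \<Longrightarrow> p + q \<in> null A"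
  using null.diff[OF _ null_minus] by fastforce

lemma eqv_refl [simp]: "eqv A p p"
  by (simp add: eqv_def null.zero)

lemma eqv_sym: "eqv A p q \<Longrightarrow> eqv A q p"
  using null_minus by (fastforce simp: eqv_def)

lemma eqv_trans [trans]: "eqv A p q \<Longrightarrow> eqv A q r \<Longrightarrow> eqv A p r"
  using null_add[of "p - q" A "q - r"] by (simp add: eqv_def)

lemma eqv_eq_trans [trans]: "eqv A p q \<Longrightarrow> q = r \<Longrightarrow> eqv A p r"
  and eq_eqv_trans [trans]: "p = q \<Longrightarrow> eqv A q r \<Longrightarrow> eqv A p r"
  by simp_all

lemma eqv_diff: "eqv A p q \<Longrightarrow> eqv A p' q' \<Longrightarrow> eqv A (p - p') (q - q')"
  using null.diff[of "p - q" A "p' - q'"] by (simp add: eqv_def algebra_simps)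

lemma eqv_minus: "eqv A p q \<Longrightarrow> eqv A (- p) (- q)"
  using null_minus[of "p - q" A] by (simp add: eqv_def)

lemma eqv_add: "eqv A p q \<Longrightarrow> eqv A p' q' \<Longrightarrow> eqv A (p + p') (q + q')"
  using null_add[of "p - q" A "p' - q'"] by (simp add: eqv_def algebra_simps)

lemma eqv_sg: "eqv A p q \<Longrightarrow> eqv A (sg e p) (sg e q)"
  by (simp add: sg_def eqv_minus)

lemma eqv_sum: "(\<And>i. i \<in> S \<Longrightarrow> eqv A (f i) (g i)) \<Longrightarrow> eqv A (\<Sum>i\<in>S. f i) (\<Sum>i\<in>S. g i)"
  by (induction S rule: infinite_finite_induct) (auto intro: eqv_add)

lemma null_word: "p \<in> null A \<Longrightarrow> cat (frag_of u) (cat p (frag_of v)) \<in> null A"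
proof (induction p rule: null.induct)
  case (add x p y u' v')
  then show ?case
    using null.add[where u = "u @ u'" and v = "v' @ v"] by (simp add: cat_diff)
qed (auto simp: cat_diff intro: null.intros)

lemma null_cat:
  assumes "p \<in> null A"
  shows "cat q p \<in> null A" "cat p q \<in> null A"
proof -
  have "Poly_Mapping.keys q \<subseteq> UNIV" by simp
  then show "cat q p \<in> null A"
    by (induction q rule: frag_induction)
      (use null_word[OF assms, of _ "[]"] in \<open>auto simp: cat_diff intro: null.intros\<close>)
  have "Poly_Mapping.keys q \<subseteq> UNIV" by simp
  then show "cat p q \<in> null A"
    by (induction q rule: frag_induction)
      (use null_word[OF assms, of "[]"] in \<open>auto simp: cat_diff intro: null.intros\<close>)
qed

lemma eqv_cat:
  assumes "eqv A p p'" "eqv A q q'"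
  shows "eqv A (cat p q) (cat p' q')"
proof -
  have "cat p q - cat p' q' = cat (p - p') q + cat p' (q - q')"
    by (simp add: cat_diff)
  then show ?thesis
    using assms null_add[OF null_cat(2) null_cat(1)] by (simp add: eqv_def)
qed

lemma eqv_frag_extend:
  assumes "\<And>w. w \<in> Poly_Mapping.keys p \<Longrightarrow> eqv A (f w) (g w)"
  shows "eqv A (frag_extend f p) (frag_extend g p)"
proof -
  have "Poly_Mapping.keys p \<subseteq> {w. eqv A (f w) (g w)}" using assms by auto
  then show ?thesis
    by (induction p rule: frag_induction) (auto simp: frag_extend_diff intro: eqv_diff)
qed

text \<open>The cochain relations hold modulo \<open>null\<close> only, so a cochain may be applied
  to both sides of one only if it preserves \<open>null\<close>.\<close>

definition descends :: "(nat \<Rightarrow> ('k, 'a) module) \<Rightarrow> (nat \<Rightarrow> ('k, 'b) module) \<Rightarrow> ('a word \<Rightarrow> 'b frag) \<Rightarrow> bool" where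
  "descends A B F \<longleftrightarrow> (\<forall>p\<in>null A. frag_extend F p \<in> null B)"

lemma descendsD: "descends A B F \<Longrightarrow> eqv A p q \<Longrightarrow> eqv B (frag_extend F p) (frag_extend F q)"
  by (auto simp: descends_def eqv_def frag_extend_diff[symmetric])

section \<open>Associativity of the composition of multiplicative families\<close>

lemma refine_iff:
  "mss \<in> refine ms \<longleftrightarrow> (\<forall>m\<in>set mss. m \<noteq> []) \<and> ms = map (\<lambda>m. csum m - 1) mss"
proof (induction ms arbitrary: mss)
  case (Cons a ms)
  show ?case
  proof (cases mss)
    case (Cons m mss')
    have "m \<in> comps (Suc a) \<longleftrightarrow> m \<noteq> [] \<and> csum m - 1 = a"
      by (cases m) (auto simp: comps_def)
    then show ?thesis
      using Cons.IH[of mss'] by (auto simp: Cons image_iff)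
  qed auto
qed auto

text \<open>Both sides run over the lists of nonempty lists whose concatenation has total size n. On
  the left the sizes of the groups are chosen before their pieces, on the right all pieces are
  chosen before they are grouped.\<close>

lemma sum_reassoc:
  "(\<Sum>ms\<in>comps n. \<Sum>mss\<in>refine ms. \<phi> (rd mss) (concat mss)) =
    (\<Sum>ls\<in>comps n. \<Sum>ks\<in>comps (length ls). \<phi> ks (ls :: nat list) :: 'b :: comm_monoid_add)"
proof -
  let ?P = "{mss. (\<forall>m\<in>set mss. m \<noteq> []) \<and> csum (concat mss) = n}"
  have csum_map: "csum (map (\<lambda>m. csum m - 1) mss) = csum (concat mss)" if "\<forall>m\<in>set mss. m \<noteq> []" for mss
    using that
  proof (induction mss)
    case (Cons m mss)
    then show ?case by (cases m) auto
  qed simp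
  have csum_rd: "csum (rd mss) = length (concat mss)" if "\<forall>m\<in>set mss. m \<noteq> []" for mss :: "nat list list"
    using that by (induction mss) auto
  have 1: "bij_betw snd (SIGMA ms:comps n. refine ms) ?P"
    by (rule bij_betw_byWitness[where f' = "\<lambda>mss. (map (\<lambda>m. csum m - 1) mss, mss)"])
      (auto simp: refine_iff comps_def csum_map simp del: One_nat_def)
  \<comment> \<open>No piece is empty, so equal \<open>rd\<close> gives pieces of equal lengths;
    together with equal concatenations this determines the list of pieces.\<close>
  have inj: "inj_on (\<lambda>mss. (concat mss, rd mss)) ?P"
  proof (rule inj_onI)
    fix xs ys :: "nat list list"
    assume "xs \<in> ?P" "ys \<in> ?P" "(concat xs, rd xs) = (concat ys, rd ys)"
    then have *: "\<forall>m\<in>set xs. m \<noteq> []" "\<forall>m\<in>set ys. m \<noteq> []" "concat xs = concat ys"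
      "rd xs = rd ys" by simp_all
    have "map length xs = map Suc (rd xs)" "map length ys = map Suc (rd ys)"
      using *(1,2) by (auto simp: Suc_pred)
    then have len: "map length xs = map length ys" by (simp only: *(4))
    then have "length xs = length ys" by (metis length_map)
    moreover have "\<forall>(x, y)\<in>set (zip xs ys). length x = length y"
      using len by (auto simp: in_set_zip list_eq_iff_nth_eq)
    ultimately show "xs = ys" using *(3) by (intro concat_injective)
  qed
  have surj: "\<exists>mss. (\<forall>m\<in>set mss. m \<noteq> []) \<and> concat mss = ls \<and> rd mss = ks" if "csum ks = length ls"
    for ls ks :: "nat list"
    using that
  proof (induction ks arbitrary: ls)
    case (Cons k ks)
    then obtain mss where "\<forall>m\<in>set mss. m \<noteq> []" "concat mss = drop (Suc k) ls" "rd mss = ks"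
      by (metis add_diff_cancel_left' csum_simps(2) length_drop)
    then show ?case
      using Cons.prems by (intro exI[of _ "take (Suc k) ls # mss"]) auto
  qed auto
  have 2: "bij_betw (\<lambda>mss. (concat mss, rd mss)) ?P (SIGMA ls:comps n. comps (length ls))"
    unfolding bij_betw_def
  proof (rule conjI[OF inj], rule equalityI; rule subsetI)
    fix x assume "x \<in> (SIGMA ls:comps n. comps (length ls))"
    then obtain ls ks where "x = (ls, ks)" "csum ls = n" "csum ks = length ls"
      by (auto simp: comps_def)
    moreover from surj[OF this(3)] obtain mss where "\<forall>m\<in>set mss. m \<noteq> []" "concat mss = ls" "rd mss = ks"
      by blast
    ultimately show "x \<in> (\<lambda>mss. (concat mss, rd mss)) ` ?P"
      by (intro image_eqI[of _ _ mss]) auto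
  qed (auto simp: comps_def csum_rd simp del: One_nat_def)
  have "(\<Sum>ms\<in>comps n. \<Sum>mss\<in>refine ms. \<phi> (rd mss) (concat mss)) =
    (\<Sum>(ms, mss)\<in>(SIGMA ms:comps n. refine ms). \<phi> (rd mss) (concat mss))"
    by (simp add: sum.Sigma)
  also have "\<dots> = (\<Sum>mss\<in>?P. \<phi> (rd mss) (concat mss))"
    using sum.reindex_bij_betw[OF 1, of "\<lambda>mss. \<phi> (rd mss) (concat mss)"]
    by (simp add: case_prod_unfold)
  also have "\<dots> = (\<Sum>(ls, ks)\<in>(SIGMA ls:comps n. comps (length ls)). \<phi> ks ls)"
    using sum.reindex_bij_betw[OF 2, of "\<lambda>(ls, ks). \<phi> ks ls"] by simp
  also have "\<dots> = (\<Sum>ls\<in>comps n. \<Sum>ks\<in>comps (length ls). \<phi> ks ls)"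
    by (simp add: sum.Sigma)
  finally show ?thesis .
qed

lemma frag_extend_extend:
  "frag_extend f (frag_extend g p) = frag_extend (\<lambda>x. frag_extend f (g x)) p"
  by (rule frag_ext[where p = p]) (simp_all add: frag_extend_diff)

text \<open>Associativity, obtained from \<open>sum_reassoc\<close>. The hypothesis says that \<psi>
  turns each small block into one letter, so compositions of the output word are groupings of the
  blocks.\<close>

lemma comp_conv:
  assumes "\<And>ls w. ls \<in> comps (length u) \<Longrightarrow> w \<in> Poly_Mapping.keys (\<psi> ls u) \<Longrightarrow> length w = length ls"
  shows "comp K (conv \<phi> \<psi>) u = comp (comp K \<phi>) \<psi> u"
proof -
  have "comp (comp K \<phi>) \<psi> u = (\<Sum>ls\<in>comps (length u). \<Sum>ks\<in>comps (length ls).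
      frag_extend K (frag_extend (\<phi> ks) (\<psi> ls u)))"
    unfolding comp_def[of "comp K \<phi>"]
  proof (rule sum.cong[OF refl])
    fix ls assume ls: "ls \<in> comps (length u)"
    have "frag_extend (comp K \<phi>) (\<psi> ls u) =
      frag_extend (\<lambda>w. \<Sum>ks\<in>comps (length ls). frag_extend K (\<phi> ks w)) (\<psi> ls u)"
      by (rule frag_extend_eq) (simp add: comp_def assms[OF ls])
    also have "\<dots> = (\<Sum>ks\<in>comps (length ls). frag_extend K (frag_extend (\<phi> ks) (\<psi> ls u)))"
      by (simp add: frag_extend_fun_sum frag_extend_extend)
    finally show "frag_extend (comp K \<phi>) (\<psi> ls u) = \<dots>" .
  qed
  also have "\<dots> = (\<Sum>ms\<in>comps (length u). \<Sum>mss\<in>refine ms.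
      frag_extend K (frag_extend (\<phi> (rd mss)) (\<psi> (concat mss) u)))"
    by (rule sum_reassoc[symmetric])
  also have "\<dots> = comp K (conv \<phi> \<psi>) u"
    by (simp add: comp_def conv_def frag_extend_sum)
  finally show ?thesis ..
qed

section \<open>The identity cochain and the total differential\<close>

definition idc :: "(nat \<Rightarrow> ('k, 'a) module) \<Rightarrow> 'a word \<Rightarrow> 'a frag" where
  "idc A u = (if length u = 1 \<and> valid A u then frag_of u else 0)"

abbreviation Ds :: "(nat \<Rightarrow> ('k, 'a) module) \<Rightarrow> ('a word \<Rightarrow> 'a frag) \<Rightarrow> nat list \<Rightarrow> 'a word \<Rightarrow> 'a frag" where
  "Ds A b \<equiv> Hs (idc A) (idc A) b"

definition into :: "(nat \<Rightarrow> ('k, 'b) module) \<Rightarrow> ('a word \<Rightarrow> 'b frag) \<Rightarrow> bool" where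
  "into B F \<longleftrightarrow> (\<forall>u. \<forall>w\<in>Poly_Mapping.keys (F u). valid B w)"

definition cochain :: "(nat \<Rightarrow> ('k, 'b) module) \<Rightarrow> nat \<Rightarrow> ('a word \<Rightarrow> 'b frag) \<Rightarrow> bool" where
  "cochain B e F \<longleftrightarrow> shifts e F \<and> into B F \<and> F [] = 0"

lemma cochain_shifts: "cochain B e F \<Longrightarrow> shifts e F"
  and cochain_into: "cochain B e F \<Longrightarrow> into B F"
  by (simp_all add: cochain_def)

lemma idc_cochain: "cochain A 0 (idc A)"
  by (auto simp: cochain_def shifts_def into_def idc_def split: if_splits)

lemma Fs_into: "into B F \<Longrightarrow> into B (Fs F ns)"
  unfolding into_def
proof (induction ns)
  case (Cons a ns)
  then show ?case by (fastforce elim!: keys_catE)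
qed simp

lemma Hs_into: "into B F \<Longrightarrow> into B G \<Longrightarrow> into B H \<Longrightarrow> into B (Hs F G H ns)"
proof (induction ns)
  case (Cons a ns)
  note IH = Cons.IH[OF Cons.prems]
  show ?case
    unfolding into_def
  proof (intro allI ballI)
    fix u w assume w: "w \<in> Poly_Mapping.keys (Hs F G H (a # ns) u)"
    let ?u = "take (Suc a) u" and ?v = "drop (Suc a) u"
    have "w \<in> Poly_Mapping.keys (cat (H ?u) (Fs F ns ?v)) \<or>
        w \<in> Poly_Mapping.keys (cat (G ?u) (Hs F G H ns ?v))"
      using subsetD[OF keys_add, of w "cat (H ?u) (Fs F ns ?v)" "sg (sdeg ?u) (cat (G ?u) (Hs F G H ns ?v))"]
        w by auto
    then show "valid B w"
      using IH Cons.prems Fs_into[OF Cons.prems(1), of ns] unfolding into_def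
      by (auto elim!: keys_catE)
  qed
qed (simp add: into_def)

lemma frag_extend_idc:
  assumes "\<And>w. w \<in> Poly_Mapping.keys p \<Longrightarrow> length w = 1 \<and> valid B w"
  shows "frag_extend (idc B) p = p"
proof -
  have "frag_extend (idc B) p = frag_extend frag_of p"
    by (rule frag_extend_eq) (use assms in \<open>auto simp: idc_def\<close>)
  then show ?thesis by (simp add: frag_expansion[symmetric])
qed

lemma frag_extend_idc_zero:
  assumes "\<And>w. w \<in> Poly_Mapping.keys p \<Longrightarrow> length w \<noteq> 1"
  shows "frag_extend (idc B) p = 0"
  by (rule frag_extend_eq_0) (use assms in \<open>auto simp: idc_def\<close>)

text \<open>The identity cochain sees only words of one letter, and among all decompositions only
  the one with a single block produces such words.\<close>

lemma comp_idc_left: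
  assumes len: "\<And>ms w. ms \<in> comps (length u) \<Longrightarrow> w \<in> Poly_Mapping.keys (\<psi> ms u) \<Longrightarrow> length w = length ms"
    and "into B (\<psi> [length u - 1])" "u \<noteq> []"
  shows "comp (idc B) \<psi> u = \<psi> [length u - 1] u"
proof -
  have "comp (idc B) \<psi> u = (\<Sum>ms\<in>{[length u - 1]}. frag_extend (idc B) (\<psi> ms u))"
    unfolding comp_def
  proof (rule sum.mono_neutral_right)
    show "{[length u - 1]} \<subseteq> comps (length u)" using assms(3) by (simp add: comps_def)
    show "\<forall>ms\<in>comps (length u) - {[length u - 1]}. frag_extend (idc B) (\<psi> ms u) = 0"
    proof
      fix ms assume ms: "ms \<in> comps (length u) - {[length u - 1]}"
      then have "length ms \<noteq> 1" by (auto simp: comps_def length_Suc_conv)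
      then show "frag_extend (idc B) (\<psi> ms u) = 0"
        using len[of ms] ms by (intro frag_extend_idc_zero) auto
    qed
  qed simp
  also have "\<dots> = \<psi> [length u - 1] u"
    using assms len[of "[length u - 1]"] by (simp, intro frag_extend_idc) (auto simp: into_def comps_def)
  finally show ?thesis .
qed

lemma comp_idc_Fs:
  assumes "cochain B 0 F" "u \<noteq> []"
  shows "comp (idc B) (Fs F) u = F u"
  by (subst comp_idc_left)
    (use assms in \<open>auto simp: comps_def Fs_into[OF cochain_into] dest: Fs_keys[OF cochain_shifts[OF assms(1)]]\<close>)

lemma comp_idc_Hs:
  assumes "cochain B 0 F" "cochain B 0 G" "cochain B 1 H" "u \<noteq> []"
  shows "comp (idc B) (Hs F G H) u = H u"
  by (subst comp_idc_left)
    (use assms in \<open>auto simp: comps_def Hs_into[OF assms(1-3)[THEN cochain_into]]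
      dest: Hs_keys[OF assms(1-3)[THEN cochain_shifts]]\<close>)

lemma Fs_idc:
  assumes "valid A w" "length w = csum ns"
  shows "Fs (idc A) ns w = (if set ns \<subseteq> {0} then frag_of w else 0)"
  using assms
proof (induction ns arbitrary: w)
  case (Cons a ns)
  have "Fs (idc A) ns (drop (Suc a) w) = (if set ns \<subseteq> {0} then frag_of (drop (Suc a) w) else 0)"
    using Cons by (simp add: valid_drop)
  moreover have "idc A (take (Suc a) w) = (if a = 0 then frag_of (take (Suc a) w) else 0)"
    using Cons.prems by (simp add: idc_def valid_take)
  ultimately show ?case by simp
qed simp

lemma comps_zero: "ms \<in> comps n \<Longrightarrow> set ms \<subseteq> {0} \<longleftrightarrow> ms = replicate n 0"
proof -
  assume ms: "ms \<in> comps n"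
  have csum: "csum (replicate (length ms) 0) = length ms" by (simp add: csum_eq sum_list_replicate)
  show ?thesis
  proof
    assume "set ms \<subseteq> {0}"
    then have "replicate (length ms) 0 = ms" by (intro replicate_length_same) auto
    then show "ms = replicate n 0" using csum ms by (simp add: comps_def)
  qed (simp add: set_replicate_conv_if)
qed

text \<open>The identity cochain kills every block of more than one letter, so only the
  decomposition into single letters survives.\<close>

lemma comp_Fs_idc:
  assumes "valid A u"
  shows "comp K (Fs (idc A)) u = K u"
proof -
  have rep: "replicate (length u) 0 \<in> comps (length u)"
    by (simp add: comps_def csum_eq sum_list_replicate)
  have "comp K (Fs (idc A)) u = (\<Sum>ms\<in>comps (length u). if ms = replicate (length u) 0 then K u else 0)"
    unfolding comp_def
  proof (rule sum.cong[OF refl])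
    fix ms assume ms: "ms \<in> comps (length u)"
    then have "length u = csum ms" by (simp add: comps_def)
    then show "frag_extend K (Fs (idc A) ms u) = (if ms = replicate (length u) 0 then K u else 0)"
      by (simp only: Fs_idc[OF assms] comps_zero[OF ms] if_distrib[of "frag_extend K"] frag_extend_of frag_extend_0)
  qed
  also have "\<dots> = K u" using rep by simp
  finally show ?thesis .
qed

section \<open>Composition with the identity family\<close>

lemma conv_Nil: "conv \<phi> \<psi> [] w = frag_extend (\<phi> []) (\<psi> [] w)"
  by (simp add: conv_def)

lemma length_Cons_csum:
  assumes "length w = csum (a # ns)" "valid A w"
  shows "take (Suc a) w \<noteq> []" "length (drop (Suc a) w) = csum ns" "valid A (take (Suc a) w)"
    "valid A (drop (Suc a) w)"
  using assms by (auto simp: valid_take valid_drop)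

lemma conv_Fs_Fs:
  assumes "shifts 0 F" "length w = csum ns"
  shows "conv (Fs G) (Fs F) ns w = Fs (comp G (Fs F)) ns w"
  using assms(2)
  by (induction ns arbitrary: w) (simp_all add: conv_Nil conv_Fs_Fs_Cons[OF _ assms(1)])

lemma conv_id_Fs:
  assumes "cochain B 0 F" "length w = csum ns"
  shows "conv (Fs (idc B)) (Fs F) ns w = Fs F ns w"
  using assms(2)
proof (induction ns arbitrary: w)
  case (Cons a ns)
  moreover from this have "w \<noteq> []" by auto
  ultimately show ?case
    using comp_idc_Fs[OF assms(1), of "take (Suc a) w"]
    by (simp add: conv_Fs_Fs_Cons[OF _ cochain_shifts[OF assms(1)]])
qed (simp add: conv_Nil)

lemma conv_id_Hs:
  assumes "cochain B 0 F" "cochain B 0 G" "cochain B 1 H" "length w = csum ns"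
  shows "conv (Fs (idc B)) (Hs F G H) ns w = Hs F G H ns w"
  using assms(4)
proof (induction ns arbitrary: w)
  case (Cons a ns)
  have "w \<noteq> []" using Cons.prems by auto
  then show ?case
    using Cons comp_idc_Hs[OF assms(1-3)] comp_idc_Fs[OF assms(2)] conv_id_Fs[OF assms(1)]
    by (simp add: conv_Fs_Hs_Cons[OF _ assms(1-3)[THEN cochain_shifts]])
qed (simp add: conv_Nil)

lemma conv_Fs_id:
  assumes "valid A w" "length w = csum ns"
  shows "conv (Fs F) (Fs (idc A)) ns w = Fs F ns w"
  using assms
proof (induction ns arbitrary: w)
  case (Cons a ns)
  then show ?case
    using length_Cons_csum[OF Cons.prems(2,1)]
    by (simp add: conv_Fs_Fs_Cons[OF _ cochain_shifts[OF idc_cochain]] comp_Fs_idc)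
qed (simp add: conv_Nil)

lemma conv_Hs_id:
  assumes "valid A w" "length w = csum ns"
  shows "conv (Hs F G H) (Fs (idc A)) ns w = Hs F G H ns w"
  using assms
proof (induction ns arbitrary: w)
  case (Cons a ns)
  then show ?case
    using length_Cons_csum[OF Cons.prems(2,1)] conv_Fs_id[OF length_Cons_csum(4,2)[OF Cons.prems(2,1)], of F]
    by (simp add: conv_Hs_Fs_Cons[OF _ cochain_shifts[OF idc_cochain]] comp_Fs_idc)
qed (simp add: conv_Nil)

section \<open>The relations for multiplicative families\<close>

lemma conv_D_Fs_Cons:
  assumes F: "cochain B 0 F" and w: "length w = csum (a # ns)"
  shows "conv (Ds B b) (Fs F) (a # ns) w =
    cat (comp b (Fs F) (take (Suc a) w)) (Fs F ns (drop (Suc a) w)) +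
    sg (sdeg (take (Suc a) w)) (cat (F (take (Suc a) w)) (conv (Ds B b) (Fs F) ns (drop (Suc a) w)))"
proof -
  have "w \<noteq> []" "length (drop (Suc a) w) = csum ns" using w by auto
  then show ?thesis
    by (simp add: conv_Hs_Fs_Cons[OF w cochain_shifts[OF F]] conv_id_Fs[OF F] comp_idc_Fs[OF F]
        del: length_drop)
qed

lemma conv_Fs_D_Cons:
  assumes b: "cochain A 1 b" and w: "length w = csum (a # ns)" "valid A w"
  shows "conv (Fs F) (Ds A b) (a # ns) w =
    cat (comp F (Ds A b) (take (Suc a) w)) (Fs F ns (drop (Suc a) w)) +
    sg (sdeg (take (Suc a) w)) (cat (F (take (Suc a) w)) (conv (Fs F) (Ds A b) ns (drop (Suc a) w)))"
  by (simp add: conv_Fs_Hs_Cons[OF w(1) cochain_shifts[OF idc_cochain] cochain_shifts[OF idc_cochain]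
        cochain_shifts[OF b]] conv_Fs_id[OF length_Cons_csum(4,2)[OF w]]
        length_Cons_csum(3)[OF w] comp_Fs_idc)

text \<open>In the four-term expansion all even cochains are identities, so the two middle terms
  coincide up to sign and cancel. The first term vanishes by the relation for one block, the last by
  induction.\<close>

theorem conv_D_D:
  assumes b: "cochain A 1 b" and bb: "\<And>u. valid A u \<Longrightarrow> u \<noteq> [] \<Longrightarrow> eqv A (comp b (Ds A b) u) 0"
    and w: "valid A w" "length w = csum ns"
  shows "eqv A (conv (Ds A b) (Ds A b) ns w) 0"
  using w
proof (induction ns arbitrary: w)
  case (Cons a ns)
  note id = idc_cochain[of A] and sh = cochain_shifts[OF idc_cochain[of A]]
  let ?u = "take (Suc a) w" and ?v = "drop (Suc a) w"
  note l = length_Cons_csum[OF Cons.prems(2,1)]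
  have "conv (Ds A b) (Ds A b) (a # ns) w =
    cat (comp b (Ds A b) ?u) (Fs (idc A) ns ?v) + cat (idc A ?u) (conv (Ds A b) (Ds A b) ns ?v)"
    using l by (simp add: conv_Hs_Hs_Cons[OF Cons.prems(2) sh sh cochain_shifts[OF b]]
        conv_Fs_id[OF l(4,2)] conv_Hs_id[OF l(4,2)] conv_id_Hs[OF id id b l(2)]
        comp_idc_Hs[OF id id b l(1)] comp_Fs_idc[OF l(3)])
  also have "eqv A \<dots> (cat 0 (Fs (idc A) ns ?v) + cat (idc A ?u) 0)"
    by (intro eqv_add eqv_cat bb Cons.IH l eqv_refl)
  finally show ?case by simp
qed (simp add: conv_Nil)

text \<open>Both composites expand to the same shape with the same sign. The head terms agree by the
  relation for one block, the tail terms by induction.\<close>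

theorem conv_D_Fs:
  assumes b: "cochain A 1 b" and F: "cochain B 0 F"
    and bF: "\<And>u. valid A u \<Longrightarrow> u \<noteq> [] \<Longrightarrow> eqv B (comp b' (Fs F) u) (comp F (Ds A b) u)"
    and w: "valid A w" "length w = csum ns"
  shows "eqv B (conv (Ds B b') (Fs F) ns w) (conv (Fs F) (Ds A b) ns w)"
  using w
proof (induction ns arbitrary: w)
  case (Cons a ns)
  note l = length_Cons_csum[OF Cons.prems(2,1)]
  show ?case
    unfolding conv_D_Fs_Cons[OF F Cons.prems(2)] conv_Fs_D_Cons[OF b Cons.prems(2,1)]
    by (intro eqv_add eqv_cat eqv_sg bF Cons.IH l eqv_refl)
qed (simp add: conv_Nil)

text \<open>The expansion of the two composites gives eight terms. The mixed ones, in which the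
  differential and H act on different sides of the cut, pair up into commutators of the differential
  with F and G, which are null; the remaining terms give a telescoping difference.\<close>

theorem conv_D_Hs:
  assumes b: "cochain A 1 b" and F: "cochain B 0 F" and G: "cochain B 0 G" and H: "cochain B 1 H"
    and bF: "\<And>u. valid A u \<Longrightarrow> u \<noteq> [] \<Longrightarrow> eqv B (comp b' (Fs F) u) (comp F (Ds A b) u)"
    and bG: "\<And>u. valid A u \<Longrightarrow> u \<noteq> [] \<Longrightarrow> eqv B (comp b' (Fs G) u) (comp G (Ds A b) u)"
    and bH: "\<And>u. valid A u \<Longrightarrow> u \<noteq> [] \<Longrightarrow>
      eqv B (comp b' (Hs F G H) u + comp H (Ds A b) u) (F u - G u)"
    and w: "valid A w" "length w = csum ns"
  shows "eqv B (conv (Ds B b') (Hs F G H) ns w + conv (Hs F G H) (Ds A b) ns w) (Fs F ns w - Fs G ns w)"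
  using w
proof (induction ns arbitrary: w)
  case (Cons a ns)
  note id = idc_cochain[of A] and sh = cochain_shifts[OF idc_cochain[of A]]
    and shB = cochain_shifts[OF idc_cochain[of B]]
  let ?u = "take (Suc a) w" and ?v = "drop (Suc a) w" and ?s = "sg (sdeg (take (Suc a) w))"
  note l = length_Cons_csum[OF Cons.prems(2,1)]
  let ?DF = "conv (Ds B b') (Fs F) ns ?v" and ?FD = "conv (Fs F) (Ds A b) ns ?v"
  let ?DH = "conv (Ds B b') (Hs F G H) ns ?v" and ?HD = "conv (Hs F G H) (Ds A b) ns ?v"
  have "conv (Ds B b') (Hs F G H) (a # ns) w + conv (Hs F G H) (Ds A b) (a # ns) w =
     (cat (comp b' (Hs F G H) ?u) (Fs F ns ?v) - ?s (cat (H ?u) ?DF)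
       + ?s (cat (comp b' (Fs G) ?u) (Hs F G H ns ?v)) + cat (G ?u) ?DH) +
     (cat (comp H (Ds A b) ?u) (Fs F ns ?v) - ?s (cat (comp G (Ds A b) ?u) (Hs F G H ns ?v))
       + ?s (cat (H ?u) ?FD) + cat (G ?u) ?HD)"
    using l by (simp add: conv_Hs_Hs_Cons[OF Cons.prems(2) sh sh cochain_shifts[OF b]]
        conv_Hs_Hs_Cons[OF Cons.prems(2) F[THEN cochain_shifts] G[THEN cochain_shifts] H[THEN cochain_shifts]]
        conv_Fs_id[OF l(4,2)] conv_Hs_id[OF l(4,2)] conv_id_Hs[OF F G H l(2)] conv_id_Fs[OF F l(2)]
        comp_idc_Hs[OF F G H l(1)] comp_idc_Fs[OF G l(1)] comp_Fs_idc[OF l(3)])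
  \<comment> \<open>Here the mixed terms are collected: one pair is H against the commutator of the
    differential with F on the rest, the other is the commutator with G on the first block against
    \<open>Hs\<close> on the rest.\<close>
  also have "\<dots> = cat (comp b' (Hs F G H) ?u + comp H (Ds A b) ?u) (Fs F ns ?v)
      - ?s (cat (H ?u) (?DF - ?FD)) + ?s (cat (comp b' (Fs G) ?u - comp G (Ds A b) ?u) (Hs F G H ns ?v))
      + cat (G ?u) (?DH + ?HD)"
    by (simp add: cat_add cat_diff sg_diff)
  also have "eqv B \<dots> (cat (F ?u - G ?u) (Fs F ns ?v)
      - ?s (cat (H ?u) (?DF - ?DF)) + ?s (cat (comp G (Ds A b) ?u - comp G (Ds A b) ?u) (Hs F G H ns ?v))
      + cat (G ?u) (Fs F ns ?v - Fs G ns ?v))"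
    by (intro eqv_add eqv_diff eqv_sg eqv_cat bH bG Cons.IH l eqv_refl
        eqv_sym[OF conv_D_Fs[OF b F bF]]) auto
  \<comment> \<open>The product of F with F minus the product of G with G arises by telescoping
    through G on the first block and F on the rest.\<close>
  also have "\<dots> = Fs F (a # ns) w - Fs G (a # ns) w"
    by (simp add: cat_diff)
  finally show ?case .
qed (simp add: conv_Nil)

lemma eqv_Fs:
  assumes "\<And>u. valid A u \<Longrightarrow> u \<noteq> [] \<Longrightarrow> eqv B (F u) (F' u)" "valid A w" "length w = csum ns"
  shows "eqv B (Fs F ns w) (Fs F' ns w)"
  using assms(2,3)
proof (induction ns arbitrary: w)
  case (Cons a ns)
  note l = length_Cons_csum[OF Cons.prems(2,1)]
  show ?case unfolding Fs.simps by (intro eqv_cat assms(1) Cons.IH l)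
qed simp

text \<open>The chain is b(GF) = (bG)F ~ (Gb)F = G(bF) ~ G(Fb) = (GF)b. The equalities are
  associativity; the first relation is used on the words produced by F, the second under G, which is
  why G must descend.\<close>

theorem comp_commutes:
  assumes b: "cochain A 1 b" and b': "cochain B 1 b'" and F: "cochain B 0 F" and G: "cochain C 0 G"
    and G_resp: "descends B C G"
    and bF: "\<And>u. valid A u \<Longrightarrow> u \<noteq> [] \<Longrightarrow> eqv B (comp b' (Fs F) u) (comp F (Ds A b) u)"
    and bG: "\<And>u. valid B u \<Longrightarrow> u \<noteq> [] \<Longrightarrow> eqv C (comp b'' (Fs G) u) (comp G (Ds B b') u)"
    and u: "valid A u" "u \<noteq> []"
  shows "eqv C (comp b'' (Fs (comp G (Fs F))) u) (comp (comp G (Fs F)) (Ds A b) u)"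
proof -
  note shF = cochain_shifts[OF F] and shG = cochain_shifts[OF G]
    and sh = cochain_shifts[OF idc_cochain[of A]]
  have "comp b'' (Fs (comp G (Fs F))) u = comp b'' (conv (Fs G) (Fs F)) u"
    unfolding comp_def[of b'']
    by (intro sum.cong refl arg_cong[where f = "frag_extend _"] conv_Fs_Fs[OF shF, symmetric])
      (simp add: comps_def)
  also have "\<dots> = comp (comp b'' (Fs G)) (Fs F) u"
    by (rule comp_conv) (use Fs_keys[OF shF] in \<open>auto simp: comps_def\<close>)
  also have "eqv C \<dots> (comp (comp G (Ds B b')) (Fs F) u)"
    unfolding comp_def[of _ "Fs F"]
  proof (intro eqv_sum eqv_frag_extend)
    fix ms w assume ms: "ms \<in> comps (length u)" and w: "w \<in> Poly_Mapping.keys (Fs F ms u)"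
    have "length w = length ms" using Fs_keys[OF shF w] ms by (simp add: comps_def)
    moreover have "ms \<noteq> []" using ms u(2) by (auto simp: comps_def)
    ultimately have "w \<noteq> []" by auto
    moreover have "valid B w" using Fs_into[OF cochain_into[OF F]] w by (auto simp: into_def)
    ultimately show "eqv C (comp b'' (Fs G) w) (comp G (Ds B b') w)" by (rule bG[rotated])
  qed
  also have "comp (comp G (Ds B b')) (Fs F) u = comp G (conv (Ds B b') (Fs F)) u"
    by (rule comp_conv[symmetric]) (use Fs_keys[OF shF] in \<open>auto simp: comps_def\<close>)
  also have "eqv C \<dots> (comp G (conv (Fs F) (Ds A b)) u)"
    unfolding comp_def[of G]
    by (intro eqv_sum descendsD[OF G_resp] conv_D_Fs[OF b F bF]) (auto simp: u comps_def)
  also have "comp G (conv (Fs F) (Ds A b)) u = comp (comp G (Fs F)) (Ds A b) u"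
    by (rule comp_conv) (use Hs_keys[OF sh sh cochain_shifts[OF b]] in \<open>auto simp: comps_def\<close>)
  finally show ?thesis .
qed

section \<open>Evaluating formal sums of words in tensor powers\<close>

text \<open>The sign $(-1)^{\theta(w)}$ identifies $A^{\otimes n}$ with the tensor power of the shifted
  module; it removes all signs from the relations that are not Koszul signs.\<close>

fun theta :: "'a word \<Rightarrow> nat" where
  "theta [] = 0"
| "theta (a # w) = length w * (fst a + 1) + theta w"

text \<open>The summand 1 in the definition of \<open>theta\<close> is there for this formula: the
  mixed term then depends on u through \<open>sdeg u\<close> only, which is what Koszul signs in the
  bar construction see.\<close>

lemma theta_append: "theta (u @ v) = theta u + length v * sdeg u + theta v"
  by (induction u) (simp_all add: algebra_simps)

lemma theta_cong: "map fst w = map fst w' \<Longrightarrow> theta w = theta w'"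
  by (induction w w' rule: list_induct2') (auto dest: map_eq_imp_length_eq)

abbreviation lt :: "nat \<Rightarrow> 'a \<Rightarrow> 'a frag" where
  "lt e x \<equiv> frag_of [(e, x)]"

context graded_module
begin

lemma T_add_comm: "comm_group (add_monoid (T n q))"
proof -
  interpret module R "T n q" by (rule T_module)
  show ?thesis by (rule M.a_comm_group)
qed

text \<open>Words of another length or degree are sent to 0, so that the evaluation is additive on
  all formal sums, mixed ones included.\<close>

definition ev_word :: "nat \<Rightarrow> nat \<Rightarrow> 'a word \<Rightarrow> ('k, 'a) tensor" where
  "ev_word n q w = (if w \<in> words A n q then signed (T n q) (int (theta w)) (pure w) else \<zero>\<^bsub>T n q\<^esub>)"

lemma ev_word_closed: "ev_word n q w \<in> carrier (T n q)"
proof -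
  interpret module R "T n q" by (rule T_module)
  show ?thesis by (auto simp: ev_word_def intro: signed_closed[OF T_module] pure_closed)
qed

text \<open>Any additive extension of \<open>ev_word\<close> will do; the universal property of the
  free abelian group provides one.\<close>

definition ev :: "nat \<Rightarrow> nat \<Rightarrow> 'a frag \<Rightarrow> ('k, 'a) tensor" where
  "ev n q = (SOME h. h \<in> hom (free_Abelian_group UNIV) (add_monoid (T n q)) \<and>
     (\<forall>w. h (frag_of w) = ev_word n q w))"

lemma ev_spec: "ev n q \<in> hom (free_Abelian_group UNIV) (add_monoid (T n q)) \<and>
     (\<forall>w. ev n q (frag_of w) = ev_word n q w)"
proof -
  interpret comm_group "add_monoid (T n q)" by (rule T_add_comm)
  obtain h where "h \<in> hom (free_Abelian_group UNIV) (add_monoid (T n q))"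
    "\<And>w. w \<in> UNIV \<Longrightarrow> h (frag_of w) = ev_word n q w"
    by (rule free_Abelian_group_universal[of "ev_word n q" UNIV]) (use ev_word_closed in auto)
  then show ?thesis
    unfolding ev_def by (intro someI_ex[of "\<lambda>h. h \<in> _ \<and> _ h"]) auto
qed

lemma ev_of: "ev n q (frag_of w) = ev_word n q w"
  using ev_spec by blast

lemma ev_closed: "ev n q p \<in> carrier (T n q)"
  and ev_add: "ev n q (p + p') = ev n q p \<oplus>\<^bsub>T n q\<^esub> ev n q p'"
  using ev_spec[of n q] by (auto simp: hom_def)

lemma ev_zero: "ev n q 0 = \<zero>\<^bsub>T n q\<^esub>"
proof -
  interpret module R "T n q" by (rule T_module)
  have "ev n q 0 = ev n q 0 \<oplus>\<^bsub>T n q\<^esub> ev n q 0" using ev_add[of n q 0 0] by simp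
  then show ?thesis using ev_closed[of n q 0] by simp
qed

lemma ev_minus: "ev n q (- p) = \<ominus>\<^bsub>T n q\<^esub> ev n q p"
proof -
  interpret module R "T n q" by (rule T_module)
  have "ev n q (- p) \<oplus>\<^bsub>T n q\<^esub> ev n q p = \<zero>\<^bsub>T n q\<^esub>"
    using ev_add[of n q "- p" p] by (simp add: ev_zero)
  then show ?thesis using ev_closed by (metis M.minus_equality)
qed

lemma ev_diff: "ev n q (p - p') = ev n q p \<ominus>\<^bsub>T n q\<^esub> ev n q p'"
  using ev_add[of n q p "- p'"] by (simp add: ev_minus a_minus_def)

lemma ev_sg: "ev n q (sg e p) = signed (T n q) (int e) (ev n q p)"
  by (simp add: sg_def signed_def ev_minus)

lemma ev_sum: "ev n q (\<Sum>i\<in>S. f i) = (\<Oplus>\<^bsub>T n q\<^esub>i\<in>S. ev n q (f i))"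
proof -
  interpret module R "T n q" by (rule T_module)
  show ?thesis
    by (induction S rule: infinite_finite_induct) (simp_all add: ev_zero ev_add ev_closed)
qed

text \<open>\<open>theta\<close> depends on the degrees of the letters only, so the three words of
  an additivity relation carry the same sign and the relation is multilinearity of pure
  tensors.\<close>

lemma ev_null: "p \<in> null A \<Longrightarrow> ev n q p = \<zero>\<^bsub>T n q\<^esub>"
proof (induction p rule: null.induct)
  case (add x p y u v)
  interpret M: module R "T n q" by (rule T_module)
  have iff: "u @ (p, x \<oplus>\<^bsub>A p\<^esub> y) # v \<in> words A n q \<longleftrightarrow> u @ (p, x) # v \<in> words A n q"
    "u @ (p, y) # v \<in> words A n q \<longleftrightarrow> u @ (p, x) # v \<in> words A n q"
    using add letter_closed(1)[OF add] by (auto simp: words_iff)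
  have th: "theta (u @ (p, x \<oplus>\<^bsub>A p\<^esub> y) # v) = theta (u @ (p, x) # v)"
    "theta (u @ (p, y) # v) = theta (u @ (p, x) # v)"
    by (auto intro: theta_cong)
  show ?case
  proof (cases "u @ (p, x) # v \<in> words A n q")
    case w: True
    have cl: "pure (u @ (p, x) # v) \<in> carrier (T n q)" "pure (u @ (p, y) # v) \<in> carrier (T n q)"
      using w iff by (auto intro: pure_closed)
    show ?thesis
      using w cl add
      by (simp add: ev_diff ev_of ev_word_def iff th multilinear_add[OF pure_multilinear T_module w]
          M.M.minus_minus_eq_zero_iff signed_closed[OF T_module])
        (simp add: signed_def M.M.minus_add)
  qed (simp add: ev_diff ev_of ev_word_def iff M.M.minus_minus_eq_zero_iff)
next
  case (invalid w)
  then show ?case by (simp add: ev_of ev_word_def words_iff)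
next
  case (diff a b)
  interpret module R "T n q" by (rule T_module)
  show ?case using diff by (simp add: ev_diff a_minus_def)
qed (rule ev_zero)

lemma ev_eqv: "eqv A p p' \<Longrightarrow> ev n q p = ev n q p'"
proof -
  assume "eqv A p p'"
  then have "ev n q p \<ominus>\<^bsub>T n q\<^esub> ev n q p' = \<zero>\<^bsub>T n q\<^esub>"
    by (simp add: eqv_def ev_null ev_diff[symmetric])
  interpret module R "T n q" by (rule T_module)
  show ?thesis
    using \<open>ev n q p \<ominus>\<^bsub>T n q\<^esub> ev n q p' = _\<close> by (simp add: M.minus_eq_zero_iff ev_closed)
qed

section \<open>Module elements as one-letter words\<close>

lemma lt_add: "x \<in> carrier (A e) \<Longrightarrow> y \<in> carrier (A e) \<Longrightarrow> eqv A (lt e (x \<oplus>\<^bsub>A e\<^esub> y)) (lt e x + lt e y)"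
  using null.add[of x A e y "[]" "[]"] by (simp add: eqv_def algebra_simps)

lemma lt_zero: "eqv A (lt e \<zero>\<^bsub>A e\<^esub>) 0"
proof -
  interpret module R "A e" by (rule module)
  have "- (lt e (\<zero>\<^bsub>A e\<^esub> \<oplus>\<^bsub>A e\<^esub> \<zero>\<^bsub>A e\<^esub>) - (lt e \<zero>\<^bsub>A e\<^esub> + lt e \<zero>\<^bsub>A e\<^esub>)) \<in> null A"
    using lt_add[of "\<zero>\<^bsub>A e\<^esub>" e "\<zero>\<^bsub>A e\<^esub>"] by (intro null_minus) (simp add: eqv_def)
  then show ?thesis by (simp add: eqv_def)
qed

lemma lt_minus: "x \<in> carrier (A e) \<Longrightarrow> eqv A (lt e (\<ominus>\<^bsub>A e\<^esub> x)) (- lt e x)"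
proof -
  assume x: "x \<in> carrier (A e)"
  interpret module R "A e" by (rule module)
  have "eqv A 0 (lt e (\<ominus>\<^bsub>A e\<^esub> x \<oplus>\<^bsub>A e\<^esub> x))"
    using x eqv_sym[OF lt_zero] by (simp add: M.l_neg)
  also have "eqv A \<dots> (lt e (\<ominus>\<^bsub>A e\<^esub> x) + lt e x)"
    using x by (intro lt_add) auto
  finally have "eqv A (0 - lt e x) (lt e (\<ominus>\<^bsub>A e\<^esub> x) + lt e x - lt e x)"
    by (intro eqv_diff) auto
  then show ?thesis by (auto intro: eqv_sym)
qed

lemma lt_diff: "x \<in> carrier (A e) \<Longrightarrow> y \<in> carrier (A e) \<Longrightarrow> eqv A (lt e (x \<ominus>\<^bsub>A e\<^esub> y)) (lt e x - lt e y)"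
proof -
  assume xy: "x \<in> carrier (A e)" "y \<in> carrier (A e)"
  interpret module R "A e" by (rule module)
  have "eqv A (lt e (x \<ominus>\<^bsub>A e\<^esub> y)) (lt e x + lt e (\<ominus>\<^bsub>A e\<^esub> y))"
    using xy by (simp add: a_minus_def lt_add)
  also have "eqv A \<dots> (lt e x + - lt e y)"
    by (intro eqv_add lt_minus xy) simp
  finally show ?thesis by simp
qed

lemma lt_signed: "x \<in> carrier (A e) \<Longrightarrow> eqv A (lt e (signed (A e) (int k) x)) (sg k (lt e x))"
  by (auto simp: signed_def sg_def lt_minus)

lemma lt_finsum:
  assumes "\<And>i. i \<in> S \<Longrightarrow> f i \<in> carrier (A e)"
  shows "eqv A (lt e (\<Oplus>\<^bsub>A e\<^esub>i\<in>S. f i)) (\<Sum>i\<in>S. lt e (f i))"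
proof -
  interpret module R "A e" by (rule module)
  show ?thesis
    using assms
  proof (induction S rule: infinite_finite_induct)
    case (insert i S)
    have "eqv A (lt e (f i \<oplus>\<^bsub>A e\<^esub> (\<Oplus>\<^bsub>A e\<^esub>i\<in>S. f i))) (lt e (f i) + lt e (\<Oplus>\<^bsub>A e\<^esub>i\<in>S. f i))"
      using insert by (intro lt_add M.finsum_closed) auto
    also have "eqv A \<dots> (lt e (f i) + (\<Sum>i\<in>S. lt e (f i)))"
      using insert by (intro eqv_add) auto
    finally show ?case
      using insert by (subst M.finsum_insert) auto
  qed (simp_all add: lt_zero)
qed

end

section \<open>Cochains from multilinear maps\<close>

text \<open>The multilinear map seen on shifted modules: the input is corrected by
  \<open>theta\<close>, while the output is one letter, whose \<open>theta\<close> is 0. Outside the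
  words of the right length the cochain is 0, so components of different arity can be combined into
  one cochain.\<close>

fun lbar :: "('k, 'r) ring_scheme \<Rightarrow> (nat \<Rightarrow> ('k, 'a) module) \<Rightarrow> ('k, 'a, 'b) multi_map \<Rightarrow> 'a word \<Rightarrow> 'b frag" where
  "lbar R A (p, e, u) v = (if valid A v \<and> length v = p
     then sg (theta v) (lt (wdeg v + e) (u (wdeg v) (pure_tensor R A v))) else 0)"

text \<open>A map of arity p and degree e changes \<open>sdeg\<close> by e + 1 - p, so this is the
  parity of the degree of the whole product in the bar construction.\<close>

definition oddity :: "('k, 'a, 'b) multi_map list \<Rightarrow> nat" where
  "oddity us = degree us + arity us + length us"

text \<open>The tensor product of the shifted maps; the sign moves all later maps across the first
  block.\<close>

fun Bs :: "('k, 'r) ring_scheme \<Rightarrow> (nat \<Rightarrow> ('k, 'a) module) \<Rightarrow> ('k, 'a, 'b) multi_map list \<Rightarrow> 'a word \<Rightarrow> 'b frag" where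
  "Bs R A [] w = frag_of []"
| "Bs R A (m # us) w =
     sg (sdeg (take (fst m) w) * oddity us) (cat (lbar R A m (take (fst m) w)) (Bs R A us (drop (fst m) w)))"

text \<open>What is left of the sign between the tensor product of the maps and that of their shifts
  after all signs depending on the word have cancelled. Only arities and degrees enter.\<close>

fun kexp :: "('k, 'a, 'b) multi_map list \<Rightarrow> nat" where
  "kexp [] = 0"
| "kexp ((p, e, u) # us) = p * degree us + (p + e + 1) * length us + kexp us"

fun bexp :: "('k, 'a, 'b) multi_map list \<Rightarrow> 'a word \<Rightarrow> nat" where
  "bexp [] w = 0"
| "bexp ((p, e, u) # us) w = sdeg (take p w) * oddity us + theta (take p w) + bexp us (drop p w)"

lemma Bs_apply:
  assumes "valid A w" "length w = arity us"
  shows "Bs R A us w = sg (bexp us w) (frag_of (apply_maps R A us w))"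
  using assms
proof (induction us arbitrary: w)
  case (Cons m us)
  obtain p e u where m: "m = (p, e, u)" by (cases m)
  have "Bs R A us (drop p w) = sg (bexp us (drop p w)) (frag_of (apply_maps R A us (drop p w)))"
    using Cons by (simp add: m valid_drop)
  then show ?case
    using Cons.prems by (simp add: m valid_take cat_sg sg_sg algebra_simps)
qed simp

lemma koszul_theta:
  assumes "length w = arity us"
  shows "even (koszul_exp us w + theta w + theta (apply_maps R A us w) + bexp us w + kexp us)"
  using assms
proof (induction us arbitrary: w)
  case (Cons m us)
  obtain p e u where m: "m = (p, e, u)" by (cases m)
  let ?t = "take p w" and ?d = "drop p w"
  have len: "length ?d = arity us" "length ?t = p" using Cons.prems by (simp_all add: m)
  have "theta w = theta (?t @ ?d)" by simp
  then have th: "theta w = theta ?t + arity us * sdeg ?t + theta ?d"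
    by (simp only: theta_append len)
  have sd: "sdeg ?t = wdeg ?t + p" using len by (simp add: sdeg_def)
  have al: "length (apply_maps R A us w') = length us" for w'
    by (induction us arbitrary: w') auto
  have IH: "even (koszul_exp us ?d + theta ?d + theta (apply_maps R A us ?d) + bexp us ?d + kexp us)"
    by (rule Cons.IH[OF len(1)])
  have deg: "(\<Sum>(p', e', u')\<leftarrow>us. e') = degree us" by (simp add: degree_def)
  \<comment> \<open>The contribution of the first block alone: after expanding, every monomial
    occurs an even number of times. The remaining exponents form the induction hypothesis.\<close>
  have "even (wdeg ?t * degree us + (theta ?t + arity us * (wdeg ?t + p)) + length us * (wdeg ?t + e + 1)
      + ((wdeg ?t + p) * (degree us + arity us + length us) + theta ?t)
      + (p * degree us + (p + e + 1) * length us))"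
    by (simp add: algebra_simps)
  then have "even ((koszul_exp us ?d + theta ?d + theta (apply_maps R A us ?d) + bexp us ?d + kexp us) +
     (wdeg ?t * degree us + (theta ?t + arity us * (wdeg ?t + p)) + length us * (wdeg ?t + e + 1)
      + ((wdeg ?t + p) * (degree us + arity us + length us) + theta ?t)
      + (p * degree us + (p + e + 1) * length us)))"
    using IH by simp
  then show ?case
    unfolding m koszul_exp.simps bexp.simps kexp.simps apply_maps.simps theta.simps th deg al sd oddity_def fst_conv
    by (simp only: ac_simps)
qed simp

context graded_modules
begin

lemma lin_ev:
  assumes \<phi>: "\<phi> \<in> lin_maps R (A.T n q) (B.T n' q')" and p: "Poly_Mapping.keys p \<subseteq> words A n q"
    and \<psi>: "\<And>w. w \<in> words A n q \<Longrightarrow> \<phi> (A.ev n q (frag_of w)) = B.ev n' q' (\<psi> w)"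
  shows "\<phi> (A.ev n q p) = B.ev n' q' (frag_extend \<psi> p)"
  using p
proof (induction p rule: frag_induction)
  case zero
  then show ?case by (simp add: A.ev_zero B.ev_zero lin_maps_zero[OF \<phi> A.T_module B.T_module])
next
  case (diff a b)
  interpret MA: module R "A.T n q" by (rule A.T_module)
  show ?case
    using diff A.ev_closed
    by (simp add: A.ev_diff B.ev_diff frag_extend_diff a_minus_def lin_maps_add[OF \<phi>]
        lin_maps_minus[OF \<phi> A.T_module B.T_module])
qed (simp add: \<psi>)

lemma lin_lt:
  assumes \<phi>: "\<phi> \<in> lin_maps R (A.T n q) (B e)" and p: "Poly_Mapping.keys p \<subseteq> words A n q"
  shows "eqv B (lt e (\<phi> (A.ev n q p))) (frag_extend (\<lambda>w. sg (theta w) (lt e (\<phi> (A.pure w)))) p)"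
  using p
proof (induction p rule: frag_induction)
  case zero
  then show ?case
    by (simp add: A.ev_zero B.lt_zero lin_maps_zero[OF \<phi> A.T_module B.module])
next
  case (one w)
  then show ?case
    by (simp add: A.ev_of A.ev_word_def lin_maps_signed[OF \<phi> A.T_module B.module] A.pure_closed
        B.lt_signed lin_maps_closed[OF \<phi>])
next
  case (diff a b)
  interpret MA: module R "A.T n q" by (rule A.T_module)
  have "\<phi> (A.ev n q (a - b)) = \<phi> (A.ev n q a) \<ominus>\<^bsub>B e\<^esub> \<phi> (A.ev n q b)"
    using A.ev_closed by (simp add: A.ev_diff a_minus_def lin_maps_add[OF \<phi>]
        lin_maps_minus[OF \<phi> A.T_module B.module])
  then have "eqv B (lt e (\<phi> (A.ev n q (a - b)))) (lt e (\<phi> (A.ev n q a)) - lt e (\<phi> (A.ev n q b)))"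
    using B.lt_diff lin_maps_closed[OF \<phi> A.ev_closed] by simp
  also have "eqv B \<dots> (frag_extend (\<lambda>w. sg (theta w) (lt e (\<phi> (A.pure w)))) a -
      frag_extend (\<lambda>w. sg (theta w) (lt e (\<phi> (A.pure w)))) b)"
    by (intro eqv_diff diff)
  finally show ?case by (simp add: frag_extend_diff)
qed

text \<open>The \<open>theta\<close> built into \<open>ev\<close> is the \<open>theta\<close> built
  into \<open>lbar\<close>, so the two sides carry the same sign word by word.\<close>

lemma lin_lbar:
  assumes m: "multi_lin (n, e, u)" and p: "Poly_Mapping.keys p \<subseteq> words A n q"
  shows "eqv B (lt (q + e) (u q (A.ev n q p))) (frag_extend (lbar R A (n, e, u)) p)"
proof -
  have "u q \<in> lin_maps R (A.T n q) (B (q + e))" using m by (simp add: multi_lin_def)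
  from lin_lt[OF this p] show ?thesis
    by (rule eqv_eq_trans) (intro frag_extend_eq, use p in \<open>auto simp: words_iff\<close>)
qed

text \<open>The Koszul sign, \<open>theta\<close> of the input, \<open>theta\<close> of the output
  and the signs in \<open>Bs\<close> add up to \<open>kexp\<close> by
  \<open>koszul_theta\<close>.\<close>

lemma tensor_maps_ev:
  assumes us: "\<forall>m\<in>set us. multi_lin m" and w: "w \<in> words A n q" and n: "n = arity us"
    and q': "q' = q + degree us" and r: "r = length us"
  shows "tensor_maps R A B us q (A.ev n q (frag_of w)) = signed (B.T r q') (int (kexp us)) (B.ev r q' (Bs R A us w))"
proof -
  have v: "valid A w" and len: "length w = arity us" using w n by (auto simp: words_iff)
  have app: "apply_maps R A us w \<in> words B r q'"
    using apply_maps_words[OF us] w n q' r by simp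
  note cl = B.pure_closed[OF app]
  interpret M: module R "B.T r q'" by (rule B.T_module)
  have "tensor_maps R A B us q (A.ev n q (frag_of w)) =
      signed (B.T r q') (int (theta w)) (tensor_maps R A B us q (A.pure w))"
    using lin_maps_signed[OF tensor_maps_lin[OF us n r q'] A.T_module B.T_module A.pure_closed[OF w]] w
    by (simp add: A.ev_of A.ev_word_def)
  moreover have "tensor_maps R A B us q (A.pure w) =
      signed (B.T r q') (int (koszul_exp us w)) (B.pure (apply_maps R A us w))"
    using tensor_maps_pure[OF us _ q'] w n r by simp
  moreover have "B.ev r q' (Bs R A us w) = signed (B.T r q') (int (bexp us w))
      (signed (B.T r q') (int (theta (apply_maps R A us w))) (B.pure (apply_maps R A us w)))"
    by (simp add: Bs_apply[OF v len] B.ev_sg B.ev_of B.ev_word_def app)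
  ultimately show ?thesis
    using koszul_theta[OF len, of R A] cl by (auto simp: signed_def)
qed

end

section \<open>Sums over compositions\<close>

definition nonzeros :: "nat list \<Rightarrow> nat" where
  "nonzeros ns = length (filter (\<lambda>k. k \<noteq> 0) ns)"

text \<open>The decomposition with one long block, which belongs to a tuple of consecutive indices:
  i single letters, a block of k + 1 letters, c single letters.\<close>

definition single :: "nat \<Rightarrow> nat \<Rightarrow> nat \<Rightarrow> nat list" where
  "single i k c = replicate i 0 @ [k] @ replicate c 0"

lemma nonzeros_simps [simp]:
  "nonzeros [] = 0" "nonzeros (a # ns) = (if a = 0 then 0 else 1) + nonzeros ns"
  by (simp_all add: nonzeros_def)

lemma nonzeros_eq_0_iff: "nonzeros ns = 0 \<longleftrightarrow> set ns \<subseteq> {0}"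
  by (induction ns) auto

lemma nonzeros_replicate [simp]: "nonzeros (replicate n 0) = 0"
  by (simp add: nonzeros_eq_0_iff set_replicate_conv_if)

lemma nonzeros_single: "k \<noteq> 0 \<Longrightarrow> nonzeros (single i k c) = 1"
  by (simp add: nonzeros_def single_def)

lemma csum_replicate [simp]: "csum (replicate n 0) = n"
  by (simp add: csum_eq sum_list_replicate)

lemma csum_single [simp]: "csum (single i k c) = i + Suc k + c"
  by (simp add: single_def)

lemma length_single [simp]: "length (single i k c) = i + Suc c"
  by (simp add: single_def)

lemma nonzeros_1E:
  assumes "nonzeros ns = 1"
  obtains i k c where "ns = single i k c" "k \<noteq> 0"
proof -
  have "\<exists>i k c. ns = single i k c \<and> k \<noteq> 0"
    using assms
  proof (induction ns)
    case (Cons a ns)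
    show ?case
    proof (cases "a = 0")
      case True
      then obtain i k c where "ns = single i k c" "k \<noteq> 0" using Cons by auto
      then show ?thesis
        using True by (intro exI[of _ "Suc i"] exI[of _ k] exI[of _ c]) (simp add: single_def)
    next
      case False
      then have "set ns \<subseteq> {0}" using Cons.prems by (simp add: nonzeros_eq_0_iff)
      then have "ns = replicate (length ns) 0" by (intro replicate_length_same[symmetric]) auto
      then show ?thesis
        using False by (intro exI[of _ 0] exI[of _ a] exI[of _ "length ns"]) (simp add: single_def)
    qed
  qed simp
  then show ?thesis using that by blast
qed

lemma single_inject: "single i k c = single i' k' c' \<Longrightarrow> k \<noteq> 0 \<Longrightarrow> k' \<noteq> 0 \<Longrightarrow> i = i' \<and> k = k' \<and> c = c'"
proof (induction i arbitrary: i')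
  case 0
  then show ?case by (cases i') (auto simp: single_def dest: arg_cong[of _ _ length])
next
  case (Suc i)
  obtain j where j: "i' = Suc j"
    using Suc.prems by (cases i') (auto simp: single_def)
  have "single i k c = single j k' c'" using Suc.prems(1) by (simp add: j single_def)
  then show ?case using Suc.IH[of j] Suc.prems(2,3) by (simp add: j)
qed

text \<open>A decomposition of N + 1 letters into m + 1 blocks with exactly one long block, in place
  t, gives that block N - m + 1 letters. This produces the double sum over m and t of the
  definitions; the all-zero list is the part of the differential coming from d.\<close>

lemma sum_comps_single:
  fixes g :: "nat list \<Rightarrow> 'b :: ab_group_add"
  assumes "\<And>ms. ms \<in> comps (Suc N) \<Longrightarrow> nonzeros ms \<ge> 2 \<Longrightarrow> g ms = 0"
  shows "(\<Sum>ms\<in>comps (Suc N). g ms) =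
    g (replicate (Suc N) 0) + (\<Sum>m<N. \<Sum>t\<in>{1..m + 1}. g (single (t - 1) (N - m) (m + 1 - t)))"
proof -
  let ?S = "SIGMA m:{..<N}. {1..m + 1}" and ?f = "\<lambda>(m, t). single (t - 1) (N - m) (m + 1 - t)"
  have inj: "inj_on ?f ?S"
  proof (rule inj_onI)
    fix x y assume xy: "x \<in> ?S" "y \<in> ?S" "?f x = ?f y"
    obtain m t m' t' where eq: "x = (m, t)" "y = (m', t')" by (cases x, cases y)
    have "t - 1 = t' - 1 \<and> N - m = N - m' \<and> m + 1 - t = m' + 1 - t'"
      using xy unfolding eq by (intro single_inject) auto
    then show "x = y" using xy(1,2) unfolding eq by auto
  qed
  have img: "?f ` ?S = {ms \<in> comps (Suc N). nonzeros ms = 1}"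
  proof (intro equalityI subsetI)
    fix ms assume "ms \<in> {ms \<in> comps (Suc N). nonzeros ms = 1}"
    then have ms: "csum ms = Suc N" "nonzeros ms = 1" by (auto simp: comps_def)
    obtain i k c where s: "ms = single i k c" "k \<noteq> 0" using ms(2) by (rule nonzeros_1E)
    then have k: "k = N - (i + c)" "i + c < N" using ms(1) by auto
    then show "ms \<in> ?f ` ?S"
      using s by (intro image_eqI[of _ _ "(i + c, Suc i)"]) auto
  next
    fix ms assume "ms \<in> ?f ` ?S"
    then obtain m t where "ms = single (t - 1) (N - m) (m + 1 - t)" "m < N" "1 \<le> t" "t \<le> m + 1"
      by auto
    then show "ms \<in> {ms \<in> comps (Suc N). nonzeros ms = 1}"
      by (auto simp: comps_def nonzeros_single)
  qed
  have "(\<Sum>ms\<in>comps (Suc N). g ms) =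
      (\<Sum>ms\<in>{replicate (Suc N) 0} \<union> {ms \<in> comps (Suc N). nonzeros ms = 1}. g ms)"
  proof (rule sum.mono_neutral_right)
    show "\<forall>ms\<in>comps (Suc N) - ({replicate (Suc N) 0} \<union> {ms \<in> comps (Suc N). nonzeros ms = 1}). g ms = 0"
    proof
      fix ms assume ms: "ms \<in> comps (Suc N) - ({replicate (Suc N) 0} \<union> {ms \<in> comps (Suc N). nonzeros ms = 1})"
      have "nonzeros ms \<noteq> 0"
        using ms comps_zero[of ms "Suc N"] by (auto simp: nonzeros_eq_0_iff)
      then show "g ms = 0" using ms assms[of ms] by auto
    qed
    show "finite (comps (Suc N))" by simp
    show "{replicate (Suc N) 0} \<union> {ms \<in> comps (Suc N). nonzeros ms = 1} \<subseteq> comps (Suc N)"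
      by (auto simp: comps_def simp del: replicate_Suc)
  qed
  also have "\<dots> = g (replicate (Suc N) 0) + (\<Sum>ms\<in>{ms \<in> comps (Suc N). nonzeros ms = 1}. g ms)"
    by (subst sum.union_disjoint) (auto simp del: replicate_Suc)
  also have "(\<Sum>ms\<in>{ms \<in> comps (Suc N). nonzeros ms = 1}. g ms) = (\<Sum>x\<in>?S. g (?f x))"
    by (simp only: img[symmetric] sum.reindex[OF inj] o_def)
  also have "\<dots> = (\<Sum>m<N. \<Sum>t\<in>{1..m + 1}. g (single (t - 1) (N - m) (m + 1 - t)))"
    by (subst sum.Sigma) (simp_all add: case_prod_unfold del: sum.cl_ivl_Suc)
  finally show ?thesis .
qed

lemma finite_sum_tuples [simp]: "finite (sum_tuples r s)"
  by (rule finite_subset[OF _ finite_comps[of "s + r"]]) (auto simp: sum_tuples_def comps_def csum_eq)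

lemma sum_comps_tuples:
  "(\<Sum>ns\<in>comps (Suc N). g ns) = (\<Sum>m\<le>N. \<Sum>ns\<in>sum_tuples (m + 1) (N - m). g ns)"
proof -
  have "comps (Suc N) = (\<Union>m\<in>{..N}. sum_tuples (m + 1) (N - m))"
  proof (intro equalityI subsetI)
    fix ns assume ns: "ns \<in> comps (Suc N)"
    then have "ns \<noteq> []" by (rule comps_Suc_ne)
    then have "ns \<in> sum_tuples (length ns - 1 + 1) (N - (length ns - 1))" "length ns - 1 \<in> {..N}"
      using ns by (auto simp: comps_def csum_eq sum_tuples_def Suc_le_eq)
    then show "ns \<in> (\<Union>m\<in>{..N}. sum_tuples (m + 1) (N - m))" by blast
  qed (auto simp: comps_def csum_eq sum_tuples_def)
  then show ?thesis
    by (simp only:) (rule sum.UNION_disjoint, simp, simp, auto simp: sum_tuples_def)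
qed

text \<open>The decomposition into a single block is separated because there the outer cochain meets
  one letter and acts by d; in the definitions that term belongs to the left-hand side.\<close>

lemma sum_comps_tuples':
  fixes g :: "nat list \<Rightarrow> 'b :: ab_group_add"
  shows "(\<Sum>ns\<in>comps (Suc N). g ns) = g [N] + (\<Sum>m<N. \<Sum>ns\<in>sum_tuples (m + 2) (N - 1 - m). g ns)"
proof -
  have "sum_tuples 1 N = {[N]}"
    by (auto simp: sum_tuples_def length_Suc_conv)
  then show ?thesis
    by (cases N) (simp_all add: sum_comps_tuples lessThan_Suc_atMost sum.atMost_Suc_shift del: sum.atMost_Suc)
qed

section \<open>Homogeneous cochains\<close>

text \<open>\<open>F\<close> has degree \<open>c' - c\<close> in the bar construction.\<close>

definition homog :: "(nat \<Rightarrow> ('k, 'b) module) \<Rightarrow> nat \<Rightarrow> nat \<Rightarrow> ('a word \<Rightarrow> 'b frag) \<Rightarrow> bool" where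
  "homog B c c' F \<longleftrightarrow> F [] = 0 \<and>
     (\<forall>u. \<forall>w\<in>Poly_Mapping.keys (F u). valid B w \<and> length w = 1 \<and> sdeg w + c = sdeg u + c')"

lemma homog_cochain: "homog B c c' F \<Longrightarrow> even (c + c' + e) \<Longrightarrow> cochain B e F"
  unfolding cochain_def shifts_def into_def homog_def
proof (intro conjI allI ballI)
  fix u w assume *: "F [] = 0 \<and> (\<forall>u. \<forall>w\<in>Poly_Mapping.keys (F u). valid B w \<and> length w = 1 \<and> sdeg w + c = sdeg u + c')"
    "even (c + c' + e)" and w: "w \<in> Poly_Mapping.keys (F u)"
  have eq: "sdeg w + c = sdeg u + c'" using * w by blast
  have "even ((sdeg w + c) + (sdeg u + c') + (c + c' + e))"
    unfolding eq using *(2) by simp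
  also have "(sdeg w + c) + (sdeg u + c') + (c + c' + e) = (sdeg w + sdeg u + e) + 2 * (c + c')"
    by simp
  finally have "even ((sdeg w + sdeg u + e) + 2 * (c + c'))" .
  then show "even (sdeg w + sdeg u + e)" by (simp only: even_add even_mult_iff even_numeral simp_thms)
qed auto

lemma Fs_homog:
  assumes F: "homog B 0 0 F" and "w \<in> Poly_Mapping.keys (Fs F ns u)" "length u = csum ns"
  shows "valid B w \<and> length w = length ns \<and> sdeg w = sdeg u"
  using assms(2,3)
proof (induction ns arbitrary: u w)
  case (Cons a ns)
  obtain w1 w2 where w: "w = w1 @ w2" "w1 \<in> Poly_Mapping.keys (F (take (Suc a) u))"
    "w2 \<in> Poly_Mapping.keys (Fs F ns (drop (Suc a) u))"
    using Cons.prems(1) by (auto elim: keys_catE)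
  have "valid B w2 \<and> length w2 = length ns \<and> sdeg w2 = sdeg (drop (Suc a) u)"
    using Cons.IH[OF w(3)] Cons.prems(2) by simp
  moreover have "valid B w1 \<and> length w1 = 1 \<and> sdeg w1 = sdeg (take (Suc a) u)"
    using F w(2) by (auto simp: homog_def)
  ultimately show ?case using w(1) sdeg_take_drop[of "Suc a" u] by auto
qed auto

lemma Hs_homog:
  assumes F: "homog B 0 0 F" and G: "homog B 0 0 G" and H: "homog B c c' H"
    and "w \<in> Poly_Mapping.keys (Hs F G H ns u)" "length u = csum ns"
  shows "valid B w \<and> length w = length ns \<and> sdeg w + c = sdeg u + c'"
  using assms(4,5)
proof (induction ns arbitrary: u w)
  case (Cons a ns)
  let ?u = "take (Suc a) u" and ?v = "drop (Suc a) u"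
  note td = sdeg_take_drop[of "Suc a" u]
  have "w \<in> Poly_Mapping.keys (cat (H ?u) (Fs F ns ?v)) \<or>
    w \<in> Poly_Mapping.keys (cat (G ?u) (Hs F G H ns ?v))"
    using subsetD[OF keys_add, of w "cat (H ?u) (Fs F ns ?v)" "sg (sdeg ?u) (cat (G ?u) (Hs F G H ns ?v))"]
      Cons.prems(1) by auto
  then show ?case
  proof
    assume "w \<in> Poly_Mapping.keys (cat (H ?u) (Fs F ns ?v))"
    then obtain w1 w2 where w: "w = w1 @ w2" "w1 \<in> Poly_Mapping.keys (H ?u)"
      "w2 \<in> Poly_Mapping.keys (Fs F ns ?v)"
      by (auto elim: keys_catE)
    have "valid B w2 \<and> length w2 = length ns \<and> sdeg w2 = sdeg ?v"
      using Fs_homog[OF F w(3)] Cons.prems(2) by simp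
    moreover have "valid B w1 \<and> length w1 = 1 \<and> sdeg w1 + c = sdeg ?u + c'"
      using H w(2) by (auto simp: homog_def)
    ultimately show ?thesis using w(1) td by auto
  next
    assume "w \<in> Poly_Mapping.keys (cat (G ?u) (Hs F G H ns ?v))"
    then obtain w1 w2 where w: "w = w1 @ w2" "w1 \<in> Poly_Mapping.keys (G ?u)"
      "w2 \<in> Poly_Mapping.keys (Hs F G H ns ?v)"
      by (auto elim: keys_catE)
    have "valid B w2 \<and> length w2 = length ns \<and> sdeg w2 + c = sdeg ?v + c'"
      using Cons.IH[OF w(3)] Cons.prems(2) by simp
    moreover have "valid B w1 \<and> length w1 = 1 \<and> sdeg w1 = sdeg ?u"
      using G w(2) by (auto simp: homog_def)
    ultimately show ?thesis using w(1) td by auto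
  qed
qed auto

lemma idc_homog: "homog A 0 0 (idc A)"
  by (auto simp: homog_def idc_def split: if_splits)

section \<open>Signs\<close>

lemma eps_Cons: "eps (n # ns) = (n + 1) * sum_list ns + eps ns"
proof (cases ns)
  case (Cons m ms)
  have "eps (n # ns) = (\<Sum>i<Suc (length ms). ((n # ns) ! i + 1) * sum_list (drop (i + 1) (n # ns)))"
    by (simp add: eps_def Cons)
  also have "\<dots> = (n + 1) * sum_list ns + (\<Sum>i<length ms. (ns ! i + 1) * sum_list (drop (i + 1) ns))"
    by (subst sum.lessThan_Suc_shift) simp
  finally show ?thesis by (simp add: eps_def Cons)
qed (simp add: eps_def)

lemma multi_map_Cons [simp]:
  "kexp (m # us) = fst m * degree us + (fst m + fst (snd m) + 1) * length us + kexp us"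
  "degree (m # us) = fst (snd m) + degree us"
  "arity (m # us) = fst m + arity us"
  by (cases m; simp)+

lemma multi_map_fst [simp]:
  "fst (mor_m f n) = Suc n" "fst (snd (mor_m f n)) = n"
  "fst (hty_m f n) = Suc n" "fst (snd (hty_m f n)) = Suc n"
  "fst (op_m A n) = Suc (Suc n)" "fst (snd (op_m A n)) = n"
  "fst (one_m R B) = Suc 0" "fst (snd (one_m R B)) = 0"
  by (simp_all add: mor_m_def hty_m_def op_m_def one_m_def)

lemma sg_even: "even e \<Longrightarrow> sg e p = p"
  by (simp add: sg_def)

lemma even_double_add: "even (x :: nat) \<Longrightarrow> even (2 * a + 2 * b + x)"
  by simp

lemma degree_mor [simp]: "degree (map (mor_m f) ns) = sum_list ns"
  and arity_mor [simp]: "arity (map (mor_m f) ns) = csum ns"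
  by (induction ns) simp_all

text \<open>Thus the exponent \<epsilon> in the definition of morphisms and of their composition is
  precisely what turns a tensor product of components into its shifted form.\<close>

lemma kexp_mor: "even (kexp (map (mor_m f) ns) + eps ns)"
proof (induction ns)
  case (Cons n ns)
  have eq: "kexp (map (mor_m f) (n # ns)) + eps (n # ns) = 2 * ((n + 1) * sum_list ns)
    + 2 * ((n + 1) * length ns) + (kexp (map (mor_m f) ns) + eps ns)"
    unfolding eps_Cons by (simp add: algebra_simps)
  show ?case unfolding eq by (rule even_double_add) (rule Cons)
qed (simp add: eps_def)

text \<open>The factors before, after and including the one from the homotopy number m + 2, so the
  two lengths sum to m + 1. Hence \<rho> and \<open>kexp\<close> have opposite parity, and each of
  these terms acquires a minus sign in the bar construction.\<close>

lemma kexp_hty: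
  "even (kexp (map (mor_m g) xs @ [hty_m h b] @ map (mor_m f) ys)
    + eps (xs @ b # ys) + sum_list xs + length xs + length ys)"
proof (induction xs)
  case Nil
  have eq: "kexp (map (mor_m g) [] @ [hty_m h b] @ map (mor_m f) ys) + eps ([] @ b # ys) + sum_list [] + length [] + length ys
    = 2 * ((b + 1) * sum_list ys) + 2 * ((b + 2) * length ys) + (kexp (map (mor_m f) ys) + eps ys)"
    by (simp add: eps_Cons algebra_simps)
  show ?case unfolding eq by (rule even_double_add) (rule kexp_mor)
next
  case (Cons a xs)
  have eq: "kexp (map (mor_m g) (a # xs) @ [hty_m h b] @ map (mor_m f) ys) + eps ((a # xs) @ b # ys)
      + sum_list (a # xs) + length (a # xs) + length ys
    = 2 * ((a + 1) * (sum_list (xs @ b # ys) + 1)) + 2 * ((a + 1) * (length xs + 1 + length ys))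
      + (kexp (map (mor_m g) xs @ [hty_m h b] @ map (mor_m f) ys)
      + eps (xs @ b # ys) + sum_list xs + length xs + length ys)"
    unfolding append_Cons eps_Cons by (simp add: algebra_simps)
  show ?case unfolding eq by (rule even_double_add) (rule Cons)
qed

lemma degree_one [simp]: "degree (replicate i (one_m R A)) = 0"
  and arity_one [simp]: "arity (replicate i (one_m R A)) = i"
  by (induction i) simp_all

lemma kexp_one: "even (kexp (replicate i (one_m R A)))"
  by (induction i) simp_all

text \<open>With i = t - 1 and c the number of identities on the right, this remainder accounts for
  the exponent t(n - m + 1) in the defining relations up to a global sign.\<close>

lemma kexp_op:
  "k \<noteq> 0 \<Longrightarrow> even (kexp (replicate i (one_m R A) @ [op_m X (k - 1)] @ replicate c (one_m R A)) + i * (k - 1) + c)"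
proof (induction i)
  case 0
  obtain l where k: "k = Suc l" using 0 by (cases k) auto
  have eq: "kexp (replicate 0 (one_m R A) @ [op_m X (k - 1)] @ replicate c (one_m R A)) + 0 * (k - 1) + c
    = 2 * ((l + 2) * c) + 2 * 0 + kexp (replicate c (one_m R A))"
    by (simp add: k algebra_simps)
  show ?case unfolding eq by (rule even_double_add) (rule kexp_one)
next
  case (Suc i)
  obtain l where k: "k = Suc l" using Suc.prems by (cases k) auto
  have eq: "kexp (replicate (Suc i) (one_m R A) @ [op_m X (k - 1)] @ replicate c (one_m R A)) + Suc i * (k - 1) + c
    = 2 * (k - 1) + 2 * (i + Suc c)
      + (kexp (replicate i (one_m R A) @ [op_m X (k - 1)] @ replicate c (one_m R A)) + i * (k - 1) + c)"
    by (simp add: k algebra_simps)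
  show ?case unfolding eq by (rule even_double_add) (rule Suc.IH[OF Suc.prems])
qed

section \<open>Multiplicative families as tensor products of maps\<close>

text \<open>The length of the word selects the component. On the empty word the truncated index is
  0, and the arity test in \<open>lbar\<close> makes the value 0.\<close>

definition fbar :: "('k, 'r) ring_scheme \<Rightarrow> (nat \<Rightarrow> ('k, 'a) module) \<Rightarrow>
    (nat \<Rightarrow> nat \<Rightarrow> ('k, 'a) tensor \<Rightarrow> 'b) \<Rightarrow> 'a word \<Rightarrow> 'b frag" where
  "fbar R A f u = lbar R A (mor_m f (length u - 1)) u"

definition hbar :: "('k, 'r) ring_scheme \<Rightarrow> (nat \<Rightarrow> ('k, 'a) module) \<Rightarrow>
    (nat \<Rightarrow> nat \<Rightarrow> ('k, 'a) tensor \<Rightarrow> 'b) \<Rightarrow> 'a word \<Rightarrow> 'b frag" where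
  "hbar R A h u = lbar R A (hty_m h (length u - 1)) u"

text \<open>The differential acts on single letters and the operations on longer words, which merges
  all structure maps into one cochain. A letter of degree 0 goes to 0 because its differential has
  no target degree, and on the empty word the arity test fails.\<close>

definition bbar :: "('k, 'r) ring_scheme \<Rightarrow> ('k, 'a) ainf \<Rightarrow> 'a word \<Rightarrow> 'a frag" where
  "bbar R A u =
     (if length u = 1
      then if valid (a_mod A) u \<and> 0 < fst (hd u)
        then lt (fst (hd u) - 1) (a_diff A (fst (hd u)) (snd (hd u))) else 0
      else lbar R (a_mod A) (op_m A (length u - 2)) u)"

lemma oddity_mor: "even (oddity (map (mor_m f) ns))"
proof -
  have "oddity (map (mor_m f) ns) = 2 * (sum_list ns + length ns)"
    by (simp add: oddity_def csum_eq)
  then show ?thesis by simp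
qed

text \<open>Shifted components of a morphism are even, so no sign arises from moving them across
  blocks.\<close>

lemma Fs_Bs: "length w = csum ns \<Longrightarrow> Fs (fbar R A f) ns w = Bs R A (map (mor_m f) ns) w"
proof (induction ns arbitrary: w)
  case (Cons a ns)
  have "fbar R A f (take (Suc a) w) = lbar R A (mor_m f a) (take (Suc a) w)"
    using Cons.prems by (simp add: fbar_def min_def)
  moreover have "even (sdeg (take (Suc a) w) * oddity (map (mor_m f) ns))"
    using oddity_mor[of f ns] by simp
  ultimately show ?case using Cons by (simp add: sg_even del: even_mult_iff)
qed simp

lemma Hs_Bs:
  assumes "length w = csum ns"
  shows "Hs (fbar R A f) (fbar R A g) (hbar R A h) ns w =
    (\<Sum>i<length ns. Bs R A (map (mor_m g) (take i ns) @ [hty_m h (ns ! i)] @ map (mor_m f) (drop (i + 1) ns)) w)"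
  using assms
proof (induction ns arbitrary: w)
  case (Cons a ns)
  let ?u = "take (Suc a) w" and ?v = "drop (Suc a) w"
  have bar: "fbar R A g ?u = lbar R A (mor_m g a) ?u" "hbar R A h ?u = lbar R A (hty_m h a) ?u"
    using Cons.prems by (simp_all add: fbar_def hbar_def min_def)
  have even: "even (sdeg ?u * oddity (map (mor_m f) ns))"
    using oddity_mor[of f ns] by simp
  let ?us = "\<lambda>i. map (mor_m g) (take i ns) @ [hty_m h (ns ! i)] @ map (mor_m f) (drop (i + 1) ns)"
  \<comment> \<open>The list contains exactly one odd factor, the one from the homotopy, so moving
    it across the first block produces the sign in \<open>Hs\<close>.\<close>
  have odd: "even (sdeg ?u * oddity (?us i) + sdeg ?u)" for i
  proof -
    have "oddity (?us i) = 2 * (sum_list (take i ns) + ns ! i + sum_list (drop (i + 1) ns) +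
        length (take i ns) + length (drop (i + 1) ns) + 1) + 1"
      by (simp add: oddity_def csum_eq del: length_take length_drop)
    then show ?thesis by simp
  qed
  have len: "length ?v = csum ns" using Cons.prems by simp
  have v: "Hs (fbar R A f) (fbar R A g) (hbar R A h) ns ?v = (\<Sum>i<length ns. Bs R A (?us i) ?v)"
    by (rule Cons.IH[OF len])
  have step: "Bs R A (mor_m g a # ?us i) w = sg (sdeg ?u) (cat (lbar R A (mor_m g a) ?u) (Bs R A (?us i) ?v))" for i
    unfolding Bs.simps multi_map_fst by (rule sg_cong[OF odd])
  have first: "Bs R A (hty_m h a # map (mor_m f) ns) w = cat (lbar R A (hty_m h a) ?u) (Fs (fbar R A f) ns ?v)"
    unfolding Bs.simps multi_map_fst Fs_Bs[OF len] by (rule sg_even[OF even])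
  have "(\<Sum>i<length (a # ns). Bs R A (map (mor_m g) (take i (a # ns)) @ [hty_m h ((a # ns) ! i)]
      @ map (mor_m f) (drop (i + 1) (a # ns))) w)
    = Bs R A (hty_m h a # map (mor_m f) ns) w + (\<Sum>i<length ns. Bs R A (mor_m g a # ?us i) w)"
    unfolding list.size(4) add_0_right add_Suc_right by (subst sum.lessThan_Suc_shift) simp
  also have "\<dots> = Hs (fbar R A f) (fbar R A g) (hbar R A h) (a # ns) w"
    unfolding step first by (simp only: Hs.simps bar v cat_sum sg_sum)
  finally show ?case ..
qed simp

text \<open>Only one block is treated by the odd cochain; the other long block meets the identity
  cochain and is killed. This matches the vanishing of faces whose index is not a run of consecutive
  integers.\<close>

lemma Ds_zero:
  assumes "valid A w" "length w = csum ns" "nonzeros ns \<ge> 2"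
  shows "Ds A b ns w = 0"
  using assms
proof (induction ns arbitrary: w)
  case (Cons a ns)
  note l = length_Cons_csum[OF Cons.prems(2,1)]
  show ?case
  proof (cases "a = 0")
    case True
    then have "Fs (idc A) ns (drop (Suc a) w) = 0"
      using Cons.prems(3) Fs_idc[OF l(4,2)] nonzeros_eq_0_iff[of ns] by auto
    then show ?thesis using Cons.IH[OF l(4,2)] Cons.prems(3) True by simp
  next
    case False
    then have "Fs (idc A) ns (drop (Suc a) w) = 0"
      using Cons.prems(3) Fs_idc[OF l(4,2)] nonzeros_eq_0_iff[of ns] by auto
    moreover have "idc A (take (Suc a) w) = 0"
      using False Cons.prems(2) by (simp add: idc_def)
    ultimately show ?thesis by simp
  qed
qed simp

context graded_module
begin

lemma lbar_one: "x \<in> carrier (A p) \<Longrightarrow> lbar R A (one_m R A) [(p, x)] = frag_of [(p, x)]"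
  by (simp add: one_m_def unit_map_pure)

lemma Bs_one: "valid A w \<Longrightarrow> length w = c \<Longrightarrow> Bs R A (replicate c (one_m R A)) w = frag_of w"
proof (induction w arbitrary: c)
  case (Cons a w)
  obtain c' where c: "c = Suc c'" using Cons.prems by (cases c) auto
  have "even (sdeg [a] * oddity (replicate c' (one_m R A)))" by (simp add: oddity_def)
  then show ?case
    using Cons lbar_one[of "snd a" "fst a"] by (simp add: c sg_even del: lbar.simps even_mult_iff)
qed simp

end

text \<open>The odd cochain must hit the long block, since the identity would kill it. All factors
  are identities except one, so the sum in \<open>Hs\<close> has one summand.\<close>

lemma Ds_single:
  assumes A: "graded_module R (a_mod X)" and "valid (a_mod X) w" "length w = i + Suc k + c" "k \<noteq> 0"
  shows "Ds (a_mod X) (bbar R X) (single i k c) w =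
    Bs R (a_mod X) (replicate i (one_m R (a_mod X)) @ [op_m X (k - 1)] @ replicate c (one_m R (a_mod X))) w"
  using assms(2,3)
proof (induction i arbitrary: w)
  case 0
  interpret graded_module R "a_mod X" by (rule A)
  let ?A = "a_mod X"
  have v: "valid ?A (drop (Suc k) w)" "length (drop (Suc k) w) = c"
    using 0 by (simp_all add: valid_drop)
  have even: "even (sdeg (take (Suc k) w) * oddity (replicate c (one_m R ?A)))"
    by (simp add: oddity_def)
  have "Fs (idc ?A) (replicate c 0) (drop (Suc k) w) = frag_of (drop (Suc k) w)"
    using Fs_idc[OF v(1), of "replicate c 0"] v by (simp add: set_replicate_conv_if)
  moreover have "idc ?A (take (Suc k) w) = 0"
    using 0 assms(4) by (simp add: idc_def)
  moreover have "bbar R X (take (Suc k) w) = lbar R ?A (op_m X (k - 1)) (take (Suc k) w)"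
    using 0 assms(4) by (simp add: bbar_def)
  moreover have "Suc (Suc (k - 1)) = Suc k" using assms(4) by simp
  ultimately show ?case
    by (simp only: single_def replicate.simps append_Nil append_Cons Hs.simps Bs.simps multi_map_fst
        Bs_one[OF v] sg_even[OF even] cat_zero sg_0 add_0_right)
next
  case (Suc i)
  interpret graded_module R "a_mod X" by (rule A)
  let ?A = "a_mod X"
  obtain a v where w: "w = a # v" using Suc.prems by (cases w) auto
  have v: "valid ?A v" "length v = csum (single i k c)" using Suc.prems by (simp_all add: w)
  have s: "single (Suc i) k c = 0 # single i k c" by (simp add: single_def)
  have z: "Fs (idc ?A) (single i k c) v = 0"
    using Fs_idc[OF v] nonzeros_eq_0_iff[of "single i k c"] nonzeros_single[OF assms(4)] by auto
  have ida: "idc ?A [a] = frag_of [a]" using Suc.prems by (simp add: idc_def w)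
  have one: "lbar R ?A (one_m R ?A) [a] = frag_of [a]"
    using lbar_one[of "snd a" "fst a"] Suc.prems by (simp add: w)
  have odd: "even (sdeg [a] * oddity (replicate i (one_m R ?A) @ [op_m X (k - 1)] @ replicate c (one_m R ?A)) + sdeg [a])"
  proof -
    have "oddity (replicate i (one_m R ?A) @ [op_m X (k - 1)] @ replicate c (one_m R ?A)) =
        2 * (i + (k - 1) + c + 1) + 1"
      by (simp add: oddity_def)
    then show ?thesis by simp
  qed
  define us where "us = replicate i (one_m R ?A) @ [op_m X (k - 1)] @ replicate c (one_m R ?A)"
  have odd: "even (sdeg [a] * oddity us + sdeg [a])"
    using odd by (simp only: us_def)
  have "Ds ?A (bbar R X) (single (Suc i) k c) w = sg (sdeg [a]) (cat (frag_of [a]) (Bs R ?A us v))"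
    using Suc.IH[OF v(1)] v(2) by (simp add: w s z ida us_def del: sdeg_simps)
  also have "\<dots> = sg (sdeg [a] * oddity us) (cat (frag_of [a]) (Bs R ?A us v))"
    by (rule sg_cong[OF odd, symmetric])
  also have "\<dots> = Bs R ?A (one_m R ?A # us) w"
    using one by (simp add: w del: lbar.simps sdeg_simps)
  finally show ?case by (simp add: us_def)
qed

section \<open>The relations of \<open>A\<^sub>\<infinity>\<close>-algebras in the bar construction\<close>

lemma frag_zeroI: "(\<And>w. w \<notin> Poly_Mapping.keys p) \<Longrightarrow> p = (0 :: 'a frag)"
  by (metis keys_eq_empty equals0I)

lemma signed_cong: "even (k + k') \<Longrightarrow> signed M k x = signed M k' x"
  by (auto simp: signed_def)

lemma signed_signed:
  "module R M \<Longrightarrow> x \<in> carrier M \<Longrightarrow> signed M k (signed M k' x) = signed M (k + k') x"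
proof -
  assume "module R M" "x \<in> carrier M"
  then interpret module R M by simp
  show ?thesis using \<open>x \<in> carrier M\<close> by (auto simp: signed_def)
qed

lemma lin_maps_finsum_apply:
  assumes u: "u \<in> lin_maps R M N" and M: "module R M" and N: "module R N"
    and f: "\<And>i. i \<in> S \<Longrightarrow> f i \<in> carrier M"
  shows "u (\<Oplus>\<^bsub>M\<^esub>i\<in>S. f i) = (\<Oplus>\<^bsub>N\<^esub>i\<in>S. u (f i))"
proof -
  interpret M: module R M by (fact M)
  interpret N: module R N by (fact N)
  show ?thesis
    using f
  proof (induction S rule: infinite_finite_induct)
    case (insert i S)
    have "f i \<in> carrier M" "f \<in> S \<rightarrow> carrier M" using insert.prems by auto
    moreover have "u (f j) \<in> carrier N" if "j \<in> insert i S" for j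
      by (rule lin_maps_closed[OF u insert.prems[OF that]])
    ultimately show ?case
      using insert.hyps insert.IH insert.prems
      by (simp add: Pi_iff lin_maps_add[OF u])
  qed (simp_all add: lin_maps_zero[OF u M N])
qed

context graded_module
begin

lemma lt_signed':
  "x \<in> carrier (A e) \<Longrightarrow> even (k + int s) \<Longrightarrow> eqv A (lt e (signed (A e) k x)) (sg s (lt e x))"
  using lt_signed[of x e s] signed_cong[of k "int s" "A e" x] by simp

lemma lt_finsum2:
  assumes "\<And>i j. i \<in> I \<Longrightarrow> j \<in> J i \<Longrightarrow> f i j \<in> carrier (A e)"
    and "\<And>i j. i \<in> I \<Longrightarrow> j \<in> J i \<Longrightarrow> eqv A (lt e (f i j)) (g i j)"
  shows "eqv A (lt e (\<Oplus>\<^bsub>A e\<^esub>i\<in>I. \<Oplus>\<^bsub>A e\<^esub>j\<in>J i. f i j)) (\<Sum>i\<in>I. \<Sum>j\<in>J i. g i j)"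
    and "(\<Oplus>\<^bsub>A e\<^esub>i\<in>I. \<Oplus>\<^bsub>A e\<^esub>j\<in>J i. f i j) \<in> carrier (A e)"
proof -
  interpret module R "A e" by (rule module)
  have cl: "(\<Oplus>\<^bsub>A e\<^esub>j\<in>J i. f i j) \<in> carrier (A e)" if "i \<in> I" for i
    using assms(1)[OF that] by (intro M.finsum_closed) auto
  have "eqv A (lt e (\<Oplus>\<^bsub>A e\<^esub>i\<in>I. \<Oplus>\<^bsub>A e\<^esub>j\<in>J i. f i j)) (\<Sum>i\<in>I. lt e (\<Oplus>\<^bsub>A e\<^esub>j\<in>J i. f i j))"
    by (rule lt_finsum) (rule cl)
  also have "eqv A \<dots> (\<Sum>i\<in>I. \<Sum>j\<in>J i. g i j)"
  proof (rule eqv_sum)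
    fix i assume i: "i \<in> I"
    have "eqv A (lt e (\<Oplus>\<^bsub>A e\<^esub>j\<in>J i. f i j)) (\<Sum>j\<in>J i. lt e (f i j))"
      by (rule lt_finsum) (rule assms(1)[OF i])
    also have "eqv A \<dots> (\<Sum>j\<in>J i. g i j)"
      by (rule eqv_sum) (rule assms(2)[OF i])
    finally show "eqv A (lt e (\<Oplus>\<^bsub>A e\<^esub>j\<in>J i. f i j)) (\<Sum>j\<in>J i. g i j)" .
  qed
  finally show "eqv A (lt e (\<Oplus>\<^bsub>A e\<^esub>i\<in>I. \<Oplus>\<^bsub>A e\<^esub>j\<in>J i. f i j)) (\<Sum>i\<in>I. \<Sum>j\<in>J i. g i j)" .
  show "(\<Oplus>\<^bsub>A e\<^esub>i\<in>I. \<Oplus>\<^bsub>A e\<^esub>j\<in>J i. f i j) \<in> carrier (A e)"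
    using cl by (intro M.finsum_closed) auto
qed

end

lemma (in graded_modules) lbar_keys:
  assumes "multi_lin (n, e, \<phi>)" "w \<in> Poly_Mapping.keys (lbar R A (n, e, \<phi>) u)"
  shows "valid B w \<and> length w = 1 \<and> wdeg w = wdeg u + e \<and> length u = n"
proof -
  have u: "u \<in> words A n (wdeg u)" and w: "w = [(wdeg u + e, \<phi> (wdeg u) (A.pure u))]"
    using assms(2) by (auto simp: words_iff split: if_splits)
  have "\<phi> (wdeg u) \<in> lin_maps R (A.T n (wdeg u)) (B (wdeg u + e))"
    using assms(1) by (simp add: multi_lin_def)
  then show ?thesis
    using lin_maps_closed A.pure_closed[OF u] u by (fastforce simp: w words_iff)
qed

lemma (in graded_modules) fbar_homog:
  assumes "\<And>n. multi_lin (mor_m f n)"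
  shows "homog B 0 0 (fbar R A f)"
  unfolding homog_def
proof (intro conjI allI ballI)
  fix u w assume w: "w \<in> Poly_Mapping.keys (fbar R A f u)"
  note k = lbar_keys[OF assms[unfolded mor_m_def] w[unfolded fbar_def mor_m_def]]
  from k show "valid B w" "length w = 1" by simp_all
  from k show "sdeg w + 0 = sdeg u + 0" by (cases "length u") (auto simp: sdeg_def)
qed (simp add: fbar_def mor_m_def)

lemma (in graded_modules) hbar_homog:
  assumes "\<And>n. multi_lin (hty_m h n)"
  shows "homog B 0 1 (hbar R A h)"
  unfolding homog_def
proof (intro conjI allI ballI)
  fix u w assume w: "w \<in> Poly_Mapping.keys (hbar R A h u)"
  note k = lbar_keys[OF assms[unfolded hty_m_def] w[unfolded hbar_def hty_m_def]]
  from k show "valid B w" "length w = 1" by simp_all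
  from k show "sdeg w + 0 = sdeg u + 1" by (cases "length u") (auto simp: sdeg_def)
qed (simp add: hbar_def hty_m_def)

lemma (in graded_modules) lbar_add:
  assumes m: "multi_lin (n, e, \<phi>)" and xy: "x \<in> carrier (A d)" "y \<in> carrier (A d)"
  shows "eqv B (lbar R A (n, e, \<phi>) (u @ (d, x \<oplus>\<^bsub>A d\<^esub> y) # v))
    (lbar R A (n, e, \<phi>) (u @ (d, x) # v) + lbar R A (n, e, \<phi>) (u @ (d, y) # v))"
proof (cases "valid A u \<and> valid A v \<and> length u + length v + 1 = n")
  case False
  then have "lbar R A (n, e, \<phi>) (u @ (d, z) # v) = 0" for z by auto
  then show ?thesis by simp
next
  case True
  let ?W = "\<lambda>z. u @ (d, z) # v"
  let ?q = "wdeg (?W x)"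
  have th: "theta (?W z) = theta (?W x)" for z by (rule theta_cong) simp
  have z: "x \<oplus>\<^bsub>A d\<^esub> y \<in> carrier (A d)" by (rule A.letter_closed(1)[OF xy])
  have w: "?W z \<in> words A n ?q" if "z \<in> carrier (A d)" for z
    using True that by (simp add: words_iff)
  have \<phi>: "\<phi> ?q \<in> lin_maps R (A.T n ?q) (B (?q + e))"
    using m by (simp add: multi_lin_def)
  have F: "lbar R A (n, e, \<phi>) (?W z) = sg (theta (?W x)) (lt (?q + e) (\<phi> ?q (A.pure (?W z))))"
    if "z \<in> carrier (A d)" for z
    using True that by (simp add: th[of z])
  have "eqv B (lt (?q + e) (\<phi> ?q (A.pure (?W (x \<oplus>\<^bsub>A d\<^esub> y)))))
    (lt (?q + e) (\<phi> ?q (A.pure (?W x))) + lt (?q + e) (\<phi> ?q (A.pure (?W y))))"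
    unfolding A.multilinear_add[OF A.pure_multilinear A.T_module w[OF xy(1)] xy(2)]
      lin_maps_add[OF \<phi> A.pure_closed[OF w[OF xy(1)]] A.pure_closed[OF w[OF xy(2)]]]
    by (intro B.lt_add lin_maps_closed[OF \<phi>] A.pure_closed w xy)
  then show ?thesis
    unfolding F[OF xy(1)] F[OF xy(2)] F[OF z] sg_add[symmetric] by (rule eqv_sg)
qed

text \<open>It suffices to look at the generators of \<open>null\<close>, since closure under
  differences is inherited from additivity of the extension.\<close>

lemma descendsI:
  assumes "\<And>u v d x y. x \<in> carrier (A d) \<Longrightarrow> y \<in> carrier (A d) \<Longrightarrow>
      eqv B (F (u @ (d, x \<oplus>\<^bsub>A d\<^esub> y) # v)) (F (u @ (d, x) # v) + F (u @ (d, y) # v))"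
    and "\<And>w. \<not> valid A w \<Longrightarrow> F w = 0"
  shows "descends A B F"
  unfolding descends_def
proof
  fix p assume "p \<in> null A"
  then show "frag_extend F p \<in> null B"
  proof (induction p rule: null.induct)
    case (add x d y u v)
    then show ?case
      using assms(1)[of x d y u v]
      unfolding eqv_def diff_diff_eq[symmetric] by (simp only: frag_extend_diff frag_extend_of)
  qed (simp_all add: frag_extend_diff assms(2) null.intros)
qed

lemma (in graded_modules) fbar_descends:
  assumes f: "\<And>n. multi_lin (mor_m f n)"
  shows "descends A B (fbar R A f)"
proof (rule descendsI)
  show "eqv B (fbar R A f (u @ (d, x \<oplus>\<^bsub>A d\<^esub> y) # v)) (fbar R A f (u @ (d, x) # v) + fbar R A f (u @ (d, y) # v))"
    if "x \<in> carrier (A d)" "y \<in> carrier (A d)" for u v d x y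
    using lbar_add[OF f[of "length u + length v", unfolded mor_m_def] that]
    by (simp add: fbar_def mor_m_def del: lbar.simps)
qed (simp add: fbar_def mor_m_def)

text \<open>Every summand on the right of the relations for algebras, morphisms and homotopies, and
  of the composition formula, has this form: one map after a tensor product of maps. The shift costs
  the single sign \<open>kexp\<close>.\<close>

lemma term_eqv:
  assumes AB: "graded_modules R A B" and BC: "graded_modules R B C"
    and us: "\<forall>m\<in>set us. graded_modules.multi_lin R A B m"
    and v: "graded_modules.multi_lin R B C (length us, e, \<phi>)"
    and u: "u \<in> words A n q" "n = arity us" and q': "q' = q + degree us" and E: "E = q' + e"
  shows "\<phi> q' (tensor_maps R A B us q (graded_module.ev R A n q (frag_of u))) \<in> carrier (C E)"
    and "eqv C (lt E (\<phi> q' (tensor_maps R A B us q (graded_module.ev R A n q (frag_of u)))))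
      (sg (kexp us) (frag_extend (lbar R B (length us, e, \<phi>)) (Bs R A us u)))"
proof -
  interpret AB: graded_modules R A B by (rule AB)
  interpret BC: graded_modules R B C by (rule BC)
  have \<phi>: "\<phi> q' \<in> lin_maps R (AB.B.T (length us) q') (C E)"
    using v by (simp add: BC.multi_lin_def E)
  have keys: "Poly_Mapping.keys (Bs R A us u) \<subseteq> words B (length us) q'"
    using Bs_apply[of A u us R] AB.apply_maps_words[OF us] u q' by (simp add: words_iff)
  have x: "tensor_maps R A B us q (AB.A.ev n q (frag_of u)) \<in> carrier (AB.B.T (length us) q')"
    by (rule lin_maps_closed[OF AB.tensor_maps_lin[OF us u(2) refl q'] AB.A.ev_closed])
  then show "\<phi> q' (tensor_maps R A B us q (AB.A.ev n q (frag_of u))) \<in> carrier (C E)"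
    by (rule lin_maps_closed[OF \<phi>])
  have "\<phi> q' (tensor_maps R A B us q (AB.A.ev n q (frag_of u))) =
      signed (C E) (int (kexp us)) (\<phi> q' (AB.B.ev (length us) q' (Bs R A us u)))"
    by (simp add: AB.tensor_maps_ev[OF us u q' refl] lin_maps_signed[OF \<phi> AB.B.T_module BC.B.module]
        AB.B.ev_closed)
  then have "eqv C (lt E (\<phi> q' (tensor_maps R A B us q (AB.A.ev n q (frag_of u)))))
      (sg (kexp us) (lt E (\<phi> q' (AB.B.ev (length us) q' (Bs R A us u)))))"
    using BC.B.lt_signed[OF lin_maps_closed[OF \<phi> AB.B.ev_closed]] by simp
  also have "eqv C \<dots> (sg (kexp us) (frag_extend (lbar R B (length us, e, \<phi>)) (Bs R A us u)))"
    using BC.lin_lbar[OF v keys] by (simp add: E eqv_sg)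
  finally show "eqv C (lt E (\<phi> q' (tensor_maps R A B us q (AB.A.ev n q (frag_of u)))))
      (sg (kexp us) (frag_extend (lbar R B (length us, e, \<phi>)) (Bs R A us u)))" .
qed

section \<open>The structure cochain of an algebra\<close>

locale ainf_alg =
  fixes R (structure) and A :: "('k, 'a) ainf"
  assumes cring: "cring R" and ainf: "is_ainf R A"
begin

sublocale dg_module R "a_mod A" "a_diff A"
  using cring ainf
  by (intro dg_module.intro graded_module.intro dg_module_axioms.intro)
    (auto simp: is_ainf_def diff_module_def)

sublocale self: graded_modules R "a_mod A" "a_mod A"
  by unfold_locales

lemma op_lin: "self.multi_lin (op_m A n)"
  using ainf by (simp add: self.multi_lin_def op_m_def is_ainf_def)

lemma one_lin: "self.multi_lin (one_m R (a_mod A))"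
  using unit_map_lin by (simp add: self.multi_lin_def one_m_def)

abbreviation "b \<equiv> bbar R A"
abbreviation "D \<equiv> Ds (a_mod A) b"

lemma bbar_homog: "homog (a_mod A) 1 0 b"
  unfolding homog_def
proof (intro conjI allI ballI)
  fix u w assume w: "w \<in> Poly_Mapping.keys (b u)"
  have "valid (a_mod A) w \<and> length w = 1 \<and> sdeg w + 1 = sdeg u + 0"
  proof (cases "length u = 1")
    case True
    then obtain p x where u: "u = [(p, x)]" by (auto simp: length_Suc_conv)
    have w': "w = [(p - 1, a_diff A p x)]" and p: "x \<in> carrier (a_mod A p)" "0 < p"
      using w by (auto simp: bbar_def u split: if_splits)
    show ?thesis
      using lin_maps_closed[OF d_lin p(1)] p(2) by (simp add: w' u)
  next
    case False
    then have "w \<in> Poly_Mapping.keys (lbar R (a_mod A) (op_m A (length u - 2)) u)"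
      using w by (simp add: bbar_def)
    note k = self.lbar_keys[OF op_lin[unfolded op_m_def] this[unfolded op_m_def]]
    then obtain l where "length u = Suc (Suc l)" by (metis add_2_eq_Suc' )
    then show ?thesis using k by (simp add: sdeg_def)
  qed
  then show "valid (a_mod A) w" "length w = 1" "sdeg w + 1 = sdeg u + 0" by simp_all
qed (simp add: bbar_def op_m_def)

text \<open>Equality holds only modulo \<open>null\<close>: in degree 0 one side is the letter zero
  and the other the empty formal sum.\<close>

lemma bbar_letter:
  assumes "x \<in> carrier (a_mod A p)"
  shows "eqv (a_mod A) (lt (p - 1) (a_diff A p x)) (b [(p, x)])"
proof (cases "p = 0")
  case True
  then have "a_diff A p x = \<zero>\<^bsub>a_mod A p\<^esub>"
    using diff_module assms by (auto simp: diff_module_def)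
  then show ?thesis using lt_zero True by (simp add: bbar_def)
qed (use assms in \<open>simp add: bbar_def\<close>)

lemma bbar_descends: "descends (a_mod A) (a_mod A) b"
proof (rule descendsI)
  fix u v d x y assume xy: "x \<in> carrier (a_mod A d)" "y \<in> carrier (a_mod A d)"
  show "eqv (a_mod A) (b (u @ (d, x \<oplus>\<^bsub>a_mod A d\<^esub> y) # v)) (b (u @ (d, x) # v) + b (u @ (d, y) # v))"
  proof (cases "u = [] \<and> v = []")
    case True
    have "eqv (a_mod A) (b [(d, x \<oplus>\<^bsub>a_mod A d\<^esub> y)]) (lt (d - 1) (a_diff A d (x \<oplus>\<^bsub>a_mod A d\<^esub> y)))"
      by (intro eqv_sym[OF bbar_letter] letter_closed xy)
    also have "eqv (a_mod A) \<dots> (lt (d - 1) (a_diff A d x) + lt (d - 1) (a_diff A d y))"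
      unfolding lin_maps_add[OF d_lin xy] by (intro lt_add lin_maps_closed[OF d_lin] xy)
    also have "eqv (a_mod A) \<dots> (b [(d, x)] + b [(d, y)])"
      by (intro eqv_add bbar_letter xy)
    finally show ?thesis by (simp add: True)
  next
    case False
    then have "length (u @ (d, z) # v) \<noteq> 1" for z by (cases u) auto
    moreover have "length (u @ (d, z) # v) - 2 = length u + length v - 1" for z by simp
    ultimately have bz: "b (u @ (d, z) # v) =
        lbar R (a_mod A) (op_m A (length u + length v - 1)) (u @ (d, z) # v)" for z
      by (simp only: bbar_def if_False)
    show ?thesis
      unfolding bz op_m_def by (rule self.lbar_add[OF op_lin[unfolded op_m_def] xy])
  qed
qed (simp add: bbar_def op_m_def)

lemma Ds_zeros:
  assumes "valid (a_mod A) w"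
  shows "D (replicate (length w) 0) w = (\<Sum>i<length w. sg (sdeg (take i w))
    (if 0 < fst (w ! i) then frag_of (w[i := (fst (w ! i) - 1, a_diff A (fst (w ! i)) (snd (w ! i)))]) else 0))"
  using assms
proof (induction w)
  case (Cons a w)
  have v: "valid (a_mod A) w" using Cons.prems by simp
  have id: "Fs (idc (a_mod A)) (replicate (length w) 0) w = frag_of w"
    using Fs_idc[OF v, of "replicate (length w) 0"] by (simp add: set_replicate_conv_if)
  have ida: "idc (a_mod A) [a] = frag_of [a]" using Cons.prems by (simp add: idc_def)
  have ba: "b [a] = (if 0 < fst a then frag_of [(fst a - 1, a_diff A (fst a) (snd a))] else 0)"
    using Cons.prems by (simp add: bbar_def)
  have "D (replicate (length (a # w)) 0) (a # w) = cat (b [a]) (frag_of w) +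
      sg (sdeg [a]) (cat (frag_of [a]) (D (replicate (length w) 0) w))"
    by (simp add: id ida)
  also have "cat (b [a]) (frag_of w) = (if 0 < fst a then frag_of ((fst a - 1, a_diff A (fst a) (snd a)) # w) else 0)"
    by (simp add: ba)
  finally show ?case
    unfolding list.size(4) add_0_right add_Suc_right
    by (subst sum.lessThan_Suc_shift)
      (auto simp: Cons.IH[OF v] cat_sum sg_sum sg_sg cat_sg intro!: arg_cong2[where f = "(+)"] sum.cong)
qed simp

lemma D_keys: "w \<in> Poly_Mapping.keys (D ns u) \<Longrightarrow> length u = csum ns \<Longrightarrow>
    valid (a_mod A) w \<and> length w = length ns \<and> sdeg w + 1 = sdeg u"
  using Hs_homog[OF idc_homog idc_homog bbar_homog] by fastforce

lemma D_words:
  assumes "u \<in> words (a_mod A) n q" "n = csum ns" "q + n = q' + length ns + 1"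
  shows "Poly_Mapping.keys (D ns u) \<subseteq> words (a_mod A) (length ns) q'"
  using D_keys[of _ ns u] assms by (force simp: words_iff sdeg_def)

lemma D_zeros_0: "u \<in> words (a_mod A) n 0 \<Longrightarrow> D (replicate n 0) u = 0"
  using D_keys[of _ "replicate n 0" u] by (intro frag_zeroI) (fastforce simp: words_iff sdeg_def)

text \<open>Lowering the degree of letter i by one removes one unit for each letter to its
  right.\<close>

lemma theta_update:
  assumes "i < length w" "0 < fst (w ! i)"
  shows "theta w = theta (w[i := (fst (w ! i) - 1, y)]) + (length w - 1 - i)"
  using assms
proof (induction w arbitrary: i)
  case (Cons a w)
  show ?case
  proof (cases i)
    case 0
    then obtain p where "fst a = Suc p" using Cons.prems by (cases "fst a") auto
    then show ?thesis by (simp add: 0)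
  next
    case (Suc j)
    then show ?thesis using Cons.IH[of j] Cons.prems by simp
  qed
qed simp

text \<open>The Koszul signs of d with and without shift differ by i at letter i, and
  \<open>theta\<close> changes by n - 1 - i. The sum n - 1 is independent of i, so one global sign
  remains.\<close>

lemma tensor_diff_ev:
  assumes w: "w \<in> words (a_mod A) n q"
  shows "dT n q (ev n q (frag_of w)) =
    signed (T n (q - 1)) (int (n + 1)) (ev n (q - 1) (D (replicate n 0) w))"
proof -
  interpret M: module R "T n (q - 1)" by (rule T_module)
  have v: "valid (a_mod A) w" and len: "length w = n" using w by (auto simp: words_iff)
  let ?w = "\<lambda>i. w[i := (fst (w ! i) - 1, a_diff A (fst (w ! i)) (snd (w ! i)))]"
  let ?S = "{i. i < n \<and> 0 < fst (w ! i)}"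
  have "ev n (q - 1) (D (replicate n 0) w) = (\<Oplus>\<^bsub>T n (q - 1)\<^esub>i\<in>{..<n}.
      ev n (q - 1) (sg (sdeg (take i w)) (if 0 < fst (w ! i) then frag_of (?w i) else 0)))"
    using Ds_zeros[OF v] by (simp add: len ev_sum)
  also have "\<dots> = (\<Oplus>\<^bsub>T n (q - 1)\<^esub>i\<in>?S. ev n (q - 1) (sg (sdeg (take i w)) (frag_of (?w i))))"
    by (rule M.M.add.finprod_mono_neutral_cong_right) (auto simp: ev_zero ev_closed)
  also have "\<dots> = (\<Oplus>\<^bsub>T n (q - 1)\<^esub>i\<in>?S. signed (T n (q - 1)) (int (n + 1 + theta w)) (dterm n q i w))"
  proof (rule M.M.finsum_cong')
    fix i assume i: "i \<in> ?S"
    have w': "?w i \<in> words (a_mod A) n (q - 1)" using dterm_word[OF w] i by simp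
    have "i < length w" "0 < fst (w ! i)" using i len by auto
    from theta_update[OF this, of "a_diff A (fst (w ! i)) (snd (w ! i))"] this(1)
    have th: "theta w + i + 1 = theta (?w i) + n" by (simp add: len)
    have sd: "sdeg (take i w) = wdeg (take i w) + i" using i len by (simp add: sdeg_def)
    have "sdeg (take i w) + theta (?w i) + (n + 1 + theta w + wdeg (take i w)) =
        2 * (wdeg (take i w) + i + theta w + 1)"
      using th unfolding sd by simp
    then have "even (int (sdeg (take i w)) + int (theta (?w i)) + (int (n + 1 + theta w) + int (wdeg (take i w))))"
      by (metis dvd_triv_left even_of_nat of_nat_add)
    then show "ev n (q - 1) (sg (sdeg (take i w)) (frag_of (?w i))) =
        signed (T n (q - 1)) (int (n + 1 + theta w)) (dterm n q i w)"
      unfolding ev_sg ev_of ev_word_def dterm_def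
      by (simp only: w' if_True signed_signed[OF T_module pure_closed[OF w']] signed_cong)
  qed (auto intro!: signed_closed[OF T_module] dterm_closed[OF w] simp del: One_nat_def)
  also have "\<dots> = signed (T n (q - 1)) (int (n + 1 + theta w)) (dword n q w)"
    by (rule lin_maps_finsum_apply[OF lin_maps_signed_fun[OF T_module lin_maps_id] T_module T_module, symmetric])
      (use dterm_closed[OF w] in auto)
  finally have "signed (T n (q - 1)) (int (n + 1)) (ev n (q - 1) (D (replicate n 0) w)) =
      signed (T n (q - 1)) (int (n + 1) + int (n + 1 + theta w)) (dword n q w)"
    by (simp only: signed_signed[OF T_module multilinear_closed[OF dword_multilinear w]])
  also have "\<dots> = signed (T n (q - 1)) (int (theta w)) (dword n q w)"
    by (rule signed_cong) simp
  finally have "signed (T n (q - 1)) (int (n + 1)) (ev n (q - 1) (D (replicate n 0) w)) =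
      signed (T n (q - 1)) (int (theta w)) (dword n q w)" .
  moreover have "dT n q (ev n q (frag_of w)) = signed (T n (q - 1)) (int (theta w)) (dword n q w)"
    by (simp add: ev_of ev_word_def w lin_maps_signed[OF tensor_diff_lin T_module T_module pure_closed[OF w]]
        tensor_diff_pure[OF w] del: One_nat_def)
  ultimately show ?thesis by simp
qed

end

section \<open>Translating single terms of the defining relations\<close>

locale ainf_pair = A: ainf_alg R A + B: ainf_alg R B
  for R (structure) and A :: "('k, 'a) ainf" and B :: "('k, 'b) ainf"
begin

sublocale graded_modules R "a_mod A" "a_mod B"
  by unfold_locales

lemma graded: "graded_modules R (a_mod A) (a_mod B)"
  by (rule graded_modules_axioms)

text \<open>The first summand is the structure cochain on the letter produced by \<phi>. In the
  second, the exponent s comes from \<open>hom_diff\<close> and n + 1 from the tensor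
  differential.\<close>

lemma hom_diff_eqv:
  assumes m: "multi_lin (n, e, \<phi>)" and u: "u \<in> words (a_mod A) n q" and E: "E = q + e - 1"
  shows "hom_diff (a_mod B E) (int s) (a_diff B (q + e)) \<phi> (A.dT n) q (A.ev n q (frag_of u)) \<in> carrier (a_mod B E)"
    and "eqv (a_mod B)
      (lt E (hom_diff (a_mod B E) (int s) (a_diff B (q + e)) \<phi> (A.dT n) q (A.ev n q (frag_of u))))
      (frag_extend B.b (lbar R (a_mod A) (n, e, \<phi>) u)
        - sg (s + n + 1) (frag_extend (lbar R (a_mod A) (n, e, \<phi>)) (A.D (replicate n 0) u)))"
proof -
  let ?x = "A.ev n q (frag_of u)" and ?M = "a_mod B E"
  interpret M: module R ?M by (rule B.module)
  have len: "length u = n" and v: "valid (a_mod A) u" and wd: "wdeg u = q" using u by (auto simp: words_iff)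
  have \<phi>: "\<phi> q \<in> lin_maps R (A.T n q) (a_mod B (q + e))" for q
    using m by (simp add: multi_lin_def)
  have d: "a_diff B (q + e) \<in> lin_maps R (a_mod B (q + e)) ?M"
    unfolding E by (rule B.d_lin)
  have d\<phi>: "(\<lambda>x. a_diff B (q + e) (\<phi> q x)) \<in> lin_maps R (A.T n q) ?M"
    by (rule lin_maps_compose[OF d \<phi>])
  have cl1: "a_diff B (q + e) (\<phi> q ?x) \<in> carrier ?M"
    by (rule lin_maps_closed[OF d\<phi> A.ev_closed])
  have "eqv (a_mod B) (lt E (a_diff B (q + e) (\<phi> q ?x)))
      (frag_extend (\<lambda>w. sg (theta w) (lt E (a_diff B (q + e) (\<phi> q (A.pure w))))) (frag_of u))"
    by (rule lin_lt[OF d\<phi>]) (simp add: u)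
  also have "\<dots> = sg (theta u) (lt E (a_diff B (q + e) (\<phi> q (A.pure u))))" by simp
  also have "eqv (a_mod B) \<dots> (sg (theta u) (B.b [(q + e, \<phi> q (A.pure u))]))"
    unfolding E by (intro eqv_sg B.bbar_letter lin_maps_closed[OF \<phi> A.pure_closed[OF u]])
  also have "\<dots> = frag_extend B.b (lbar R (a_mod A) (n, e, \<phi>) u)"
    by (simp add: v len wd frag_extend_sg)
  finally have 1: "eqv (a_mod B) (lt E (a_diff B (q + e) (\<phi> q ?x)))
      (frag_extend B.b (lbar R (a_mod A) (n, e, \<phi>) u))" .
  have both: "hom_diff ?M (int s) (a_diff B (q + e)) \<phi> (A.dT n) q ?x \<in> carrier ?M \<and> eqv (a_mod B)
      (lt E (hom_diff ?M (int s) (a_diff B (q + e)) \<phi> (A.dT n) q ?x))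
      (frag_extend B.b (lbar R (a_mod A) (n, e, \<phi>) u)
        - sg (s + n + 1) (frag_extend (lbar R (a_mod A) (n, e, \<phi>)) (A.D (replicate n 0) u)))"
  \<comment> \<open>In degree 0 \<open>hom_diff\<close> omits its second summand, and the formal
    differential of a word of degree 0 is 0, so both sides lose the same term.\<close>
  proof (cases "q = 0")
    case True
    then show ?thesis
      using 1 cl1 u A.D_zeros_0[of u n] by (simp add: hom_diff_def)
  next
    case False
    then have E': "E = q - 1 + e" by (simp add: E)
    have \<phi>': "\<phi> (q - 1) \<in> lin_maps R (A.T n (q - 1)) ?M"
      unfolding E' by (rule \<phi>)
    let ?y = "A.ev n (q - 1) (A.D (replicate n 0) u)"
    have cl2: "\<phi> (q - 1) ?y \<in> carrier ?M"
      by (rule lin_maps_closed[OF \<phi>' A.ev_closed])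
    have "signed ?M (int s) (\<phi> (q - 1) (A.dT n q ?x)) = signed ?M (int s + int (n + 1)) (\<phi> (q - 1) ?y)"
      unfolding A.tensor_diff_ev[OF u] lin_maps_signed[OF \<phi>' A.T_module B.module A.ev_closed]
      by (rule signed_signed[OF B.module cl2])
    then have h: "hom_diff ?M (int s) (a_diff B (q + e)) \<phi> (A.dT n) q ?x =
        a_diff B (q + e) (\<phi> q ?x) \<ominus>\<^bsub>?M\<^esub> signed ?M (int s + int (n + 1)) (\<phi> (q - 1) ?y)"
      using False by (simp add: hom_diff_def)
    have keys: "Poly_Mapping.keys (A.D (replicate n 0) u) \<subseteq> words (a_mod A) n (q - 1)"
      using A.D_words[OF u, of "replicate n 0" "q - 1"] False by simp
    have "eqv (a_mod B) (lt E (signed ?M (int s + int (n + 1)) (\<phi> (q - 1) ?y)))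
        (sg (s + n + 1) (lt E (\<phi> (q - 1) ?y)))"
      by (rule B.lt_signed'[OF cl2]) simp
    also have "eqv (a_mod B) \<dots> (sg (s + n + 1) (frag_extend (lbar R (a_mod A) (n, e, \<phi>)) (A.D (replicate n 0) u)))"
      unfolding E' by (intro eqv_sg lin_lbar[OF m keys])
    finally have 2: "eqv (a_mod B) (lt E (signed ?M (int s + int (n + 1)) (\<phi> (q - 1) ?y)))
        (sg (s + n + 1) (frag_extend (lbar R (a_mod A) (n, e, \<phi>)) (A.D (replicate n 0) u)))" .
    have cl3: "signed ?M (int s + int (n + 1)) (\<phi> (q - 1) ?y) \<in> carrier ?M"
      by (rule signed_closed[OF B.module cl2])
    have "eqv (a_mod B) (lt E (hom_diff ?M (int s) (a_diff B (q + e)) \<phi> (A.dT n) q ?x))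
        (lt E (a_diff B (q + e) (\<phi> q ?x)) - lt E (signed ?M (int s + int (n + 1)) (\<phi> (q - 1) ?y)))"
      unfolding h by (rule B.lt_diff[OF cl1 cl3])
    also have "eqv (a_mod B) \<dots> (frag_extend B.b (lbar R (a_mod A) (n, e, \<phi>) u)
        - sg (s + n + 1) (frag_extend (lbar R (a_mod A) (n, e, \<phi>)) (A.D (replicate n 0) u)))"
      by (intro eqv_diff 1 2)
    finally show ?thesis using cl1 cl3 h M.M.minus_closed by simp
  qed
  from both show "hom_diff ?M (int s) (a_diff B (q + e)) \<phi> (A.dT n) q ?x \<in> carrier ?M" ..
  from both show "eqv (a_mod B)
      (lt E (hom_diff ?M (int s) (a_diff B (q + e)) \<phi> (A.dT n) q ?x))
      (frag_extend B.b (lbar R (a_mod A) (n, e, \<phi>) u)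
        - sg (s + n + 1) (frag_extend (lbar R (a_mod A) (n, e, \<phi>)) (A.D (replicate n 0) u)))" ..
qed

text \<open>The parity hypothesis asks that the exponent k of the relation, corrected by
  \<open>kexp_op\<close>, leaves the exponent s. It is instantiated with s = 1 for algebras and
  homotopies and with s = 0 for morphisms.\<close>

lemma inner_term:
  assumes m: "multi_lin (r, e, \<phi>)" and u: "u \<in> words (a_mod A) (l + r) q"
    and t: "1 \<le> t" "t \<le> r" and l: "1 \<le> l" and E: "E = q + (l - 1) + e"
    and s: "even (k + int (s + (t - 1) * (l - 1) + (r - t)))"
  shows "signed (a_mod B E) k (\<phi> (q + (l - 1)) (tensor_maps R (a_mod A) (a_mod A)
        (replicate (t - 1) (one_m R (a_mod A)) @ [op_m A (l - 1)] @ replicate (r - t) (one_m R (a_mod A)))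
        q (A.ev (l + r) q (frag_of u)))) \<in> carrier (a_mod B E)" (is "signed _ _ ?y \<in> _")
    and "eqv (a_mod B) (lt E (signed (a_mod B E) k (\<phi> (q + (l - 1)) (tensor_maps R (a_mod A) (a_mod A)
        (replicate (t - 1) (one_m R (a_mod A)) @ [op_m A (l - 1)] @ replicate (r - t) (one_m R (a_mod A)))
        q (A.ev (l + r) q (frag_of u))))))
      (sg s (frag_extend (lbar R (a_mod A) (r, e, \<phi>)) (A.D (single (t - 1) l (r - t)) u)))"
proof -
  define us where "us = replicate (t - 1) (one_m R (a_mod A)) @ [op_m A (l - 1)] @ replicate (r - t) (one_m R (a_mod A))"
  have lin: "\<forall>m\<in>set us. A.self.multi_lin m"
    using A.one_lin A.op_lin by (auto simp: us_def)
  have len: "length us = r" and ar: "l + r = arity us" and deg: "q + (l - 1) = q + degree us"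
    using t l by (auto simp: us_def)
  have m': "multi_lin (length us, e, \<phi>)" using m by (simp add: len)
  have A: "graded_module R (a_mod A)" by unfold_locales
  have Bs: "Bs R (a_mod A) us u = A.D (single (t - 1) l (r - t)) u"
    unfolding us_def by (rule Ds_single[symmetric, OF A]) (use u t l in \<open>auto simp: words_iff\<close>)
  note te = term_eqv[OF A.self.graded_modules_axioms graded lin m' u ar deg E]
  have y: "?y \<in> carrier (a_mod B E)"
    using te(1) by (simp add: us_def)
  then show "signed (a_mod B E) k ?y \<in> carrier (a_mod B E)"
    by (rule signed_closed[OF B.module])
  have "even (kexp us + (t - 1) * (l - 1) + (r - t))"
    unfolding us_def by (rule kexp_op) (use l in simp)
  then have "even (int (kexp us) + int ((t - 1) * (l - 1) + (r - t)))"
    by (metis add.assoc even_of_nat of_nat_add)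
  then have par: "even (k + int (s + kexp us))"
    using s by (simp only: of_nat_add) presburger
  have "eqv (a_mod B) (lt E (signed (a_mod B E) k ?y)) (sg (s + kexp us) (lt E ?y))"
    by (rule B.lt_signed'[OF y par])
  also have "eqv (a_mod B) \<dots> (sg (s + kexp us) (sg (kexp us) (frag_extend (lbar R (a_mod A) (r, e, \<phi>)) (Bs R (a_mod A) us u))))"
    using te(2)[unfolded len] unfolding us_def by (rule eqv_sg)
  also have "\<dots> = sg s (frag_extend (lbar R (a_mod A) (r, e, \<phi>)) (A.D (single (t - 1) l (r - t)) u))"
    unfolding sg_sg Bs by (rule sg_cong) presburger
  finally show "eqv (a_mod B) (lt E (signed (a_mod B E) k ?y))
      (sg s (frag_extend (lbar R (a_mod A) (r, e, \<phi>)) (A.D (single (t - 1) l (r - t)) u)))" .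
qed

end

text \<open>On words of one fixed length the merged cochain is a single component.\<close>

lemma extend_fbar:
  assumes "\<And>w. w \<in> Poly_Mapping.keys p \<Longrightarrow> length w = Suc m"
  shows "frag_extend (lbar R A (m + 1, m, f m)) p = frag_extend (fbar R A f) p"
  by (rule frag_extend_eq) (use assms in \<open>auto simp: fbar_def mor_m_def\<close>)

lemma extend_hbar:
  assumes "\<And>w. w \<in> Poly_Mapping.keys p \<Longrightarrow> length w = Suc m"
  shows "frag_extend (lbar R A (m + 1, m + 1, f m)) p = frag_extend (hbar R A f) p"
  by (rule frag_extend_eq) (use assms in \<open>auto simp: hbar_def hty_m_def\<close>)

lemma extend_bbar:
  assumes "\<And>w. w \<in> Poly_Mapping.keys p \<Longrightarrow> length w = m + 2"
  shows "frag_extend (lbar R (a_mod A) (m + 2, m, a_op A m)) p = frag_extend (bbar R A) p"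
  by (rule frag_extend_eq) (use assms in \<open>auto simp: bbar_def op_m_def\<close>)

context ainf_alg
begin

lemma comp_D:
  assumes "valid (a_mod A) u" "length u = Suc N"
  shows "comp K D u = frag_extend K (D (replicate (Suc N) 0) u) +
    (\<Sum>m<N. \<Sum>t\<in>{1..m + 1}. frag_extend K (D (single (t - 1) (N - m) (m + 1 - t)) u))"
  unfolding comp_def assms(2)
  by (rule sum_comps_single) (simp add: comps_def Ds_zero[OF assms(1)] assms(2))

text \<open>On one letter the claim is d d = 0. On longer words it is the relation for the next
  operation, where the terms involving d come from \<open>hom_diff\<close> and every other term of
  the relation appears with a minus sign.\<close>

lemma b_b:
  assumes u: "valid (a_mod A) u" "u \<noteq> []"
  shows "eqv (a_mod A) (comp b D u) 0"
proof (cases "length u = 1")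
  case True
  then obtain p x where ux: "u = [(p, x)]" by (auto simp: length_Suc_conv)
  have x: "x \<in> carrier (a_mod A p)" using u by (simp add: ux)
  have "D [0] u = b u"
    by (simp add: ux)
  then have "comp b D u = frag_extend b (b u)"
    using comp_D[OF u(1), of 0 b] True by simp
  also have "eqv (a_mod A) \<dots> 0"
  proof (cases "p = 0")
    case False
    have "frag_extend b (b u) = b [(p - 1, a_diff A p x)]" using False x by (simp add: ux bbar_def)
    also have "eqv (a_mod A) \<dots> (lt (p - 1 - 1) (a_diff A (p - 1) (a_diff A p x)))"
      by (intro eqv_sym[OF bbar_letter] lin_maps_closed[OF d_lin] x)
    also have "a_diff A (p - 1) (a_diff A p x) = \<zero>\<^bsub>a_mod A (p - 1 - 1)\<^esub>"
      using diff_module x unfolding diff_module_def by blast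
    also have "eqv (a_mod A) (lt (p - 1 - 1) \<zero>\<^bsub>a_mod A (p - 1 - 1)\<^esub>) 0" by (rule lt_zero)
    finally show ?thesis .
  qed (simp add: ux bbar_def)
  finally show ?thesis .
next
  case False
  then obtain N where len: "length u = Suc (Suc N)"
    using u(2) by (cases u rule: list.exhaust; cases "tl u") auto
  interpret P: ainf_pair R A A by unfold_locales
  define q where "q = wdeg u"
  define E where "E = q + N - 1"
  have w: "u \<in> words (a_mod A) (N + 2) q" using u(1) len by (simp add: words_iff q_def)
  let ?x = "ev (N + 2) q (frag_of u)" and ?M = "a_mod A E"
  let ?y = "\<lambda>m t. signed ?M (int (t * (N - m) + N)) (a_op A m (q + (N - 1 - m))
     (tensor_maps R (a_mod A) (a_mod A)
       (replicate (t - 1) (one_m R (a_mod A)) @ [op_m A (N - 1 - m)] @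
        replicate (m + 2 - t) (one_m R (a_mod A))) q ?x))"
  have rel: "hom_diff ?M (int N) (a_diff A (q + N)) (a_op A N) (dT (N + 2)) q ?x =
      (\<Oplus>\<^bsub>?M\<^esub>m\<in>{..<N}. \<Oplus>\<^bsub>?M\<^esub>t\<in>{1..m + 2}. ?y m t)"
    using ainf ev_closed unfolding is_ainf_def Let_def E_def by blast
  have trm: "?y m t \<in> carrier ?M \<and> eqv (a_mod A) (lt E (?y m t))
      (- frag_extend b (D (single (t - 1) (N - m) (m + 2 - t)) u))"
    if m: "m \<in> {..<N}" and t: "t \<in> {1..m + 2}" for m t
  proof -
    obtain k where k: "N = m + Suc k" using m by (auto dest: less_imp_Suc_add)
    obtain i where i: "t = Suc i" using t by (cases t) auto
    obtain c where c: "m + 2 = t + c" using t by (auto dest: le_Suc_ex)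
    have op: "self.multi_lin (m + 2, m, a_op A m)" using op_lin[of m] by (simp add: op_m_def)
    have w': "u \<in> words (a_mod A) (N - m + (m + 2)) q" using w m by simp
    \<comment> \<open>In terms of i, k and c the exponent is visibly twice an integer; the summand 1
      is the exponent s = 1 of the minus sign.\<close>
    have par: "even (int (t * (N - m) + N) + int (1 + (t - 1) * (N - m - 1) + (m + 2 - t)))"
    proof -
      have "t * (N - m) + N + (1 + (t - 1) * (N - m - 1) + (m + 2 - t)) = 2 * (i * k + m + k + 2)"
        using c unfolding k i by (simp add: algebra_simps)
      then show ?thesis by (metis dvd_triv_left even_of_nat of_nat_add)
    qed
    have E: "E = q + (N - m - 1) + m" using m by (auto simp: E_def)
    have t': "1 \<le> t" "t \<le> m + 2" "1 \<le> N - m" using t m by auto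
    have eq: "N - m - 1 = N - 1 - m" "N - m + (m + 2) = N + 2" using m by auto
    have keys: "length w = m + 2" if "w \<in> Poly_Mapping.keys (D (single (t - 1) (N - m) (m + 2 - t)) u)" for w
      using D_keys[OF that] len m t by auto
    have bx: "frag_extend (lbar R (a_mod A) (m + 2, m, a_op A m)) (D (single (t - 1) (N - m) (m + 2 - t)) u) =
        frag_extend b (D (single (t - 1) (N - m) (m + 2 - t)) u)"
      by (rule extend_bbar) (rule keys)
    have sg1: "sg 1 p = - p" for p :: "'a frag" by (simp add: sg_def)
    show ?thesis
      using P.inner_term[OF op w' t' E par] unfolding eq bx sg1 by (rule conjI)
  qed
  have "eqv (a_mod A) (lt E (hom_diff ?M (int N) (a_diff A (q + N)) (a_op A N) (dT (N + 2)) q ?x))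
      (\<Sum>m<N. \<Sum>t\<in>{1..m + 2}. - frag_extend b (D (single (t - 1) (N - m) (m + 2 - t)) u))"
    unfolding rel by (rule lt_finsum2(1)) (use trm in blast)+
  then have 1: "eqv (a_mod A) (lt E (hom_diff ?M (int N) (a_diff A (q + N)) (a_op A N) (dT (N + 2)) q ?x))
      (- (\<Sum>m<N. \<Sum>t\<in>{1..m + 2}. frag_extend b (D (single (t - 1) (N - m) (m + 2 - t)) u)))"
    by (simp only: sum_negf)
  have op: "self.multi_lin (N + 2, N, a_op A N)" using op_lin[of N] by (simp add: op_m_def)
  have bu: "lbar R (a_mod A) (N + 2, N, a_op A N) u = b u"
    using len by (simp add: bbar_def op_m_def)
  have keys: "length w = N + 2" if "w \<in> Poly_Mapping.keys (D (replicate (N + 2) 0) u)" for w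
    using D_keys[OF that] len by simp
  have bx: "frag_extend (lbar R (a_mod A) (N + 2, N, a_op A N)) (D (replicate (N + 2) 0) u) =
      frag_extend b (D (replicate (N + 2) 0) u)"
    by (rule extend_bbar) (rule keys)
  have 2: "eqv (a_mod A) (lt E (hom_diff ?M (int N) (a_diff A (q + N)) (a_op A N) (dT (N + 2)) q ?x))
      (frag_extend b (b u) + frag_extend b (D (replicate (N + 2) 0) u))"
    using P.hom_diff_eqv(2)[OF op w E_def, of N] unfolding bu bx by (simp add: sg_def)
  \<comment> \<open>The decomposition into one block is the term with m = 0 of
    \<open>comp_D\<close>. It is the term in which d is applied after the operation, so the sum has
    to be shifted by one to match the relation.\<close>
  have D1: "D [Suc N] u = b u" using len by (simp add: idc_def)
  have "comp b D u = frag_extend b (D (replicate (N + 2) 0) u) + (frag_extend b (b u) +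
      (\<Sum>m<N. \<Sum>t\<in>{1..m + 2}. frag_extend b (D (single (t - 1) (N - m) (m + 2 - t)) u)))"
    unfolding comp_D[OF u(1) len] by (subst sum.lessThan_Suc_shift) (simp add: single_def D1 len idc_def)
  also have "\<dots> = (frag_extend b (b u) + frag_extend b (D (replicate (N + 2) 0) u)) -
      - (\<Sum>m<N. \<Sum>t\<in>{1..m + 2}. frag_extend b (D (single (t - 1) (N - m) (m + 2 - t)) u))"
    by simp
  also have "eqv (a_mod A) \<dots> 0"
    using eqv_trans[OF eqv_sym[OF 2] 1] unfolding eqv_def diff_zero .
  finally show ?thesis .
qed

end

lemma length_apply_maps [simp]: "length (apply_maps R A us w) = length us"
  by (induction R A us w rule: apply_maps.induct) auto

lemma Bs_keys:
  "valid A u \<Longrightarrow> length u = arity us \<Longrightarrow> w \<in> Poly_Mapping.keys (Bs R A us u) \<Longrightarrow> length w = length us"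
  using Bs_apply[of A u us R] by simp

lemma sg_one: "sg 1 p = - p"
  by (simp add: sg_def)

lemma comp_tuples:
  assumes "length u = Suc N"
  shows "comp K \<psi> u = frag_extend K (\<psi> [N] u) +
    (\<Sum>m<N. \<Sum>ns\<in>sum_tuples (m + 2) (N - 1 - m). frag_extend K (\<psi> ns u))"
  unfolding comp_def assms by (rule sum_comps_tuples')

context ainf_pair
begin

abbreviation "fb \<equiv> fbar R (a_mod A)"
abbreviation "hb \<equiv> hbar R (a_mod A)"

text \<open>The form of a morphism used from here on. It is stable under composition and contains
  the identity by arguments on cochains, so the defining relation of \<open>ainf_morphism\<close>
  need not be verified for composites.\<close>

definition mor_ok :: "(nat \<Rightarrow> nat \<Rightarrow> ('k, 'a) tensor \<Rightarrow> 'b) \<Rightarrow> bool" where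
  "mor_ok f \<longleftrightarrow> (\<forall>n. multi_lin (mor_m f n)) \<and>
     (\<forall>u. valid (a_mod A) u \<longrightarrow> u \<noteq> [] \<longrightarrow> eqv (a_mod B) (comp B.b (Fs (fb f)) u) (comp (fb f) A.D u))"

text \<open>The same bookkeeping as for the inner terms, with the operation of the target on the
  outside. For morphisms \<open>kexp_mor\<close> gives s = 0, for homotopies \<open>kexp_hty\<close>
  gives s = 1.\<close>

lemma outer_term:
  assumes lin: "\<forall>m\<in>set us. multi_lin m" and len: "length us = m + 2"
    and u: "u \<in> words (a_mod A) n q" "n = arity us" and q': "q' = q + degree us" and E: "E = q' + m"
    and par: "even (k + int (s + kexp us))"
  shows "signed (a_mod B E) k (a_op B m q' (tensor_maps R (a_mod A) (a_mod B) us q (A.ev n q (frag_of u))))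
      \<in> carrier (a_mod B E)" (is "signed _ _ ?y \<in> _")
    and "eqv (a_mod B) (lt E (signed (a_mod B E) k (a_op B m q' (tensor_maps R (a_mod A) (a_mod B) us q (A.ev n q (frag_of u))))))
      (sg s (frag_extend B.b (Bs R (a_mod A) us u)))"
proof -
  have m: "B.self.multi_lin (length us, m, a_op B m)"
    using B.op_lin[of m] by (simp add: op_m_def len)
  note te = term_eqv[OF graded B.self.graded_modules_axioms lin m u q' E]
  have y: "?y \<in> carrier (a_mod B E)" by (rule te(1))
  then show "signed (a_mod B E) k ?y \<in> carrier (a_mod B E)"
    by (rule signed_closed[OF B.module])
  have v: "valid (a_mod A) u" "length u = arity us" using u by (auto simp: words_iff)
  have bx: "frag_extend (lbar R (a_mod B) (m + 2, m, a_op B m)) (Bs R (a_mod A) us u) =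
      frag_extend B.b (Bs R (a_mod A) us u)"
    by (rule extend_bbar) (use Bs_keys[OF v] len in auto)
  have "eqv (a_mod B) (lt E (signed (a_mod B E) k ?y)) (sg (s + kexp us) (lt E ?y))"
    by (rule B.lt_signed'[OF y par])
  also have "eqv (a_mod B) \<dots> (sg (s + kexp us) (sg (kexp us) (frag_extend B.b (Bs R (a_mod A) us u))))"
    using te(2)[unfolded len bx] by (rule eqv_sg)
  also have "\<dots> = sg s (frag_extend B.b (Bs R (a_mod A) us u))"
    unfolding sg_sg by (rule sg_cong) presburger
  finally show "eqv (a_mod B) (lt E (signed (a_mod B E) k ?y)) (sg s (frag_extend B.b (Bs R (a_mod A) us u)))" .
qed

lemma inner_parity:
  assumes "m < N" "1 \<le> t" "t \<le> m + 1"
  shows "even (int (t * (N - m) + N) + int (0 + (t - 1) * (N - m - 1) + (m + 1 - t)))"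
proof -
  obtain k where k: "N = m + Suc k" using assms(1) by (auto dest: less_imp_Suc_add)
  obtain i where i: "t = Suc i" using assms(2) by (cases t) auto
  obtain c where c: "m + 1 = t + c" using assms(3) by (auto dest: le_Suc_ex)
  have "t * (N - m) + N + (0 + (t - 1) * (N - m - 1) + (m + 1 - t)) = 2 * (i * k + m + k + 1)"
    using c unfolding k i by (simp add: algebra_simps)
  then show ?thesis by (metis dvd_triv_left even_of_nat of_nat_add)
qed

text \<open>After translation the inner terms and the terms with an outer operation occur with the
  signs of the cochain relation. Moving the second sum and the d-term to the other side completes
  both compositions.\<close>

lemma morphism_ok:
  assumes f: "ainf_morphism R A B f"
  shows "mor_ok f"
  unfolding mor_ok_def
proof (intro conjI allI impI)
  show lin: "multi_lin (mor_m f n)" for n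
    using f by (simp add: ainf_morphism_def multi_lin_def mor_m_def)
  fix u :: "'a word" assume u: "valid (a_mod A) u" "u \<noteq> []"
  obtain N where len: "length u = Suc N" using u(2) by (cases u) auto
  define q where "q = wdeg u"
  define E where "E = q + N - 1"
  have w: "u \<in> words (a_mod A) (N + 1) q" using u(1) len by (simp add: words_iff q_def)
  let ?x = "A.ev (N + 1) q (frag_of u)" and ?M = "a_mod B E"
  interpret M: module R ?M by (rule B.module)
  let ?y = "\<lambda>m t. signed ?M (int (t * (N - m) + N)) (f m (q + (N - 1 - m))
     (tensor_maps R (a_mod A) (a_mod A)
       (replicate (t - 1) (one_m R (a_mod A)) @ [op_m A (N - 1 - m)] @
        replicate (m + 1 - t) (one_m R (a_mod A))) q ?x))"
  let ?z = "\<lambda>m ns. signed ?M (int (eps ns)) (a_op B m (q + (N - 1 - m))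
     (tensor_maps R (a_mod A) (a_mod B) (map (mor_m f) ns) q ?x))"
  let ?h = "hom_diff ?M (int N) (a_diff B (q + N)) (f N) (A.dT (N + 1)) q ?x"
  have rel: "?h = (\<Oplus>\<^bsub>?M\<^esub>m\<in>{..<N}. \<Oplus>\<^bsub>?M\<^esub>t\<in>{1..m + 1}. ?y m t) \<ominus>\<^bsub>?M\<^esub>
      (\<Oplus>\<^bsub>?M\<^esub>m\<in>{..<N}. \<Oplus>\<^bsub>?M\<^esub>ns\<in>sum_tuples (m + 2) (N - 1 - m). ?z m ns)"
    using f A.ev_closed unfolding ainf_morphism_def Let_def E_def by blast
  have y: "?y m t \<in> carrier ?M \<and> eqv (a_mod B) (lt E (?y m t))
      (frag_extend (fb f) (A.D (single (t - 1) (N - m) (m + 1 - t)) u))"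
    if m: "m \<in> {..<N}" and t: "t \<in> {1..m + 1}" for m t
  proof -
    have m': "multi_lin (m + 1, m, f m)" using lin[of m] by (simp add: mor_m_def)
    have w': "u \<in> words (a_mod A) (N - m + (m + 1)) q" using w m by simp
    have par: "even (int (t * (N - m) + N) + int (0 + (t - 1) * (N - m - 1) + (m + 1 - t)))"
      by (rule inner_parity) (use m t in auto)
    have E: "E = q + (N - m - 1) + m" using m by (auto simp: E_def)
    have t': "1 \<le> t" "t \<le> m + 1" "1 \<le> N - m" using t m by auto
    have eq: "N - m - 1 = N - 1 - m" "N - m + (m + 1) = N + 1" using m by auto
    have bx: "frag_extend (lbar R (a_mod A) (m + 1, m, f m)) (A.D (single (t - 1) (N - m) (m + 1 - t)) u) =
        frag_extend (fb f) (A.D (single (t - 1) (N - m) (m + 1 - t)) u)"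
      by (rule extend_fbar) (use A.D_keys len m t in fastforce)
    show ?thesis
      using inner_term[OF m' w' t' E par] unfolding eq bx sg_0 by (rule conjI)
  qed
  have z: "?z m ns \<in> carrier ?M \<and> eqv (a_mod B) (lt E (?z m ns)) (frag_extend B.b (Fs (fb f) ns u))"
    if m: "m \<in> {..<N}" and ns: "ns \<in> sum_tuples (m + 2) (N - 1 - m)" for m ns
  proof -
    have lin': "\<forall>m\<in>set (map (mor_m f) ns). multi_lin m" using lin by auto
    have len': "length (map (mor_m f) ns) = m + 2" using ns by (simp add: sum_tuples_def)
    have ar: "N + 1 = arity (map (mor_m f) ns)" using ns m by (simp add: sum_tuples_def csum_eq)
    have q': "q + (N - 1 - m) = q + degree (map (mor_m f) ns)" using ns by (simp add: sum_tuples_def)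
    have E: "E = q + (N - 1 - m) + m" using m by (auto simp: E_def)
    have par: "even (int (eps ns) + int (0 + kexp (map (mor_m f) ns)))"
      using kexp_mor[of f ns] by (metis add.commute add_0 even_of_nat of_nat_add)
    have Fs: "Fs (fb f) ns u = Bs R (a_mod A) (map (mor_m f) ns) u"
      by (rule Fs_Bs) (use ar len in simp)
    show ?thesis
      using outer_term[OF lin' len' w ar q' E par] unfolding Fs sg_0 by (rule conjI)
  qed
  let ?S1 = "\<Sum>m<N. \<Sum>t\<in>{1..m + 1}. frag_extend (fb f) (A.D (single (t - 1) (N - m) (m + 1 - t)) u)"
  let ?S2 = "\<Sum>m<N. \<Sum>ns\<in>sum_tuples (m + 2) (N - 1 - m). frag_extend B.b (Fs (fb f) ns u)"
  have Y: "eqv (a_mod B) (lt E (\<Oplus>\<^bsub>?M\<^esub>m\<in>{..<N}. \<Oplus>\<^bsub>?M\<^esub>t\<in>{1..m + 1}. ?y m t)) ?S1"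
    "(\<Oplus>\<^bsub>?M\<^esub>m\<in>{..<N}. \<Oplus>\<^bsub>?M\<^esub>t\<in>{1..m + 1}. ?y m t) \<in> carrier ?M"
    by (rule B.lt_finsum2; use y in blast)+
  have Z: "eqv (a_mod B) (lt E (\<Oplus>\<^bsub>?M\<^esub>m\<in>{..<N}. \<Oplus>\<^bsub>?M\<^esub>ns\<in>sum_tuples (m + 2) (N - 1 - m). ?z m ns)) ?S2"
    "(\<Oplus>\<^bsub>?M\<^esub>m\<in>{..<N}. \<Oplus>\<^bsub>?M\<^esub>ns\<in>sum_tuples (m + 2) (N - 1 - m). ?z m ns) \<in> carrier ?M"
    by (rule B.lt_finsum2; use z in blast)+
  have 1: "eqv (a_mod B) (lt E ?h) (?S1 - ?S2)"
    unfolding rel by (rule eqv_trans[OF B.lt_diff[OF Y(2) Z(2)] eqv_diff[OF Y(1) Z(1)]])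
  have m': "multi_lin (N + 1, N, f N)" using lin[of N] by (simp add: mor_m_def)
  have fu: "lbar R (a_mod A) (N + 1, N, f N) u = fb f u"
    using len by (simp add: fbar_def mor_m_def)
  have bx: "frag_extend (lbar R (a_mod A) (N + 1, N, f N)) (A.D (replicate (N + 1) 0) u) =
      frag_extend (fb f) (A.D (replicate (N + 1) 0) u)"
    by (rule extend_fbar) (use A.D_keys len in fastforce)
  \<comment> \<open>N is the degree of the component and N + 2 comes from the tensor differential on
    N + 1 factors.\<close>
  have sgN: "sg (N + (N + 1) + 1) p = p" for p :: "'b frag" by (simp add: sg_def)
  have 2: "eqv (a_mod B) (lt E ?h)
      (frag_extend B.b (fb f u) - frag_extend (fb f) (A.D (replicate (N + 1) 0) u))"
    using hom_diff_eqv(2)[OF m' w E_def, of N] unfolding fu bx sgN .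
  have F1: "Fs (fb f) [N] u = fb f u" using len by simp
  have "eqv (a_mod B) (frag_extend B.b (fb f u) - frag_extend (fb f) (A.D (replicate (N + 1) 0) u)) (?S1 - ?S2)"
    by (rule eqv_trans[OF eqv_sym[OF 2] 1])
  then show "eqv (a_mod B) (comp B.b (Fs (fb f)) u) (comp (fb f) A.D u)"
    unfolding comp_tuples[OF len, of B.b] A.comp_D[OF u(1) len] F1 eqv_def Suc_eq_plus1
    by (simp only: algebra_simps)
qed

lemma mor_ok_lin: "mor_ok f \<Longrightarrow> multi_lin (mor_m f n)"
  and mor_ok_eqv: "mor_ok f \<Longrightarrow> valid (a_mod A) u \<Longrightarrow> u \<noteq> [] \<Longrightarrow>
    eqv (a_mod B) (comp B.b (Fs (fb f)) u) (comp (fb f) A.D u)"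
  by (auto simp: mor_ok_def)

lemma mor_ok_homog: "mor_ok f \<Longrightarrow> homog (a_mod B) 0 0 (fb f)"
  using fbar_homog mor_ok_lin by blast

lemma mor_ok_cochain: "mor_ok f \<Longrightarrow> cochain (a_mod B) 0 (fb f)"
  using homog_cochain[OF mor_ok_homog] by simp

lemma b_cochain: "cochain (a_mod A) 1 A.b"
  using homog_cochain[OF A.bbar_homog] by simp

text \<open>The components of a composite or an identity give the expected cochain only modulo
  \<open>null\<close>. Replacing it inside \<open>comp\<close> on the left requires that the
  structure cochain descends; on the right it is replaced on the words produced by the
  differential.\<close>

lemma mor_ok_cong:
  assumes lin: "\<And>n. multi_lin (mor_m f n)"
    and F: "\<And>u. valid (a_mod A) u \<Longrightarrow> u \<noteq> [] \<Longrightarrow> eqv (a_mod B) (fb f u) (F u)"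
    and rel: "\<And>u. valid (a_mod A) u \<Longrightarrow> u \<noteq> [] \<Longrightarrow> eqv (a_mod B) (comp B.b (Fs F) u) (comp F A.D u)"
  shows "mor_ok f"
  unfolding mor_ok_def
proof (intro conjI allI impI lin)
  fix u :: "'a word" assume u: "valid (a_mod A) u" "u \<noteq> []"
  have "eqv (a_mod B) (comp B.b (Fs (fb f)) u) (comp B.b (Fs F) u)"
    unfolding comp_def
    by (intro eqv_sum descendsD[OF B.bbar_descends] eqv_Fs[OF F]) (auto simp: u comps_def)
  also have "eqv (a_mod B) \<dots> (comp F A.D u)" by (rule rel[OF u])
  also have "eqv (a_mod B) \<dots> (comp (fb f) A.D u)"
    unfolding comp_def
  proof (intro eqv_sum eqv_frag_extend eqv_sym[OF F])
    fix ms w assume ms: "ms \<in> comps (length u)" and w: "w \<in> Poly_Mapping.keys (A.D ms u)"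
    have k: "valid (a_mod A) w \<and> length w = length ms \<and> sdeg w + 1 = sdeg u"
      by (rule A.D_keys[OF w]) (use ms in \<open>simp add: comps_def\<close>)
    then show "valid (a_mod A) w" by simp
    have "ms \<noteq> []" using ms u(2) by (auto simp: comps_def)
    then show "w \<noteq> []" using k by auto
  qed
  finally show "eqv (a_mod B) (comp B.b (Fs (fb f)) u) (comp (fb f) A.D u)" .
qed

end

section \<open>Composition of morphisms\<close>

locale ainf_triple = AB: ainf_pair R A B + BC: ainf_pair R B C
  for R (structure) and A :: "('k, 'a) ainf" and B :: "('k, 'b) ainf" and C :: "('k, 'c) ainf"
begin

sublocale AC: ainf_pair R A C
  by unfold_locales

lemma comp_term:
  assumes f: "AB.mor_ok f" and g: "BC.mor_ok g" and u: "u \<in> words (a_mod A) (n + 1) q"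
    and m: "m \<le> n" and ns: "ns \<in> sum_tuples (m + 1) (n - m)"
  shows "signed (a_mod C (q + n)) (int (eps ns)) (g m (q + (n - m))
      (tensor_maps R (a_mod A) (a_mod B) (map (mor_m f) ns) q (AB.A.ev (n + 1) q (frag_of u)))) \<in> carrier (a_mod C (q + n))"
      (is "signed _ _ ?y \<in> _")
    and "eqv (a_mod C) (lt (q + n) (signed (a_mod C (q + n)) (int (eps ns)) (g m (q + (n - m))
      (tensor_maps R (a_mod A) (a_mod B) (map (mor_m f) ns) q (AB.A.ev (n + 1) q (frag_of u))))))
      (frag_extend (BC.fb g) (Fs (AB.fb f) ns u))"
proof -
  let ?us = "map (mor_m f) ns"
  have lin: "\<forall>m\<in>set ?us. AB.multi_lin m" using AB.mor_ok_lin[OF f] by auto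
  have len: "length ?us = m + 1" using ns by (simp add: sum_tuples_def)
  have ar: "n + 1 = arity ?us" using ns m by (simp add: sum_tuples_def csum_eq)
  have q': "q + (n - m) = q + degree ?us" using ns by (simp add: sum_tuples_def)
  have E: "q + n = q + (n - m) + m" using m by simp
  have v: "BC.multi_lin (length ?us, m, g m)"
    using BC.mor_ok_lin[OF g, of m] by (simp add: mor_m_def len[simplified])
  note te = term_eqv[OF AB.graded BC.graded lin v u ar q' E]
  show "signed (a_mod C (q + n)) (int (eps ns)) ?y \<in> carrier (a_mod C (q + n))"
    by (rule signed_closed[OF BC.B.module te(1)])
  have Fs: "Fs (AB.fb f) ns u = Bs R (a_mod A) ?us u"
    by (rule Fs_Bs) (use ar u in \<open>simp add: words_iff\<close>)
  have uv: "valid (a_mod A) u" "length u = arity ?us" using u ar by (auto simp: words_iff)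
  have bx: "frag_extend (lbar R (a_mod B) (m + 1, m, g m)) (Bs R (a_mod A) ?us u) =
      frag_extend (BC.fb g) (Bs R (a_mod A) ?us u)"
    by (rule extend_fbar) (use Bs_keys[OF uv] len in auto)
  have "eqv (a_mod C) (lt (q + n) (signed (a_mod C (q + n)) (int (eps ns)) ?y)) (sg (kexp ?us) (lt (q + n) ?y))"
    by (rule BC.B.lt_signed'[OF te(1)]) (use kexp_mor[of f ns] in \<open>simp add: add.commute\<close>)
  also have "eqv (a_mod C) \<dots> (sg (kexp ?us) (sg (kexp ?us) (frag_extend (BC.fb g) (Bs R (a_mod A) ?us u))))"
    using te(2)[unfolded len bx] by (rule eqv_sg)
  also have "\<dots> = frag_extend (BC.fb g) (Fs (AB.fb f) ns u)"
    unfolding sg_sg Fs by (simp add: sg_def)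
  finally show "eqv (a_mod C) (lt (q + n) (signed (a_mod C (q + n)) (int (eps ns)) ?y))
    (frag_extend (BC.fb g) (Fs (AB.fb f) ns u))" .
qed

lemma comp_lin:
  assumes f: "AB.mor_ok f" and g: "BC.mor_ok g"
  shows "AC.multi_lin (mor_m (ainf_comp R A B C g f) n)"
proof -
  have "(\<lambda>x. ainf_comp R A B C g f n q x) \<in> lin_maps R (AB.A.T (n + 1) q) (a_mod C (q + n))" for q
    unfolding ainf_comp_def Let_def
  proof (intro lin_maps_finsum lin_maps_signed_fun BC.B.module AB.A.T_module)
    fix m ns assume m: "m \<in> {..n}" and ns: "ns \<in> sum_tuples (m + 1) (n - m)"
    let ?us = "map (mor_m f) ns"
    have lin: "\<forall>m\<in>set ?us. AB.multi_lin m" using AB.mor_ok_lin[OF f] by auto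
    have "tensor_maps R (a_mod A) (a_mod B) ?us q \<in> lin_maps R (AB.A.T (n + 1) q) (AB.B.T (m + 1) (q + (n - m)))"
      by (rule AB.tensor_maps_lin[OF lin]) (use ns m in \<open>simp_all add: sum_tuples_def csum_eq\<close>)
    moreover have "g m (q + (n - m)) \<in> lin_maps R (AB.B.T (m + 1) (q + (n - m))) (a_mod C (q + n))"
      using BC.mor_ok_lin[OF g, of m, unfolded mor_m_def BC.multi_lin_def] m
      by (auto dest!: spec[of _ "q + (n - m)"])
    ultimately show "(\<lambda>x. g m (q + (n - m)) (tensor_maps R (a_mod A) (a_mod B) ?us q x))
        \<in> lin_maps R (AB.A.T (n + 1) q) (a_mod C (q + n))"
      by (rule lin_maps_compose[rotated])
  qed
  then show ?thesis by (simp add: AC.multi_lin_def mor_m_def)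
qed

text \<open>By \<open>kexp_mor\<close> the exponent \<epsilon> cancels against the shift, so the
  composite becomes the composition of cochains with no signs at all.\<close>

lemma comp_fbar:
  assumes f: "AB.mor_ok f" and g: "BC.mor_ok g" and u: "valid (a_mod A) u" "u \<noteq> []"
  shows "eqv (a_mod C) (AC.fb (ainf_comp R A B C g f) u) (comp (BC.fb g) (Fs (AB.fb f)) u)"
proof -
  obtain n where len: "length u = Suc n" using u(2) by (cases u) auto
  define q where "q = wdeg u"
  have w: "u \<in> words (a_mod A) (n + 1) q" using u(1) len by (simp add: words_iff q_def)
  let ?x = "AB.A.ev (n + 1) q (frag_of u)"
  have m: "AC.multi_lin (n + 1, n, ainf_comp R A B C g f n)"
    using comp_lin[OF f g, of n] by (simp add: mor_m_def)
  have "AC.fb (ainf_comp R A B C g f) u = frag_extend (lbar R (a_mod A) (n + 1, n, ainf_comp R A B C g f n)) (frag_of u)"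
    using len by (simp add: fbar_def mor_m_def)
  also have "eqv (a_mod C) \<dots> (lt (q + n) (ainf_comp R A B C g f n q ?x))"
    by (rule eqv_sym[OF AC.lin_lbar[OF m]]) (use w in simp)
  also have "eqv (a_mod C) \<dots> (\<Sum>m\<in>{..n}. \<Sum>ns\<in>sum_tuples (m + 1) (n - m). frag_extend (BC.fb g) (Fs (AB.fb f) ns u))"
    unfolding ainf_comp_def Let_def
    by (rule BC.B.lt_finsum2(1)) (use comp_term[OF f g w] in auto)
  also have "\<dots> = comp (BC.fb g) (Fs (AB.fb f)) u"
    unfolding comp_def len by (rule sum_comps_tuples[symmetric])
  finally show ?thesis .
qed

lemma comp_ok:
  assumes f: "AB.mor_ok f" and g: "BC.mor_ok g"
  shows "AC.mor_ok (ainf_comp R A B C g f)"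
proof (rule AC.mor_ok_cong[OF comp_lin[OF f g] comp_fbar[OF f g]])
  fix u :: "'a word" assume u: "valid (a_mod A) u" "u \<noteq> []"
  show "eqv (a_mod C) (comp BC.B.b (Fs (comp (BC.fb g) (Fs (AB.fb f)))) u)
      (comp (comp (BC.fb g) (Fs (AB.fb f))) AB.A.D u)"
    by (rule comp_commutes[OF AB.b_cochain BC.b_cochain AB.mor_ok_cochain[OF f] BC.mor_ok_cochain[OF g]
          BC.fbar_descends[OF BC.mor_ok_lin[OF g]] AB.mor_ok_eqv[OF f] BC.mor_ok_eqv[OF g] u])
qed

end

section \<open>The identity morphism\<close>

context ainf_alg
begin

text \<open>The higher components are the letter zero, which equals the formal sum 0 only modulo
  \<open>null\<close>.\<close>

lemma id_fbar:
  assumes u: "valid (a_mod A) u" "u \<noteq> []"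
  shows "eqv (a_mod A) (fbar R (a_mod A) (ainf_id R A) u) (idc (a_mod A) u)"
proof (cases "length u = 1")
  case True
  then obtain p x where "u = [(p, x)]" by (auto simp: length_Suc_conv)
  then show ?thesis
    using u by (simp add: fbar_def mor_m_def ainf_id_def idc_def unit_map_pure)
next
  case False
  then have "length u \<noteq> Suc 0" "length u - 1 \<noteq> 0" using u(2) by (cases u; simp)+
  then show ?thesis
    using u lt_zero eqv_sg[OF lt_zero, of "theta u"] by (simp add: fbar_def mor_m_def ainf_id_def idc_def)
qed

end

lemma (in ainf_alg) id_ok: "ainf_pair.mor_ok R A A (ainf_id R A)"
proof -
  interpret P: ainf_pair R A A by unfold_locales
  have lin: "self.multi_lin (mor_m (ainf_id R A) n)" for n
  proof (cases "n = 0")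
    case True
    have "(\<lambda>x. ainf_id R A 0 q x) \<in> lin_maps R (T 1 q) (a_mod A (q + 0))" for q
      using unit_map_lin[of q] by (simp add: ainf_id_def)
    then show ?thesis using True by (simp add: mor_m_def self.multi_lin_def)
  next
    case False
    have "(\<lambda>x. ainf_id R A n q x) \<in> lin_maps R (T (n + 1) q) (a_mod A (q + n))" for q
      using False lin_maps_const_zero[OF module] by (simp add: ainf_id_def)
    then show ?thesis by (simp add: mor_m_def self.multi_lin_def)
  qed
  note b = P.b_cochain and id = idc_cochain[of "a_mod A"]
  show ?thesis
  proof (rule P.mor_ok_cong[OF lin id_fbar])
    fix u assume u: "valid (a_mod A) u" "u \<noteq> []"
    show "eqv (a_mod A) (comp b (Fs (idc (a_mod A))) u) (comp (idc (a_mod A)) D u)"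
      by (simp add: comp_Fs_idc[OF u(1)] comp_idc_Hs[OF id id b u(2)])
  qed
qed

section \<open>Homotopies of algebras in the bar construction\<close>

context ainf_pair
begin

lemma homotopy_lin: "ainf_homotopy R A B f g h \<Longrightarrow> multi_lin (hty_m h n)"
  by (simp add: ainf_homotopy_def multi_lin_def hty_m_def add.assoc)

text \<open>Both double sums of the definition turn into their cochain counterparts with a minus
  sign. Carried to the left they complete the two compositions, and F - G is what remains.\<close>

lemma homotopy_relation:
  assumes h: "ainf_homotopy R A B f g h"
    and f: "\<And>n. multi_lin (mor_m f n)" and g: "\<And>n. multi_lin (mor_m g n)"
    and u: "valid (a_mod A) u" "u \<noteq> []"
  shows "eqv (a_mod B) (comp B.b (Hs (fb f) (fb g) (hb h)) u + comp (hb h) A.D u) (fb f u - fb g u)"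
proof -
  note lin = homotopy_lin[OF h]
  obtain N where len: "length u = Suc N" using u(2) by (cases u) auto
  define q where "q = wdeg u"
  have w: "u \<in> words (a_mod A) (N + 1) q" using u(1) len by (simp add: words_iff q_def)
  let ?E = "q + N"
  let ?x = "A.ev (N + 1) q (frag_of u)" and ?M = "a_mod B ?E"
  let ?H = "Hs (fb f) (fb g) (hb h)"
  interpret M: module R ?M by (rule B.module)
  let ?y = "\<lambda>m t. signed ?M (int (t * (N - m)) + int N - 1) (h m (q + (N - 1 - m))
     (tensor_maps R (a_mod A) (a_mod A)
       (replicate (t - 1) (one_m R (a_mod A)) @ [op_m A (N - 1 - m)] @
        replicate (m + 1 - t) (one_m R (a_mod A))) q ?x))"
  let ?us = "\<lambda>ns i. map (mor_m g) (take (i - 1) ns) @ [hty_m h (ns ! (i - 1))] @ map (mor_m f) (drop i ns)"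
  let ?z = "\<lambda>m ns i. signed ?M (int (m + eps ns + sum_list (take (i - 1) ns))) (a_op B m (q + (N - 1 - m) + 1)
     (tensor_maps R (a_mod A) (a_mod B) (?us ns i) q ?x))"
  let ?h = "hom_diff ?M (int N + 1) (a_diff B (q + N + 1)) (h N) (A.dT (N + 1)) q ?x"
  have rel: "?h = (f N q ?x \<ominus>\<^bsub>?M\<^esub> g N q ?x) \<oplus>\<^bsub>?M\<^esub>
      (\<Oplus>\<^bsub>?M\<^esub>m\<in>{..<N}. \<Oplus>\<^bsub>?M\<^esub>t\<in>{1..m + 1}. ?y m t) \<oplus>\<^bsub>?M\<^esub>
      (\<Oplus>\<^bsub>?M\<^esub>m\<in>{..<N}. \<Oplus>\<^bsub>?M\<^esub>ns\<in>sum_tuples (m + 2) (N - 1 - m). \<Oplus>\<^bsub>?M\<^esub>i\<in>{1..m + 2}. ?z m ns i)"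
    using h A.ev_closed unfolding ainf_homotopy_def Let_def by blast
  have y: "?y m t \<in> carrier ?M \<and> eqv (a_mod B) (lt ?E (?y m t))
      (- frag_extend (hb h) (A.D (single (t - 1) (N - m) (m + 1 - t)) u))"
    if m: "m \<in> {..<N}" and t: "t \<in> {1..m + 1}" for m t
  proof -
    have m': "multi_lin (m + 1, m + 1, h m)" using lin[of m] by (simp add: hty_m_def)
    have w': "u \<in> words (a_mod A) (N - m + (m + 1)) q" using w m by simp
    have "even (int (t * (N - m) + N) + int (0 + (t - 1) * (N - m - 1) + (m + 1 - t)))"
      by (rule inner_parity) (use m t in auto)
    \<comment> \<open>The exponent for homotopies is one less than that for morphisms, which is
      compensated by s = 1.\<close>
    moreover have "int (t * (N - m)) + int N - 1 + int (1 + i + j) = int (t * (N - m) + N) + int (0 + i + j)" for i j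
      by simp
    ultimately have par: "even (int (t * (N - m)) + int N - 1 + int (1 + (t - 1) * (N - m - 1) + (m + 1 - t)))"
      by (simp only:)
    have E: "?E = q + (N - m - 1) + (m + 1)" using m by auto
    have t': "1 \<le> t" "t \<le> m + 1" "1 \<le> N - m" using t m by auto
    have eq: "N - m - 1 = N - 1 - m" "N - m + (m + 1) = N + 1" using m by auto
    have bx: "frag_extend (lbar R (a_mod A) (m + 1, m + 1, h m)) (A.D (single (t - 1) (N - m) (m + 1 - t)) u) =
        frag_extend (hb h) (A.D (single (t - 1) (N - m) (m + 1 - t)) u)"
      by (rule extend_hbar) (use A.D_keys len m t in fastforce)
    show ?thesis
      using inner_term[OF m' w' t' E par] unfolding eq bx sg_one by (rule conjI)
  qed
  have z: "?z m ns i \<in> carrier ?M \<and> eqv (a_mod B) (lt ?E (?z m ns i))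
      (- frag_extend B.b (Bs R (a_mod A) (?us ns i) u))"
    if m: "m \<in> {..<N}" and ns: "ns \<in> sum_tuples (m + 2) (N - 1 - m)" and i: "i \<in> {1..m + 2}" for m ns i
  proof -
    let ?xs = "take (i - 1) ns" and ?b = "ns ! (i - 1)" and ?ys = "drop i ns"
    have ns': "length ns = m + 2" "sum_list ns = N - 1 - m" using ns by (auto simp: sum_tuples_def)
    have split: "ns = ?xs @ ?b # ?ys"
      using id_take_nth_drop[of "i - 1" ns] i ns'(1) by auto
    have sum: "sum_list ?xs + ?b + sum_list ?ys = N - 1 - m"
      using arg_cong[OF split, of sum_list] ns'(2) by simp
    have lens: "length ?xs + length ?ys = m + 1"
      using arg_cong[OF split, of length] ns'(1) by simp
    have lin': "\<forall>m\<in>set (?us ns i). multi_lin m" using lin f g by auto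
    have len': "length (?us ns i) = m + 2" using lens by simp
    have ar: "N + 1 = arity (?us ns i)"
      using sum lens m by (simp add: csum_eq del: length_take length_drop)
    have q': "q + (N - 1 - m) + 1 = q + degree (?us ns i)"
      using sum by simp
    have E: "?E = q + (N - 1 - m) + 1 + m" using m by auto
    have "even (kexp (?us ns i) + eps ns + sum_list ?xs + length ?xs + length ?ys)"
      using kexp_hty[of g ?xs h ?b f ?ys] split by simp
    then have "even (kexp (?us ns i) + eps ns + sum_list ?xs + (m + 1))"
      using lens by (simp only: add.assoc)
    moreover have "int (m + eps ns + sum_list ?xs) + int (1 + kexp (?us ns i)) =
        int (kexp (?us ns i) + eps ns + sum_list ?xs + (m + 1))" by simp
    ultimately have par: "even (int (m + eps ns + sum_list ?xs) + int (1 + kexp (?us ns i)))"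
      by (simp only: even_of_nat)
    show ?thesis
      using outer_term[OF lin' len' w ar q' E par] unfolding sg_one by (rule conjI)
  qed
  have z': "(\<Oplus>\<^bsub>?M\<^esub>i\<in>{1..m + 2}. ?z m ns i) \<in> carrier ?M \<and>
      eqv (a_mod B) (lt ?E (\<Oplus>\<^bsub>?M\<^esub>i\<in>{1..m + 2}. ?z m ns i)) (- frag_extend B.b (?H ns u))"
    if m: "m \<in> {..<N}" and ns: "ns \<in> sum_tuples (m + 2) (N - 1 - m)" for m ns
  proof
    show "(\<Oplus>\<^bsub>?M\<^esub>i\<in>{1..m + 2}. ?z m ns i) \<in> carrier ?M"
      using z[OF m ns] by (intro M.M.finsum_closed) blast
    have ns': "length ns = m + 2" "csum ns = N + 1" using ns m by (auto simp: sum_tuples_def csum_eq)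
    have "eqv (a_mod B) (lt ?E (\<Oplus>\<^bsub>?M\<^esub>i\<in>{1..m + 2}. ?z m ns i)) (\<Sum>i\<in>{1..m + 2}. lt ?E (?z m ns i))"
      by (rule B.lt_finsum) (use z[OF m ns] in blast)
    also have "eqv (a_mod B) \<dots> (\<Sum>i\<in>{1..m + 2}. - frag_extend B.b (Bs R (a_mod A) (?us ns i) u))"
      by (rule eqv_sum) (use z[OF m ns] in blast)
    also have "\<dots> = - frag_extend B.b (\<Sum>i\<in>{Suc 0..m + 2}. Bs R (a_mod A) (?us ns i) u)"
      by (simp only: sum_negf frag_extend_sum finite_atLeastAtMost One_nat_def o_def)
    \<comment> \<open>The positions i = 1, ..., m + 2 of the definition are the positions 0, ..., m
      + 1 in \<open>Hs_Bs\<close>.\<close>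
    also have "(\<Sum>i\<in>{Suc 0..m + 2}. Bs R (a_mod A) (?us ns i) u) = ?H ns u"
      using Hs_Bs[of u ns R "a_mod A" f g h] ns' len by (simp add: sum.atLeast1_atMost_eq)
    finally show "eqv (a_mod B) (lt ?E (\<Oplus>\<^bsub>?M\<^esub>i\<in>{1..m + 2}. ?z m ns i)) (- frag_extend B.b (?H ns u))" .
  qed
  let ?S1 = "\<Sum>m<N. \<Sum>t\<in>{1..m + 1}. frag_extend (hb h) (A.D (single (t - 1) (N - m) (m + 1 - t)) u)"
  let ?S2 = "\<Sum>m<N. \<Sum>ns\<in>sum_tuples (m + 2) (N - 1 - m). frag_extend B.b (?H ns u)"
  let ?Y = "\<Oplus>\<^bsub>?M\<^esub>m\<in>{..<N}. \<Oplus>\<^bsub>?M\<^esub>t\<in>{1..m + 1}. ?y m t"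
  let ?Z = "\<Oplus>\<^bsub>?M\<^esub>m\<in>{..<N}. \<Oplus>\<^bsub>?M\<^esub>ns\<in>sum_tuples (m + 2) (N - 1 - m). \<Oplus>\<^bsub>?M\<^esub>i\<in>{1..m + 2}. ?z m ns i"
  have "eqv (a_mod B) (lt ?E ?Y)
      (\<Sum>m<N. \<Sum>t\<in>{1..m + 1}. - frag_extend (hb h) (A.D (single (t - 1) (N - m) (m + 1 - t)) u))"
    and Yc: "?Y \<in> carrier ?M"
    by (rule B.lt_finsum2; use y in blast)+
  then have Y: "eqv (a_mod B) (lt ?E ?Y) (- ?S1)"
    by (simp only: sum_negf)
  have "eqv (a_mod B) (lt ?E ?Z)
      (\<Sum>m<N. \<Sum>ns\<in>sum_tuples (m + 2) (N - 1 - m). - frag_extend B.b (?H ns u))"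
    and Zc: "?Z \<in> carrier ?M"
    by (rule B.lt_finsum2; use z' in blast)+
  then have Z: "eqv (a_mod B) (lt ?E ?Z) (- ?S2)"
    by (simp only: sum_negf)
  have comp: "f N q ?x \<in> carrier ?M \<and> eqv (a_mod B) (lt ?E (f N q ?x)) (fb f u)"
    if f: "\<And>n. multi_lin (mor_m f n)" for f
  proof
    have m': "multi_lin (N + 1, N, f N)" using f[of N] by (simp add: mor_m_def)
    then have "f N q \<in> lin_maps R (A.T (N + 1) q) ?M" by (simp add: multi_lin_def)
    then show "f N q ?x \<in> carrier ?M" by (rule lin_maps_closed[OF _ A.ev_closed])
    have "eqv (a_mod B) (lt ?E (f N q ?x)) (frag_extend (lbar R (a_mod A) (N + 1, N, f N)) (frag_of u))"
      by (rule lin_lbar[OF m']) (use w in simp)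
    then show "eqv (a_mod B) (lt ?E (f N q ?x)) (fb f u)"
      using len by (simp add: fbar_def mor_m_def)
  qed
  note F = comp[OF f] and G = comp[OF g]
  have "f N q ?x \<ominus>\<^bsub>?M\<^esub> g N q ?x \<in> carrier ?M"
    using F G by (intro M.M.minus_closed) auto
  then have "eqv (a_mod B) (lt ?E ?h) (lt ?E (f N q ?x \<ominus>\<^bsub>?M\<^esub> g N q ?x) + lt ?E ?Y + lt ?E ?Z)"
    unfolding rel using Yc Zc
    by (intro eqv_trans[OF B.lt_add eqv_add[OF B.lt_add eqv_refl]] M.M.a_closed)
  also have "eqv (a_mod B) \<dots> ((fb f u - fb g u) + - ?S1 + - ?S2)"
    using F G by (intro eqv_add Y Z eqv_trans[OF B.lt_diff eqv_diff]) auto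
  finally have 1: "eqv (a_mod B) (lt ?E ?h) ((fb f u - fb g u) + - ?S1 + - ?S2)" .
  have m': "multi_lin (N + 1, N + 1, h N)" using lin[of N] by (simp add: hty_m_def)
  have hu: "lbar R (a_mod A) (N + 1, N + 1, h N) u = hb h u"
    using len by (simp add: hbar_def hty_m_def)
  have bx: "frag_extend (lbar R (a_mod A) (N + 1, N + 1, h N)) (A.D (replicate (N + 1) 0) u) =
      frag_extend (hb h) (A.D (replicate (N + 1) 0) u)"
    by (rule extend_hbar) (use A.D_keys len in fastforce)
  \<comment> \<open>The degree is now N + 1 instead of N, so the d-term changes sign compared with
    morphisms and the two composites are added.\<close>
  have sgN: "sg (N + 1 + (N + 1) + 1) p = - p" for p :: "'b frag" by (simp add: sg_def)
  have eqs: "int (N + 1) = int N + 1" "q + (N + 1) = q + N + 1" by simp_all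
  have E: "?E = q + (N + 1) - 1" by simp
  have 2: "eqv (a_mod B) (lt ?E ?h)
      (frag_extend B.b (hb h u) - - frag_extend (hb h) (A.D (replicate (N + 1) 0) u))"
    using hom_diff_eqv(2)[OF m' w E, of "N + 1"] unfolding hu bx sgN eqs .
  have H1: "?H [N] u = hb h u" using len by simp
  have "eqv (a_mod B) (frag_extend B.b (hb h u) - - frag_extend (hb h) (A.D (replicate (N + 1) 0) u))
      ((fb f u - fb g u) + - ?S1 + - ?S2)"
    by (rule eqv_trans[OF eqv_sym[OF 2] 1])
  then show ?thesis
    unfolding comp_tuples[OF len, of B.b] A.comp_D[OF u(1) len] H1 eqv_def Suc_eq_plus1
    by (simp add: algebra_simps)
qed

end

section \<open>Inversions of permutations\<close>

definition pairs :: "nat \<Rightarrow> (nat \<times> nat) set" where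
  "pairs k = {(s, t). s < t \<and> t < k}"

text \<open>The product is multiplicative under composition, hence computable from transpositions,
  and at the same time it counts inversions. It links \<open>sign\<close> to the numbers subtracted
  in the hats.\<close>

definition inv_prod :: "nat \<Rightarrow> (nat \<Rightarrow> nat) \<Rightarrow> int" where
  "inv_prod k p = (\<Prod>(s, t)\<in>pairs k. sgn (int (p t) - int (p s)))"

lemma finite_pairs [simp]: "finite (pairs k)"
  by (rule finite_subset[of _ "{..<k} \<times> {..<k}"]) (auto simp: pairs_def)

text \<open>Sorting the image of each pair permutes the set of ordered pairs. The sign lost by
  sorting is the factor belonging to p.\<close>

lemma inv_prod_compose:
  assumes "p permutes {..<k}"
  shows "inv_prod k (q \<circ> p) = inv_prod k q * inv_prod k p"
proof -
  let ?h = "\<lambda>(s, t). if p s < p t then (p s, p t) else (p t, p s)"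
  have inj: "p s = p t \<longleftrightarrow> s = t" for s t
    using permutes_inj[OF assms] by (auto dest: injD)
  have less: "p s < k \<longleftrightarrow> s < k" for s
    using permutes_in_image[OF assms, of s] by simp
  have "?h ` pairs k \<subseteq> pairs k"
  proof (rule image_subsetI)
    fix x assume "x \<in> pairs k"
    then obtain s t where "x = (s, t)" "s < t" "t < k" by (auto simp: pairs_def)
    moreover from this have "p s \<noteq> p t" by (simp add: inj)
    ultimately show "?h x \<in> pairs k"
      using less[of s] less[of t] by (cases "p s < p t") (auto simp: pairs_def)
  qed
  moreover have "inj_on ?h (pairs k)"
  proof (rule inj_onI)
    fix x y assume "x \<in> pairs k" "y \<in> pairs k" "?h x = ?h y"
    moreover obtain s t s' t' where "x = (s, t)" "y = (s', t')" by (cases x, cases y)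
    ultimately show "x = y"
      by (cases "p s < p t"; cases "p s' < p t'") (auto simp: pairs_def inj)
  qed
  ultimately have bij: "bij_betw ?h (pairs k) (pairs k)"
    by (simp add: bij_betw_def endo_inj_surj)
  have "inv_prod k (q \<circ> p) = (\<Prod>x\<in>pairs k. (case ?h x of (s, t) \<Rightarrow> sgn (int (q t) - int (q s))) *
      (case x of (s, t) \<Rightarrow> sgn (int (p t) - int (p s))))"
    unfolding inv_prod_def
  proof (rule prod.cong[OF refl])
    fix x assume "x \<in> pairs k"
    then obtain s t where x: "x = (s, t)" and "p s \<noteq> p t" by (auto simp: pairs_def inj)
    then show "(case x of (s, t) \<Rightarrow> sgn (int ((q \<circ> p) t) - int ((q \<circ> p) s))) =
        (case ?h x of (s, t) \<Rightarrow> sgn (int (q t) - int (q s))) * (case x of (s, t) \<Rightarrow> sgn (int (p t) - int (p s)))"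
      by (cases "p s < p t") (auto simp: sgn_if)
  qed
  also have "\<dots> = inv_prod k q * inv_prod k p"
    unfolding prod.distrib inv_prod_def
    by (subst prod.reindex_bij_betw[OF bij, of "\<lambda>(s, t). sgn (int (q t) - int (q s))"]) simp
  finally show ?thesis .
qed

lemma inv_prod_power:
  "inj_on p {..<k} \<Longrightarrow> inv_prod k p = (- 1) ^ card {(s, t). s < t \<and> t < k \<and> p t < p s}"
proof -
  assume inj: "inj_on p {..<k}"
  have eq_iff: "p s = p t \<longleftrightarrow> s = t" if "s < k" "t < k" for s t
    using inj_on_eq_iff[OF inj] that by simp
  have "inv_prod k p = (\<Prod>x\<in>pairs k. if p (snd x) < p (fst x) then - 1 else 1)"
    unfolding inv_prod_def
    by (intro prod.cong) (auto simp: pairs_def sgn_if eq_iff)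
  also have "\<dots> = (\<Prod>x\<in>pairs k \<inter> {x. p (snd x) < p (fst x)}. - 1)"
    by (subst prod.inter_restrict) auto
  also have "pairs k \<inter> {x. p (snd x) < p (fst x)} = {(s, t). s < t \<and> t < k \<and> p t < p s}"
    by (auto simp: pairs_def)
  finally show ?thesis by simp
qed

lemma inv_prod_transpose_less:
  assumes "a < b" "b < k"
  shows "inv_prod k (transpose a b) = - 1"
proof -
  \<comment> \<open>The inversions of a transposition are a with everything after it up to b, and
    everything strictly between with b: an odd number, as the pair of a and b itself counts
    once.\<close>
  have "{(s, t). s < t \<and> t < k \<and> transpose a b t < transpose a b s} =
      (\<lambda>t. (a, t)) ` {a<..b} \<union> (\<lambda>s. (s, b)) ` {a<..<b}"
    using assms by (auto simp: transpose_def split: if_splits)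
  also have "card \<dots> = (b - a) + (b - a - 1)"
    by (subst card_Un_disjoint) (auto simp: card_image inj_on_def)
  finally have "card {(s, t). s < t \<and> t < k \<and> transpose a b t < transpose a b s} = 2 * (b - a - 1) + 1"
    using assms by simp
  then show ?thesis
    using permutes_inj_on[OF permutes_swap_id[of a "{..<k}" b]] assms
    by (subst inv_prod_power) simp_all
qed

lemma inv_prod_sign:
  assumes "p permutes {..<k}"
  shows "inv_prod k p = sign p"
  using assms finite_lessThan
proof (induction p rule: permutes_induct)
  case id
  have "inv_prod k id = 1"
    unfolding inv_prod_def by (rule prod.neutral) (auto simp: pairs_def)
  then show ?case by (simp only: sign_id)
next
  case (swap a b p)
  have tr: "inv_prod k (transpose a b) = - 1"
    using inv_prod_transpose_less[of a b k] inv_prod_transpose_less[of b a k] swap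
    by (cases a b rule: linorder_cases) (auto simp: transpose_commute)
  have "sign (transpose a b \<circ> p) = - sign p"
    using swap by (simp add: sign_compose permutation_swap_id permutes_imp_permutation[OF finite_lessThan] sign_swap_id)
  moreover have "inv_prod k (transpose a b \<circ> p) = inv_prod k (transpose a b) * inv_prod k p"
    by (rule inv_prod_compose) fact
  ultimately show ?case using swap.IH tr by (simp only: mult_minus1)
qed

lemma evenperm_inversions:
  fixes k :: nat
  assumes "p permutes {..<k}"
  shows "evenperm p \<longleftrightarrow> even (card {(s, t). s < t \<and> t < k \<and> p t < p s})"
proof -
  have "inj_on p {..<k}" using permutes_inj[OF assms] by (rule inj_on_subset) simp
  define c where "c = card {(s, t). s < t \<and> t < k \<and> p t < p s}"
  have "sign p = (- 1) ^ c"
    unfolding c_def inv_prod_sign[OF assms, symmetric] by (rule inv_prod_power) fact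
  then have "evenperm p \<longleftrightarrow> even c"
    by (cases "evenperm p"; cases "even c") (simp_all add: sign_def)
  then show ?thesis by (simp only: c_def)
qed

section \<open>Splittings as subsets\<close>

text \<open>The new position of i after the elements of L have been deleted below it.\<close>

definition rn :: "nat set \<Rightarrow> nat \<Rightarrow> nat" where
  "rn L i = i - card {l \<in> L. l < i}"

lemma length_hats [simp]: "length (hats J) = length J"
  by (simp add: hats_def)

section \<open>How the hats affect the order of a tuple\<close>

definition later :: "nat list \<Rightarrow> nat \<Rightarrow> nat set" where
  "later J s = {t. s < t \<and> t < length J \<and> J ! t < J ! s}"

lemma finite_later [simp]: "finite (later J s)"
  by (simp add: later_def)

lemma hats_nth: "s < length J \<Longrightarrow> hats J ! s = J ! s - card (later J s)"
  by (simp add: hats_def later_def)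

lemma card_nths:
  assumes "distinct J" "T \<subseteq> {..<length J}" "\<And>t. t \<in> T \<Longrightarrow> J ! t \<in> S" "finite S"
  shows "card T \<le> card S"
proof -
  have "inj_on (\<lambda>t. J ! t) T"
    using assms(1,2) by (auto simp: inj_on_def nth_eq_iff_index_eq subset_iff)
  then show ?thesis using assms(3,4) by (intro card_inj_on_le[of _ T S]) auto
qed

lemma later_le: "distinct J \<Longrightarrow> s < length J \<Longrightarrow> card (later J s) \<le> J ! s"
  using card_nths[of J "later J s" "{..<J ! s}"] by (auto simp: later_def)

text \<open>The numbers subtracted at adjacent places differ through the later entries lying
  strictly between the two values, and there are at most as many as integers in between. In the
  descending case the right neighbour itself accounts for one more.\<close>

lemma hats_less_iff:
  assumes J: "distinct J" and i: "Suc i < length J"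
  shows "hats J ! i < hats J ! Suc i \<longleftrightarrow> J ! i < J ! Suc i"
proof -
  let ?a = "J ! i" and ?b = "J ! Suc i"
  have ne: "?a \<noteq> ?b" using J i by (simp add: nth_eq_iff_index_eq)
  let ?B = "\<lambda>lo hi. {t. Suc i < t \<and> t < length J \<and> lo < J ! t \<and> J ! t < hi}"
  have B: "card (?B lo hi) \<le> hi - lo - 1" for lo hi
    using card_nths[OF J, of "?B lo hi" "{lo<..<hi}"] by auto
  show ?thesis
  proof (cases "?a < ?b")
    case True
    have "later J (Suc i) = later J i \<union> ?B ?a ?b"
    proof (intro equalityI subsetI)
      fix t assume t: "t \<in> later J (Suc i)"
      then have "J ! t \<noteq> ?a" using J i by (auto simp: later_def nth_eq_iff_index_eq)
      then show "t \<in> later J i \<union> ?B ?a ?b" using t by (auto simp: later_def)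
    next
      fix t assume t: "t \<in> later J i \<union> ?B ?a ?b"
      then have "t \<noteq> Suc i" using True by (auto simp: later_def)
      then show "t \<in> later J (Suc i)" using t True by (auto simp: later_def)
    qed
    then have "card (later J (Suc i)) \<le> card (later J i) + (?b - ?a - 1)"
      using card_Un_le[of "later J i" "?B ?a ?b"] B[of ?a ?b] by simp
    moreover have "card (later J i) \<le> ?a" using later_le[OF J] i by simp
    ultimately show ?thesis using True i by (simp add: hats_nth)
  next
    case False
    then have ba: "?b < ?a" using ne by simp
    have "later J i \<subseteq> insert (Suc i) (later J (Suc i) \<union> ?B ?b ?a)"
    proof
      fix t assume t: "t \<in> later J i"
      show "t \<in> insert (Suc i) (later J (Suc i) \<union> ?B ?b ?a)"
      proof (cases "t = Suc i")
        case False
        then have "J ! t \<noteq> ?b" using J i t by (auto simp: later_def nth_eq_iff_index_eq)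
        then show ?thesis using t False by (auto simp: later_def)
      qed simp
    qed
    then have "card (later J i) \<le> card (insert (Suc i) (later J (Suc i) \<union> ?B ?b ?a))"
      by (intro card_mono) auto
    also have "\<dots> \<le> Suc (card (later J (Suc i)) + (?a - ?b - 1))"
      using card_Un_le[of "later J (Suc i)" "?B ?b ?a"] B[of ?b ?a]
        card_insert_le_m1[of "Suc (card (later J (Suc i) \<union> ?B ?b ?a))" "later J (Suc i) \<union> ?B ?b ?a" "Suc i"]
      by (auto simp: card_insert_if)
    finally show ?thesis using ba i by (simp add: hats_nth)
  qed
qed

text \<open>Being strictly increasing is a condition on neighbours, so the hats may be dropped from
  it; the splittings are therefore governed by shuffles.\<close>

lemma sorted_hats_iff:
  assumes J: "distinct J"
  shows "sorted_wrt (<) (take m (hats J)) \<longleftrightarrow> sorted_wrt (<) (take m J)"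
    and "sorted_wrt (<) (drop m (hats J)) \<longleftrightarrow> sorted_wrt (<) (drop m J)"
proof -
  have srt: "sorted_wrt (<) xs \<longleftrightarrow> (\<forall>i. Suc i < length xs \<longrightarrow> xs ! i < xs ! Suc i)" for xs :: "nat list"
    by (rule sorted_wrt_iff_nth_Suc_transp) simp
  show "sorted_wrt (<) (take m (hats J)) \<longleftrightarrow> sorted_wrt (<) (take m J)"
    unfolding srt by (simp add: hats_less_iff[OF J])
  have "hats J ! (m + i) < hats J ! (m + Suc i) \<longleftrightarrow> J ! (m + i) < J ! (m + Suc i)" if "Suc i < length J - m" for i
    using hats_less_iff[OF J, of "m + i"] that by simp
  then show "sorted_wrt (<) (drop m (hats J)) \<longleftrightarrow> sorted_wrt (<) (drop m J)"
    unfolding srt by (simp del: add_Suc_right)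
qed

lemma all_splits_iff:
  assumes "distinct I"
  shows "(\<sigma>, m) \<in> all_splits I \<longleftrightarrow> \<sigma> permutes {..<length I} \<and> m \<le> length I \<and>
    sorted_wrt (<) (take m (permute_list \<sigma> I)) \<and> sorted_wrt (<) (drop m (permute_list \<sigma> I))"
proof -
  have "distinct (permute_list \<sigma> I)" if "\<sigma> permutes {..<length I}"
    using that assms by simp
  then show ?thesis by (auto simp: all_splits_def sorted_hats_iff)
qed

text \<open>In an increasing final segment no entry has a smaller one to its right, so nothing is
  subtracted.\<close>

lemma hats_drop:
  assumes J: "distinct J" and s: "sorted_wrt (<) (drop m J)"
  shows "drop m (hats J) = drop m J"
proof (rule nth_equalityI)
  fix i assume i: "i < length (drop m (hats J))"
  have "later J (m + i) = {}"
  proof -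
    have False if "t \<in> later J (m + i)" for t
    proof -
      have "drop m J ! i < drop m J ! (t - m)"
        using that by (intro sorted_wrt_nth_less[OF s]) (auto simp: later_def)
      then show False using that i by (auto simp: later_def)
    qed
    then show ?thesis by blast
  qed
  then show "drop m (hats J) ! i = drop m J ! i" using i by (simp add: hats_nth)
qed simp

text \<open>In the left segment nothing smaller follows within the segment itself, so the subtracted
  number counts exactly the smaller entries of the right segment.\<close>

lemma hats_take:
  assumes J: "distinct J" and s: "sorted_wrt (<) (take m J)"
  shows "take m (hats J) = map (rn (set (drop m J))) (take m J)"
proof (rule nth_equalityI)
  fix i assume i: "i < length (take m (hats J))"
  have "bij_betw (\<lambda>t. J ! t) (later J i) {l \<in> set (drop m J). l < J ! i}"
    unfolding bij_betw_def
  proof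
    show "inj_on (\<lambda>t. J ! t) (later J i)"
      using J by (auto simp: inj_on_def later_def nth_eq_iff_index_eq)
    show "(\<lambda>t. J ! t) ` later J i = {l \<in> set (drop m J). l < J ! i}"
    proof (intro equalityI subsetI)
      fix l assume "l \<in> (\<lambda>t. J ! t) ` later J i"
      then obtain t where t: "l = J ! t" "i < t" "t < length J" "J ! t < J ! i" by (auto simp: later_def)
      have "m \<le> t"
      proof (rule ccontr)
        assume "\<not> m \<le> t"
        then have "take m J ! i < take m J ! t" using t by (intro sorted_wrt_nth_less[OF s]) auto
        then show False using \<open>\<not> m \<le> t\<close> t by simp
      qed
      then have "drop m J ! (t - m) = l" using t by simp
      then have "l \<in> set (drop m J)" using t \<open>m \<le> t\<close> by (metis diff_less_mono length_drop nth_mem)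
      then show "l \<in> {l \<in> set (drop m J). l < J ! i}" using t by simp
    next
      fix l assume "l \<in> {l \<in> set (drop m J). l < J ! i}"
      then obtain t where t: "t < length (drop m J)" "drop m J ! t = l" and "l < J ! i"
        by (auto simp only: in_set_conv_nth)
      moreover from t have "l = J ! (m + t)" "m + t < length J" by auto
      ultimately show "l \<in> (\<lambda>t. J ! t) ` later J i" using i by (auto simp: later_def)
    qed
  qed
  then have "card (later J i) = card {l \<in> set (drop m J). l < J ! i}" by (rule bij_betw_same_card)
  then show "take m (hats J) ! i = map (rn (set (drop m J))) (take m J) ! i"
    using i by (simp add: hats_nth rn_def)
qed simp

definition lft :: "nat list \<Rightarrow> nat set \<Rightarrow> nat list" where
  "lft I L = sorted_list_of_set (rn L ` (set I - L))"

abbreviation rgt :: "nat set \<Rightarrow> nat list" where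
  "rgt L \<equiv> sorted_list_of_set L"

lemma strict_sorted_eq_sorted_list_of_set:
  "sorted_wrt (<) xs \<Longrightarrow> xs = sorted_list_of_set (set (xs :: nat list))"
  by (rule strict_sorted_equal) simp_all

lemma sign_parity: "even (int n + e + ((if even n then 0 else 1) + e))"
  by (cases "even n") simp_all

context
  fixes I :: "nat list"
  assumes sorted: "sorted_wrt (<) I"
begin

lemma distinct_I: "distinct I"
  using sorted by (simp add: strict_sorted_iff)

text \<open>Everything about a splitting is read off from the set L of its right entries. The parity
  of the permutation is recovered because each hat subtracts the number of inversions starting at
  its place.\<close>

lemma all_splits_parts:
  assumes "(\<sigma>, m) \<in> all_splits I"
  defines "J \<equiv> permute_list \<sigma> I"
  defines "L \<equiv> set (drop m J)"
  shows "L \<subseteq> set I" "drop m (hats J) = rgt L" "take m (hats J) = lft I L"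
    "take m J = sorted_list_of_set (set I - L)" "drop m J = rgt L"
    "m = length I - card L"
    "evenperm \<sigma> \<longleftrightarrow> even (sum_list I + sum_list (lft I L) + sum_list (rgt L))"
proof -
  have \<sigma>: "\<sigma> permutes {..<length I}" and m: "m \<le> length I"
    and s: "sorted_wrt (<) (take m J)" "sorted_wrt (<) (drop m J)"
    and sh: "sorted_wrt (<) (take m (hats J))"
    using assms(1) all_splits_iff[OF distinct_I] by (auto simp: J_def all_splits_def)
  have J: "distinct J" "set J = set I" "length J = length I"
    using \<sigma> distinct_I by (simp_all add: J_def)
  have un: "set (take m J) \<union> L = set I"
    unfolding L_def J(2)[symmetric] by (metis append_take_drop_id set_append)
  have disj: "set (take m J) \<inter> L = {}"
    unfolding L_def using J(1) by (metis append_take_drop_id distinct_append)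
  have tk: "set (take m J) = set I - L" using un disj by blast
  show L: "L \<subseteq> set I" using un by blast
  show drop: "drop m J = rgt L"
    unfolding L_def by (rule strict_sorted_eq_sorted_list_of_set[OF s(2)])
  show "take m J = sorted_list_of_set (set I - L)"
    unfolding tk[symmetric] by (rule strict_sorted_eq_sorted_list_of_set[OF s(1)])
  show hd: "drop m (hats J) = rgt L"
    using hats_drop[OF J(1) s(2)] drop by simp
  show ht: "take m (hats J) = lft I L"
    unfolding lft_def tk[symmetric]
    using strict_sorted_eq_sorted_list_of_set[OF sh] hats_take[OF J(1) s(1)]
    by (simp add: L_def)
  have "card L = length (drop m J)"
    unfolding L_def by (rule distinct_card) (simp add: J(1))
  then show "m = length I - card L" using m J(3) by simp
  have nth: "J ! s = I ! \<sigma> s" if "s < length I" for s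
    unfolding J_def by (rule permute_list_nth[OF \<sigma> that])
  have \<sigma>_less: "\<sigma> s < length I" if "s < length I" for s
    using permutes_in_image[OF \<sigma>, of s] that by simp
  \<comment> \<open>I is increasing, so comparing entries of the permuted tuple is comparing values
    of the permutation.\<close>
  have iff: "J ! t < J ! s \<longleftrightarrow> \<sigma> t < \<sigma> s" if "s < length I" "t < length I" for s t
    using sorted_wrt_nth_less[OF sorted] \<sigma>_less[OF that(1)] \<sigma>_less[OF that(2)] nth that
    by (metis linorder_neqE_nat order_less_asym)
  have "{(s, t). s < t \<and> t < length I \<and> \<sigma> t < \<sigma> s} = (SIGMA s:{..<length I}. later J s)"
    using iff by (auto simp: later_def J(3))
  then have inv: "card {(s, t). s < t \<and> t < length I \<and> \<sigma> t < \<sigma> s} = (\<Sum>s<length I. card (later J s))"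
    by (simp add: card_SigmaI)
  \<comment> \<open>The total of the renumbered tuple falls short of that of I by the number of
    inversions; modulo 2 this is the last claim.\<close>
  have "sum_list (hats J) + (\<Sum>s<length I. card (later J s)) = (\<Sum>s<length I. hats J ! s + card (later J s))"
    by (simp add: sum_list_sum_nth J(3) sum.distrib atLeast0LessThan)
  also have "\<dots> = (\<Sum>s<length I. J ! s)"
    using later_le[OF J(1)] by (intro sum.cong) (simp_all add: hats_nth J(3))
  also have "\<dots> = sum_list J" by (simp add: sum_list_sum_nth J(3) atLeast0LessThan)
  also have "\<dots> = sum_list I"
    using \<sigma> by (metis J_def mset_permute_list sum_mset_sum_list)
  finally have "sum_list I = sum_list (hats J) + card {(s, t). s < t \<and> t < length I \<and> \<sigma> t < \<sigma> s}"
    by (simp add: inv)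
  moreover have "sum_list (hats J) = sum_list (lft I L) + sum_list (rgt L)"
    unfolding ht[symmetric] hd[symmetric] by (metis append_take_drop_id sum_list_append)
  ultimately have "sum_list I + sum_list (lft I L) + sum_list (rgt L) =
      2 * sum_list (hats J) + card {(s, t). s < t \<and> t < length I \<and> \<sigma> t < \<sigma> s}" by simp
  then show "evenperm \<sigma> \<longleftrightarrow> even (sum_list I + sum_list (lft I L) + sum_list (rgt L))"
    by (simp only: evenperm_inversions[OF \<sigma>] even_add even_mult_iff even_numeral simp_thms)
qed

definition split_set :: "(nat \<Rightarrow> nat) \<times> nat \<Rightarrow> nat set" where
  "split_set = (\<lambda>(\<sigma>, m). set (drop m (permute_list \<sigma> I)))"

text \<open>A shuffle is determined by the set of its right entries: the cut is fixed by the
  cardinality, both parts are sorted, and the entries of I are distinct. Conversely any subset,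
  sorted and placed behind its sorted complement, gives one.\<close>

lemma split_set_bij: "bij_betw split_set (all_splits I) (Pow (set I))"
  unfolding bij_betw_def
proof
  show "inj_on split_set (all_splits I)"
  proof (rule inj_onI)
    fix x y assume x: "x \<in> all_splits I" and y: "y \<in> all_splits I" and eq: "split_set x = split_set y"
    obtain \<sigma> m \<tau> n where xy: "x = (\<sigma>, m)" "y = (\<tau>, n)" by (cases x, cases y)
    note X = all_splits_parts[OF x[unfolded xy]] and Y = all_splits_parts[OF y[unfolded xy]]
    have L: "set (drop m (permute_list \<sigma> I)) = set (drop n (permute_list \<tau> I))"
      using eq by (simp add: split_set_def xy)
    have mn: "m = n" using X(6) Y(6) L by simp
    have J: "permute_list \<sigma> I = permute_list \<tau> I"
    proof -
      have "take n (permute_list \<sigma> I) = take n (permute_list \<tau> I)"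
        using X(4)[unfolded L] Y(4) mn by simp
      moreover have "drop n (permute_list \<sigma> I) = drop n (permute_list \<tau> I)"
        using X(5)[unfolded L] Y(5) mn by simp
      ultimately show ?thesis by (metis append_take_drop_id)
    qed
    have \<sigma>: "\<sigma> permutes {..<length I}" and \<tau>: "\<tau> permutes {..<length I}"
      using x y by (auto simp: xy all_splits_def)
    have "\<sigma> s = \<tau> s" for s
    proof (cases "s < length I")
      case True
      then have "I ! \<sigma> s = I ! \<tau> s"
        using permute_list_nth[OF \<sigma> True] permute_list_nth[OF \<tau> True] J by simp
      then show ?thesis
        using distinct_I True permutes_in_image[OF \<sigma>, of s] permutes_in_image[OF \<tau>, of s]
        by (simp add: nth_eq_iff_index_eq)
    next
      case False
      then show ?thesis using \<sigma> \<tau> by (simp add: permutes_not_in)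
    qed
    then show "x = y" using mn by (auto simp: xy)
  qed
  show "split_set ` all_splits I = Pow (set I)"
  proof (intro equalityI subsetI)
    fix L assume "L \<in> split_set ` all_splits I"
    then obtain \<sigma> m where "(\<sigma>, m) \<in> all_splits I" "L = split_set (\<sigma>, m)" by auto
    with all_splits_parts(1)[OF this(1)] show "L \<in> Pow (set I)" by (simp add: split_set_def)
  next
    fix L assume "L \<in> Pow (set I)"
    then have L: "L \<subseteq> set I" "finite L" using finite_subset by auto
    define J where "J = sorted_list_of_set (set I - L) @ rgt L"
    have "distinct J" "set J = set I" using L by (auto simp: J_def)
    then have "mset J = mset I" using distinct_I by (simp add: set_eq_iff_mset_eq_distinct[symmetric])
    then obtain \<sigma> where \<sigma>: "\<sigma> permutes {..<length I}" "permute_list \<sigma> I = J"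
      by (rule mset_eq_permutation)
    define m where "m = card (set I - L)"
    have m: "m \<le> length I"
      using distinct_card[OF distinct_I] unfolding m_def by (metis Diff_subset List.finite_set card_mono)
    have tk: "take m J = sorted_list_of_set (set I - L)" and dr: "drop m J = rgt L"
      by (simp_all add: J_def m_def)
    have "(\<sigma>, m) \<in> all_splits I"
      by (simp add: all_splits_iff[OF distinct_I] \<sigma> m tk dr)
    moreover have "split_set (\<sigma>, m) = L"
      using L(2) by (simp add: split_set_def \<sigma> dr)
    ultimately show "L \<in> split_set ` all_splits I" by (metis image_eqI)
  qed
qed

definition split_term :: "('k, 'x) module \<Rightarrow> int \<Rightarrow> (nat list \<Rightarrow> nat list \<Rightarrow> 'x) \<Rightarrow> nat set \<Rightarrow> 'x" where
  "split_term M e \<phi> L = signed M (int (sum_list I + sum_list (lft I L) + sum_list (rgt L)) + e)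
     (\<phi> (lft I L) (rgt L))"

lemma split_sum_subsets:
  assumes M: "abelian_group M" and \<phi>: "\<And>L. L \<subseteq> set I \<Longrightarrow> \<phi> (lft I L) (rgt L) \<in> carrier M"
    and S: "S \<subseteq> all_splits I"
  shows "split_sum M e S I \<phi> = (\<Oplus>\<^bsub>M\<^esub>L\<in>split_set ` S. split_term M e \<phi> L)"
proof -
  interpret M: abelian_group M by (fact M)
  have inj: "inj_on split_set S"
    using split_set_bij S by (auto simp: bij_betw_def intro: inj_on_subset)
  have sub: "split_set ` S \<subseteq> Pow (set I)"
    using split_set_bij S by (auto simp: bij_betw_def)
  have cl: "split_term M e \<phi> L \<in> carrier M" if "L \<subseteq> set I" for L
    using \<phi>[OF that] by (simp add: split_term_def signed_def)
  have "(\<Oplus>\<^bsub>M\<^esub>L\<in>split_set ` S. split_term M e \<phi> L) = (\<Oplus>\<^bsub>M\<^esub>x\<in>S. split_term M e \<phi> (split_set x))"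
    by (rule M.finsum_reindex[OF _ inj]) (use cl sub in auto)
  also have "\<dots> = split_sum M e S I \<phi>"
    unfolding split_sum_def
  proof (rule M.finsum_cong')
    show "(\<lambda>(\<sigma>, m). signed M ((if evenperm \<sigma> then 0 else 1) + e)
       (\<phi> (take m (hats (permute_list \<sigma> I))) (drop m (hats (permute_list \<sigma> I))))) \<in> S \<rightarrow> carrier M"
    proof
      fix x assume x: "x \<in> S"
      obtain \<sigma> m where xs: "x = (\<sigma>, m)" by (cases x)
      note P = all_splits_parts[OF subsetD[OF S x, unfolded xs]]
      show "(case x of (\<sigma>, m) \<Rightarrow> signed M ((if evenperm \<sigma> then 0 else 1) + e)
       (\<phi> (take m (hats (permute_list \<sigma> I))) (drop m (hats (permute_list \<sigma> I))))) \<in> carrier M"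
        using \<phi>[OF P(1)] by (simp add: xs P(2,3) signed_def)
    qed
    fix x assume x: "x \<in> S"
    obtain \<sigma> m where xs: "x = (\<sigma>, m)" by (cases x)
    note P = all_splits_parts[OF subsetD[OF S x, unfolded xs]]
    have par: "even (int (sum_list I + sum_list (lft I (split_set x)) + sum_list (rgt (split_set x))) + e +
        ((if evenperm \<sigma> then 0 else 1) + e))"
      unfolding split_set_def xs prod.case P(7) by (rule sign_parity)
    show "split_term M e \<phi> (split_set x) = (case x of (\<sigma>, m) \<Rightarrow> signed M ((if evenperm \<sigma> then 0 else 1) + e)
       (\<phi> (take m (hats (permute_list \<sigma> I))) (drop m (hats (permute_list \<sigma> I)))))"
      unfolding split_term_def signed_cong[OF par] by (simp add: xs P(2,3) split_set_def)
  qed simp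
  finally show ?thesis ..
qed

lemma split_sum_all:
  assumes M: "abelian_group M" and \<phi>: "\<And>L. L \<subseteq> set I \<Longrightarrow> \<phi> (lft I L) (rgt L) \<in> carrier M"
  shows "split_sum M e (all_splits I) I \<phi> = (\<Oplus>\<^bsub>M\<^esub>L\<in>Pow (set I). split_term M e \<phi> L)"
proof -
  have "split_set ` all_splits I = Pow (set I)" using split_set_bij by (rule bij_betw_imp_surj_on)
  moreover have "split_sum M e (all_splits I) I \<phi> = (\<Oplus>\<^bsub>M\<^esub>L\<in>split_set ` all_splits I. split_term M e \<phi> L)"
    by (rule split_sum_subsets[OF M]) (fact \<phi>, rule order_refl)
  ultimately show ?thesis by (simp only:)
qed

lemma lft_empty: "lft I {} = I"
  using strict_sorted_eq_sorted_list_of_set[OF sorted] by (simp add: lft_def rn_def)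

lemma lft_full: "lft I (set I) = []"
  by (simp add: lft_def)

lemma rgt_full: "rgt (set I) = I"
  using strict_sorted_eq_sorted_list_of_set[OF sorted] by simp

text \<open>The cuts excluded from the inner sum are those with empty or full right set. For both,
  the sum of I occurs twice in the exponent, so the end terms carry only the sign of e.\<close>

lemma split_sum_inner:
  assumes M: "abelian_group M" and \<phi>: "\<And>L. L \<subseteq> set I \<Longrightarrow> \<phi> (lft I L) (rgt L) \<in> carrier M" and I: "I \<noteq> []"
  shows "(\<Oplus>\<^bsub>M\<^esub>L\<in>Pow (set I). split_term M e \<phi> L) =
      split_sum M e (inner_splits I) I \<phi> \<oplus>\<^bsub>M\<^esub> signed M e (\<phi> I []) \<oplus>\<^bsub>M\<^esub> signed M e (\<phi> [] I)"
    and "split_sum M e (inner_splits I) I \<phi> \<in> carrier M"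
proof -
  interpret M: abelian_group M by (fact M)
  have cl: "split_term M e \<phi> L \<in> carrier M" if "L \<subseteq> set I" for L
    using \<phi>[OF that] by (simp add: split_term_def signed_def)
  let ?P = "Pow (set I) - {{}, set I}"
  have inner_sub: "inner_splits I \<subseteq> all_splits I" by (auto simp: inner_splits_def)
  have "split_set ` inner_splits I = ?P"
  proof -
    have "split_set x \<in> {{}, set I} \<longleftrightarrow> \<not> (1 \<le> snd x \<and> snd x < length I)" if "x \<in> all_splits I" for x
    proof -
      obtain \<sigma> m where x: "x = (\<sigma>, m)" by (cases x)
      note P = all_splits_parts[OF that[unfolded x]]
      have fin: "finite (split_set x)" by (simp add: split_set_def x)
      have m: "m = length I - card (split_set x)" using P(6) by (simp add: split_set_def x)
      have sub: "split_set x \<subseteq> set I" using P(1) by (simp add: split_set_def x)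
      have card: "card (set I) = length I" by (rule distinct_card[OF distinct_I])
      have le: "card (split_set x) \<le> length I" using card_mono[OF _ sub] card by simp
      have "split_set x = set I \<longleftrightarrow> card (split_set x) = length I"
        using card_subset_eq[OF _ sub] card by auto
      moreover have "split_set x = {} \<longleftrightarrow> card (split_set x) = 0" using fin by simp
      ultimately have "split_set x \<in> {{}, set I} \<longleftrightarrow> card (split_set x) = 0 \<or> card (split_set x) = length I"
        by blast
      also have "\<dots> \<longleftrightarrow> \<not> (1 \<le> m \<and> m < length I)" unfolding m using le by arith
      finally show ?thesis by (simp only: x snd_conv)
    qed
    note excl = this
    have inner: "inner_splits I = {x \<in> all_splits I. split_set x \<notin> {{}, set I}}"
    proof (intro equalityI subsetI)
      fix x assume "x \<in> inner_splits I"
      then have "x \<in> all_splits I" "1 \<le> snd x \<and> snd x < length I"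
        by (auto simp: inner_splits_def)
      then show "x \<in> {x \<in> all_splits I. split_set x \<notin> {{}, set I}}" using excl by blast
    next
      fix x assume "x \<in> {x \<in> all_splits I. split_set x \<notin> {{}, set I}}"
      then have "x \<in> all_splits I" "1 \<le> snd x \<and> snd x < length I" using excl by blast+
      then show "x \<in> inner_splits I" by (cases x) (simp add: inner_splits_def)
    qed
    have surj: "split_set ` all_splits I = Pow (set I)" using split_set_bij by (rule bij_betw_imp_surj_on)
    have "split_set ` {x \<in> all_splits I. split_set x \<notin> {{}, set I}} = split_set ` all_splits I - {{}, set I}"
      by (intro equalityI subsetI) (auto simp only: image_iff mem_Collect_eq Diff_iff)
    then show ?thesis by (simp only: inner surj)
  qed
  moreover have "split_sum M e (inner_splits I) I \<phi> = (\<Oplus>\<^bsub>M\<^esub>L\<in>split_set ` inner_splits I. split_term M e \<phi> L)"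
    by (rule split_sum_subsets[OF M _ inner_sub]) (fact \<phi>)
  ultimately have inner: "split_sum M e (inner_splits I) I \<phi> = (\<Oplus>\<^bsub>M\<^esub>L\<in>?P. split_term M e \<phi> L)"
    by (simp only:)
  show cl': "split_sum M e (inner_splits I) I \<phi> \<in> carrier M"
    unfolding inner by (rule M.finsum_closed) (use cl in blast)
  have P: "insert {} (insert (set I) ?P) = Pow (set I)" by auto
  have fin: "finite ?P" "finite (insert (set I) ?P)" by simp_all
  have new: "set I \<notin> ?P" "{} \<notin> insert (set I) ?P" using I by auto
  have fn: "split_term M e \<phi> \<in> S \<rightarrow> carrier M" if "S \<subseteq> Pow (set I)" for S
    using that cl by blast
  have "(\<Oplus>\<^bsub>M\<^esub>L\<in>insert (set I) ?P. split_term M e \<phi> L) =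
      split_term M e \<phi> (set I) \<oplus>\<^bsub>M\<^esub> split_sum M e (inner_splits I) I \<phi>"
    unfolding inner by (rule M.finsum_insert[OF fin(1) new(1) fn cl]) auto
  moreover have "(\<Oplus>\<^bsub>M\<^esub>L\<in>insert {} (insert (set I) ?P). split_term M e \<phi> L) =
      split_term M e \<phi> {} \<oplus>\<^bsub>M\<^esub> (\<Oplus>\<^bsub>M\<^esub>L\<in>insert (set I) ?P. split_term M e \<phi> L)"
    by (rule M.finsum_insert[OF fin(2) new(2) fn cl]) auto
  moreover have "split_term M e \<phi> {} = signed M e (\<phi> I [])"
  proof -
    have "even (int (sum_list I + sum_list I + sum_list []) + e + e)" by simp
    then show ?thesis
      unfolding split_term_def lft_empty sorted_list_of_set_empty by (rule signed_cong)
  qed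
  moreover have "split_term M e \<phi> (set I) = signed M e (\<phi> [] I)"
  proof -
    have "even (int (sum_list I + sum_list [] + sum_list I) + e + e)" by simp
    then show ?thesis
      unfolding split_term_def lft_full rgt_full by (rule signed_cong)
  qed
  moreover have "signed M e (\<phi> I []) \<in> carrier M" "signed M e (\<phi> [] I) \<in> carrier M"
    using cl[of "{}"] cl[of "set I"] calculation(3,4) by (metis empty_subsetI, metis order_refl)
  ultimately show "(\<Oplus>\<^bsub>M\<^esub>L\<in>Pow (set I). split_term M e \<phi> L) =
      split_sum M e (inner_splits I) I \<phi> \<oplus>\<^bsub>M\<^esub> signed M e (\<phi> I []) \<oplus>\<^bsub>M\<^esub> signed M e (\<phi> [] I)"
    unfolding P using cl' by (simp only: M.a_ac M.add.m_closed)
qed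

end

section \<open>Gaps of a block decomposition\<close>

text \<open>Positions between two letters of the same block, when a word is cut into blocks of
  lengths \<open>a + 1\<close> for the entries \<open>a\<close> of the list.\<close>

fun gl :: "nat \<Rightarrow> nat list \<Rightarrow> nat list" where
  "gl o' [] = []"
| "gl o' (a # ns) = [Suc o'..<Suc (o' + a)] @ gl (Suc (o' + a)) ns"

lemma gl_append: "gl k (ms @ ns) = gl k ms @ gl (k + csum ms) ns"
  by (induction ms arbitrary: k) (simp_all add: add.assoc)

lemma length_gl [simp]: "length (gl k ns) = sum_list ns"
  by (induction ns arbitrary: k) (simp_all del: upt_Suc)

lemma set_gl: "set (gl k ns) \<subseteq> {k<..<k + csum ns}"
proof (induction ns arbitrary: k)
  case (Cons a ns)
  show ?case using Cons[of "Suc (k + a)"] by (auto simp del: upt_Suc)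
qed simp

lemma set_gl_Cons: "set (gl k (a # ns)) = {k<..k + a} \<union> set (gl (Suc (k + a)) ns)"
  by (auto simp del: upt_Suc)

lemma gl_notin: "Suc (k + a) \<notin> set (gl k (a # ns))"
  using set_gl[of "Suc (k + a)" ns] by (auto simp: set_gl_Cons simp del: gl.simps)

lemma sorted_gl: "sorted_wrt (<) (gl k ns)"
proof (induction ns arbitrary: k)
  case (Cons a ns)
  have "x < y" if "x \<in> set [Suc k..<Suc (k + a)]" "y \<in> set (gl (Suc (k + a)) ns)" for x y
    using that set_gl[of "Suc (k + a)" ns] by (auto simp del: upt_Suc)
  then show ?case using Cons by (simp add: sorted_wrt_append del: upt_Suc)
qed simp

lemma sorted_list_of_set_gl: "sorted_list_of_set (set (gl k ns)) = gl k ns"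
  using strict_sorted_eq_sorted_list_of_set[OF sorted_gl] by simp

lemma card_set_gl: "card (set (gl k ns)) = sum_list ns"
  using sorted_gl[of k ns] by (simp add: distinct_card strict_sorted_iff)

text \<open>The first position missing from the gap set is the end of the first block; it fixes the
  first entry, and the rest follows by induction.\<close>

lemma gl_inj: "set (gl k ms) = set (gl k ns) \<Longrightarrow> csum ms = csum ns \<Longrightarrow> ms = ns"
proof (induction ms arbitrary: k ns)
  case Nil
  then show ?case by (cases ns) simp_all
next
  case (Cons a ms)
  then obtain b ns' where ns: "ns = b # ns'" by (cases ns) simp_all
  have "\<not> a < b"
  proof
    assume "a < b"
    then have "Suc (k + a) \<in> set (gl k ns)" by (simp add: ns set_gl_Cons del: gl.simps)
    then show False using gl_notin[of k a ms] unfolding Cons.prems(1) by blast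
  qed
  moreover have "\<not> b < a"
  proof
    assume "b < a"
    then have "Suc (k + b) \<in> set (gl k (a # ms))" by (simp add: set_gl_Cons del: gl.simps)
    then show False using gl_notin[of k b ns'] unfolding Cons.prems(1) ns by blast
  qed
  ultimately have ab: "a = b" by simp
  have tail: "set (gl (Suc (k + a)) xs) = set (gl k (a # xs)) \<inter> {Suc (k + a)<..}" for xs
    using set_gl[of "Suc (k + a)" xs] by (auto simp: set_gl_Cons simp del: gl.simps)
  have eq: "set (gl k (a # ms)) = set (gl k (a # ns'))" using Cons.prems(1) by (simp only: ns ab)
  have "set (gl (Suc (k + a)) ms) = set (gl (Suc (k + a)) ns')"
    unfolding tail eq ..
  then show ?case using Cons.IH Cons.prems(2) by (simp add: ns ab)
qed

lemma gl_surj: "L \<subseteq> {k<..<k + b} \<Longrightarrow> \<exists>ms. csum ms = b \<and> set (gl k ms) = L"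
proof (induction b arbitrary: k L rule: less_induct)
  case (less b)
  show ?case
  proof (cases "b = 0")
    case True
    then show ?thesis using less.prems by (intro exI[of _ "[]"]) simp
  next
    case False
    \<comment> \<open>The first block extends up to the first position not in L.\<close>
    define a where "a = (LEAST a. Suc (k + a) \<notin> L)"
    have ex: "Suc (k + (b - 1)) \<notin> L" using less.prems False by auto
    have a: "Suc (k + a) \<notin> L" unfolding a_def by (rule LeastI[of "\<lambda>a. Suc (k + a) \<notin> L", OF ex])
    have ab: "a \<le> b - 1" unfolding a_def by (rule Least_le) (rule ex)
    have below: "Suc (k + c) \<in> L" if "c < a" for c
      using not_less_Least[of c "\<lambda>a. Suc (k + a) \<notin> L"] that unfolding a_def by blast
    have "L \<inter> {Suc (k + a)<..} \<subseteq> {Suc (k + a)<..<Suc (k + a) + (b - Suc a)}"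
      using less.prems ab by auto
    then obtain ms where ms: "csum ms = b - Suc a" "set (gl (Suc (k + a)) ms) = L \<inter> {Suc (k + a)<..}"
      using less.IH[of "b - Suc a" "L \<inter> {Suc (k + a)<..}" "Suc (k + a)"] False by auto
    have "{k<..k + a} \<subseteq> L"
    proof
      fix x assume "x \<in> {k<..k + a}"
      then have "x = Suc (k + (x - Suc k))" "x - Suc k < a" by auto
      then show "x \<in> L" using below by metis
    qed
    moreover have "x \<in> {k<..k + a} \<or> x \<in> {Suc (k + a)<..}" if "x \<in> L" for x
      using that less.prems a by (cases "x = Suc (k + a)") auto
    ultimately have "set (gl k (a # ms)) = L"
      unfolding set_gl_Cons ms(2) by blast
    then show ?thesis using ms(1) ab False by (intro exI[of _ "a # ms"]) simp
  qed
qed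

section \<open>Refinements as subsets of the gaps\<close>

lemma refine_Cons_iff: "x \<in> refine (a # ns) \<longleftrightarrow> (\<exists>ms mss. x = ms # mss \<and> csum ms = Suc a \<and> mss \<in> refine ns)"
  by (auto simp: comps_def)

lemma set_gl_refine:
  "csum ms = Suc a \<Longrightarrow> mss \<in> refine ns \<Longrightarrow>
    set (gl k (concat (ms # mss))) = set (gl k ms) \<union> set (gl (Suc (k + a)) (concat mss))"
  by (simp add: gl_append)

lemma refine_gl_inj: "inj_on (\<lambda>mss. set (gl k (concat mss))) (refine ns)"
proof (induction ns arbitrary: k)
  case (Cons a ns)
  show ?case
  proof (rule inj_onI)
    fix x y assume "x \<in> refine (a # ns)" "y \<in> refine (a # ns)"
      and eq: "set (gl k (concat x)) = set (gl k (concat y))"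
    then obtain m r m' r' where x: "x = m # r" "csum m = Suc a" "r \<in> refine ns"
      and y: "y = m' # r'" "csum m' = Suc a" "r' \<in> refine ns"
      unfolding refine_Cons_iff by blast
    have hd: "set (gl k m) = set (gl k (concat (m # r))) \<inter> {..Suc (k + a)}"
      and tl: "set (gl (Suc (k + a)) (concat r)) = set (gl k (concat (m # r))) \<inter> {Suc (k + a)<..}"
      if "csum m = Suc a" "r \<in> refine ns" for m r
      unfolding set_gl_refine[OF that]
      using set_gl[of k m] set_gl[of "Suc (k + a)" "concat r"] that(1) by auto
    have "m = m'"
      by (rule gl_inj[of k]) (simp_all only: hd[OF x(2,3)] hd[OF y(2,3)] eq[unfolded x(1) y(1)] x(2) y(2))
    moreover have "set (gl (Suc (k + a)) (concat r)) = set (gl (Suc (k + a)) (concat r'))"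
      by (simp only: tl[OF x(2,3)] tl[OF y(2,3)] eq[unfolded x(1) y(1)])
    then have "r = r'" by (rule inj_onD[OF Cons _ x(3) y(3)])
    ultimately show "x = y" by (simp add: x y)
  qed
qed simp

lemma refine_gl_surj: "L \<subseteq> set (gl k ns) \<Longrightarrow> \<exists>mss\<in>refine ns. set (gl k (concat mss)) = L"
proof (induction ns arbitrary: k L)
  case (Cons a ns)
  obtain ms where ms: "csum ms = Suc a" "set (gl k ms) = L \<inter> {k<..<k + Suc a}"
    using gl_surj[of "L \<inter> {k<..<k + Suc a}" k "Suc a"] by auto
  obtain mss where mss: "mss \<in> refine ns" "set (gl (Suc (k + a)) (concat mss)) = L \<inter> {Suc (k + a)<..}"
  proof -
    have "L \<inter> {Suc (k + a)<..} \<subseteq> set (gl (Suc (k + a)) ns)"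
      using Cons.prems unfolding set_gl_Cons by auto
    from Cons.IH[OF this] show thesis by (auto intro: that)
  qed
  have "x \<in> {k<..<k + Suc a} \<union> {Suc (k + a)<..}" if "x \<in> L" for x
  proof -
    have "x \<in> {k<..k + a} \<or> x \<in> {Suc (k + a)<..<Suc (k + a) + csum ns}"
      using that Cons.prems set_gl[of "Suc (k + a)" ns] unfolding set_gl_Cons by blast
    then show ?thesis by auto
  qed
  then have "L \<inter> {k<..<k + Suc a} \<union> L \<inter> {Suc (k + a)<..} = L" by blast
  then have "set (gl k (concat (ms # mss))) = L"
    unfolding set_gl_refine[OF ms(1) mss(1)] ms(2) mss(2) .
  then show ?case using ms mss by (intro bexI[of _ "ms # mss"]) (auto simp: comps_def)
qed simp

text \<open>A refinement cuts each block independently, and within one block compositions correspond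
  to subsets of its gaps. Boundaries between blocks of \<open>ns\<close> are boundaries of every
  refinement.\<close>

lemma refine_gl_bij: "bij_betw (\<lambda>mss. set (gl k (concat mss))) (refine ns) (Pow (set (gl k ns)))"
  unfolding bij_betw_def
proof (intro conjI refine_gl_inj equalityI subsetI)
  fix L assume "L \<in> Pow (set (gl k ns))"
  then show "L \<in> (\<lambda>mss. set (gl k (concat mss))) ` refine ns" using refine_gl_surj[of L k ns] by blast
next
  have sub: "set (gl k (concat mss)) \<subseteq> set (gl k ns)" if "mss \<in> refine ns" for mss
    using that
  proof (induction ns arbitrary: k mss)
    case (Cons a ns)
    then obtain m r where m: "mss = m # r" "csum m = Suc a" "r \<in> refine ns"
      unfolding refine_Cons_iff by blast
    show ?case
      unfolding m(1) set_gl_refine[OF m(2,3)] set_gl_Cons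
      using set_gl[of k m] Cons.IH[OF m(3), of "Suc (k + a)"] m(2) by auto
  qed simp
  fix L assume "L \<in> (\<lambda>mss. set (gl k (concat mss))) ` refine ns"
  then show "L \<in> Pow (set (gl k ns))" using sub by auto
qed

section \<open>Renumbering the gaps that remain\<close>

lemma card_less_step:
  fixes L :: "nat set"
  assumes "finite L" "L \<inter> {k<..<x} = S"
  shows "k < x \<Longrightarrow> card {l \<in> L. l < x} = card {l \<in> L. l \<le> k} + card S"
proof -
  assume "k < x"
  then have "{l \<in> L. l < x} = {l \<in> L. l \<le> k} \<union> S" "{l \<in> L. l \<le> k} \<inter> S = {}"
    using assms(2) by auto
  moreover have "finite S" using assms by (metis finite_Int)
  ultimately show ?thesis using assms(1) by (simp add: card_Un_disjoint)
qed

text \<open>Inside one block the positions outside L are the boundaries between consecutive small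
  blocks. The first small block contributes b gaps to L, so its end \<open>k + b + 1\<close> is
  renumbered to \<open>k - c + 1\<close>, and each further boundary to the next integer.\<close>

lemma rn_block:
  assumes "finite L" "L \<inter> {k<..k + csum ms} = set (gl k ms)" "card {l \<in> L. l \<le> k} = c" "c \<le> k"
  shows "rn L ` ({k<..<k + csum ms} - L) = {k - c<..<k - c + length ms}"
  using assms(2-)
proof (induction ms arbitrary: k c)
  case (Cons b ms)
  show ?case
  proof (cases "ms = []")
    case True
    have "{k<..<k + csum (b # ms)} \<subseteq> set (gl k (b # ms))"
      unfolding set_gl_Cons by (auto simp: True)
    then have "{k<..<k + csum (b # ms)} - L = {}" unfolding Cons.prems(1)[symmetric] by blast
    moreover have "{k - c<..<k - c + length (b # ms)} = {}" by (auto simp: True)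
    ultimately show ?thesis by (simp only: image_empty)
  next
    case False
    then have pos: "csum ms > 0" by (cases ms) simp_all
    let ?k = "Suc (k + b)"
    have tl: "x \<notin> set (gl ?k ms)" if "x \<le> ?k" for x
      using that set_gl[of ?k ms] by auto
    have eq: "x \<in> L \<longleftrightarrow> x \<le> k + b \<or> x \<in> set (gl ?k ms)" if x: "k < x" "x \<le> ?k + csum ms" for x
    proof -
      have "x \<in> L \<longleftrightarrow> x \<in> L \<inter> {k<..k + csum (b # ms)}" using x by simp
      also have "\<dots> \<longleftrightarrow> x \<le> k + b \<or> x \<in> set (gl ?k ms)"
        unfolding Cons.prems(1) set_gl_Cons using x(1) by auto
      finally show ?thesis .
    qed
    have notin: "?k \<notin> L" using eq[of ?k] tl[of ?k] by simp
    have blk: "L \<inter> {k<..<?k} = {k<..k + b}"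
    proof (intro equalityI subsetI)
      fix x assume "x \<in> {k<..k + b}" then show "x \<in> L \<inter> {k<..<?k}" using eq[of x] by simp
    qed simp
    have cb: "card {l \<in> L. l < ?k} = c + b"
      using card_less_step[OF assms(1) blk] Cons.prems(2) by simp
    have "{l \<in> L. l \<le> ?k} = {l \<in> L. l < ?k}" using notin by (auto simp: order_le_less)
    then have c': "card {l \<in> L. l \<le> ?k} = c + b" using cb by simp
    have L': "L \<inter> {?k<..?k + csum ms} = set (gl ?k ms)"
    proof (intro equalityI subsetI)
      fix x assume "x \<in> L \<inter> {?k<..?k + csum ms}"
      then show "x \<in> set (gl ?k ms)" using eq[of x] by simp
    next
      fix x assume x: "x \<in> set (gl ?k ms)"
      then have "x \<in> {?k<..<?k + csum ms}" using set_gl by blast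
      then show "x \<in> L \<inter> {?k<..?k + csum ms}" using eq[of x] x by simp
    qed
    have "x \<in> {k<..<k + csum (b # ms)} - L \<longleftrightarrow> x \<in> insert ?k ({?k<..<?k + csum ms} - L)" for x
    proof (cases x ?k rule: linorder_cases)
      case less
      then have "x \<in> L" if "k < x" using that eq[of x] by simp
      then show ?thesis using less by auto
    next
      case equal
      then show ?thesis using notin pos by simp
    next
      case greater
      then show ?thesis by auto
    qed
    then have set: "{k<..<k + csum (b # ms)} - L = insert ?k ({?k<..<?k + csum ms} - L)" by blast
    have head: "rn L ?k = Suc (k - c)" using cb Cons.prems(3) by (simp add: rn_def)
    have "Suc (k + b) - (c + b) = Suc (k - c)" using Cons.prems(3) by simp
    then have tail: "rn L ` ({?k<..<?k + csum ms} - L) = {Suc (k - c)<..<Suc (k - c) + length ms}"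
      using Cons.IH[OF L' c'] Cons.prems(3) by simp
    have "insert (Suc (k - c)) {Suc (k - c)<..<Suc (k - c) + length ms} = {k - c<..<k - c + length (b # ms)}"
      using False by (cases ms) auto
    then show ?thesis by (simp only: set image_insert head tail)
  qed
qed simp

text \<open>Applying \<open>rn_block\<close> to each block of \<open>ns\<close> gives the gaps of
  the coarse decomposition of the shortened word. The number c of elements of L up to k is the shift
  of the origin accumulated so far.\<close>

lemma rn_gl:
  assumes "finite L" "L \<inter> {k<..k + csum ns} = set (gl k (concat mss))" "card {l \<in> L. l \<le> k} = c" "c \<le> k"
    "mss \<in> refine ns"
  shows "rn L ` (set (gl k ns) - L) = set (gl (k - c) (rd mss))"
  using assms(2-)
proof (induction ns arbitrary: k c mss)
  case (Cons a ns)
  obtain m r where m: "mss = m # r" "csum m = Suc a" "r \<in> refine ns"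
    using Cons.prems(4) unfolding refine_Cons_iff by blast
  let ?k = "Suc (k + a)"
  have eq: "x \<in> L \<longleftrightarrow> x \<in> set (gl k m) \<or> x \<in> set (gl ?k (concat r))"
    if "k < x" "x \<le> k + csum (a # ns)" for x
  proof -
    have "x \<in> L \<longleftrightarrow> x \<in> L \<inter> {k<..k + csum (a # ns)}" using that by simp
    then show ?thesis unfolding Cons.prems(1) m(1) set_gl_refine[OF m(2,3)] by blast
  qed
  have hdb: "x \<in> set (gl k m) \<Longrightarrow> k < x \<and> x < ?k" for x
    using set_gl[of k m] by (auto simp: m(2))
  have tlb: "x \<in> set (gl ?k (concat r)) \<Longrightarrow> ?k < x \<and> x < ?k + csum ns" for x
    using set_gl[of ?k "concat r"] by (auto simp: csum_concat_refine[OF m(3)])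
  have L1: "L \<inter> {k<..k + csum m} = set (gl k m)"
  proof (intro equalityI subsetI)
    fix x assume "x \<in> L \<inter> {k<..k + csum m}"
    then show "x \<in> set (gl k m)" using eq[of x] tlb[of x] by (auto simp: m(2))
  next
    fix x assume "x \<in> set (gl k m)"
    then show "x \<in> L \<inter> {k<..k + csum m}" using eq[of x] hdb[of x] by (simp add: m(2))
  qed
  have L2: "L \<inter> {?k<..?k + csum ns} = set (gl ?k (concat r))"
  proof (intro equalityI subsetI)
    fix x assume "x \<in> L \<inter> {?k<..?k + csum ns}"
    then show "x \<in> set (gl ?k (concat r))" using eq[of x] hdb[of x] by auto
  next
    fix x assume "x \<in> set (gl ?k (concat r))"
    then show "x \<in> L \<inter> {?k<..?k + csum ns}" using eq[of x] tlb[of x] by simp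
  qed
  have "L \<inter> {k<..<Suc ?k} = set (gl k m)" unfolding L1[symmetric] by (auto simp: m(2))
  from card_less_step[OF assms(1) this] have "card {l \<in> L. l \<le> ?k} = c + sum_list m"
    by (simp add: card_set_gl Cons.prems(2) less_Suc_eq_le)
  moreover have lm: "sum_list m + length m = Suc a" using m(2) by (simp add: csum_eq)
  ultimately have tl: "rn L ` (set (gl ?k ns) - L) = set (gl (?k - (c + sum_list m)) (rd r))"
    using Cons.IH[OF L2 _ _ m(3)] Cons.prems(3) by simp
  have hd: "rn L ` ({k<..k + a} - L) = {k - c<..<k - c + length m}"
  proof -
    have "{k<..k + a} = {k<..<k + csum m}" by (auto simp: m(2))
    then show ?thesis using rn_block[OF assms(1) L1 Cons.prems(2,3)] by simp
  qed
  have "m \<noteq> []" using m(2) by auto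
  then have len: "length m = Suc (length m - 1)" by simp
  have k: "?k - (c + sum_list m) = Suc (k - c + (length m - 1))"
    using lm len Cons.prems(3) by linarith
  have blk: "{k - c<..<k - c + length m} = {k - c<..k - c + (length m - 1)}"
    by (subst len) auto
  show ?case
    unfolding set_gl_Cons m(1) list.map Un_Diff image_Un tl hd k blk ..
qed simp

text \<open>The hinge between tuples and blocks: if the right tuple consists of the gaps inside the
  small blocks, the left tuple consists of the gaps between small blocks of the same large block,
  counted after each small block has become one letter.\<close>

lemma lft_gl:
  assumes "mss \<in> refine ns"
  shows "lft (gl 0 ns) (set (gl 0 (concat mss))) = gl 0 (rd mss)"
proof -
  have "rn (set (gl 0 (concat mss))) ` (set (gl 0 ns) - set (gl 0 (concat mss))) = set (gl (0 - 0) (rd mss))"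
  proof (rule rn_gl[OF _ _ _ _ assms])
    show "set (gl 0 (concat mss)) \<inter> {0<..0 + csum ns} = set (gl 0 (concat mss))"
      using set_gl[of 0 "concat mss"] csum_concat_refine[OF assms] by auto
    show "card {l \<in> set (gl 0 (concat mss)). l \<le> 0} = 0"
      using set_gl[of 0 "concat mss"] by auto
  qed simp_all
  then show ?thesis by (simp add: lft_def sorted_list_of_set_gl)
qed

lemma finsum_split_terms:
  assumes M: "abelian_group M" and \<phi>: "\<And>mss. mss \<in> refine ns \<Longrightarrow> \<phi> (gl 0 (rd mss)) (gl 0 (concat mss)) \<in> carrier M"
  shows "(\<Oplus>\<^bsub>M\<^esub>L\<in>Pow (set (gl 0 ns)). split_term (gl 0 ns) M e \<phi> L) =
    (\<Oplus>\<^bsub>M\<^esub>mss\<in>refine ns. signed M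
       (int (sum_list (gl 0 ns) + sum_list (gl 0 (rd mss)) + sum_list (gl 0 (concat mss))) + e)
       (\<phi> (gl 0 (rd mss)) (gl 0 (concat mss))))"
proof -
  interpret M: abelian_group M by (fact M)
  let ?g = "\<lambda>mss. set (gl 0 (concat mss))"
  have st: "split_term (gl 0 ns) M e \<phi> (?g mss) = signed M
       (int (sum_list (gl 0 ns) + sum_list (gl 0 (rd mss)) + sum_list (gl 0 (concat mss))) + e)
       (\<phi> (gl 0 (rd mss)) (gl 0 (concat mss)))" if "mss \<in> refine ns" for mss
    by (simp only: split_term_def[OF sorted_gl] lft_gl[OF that] sorted_list_of_set_gl)
  have cl: "split_term (gl 0 ns) M e \<phi> (?g mss) \<in> carrier M" if "mss \<in> refine ns" for mss
    unfolding st[OF that] using \<phi>[OF that] by (simp add: signed_def)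
  have im: "?g ` refine ns = Pow (set (gl 0 ns))" using refine_gl_bij by (rule bij_betw_imp_surj_on)
  have "(\<Oplus>\<^bsub>M\<^esub>L\<in>?g ` refine ns. split_term (gl 0 ns) M e \<phi> L) =
      (\<Oplus>\<^bsub>M\<^esub>mss\<in>refine ns. split_term (gl 0 ns) M e \<phi> (?g mss))"
    by (rule M.finsum_reindex[OF _ refine_gl_inj]) (use cl in auto)
  also have "\<dots> = (\<Oplus>\<^bsub>M\<^esub>mss\<in>refine ns. signed M
       (int (sum_list (gl 0 ns) + sum_list (gl 0 (rd mss)) + sum_list (gl 0 (concat mss))) + e)
       (\<phi> (gl 0 (rd mss)) (gl 0 (concat mss))))"
    using cl st by (intro M.finsum_cong') auto
  finally show ?thesis by (simp only: im)
qed

text \<open>An extreme index stays extreme: in the right tuple it is unchanged, while in the left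
  tuple 0 stays 0 and n becomes n - card L, the top index of the shortened word. So every composite
  belonging to such a tuple contains a vanishing factor.\<close>

lemma split_outside:
  assumes I: "sorted_wrt (<) I" "set I \<subseteq> {0..n}" "\<not> set I \<subseteq> {1..<n}" and L: "L \<subseteq> set I"
  shows "\<not> L \<subseteq> {1..<n} \<or> \<not> set (lft I L) \<subseteq> {1..<n - card L}"
proof -
  have fin: "finite L" using L by (rule finite_subset) simp
  obtain i where i: "i \<in> set I" "i = 0 \<or> i = n" using I(2,3) by force
  show ?thesis
  proof (cases "i \<in> L")
    case True
    then show ?thesis using i by auto
  next
    case False
    then have mem: "rn L i \<in> set (lft I L)" using i(1) by (simp add: lft_def)
    have "rn L i = 0 \<or> rn L i = n - card L"
    proof (cases "i = 0")
      case False
      with i have i: "i = n" by simp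
      have "{l \<in> L. l < i} = L" using L I(2) \<open>i \<notin> L\<close> unfolding i by (auto simp: order_le_less)
      then show ?thesis by (simp add: rn_def i)
    qed (simp add: rn_def)
    then show ?thesis using mem by force
  qed
qed

section \<open>Families of maps indexed by tuples\<close>

lemma index_tuples_gl: "gl 0 ns \<in> index_tuples (csum ns)" "set (gl 0 ns) \<subseteq> {1..<csum ns}"
  using set_gl[of 0 ns] by (auto simp: index_tuples_def sorted_gl csum_eq)

lemma index_tuples_cases:
  assumes "I \<in> index_tuples n" "set I \<subseteq> {1..<n}"
  obtains ns where "n = csum ns" "I = gl 0 ns"
proof -
  have "set I \<subseteq> {0<..<0 + n}" using assms(2) by auto
  then obtain ns where ns: "csum ns = n" "set (gl 0 ns) = set I" using gl_surj by blast
  have "sorted_wrt (<) I" using assms(1) by (simp add: index_tuples_def)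
  from strict_sorted_eq_sorted_list_of_set[OF this] have "I = gl 0 ns"
    unfolding ns(2)[symmetric] sorted_list_of_set_gl .
  then show ?thesis by (rule that[OF ns(1)[symmetric]])
qed

text \<open>Read off from the corresponding shuffle, where the left tuple has as many entries as the
  left part of the permuted list.\<close>

lemma length_lft:
  assumes "sorted_wrt (<) I" "L \<subseteq> set I"
  shows "length (lft I L) + card L = length I"
proof -
  obtain \<sigma> m where "(\<sigma>, m) \<in> all_splits I" "L = split_set I (\<sigma>, m)"
    using bij_betw_imp_surj_on[OF split_set_bij[OF assms(1)]] assms(2) by (metis PowI imageE surj_pair)
  moreover from this(1) have "\<sigma> permutes {..<length I}" "m \<le> length I" by (auto simp: all_splits_def)
  moreover have "distinct I" using assms(1) by (simp add: strict_sorted_iff)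
  ultimately show ?thesis
    using all_splits_parts(3)[OF assms(1), of \<sigma> m]
    by (simp add: split_set_def[OF assms(1)] distinct_card flip: all_splits_parts(3)[OF assms(1)])
qed

text \<open>At most n - i elements of L exceed i, so at least card L - (n - i) lie below it; hence
  the renumbered index is at most n - card L.\<close>

lemma lft_index_tuples:
  assumes I: "I \<in> index_tuples n" and L: "L \<subseteq> set I"
  shows "lft I L \<in> index_tuples (n - card L)" "rgt L \<in> index_tuples n" "card L \<le> length I"
proof -
  have I': "sorted_wrt (<) I" "set I \<subseteq> {0..n}" "length I \<le> n" using I by (auto simp: index_tuples_def)
  have fin: "finite L" using L finite_subset by auto
  have len: "length (lft I L) + card L = length I" by (rule length_lft) (fact I' L)+
  then show le: "card L \<le> length I" by simp
  have "rn L i \<le> n - card L" if "i \<in> set I - L" for i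
  proof -
    have "L = {l \<in> L. l < i} \<union> {l \<in> L. i < l}" using that by (auto simp: not_less order_le_less)
    then have "card L \<le> card {l \<in> L. l < i} + card {l \<in> L. i < l}" by (metis card_Un_le)
    also have "card {l \<in> L. i < l} \<le> card {i<..n}" using L I'(2) by (intro card_mono) auto
    finally have "card L \<le> card {l \<in> L. l < i} + (n - i)" by simp
    moreover have "i \<le> n" using that I'(2) by auto
    ultimately show ?thesis unfolding rn_def by linarith
  qed
  then show "lft I L \<in> index_tuples (n - card L)"
    using len I'(3) by (auto simp: index_tuples_def lft_def)
  show "rgt L \<in> index_tuples n"
    using fin L I' le by (auto simp: index_tuples_def)
qed

text \<open>Computed in the integers and then truncated, because e is -1 for faces and -2 for
  composites of two faces.\<close>

definition deg :: "int \<Rightarrow> nat \<Rightarrow> nat \<Rightarrow> nat" where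
  "deg e q k = nat (int q + int k + e)"

text \<open>The exponent of the sign between the map with index \<open>I\<close> on \<open>A\<^sup>\<otimes>\<^sup>n\<close> in degree \<open>q\<close> and its
  counterpart in the bar construction, for a family of degree \<open>e\<close>.\<close>

definition rsign :: "int \<Rightarrow> nat list \<Rightarrow> nat \<Rightarrow> nat \<Rightarrow> int" where
  "rsign e I n q = int (sum_list I) + e * (int n + 1) + int (length I) * (int q + e) + int (length I choose 2)"

lemma rsign_compose:
  assumes k: "length I = length J + length L" and n: "n' + length L = n"
    and q: "int q' = int q + int (length L) + e2"
  shows "even (int (sum_list I + sum_list J + sum_list L) + e + (rsign e2 L n q + rsign e1 J n' q')
    + (rsign (e1 + e2) I n q + e))"
proof -
  define j l where "j = length J" and "l = length L"
  have ch: "int (j + l choose 2) = int (j choose 2) + int (l choose 2) + int j * int l" for j l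
    by (induction l) (simp_all add: numeral_2_eq_2 algebra_simps)
  have n': "int n' = int n - int l" using n by (simp add: l_def)
  have "int (sum_list I + sum_list J + sum_list L) + e + (rsign e2 L n q + rsign e1 J n' q')
    + (rsign (e1 + e2) I n q + e) =
    2 * (int (sum_list I) + int (sum_list J) + int (sum_list L) + e + (e1 + e2) * (int n + 1) + int l * (int q + e2)
      + int j * (int q + e1 + e2) + int j * int l + int (j choose 2) + int (l choose 2))"
    unfolding rsign_def k q n' j_def[symmetric] l_def[symmetric] ch by (simp add: algebra_simps)
  then show ?thesis by simp
qed

lemma if_parity:
  "even (k + s + t :: int) \<Longrightarrow>
    (if even k then if even s then p else - p else - (if even s then p else - p)) =
    (if even t then p else - p :: 'b :: ab_group_add)"
  by auto

lemma (in graded_module) signed_ev: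
  "signed (T n q) s (ev n q p) = ev n q (if even s then p else - p)"
  by (simp add: signed_def ev_minus)

context graded_modules
begin

text \<open>All that the later arguments need to know about a family: linearity, vanishing on tuples
  with an extreme index, and agreement up to \<open>rsign\<close> with a family of cochains on the
  remaining tuples. Where the target degree would be negative there is no module to compare in, and
  the cochain has to vanish.\<close>

definition represents :: "int \<Rightarrow> (nat list \<Rightarrow> 'a word \<Rightarrow> 'b frag) \<Rightarrow>
    (nat list \<Rightarrow> nat \<Rightarrow> nat \<Rightarrow> ('k, 'a) tensor \<Rightarrow> ('k, 'b) tensor) \<Rightarrow> bool" where
  "represents e \<phi> \<Phi> \<longleftrightarrow>
     (\<forall>n q. \<forall>I\<in>index_tuples n. \<Phi> I n q \<in> lin_maps R (A.T n q) (B.T (n - length I) (deg e q (length I)))) \<and>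
     (\<forall>n q. \<forall>I\<in>index_tuples n. \<not> set I \<subseteq> {1..<n} \<longrightarrow> (\<forall>x\<in>carrier (A.T n q).
        \<Phi> I n q x = \<zero>\<^bsub>B.T (n - length I) (deg e q (length I))\<^esub>)) \<and>
     (\<forall>ns q. \<forall>w\<in>words A (csum ns) q.
        if int q + int (sum_list ns) + e < 0 then \<phi> ns w = 0
        else Poly_Mapping.keys (\<phi> ns w) \<subseteq> words B (length ns) (deg e q (sum_list ns)) \<and>
          \<Phi> (gl 0 ns) (csum ns) q (A.ev (csum ns) q (frag_of w)) =
            signed (B.T (length ns) (deg e q (sum_list ns))) (rsign e (gl 0 ns) (csum ns) q)
              (B.ev (length ns) (deg e q (sum_list ns)) (\<phi> ns w)))"

lemma representsD:
  assumes "represents e \<phi> \<Phi>"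
  shows "I \<in> index_tuples n \<Longrightarrow> \<Phi> I n q \<in> lin_maps R (A.T n q) (B.T (n - length I) (deg e q (length I)))"
    and "I \<in> index_tuples n \<Longrightarrow> \<not> set I \<subseteq> {1..<n} \<Longrightarrow> x \<in> carrier (A.T n q) \<Longrightarrow>
      \<Phi> I n q x = \<zero>\<^bsub>B.T (n - length I) (deg e q (length I))\<^esub>"
    and "w \<in> words A (csum ns) q \<Longrightarrow> int q + int (sum_list ns) + e < 0 \<Longrightarrow> \<phi> ns w = 0"
    and "w \<in> words A (csum ns) q \<Longrightarrow> 0 \<le> int q + int (sum_list ns) + e \<Longrightarrow>
      Poly_Mapping.keys (\<phi> ns w) \<subseteq> words B (length ns) (deg e q (sum_list ns))"
    and "w \<in> words A (csum ns) q \<Longrightarrow> 0 \<le> int q + int (sum_list ns) + e \<Longrightarrow>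
      \<Phi> (gl 0 ns) (csum ns) q (A.ev (csum ns) q (frag_of w)) =
            signed (B.T (length ns) (deg e q (sum_list ns))) (rsign e (gl 0 ns) (csum ns) q)
              (B.ev (length ns) (deg e q (sum_list ns)) (\<phi> ns w))"
proof -
  note r = assms[unfolded represents_def]
  show "I \<in> index_tuples n \<Longrightarrow> \<Phi> I n q \<in> lin_maps R (A.T n q) (B.T (n - length I) (deg e q (length I)))"
    using r[THEN conjunct1] by blast
  show "I \<in> index_tuples n \<Longrightarrow> \<not> set I \<subseteq> {1..<n} \<Longrightarrow> x \<in> carrier (A.T n q) \<Longrightarrow>
      \<Phi> I n q x = \<zero>\<^bsub>B.T (n - length I) (deg e q (length I))\<^esub>"
    using r[THEN conjunct2, THEN conjunct1] by blast
  note w = r[THEN conjunct2, THEN conjunct2, rule_format, of w ns q]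
  show "w \<in> words A (csum ns) q \<Longrightarrow> int q + int (sum_list ns) + e < 0 \<Longrightarrow> \<phi> ns w = 0"
    using w by (simp only: if_True)
  assume "w \<in> words A (csum ns) q" "0 \<le> int q + int (sum_list ns) + e"
  then have "\<not> int q + int (sum_list ns) + e < 0" by simp
  with w[OF \<open>w \<in> words A (csum ns) q\<close>] show "Poly_Mapping.keys (\<phi> ns w) \<subseteq> words B (length ns) (deg e q (sum_list ns))"
    "\<Phi> (gl 0 ns) (csum ns) q (A.ev (csum ns) q (frag_of w)) =
            signed (B.T (length ns) (deg e q (sum_list ns))) (rsign e (gl 0 ns) (csum ns) q)
              (B.ev (length ns) (deg e q (sum_list ns)) (\<phi> ns w))"
    by (simp_all only: if_False)
qed

end

text \<open>The guard concerns the intermediate degree. Truncation would otherwise let the left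
  factor act on a value in degree 0 that stands for degree -1; the same convention is built into
  \<open>hom_diff\<close> at degree 0.\<close>

definition opc :: "('k, 'z) module \<Rightarrow> int \<Rightarrow> (nat list \<Rightarrow> nat \<Rightarrow> nat \<Rightarrow> 'y \<Rightarrow> 'z) \<Rightarrow> (nat list \<Rightarrow> nat \<Rightarrow> nat \<Rightarrow> 'x \<Rightarrow> 'y) \<Rightarrow>
    nat \<Rightarrow> nat \<Rightarrow> 'x \<Rightarrow> nat list \<Rightarrow> nat list \<Rightarrow> 'z" where
  "opc M e \<Phi> \<Psi> n q x J L = (if int q + int (length L) + e < 0 then \<zero>\<^bsub>M\<^esub>
     else \<Phi> J (n - length L) (deg e q (length L)) (\<Psi> L n q x))"

locale graded_triple = AB: graded_modules R A B + BC: graded_modules R B C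
  for R (structure) and A :: "nat \<Rightarrow> ('k, 'a) module" and B :: "nat \<Rightarrow> ('k, 'b) module"
    and C :: "nat \<Rightarrow> ('k, 'c) module"
begin

lemma opc_lin:
  assumes \<Psi>: "AB.represents e2 \<psi> \<Psi>" and \<Phi>: "BC.represents e1 \<phi> \<Phi>"
    and I: "I \<in> index_tuples n" and L: "L \<subseteq> set I" and pos: "0 \<le> int q + int (length I) + e1 + e2"
  shows "(\<lambda>x. opc (BC.B.T (n - length I) (deg (e1 + e2) q (length I))) e2 \<Phi> \<Psi> n q x (lft I L) (rgt L))
    \<in> lin_maps R (AB.A.T n q) (BC.B.T (n - length I) (deg (e1 + e2) q (length I)))" (is "?f \<in> lin_maps R ?A ?M")
proof -
  have fin: "finite L" using L finite_subset by auto
  note tup = lft_index_tuples[OF I L]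
  have len: "length (rgt L) = card L" "length (lft I L) + card L = length I"
    using length_lft[of I L] I L fin by (auto simp: index_tuples_def)
  show ?thesis
  proof (cases "int q + int (card L) + e2 < 0")
    case True
    then have "?f = (\<lambda>x. \<zero>\<^bsub>?M\<^esub>)" by (simp add: opc_def len(1))
    then show ?thesis by (simp only:) (rule lin_maps_const_zero[OF BC.B.T_module])
  next
    case False
    have \<Psi>l: "\<Psi> (rgt L) n q \<in> lin_maps R ?A (AB.B.T (n - card L) (deg e2 q (card L)))"
      using AB.representsD(1)[OF \<Psi> tup(2)] by (simp add: len(1))
    have N: "n - card L - length (lft I L) = n - length I" using len(2) by simp
    have Q: "deg e1 (deg e2 q (card L)) (length (lft I L)) = deg (e1 + e2) q (length I)"
      using False len(2) by (simp add: deg_def algebra_simps)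
    note \<Phi>l = BC.representsD(1)[OF \<Phi> tup(1), of "deg e2 q (card L)", unfolded N Q]
    have "?f = (\<lambda>x. \<Phi> (lft I L) (n - card L) (deg e2 q (card L)) (\<Psi> (rgt L) n q x))"
      using False by (simp add: opc_def len(1))
    then show ?thesis by (simp only:) (rule lin_maps_compose[OF \<Phi>l \<Psi>l])
  qed
qed

text \<open>Both factors are replaced by their cochains, and \<open>rsign_compose\<close> merges
  their signs with that of the splitting into one sign independent of the refinement.\<close>

lemma opc_word:
  assumes \<Psi>: "AB.represents e2 \<psi> \<Psi>" and \<Phi>: "BC.represents e1 \<phi> \<Phi>"
    and pos: "0 \<le> int q + int (sum_list ns) + e1 + e2"
    and w: "w \<in> words A (csum ns) q" and mss: "mss \<in> refine ns"
  defines "Q \<equiv> deg (e1 + e2) q (sum_list ns)"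
  shows "signed (BC.B.T (length ns) Q)
      (int (sum_list (gl 0 ns) + sum_list (gl 0 (rd mss)) + sum_list (gl 0 (concat mss))) + e)
      (opc (BC.B.T (length ns) Q) e2 \<Phi> \<Psi> (csum ns) q (AB.A.ev (csum ns) q (frag_of w)) (gl 0 (rd mss)) (gl 0 (concat mss))) =
    BC.B.ev (length ns) Q (if even (rsign (e1 + e2) (gl 0 ns) (csum ns) q + e)
      then frag_extend (\<phi> (rd mss)) (\<psi> (concat mss) w) else - frag_extend (\<phi> (rd mss)) (\<psi> (concat mss) w))"
proof -
  define m where "m = concat mss"
  have cm: "csum m = csum ns" unfolding m_def by (rule csum_concat_refine[OF mss])
  have "mss \<in> refine ns \<Longrightarrow> csum (rd mss) = length (concat mss) \<and> length mss = length ns"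
    for mss :: "nat list list" and ns
  proof (induction ns arbitrary: mss)
    case (Cons a ns)
    then obtain ms r where "mss = ms # r" "csum ms = Suc a" "r \<in> refine ns" unfolding refine_Cons_iff by blast
    moreover from this(2) have "ms \<noteq> []" by auto
    ultimately show ?case using Cons.IH[of r] by (cases ms) auto
  qed simp
  from this[OF mss] have rd: "csum (rd mss) = length m" "length (rd mss) = length ns" by (simp_all add: m_def)
  have sums: "sum_list (rd mss) + sum_list m = sum_list ns"
    using csum_eq[of m] csum_eq[of ns] csum_eq[of "rd mss"] cm rd by simp
  have lenm: "csum ns - sum_list m = length m" using csum_eq[of m] cm by simp
  let ?M = "BC.B.T (length ns) Q"
  have wm: "w \<in> words A (csum m) q" using w cm by simp
  show ?thesis
  proof (cases "int q + int (sum_list m) + e2 < 0")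
    \<comment> \<open>The intermediate degree is negative: the composite is 0 by the convention of
      \<open>opc\<close>, and the right cochain vanishes by \<open>represents\<close>.\<close>
    case True
    then have "\<psi> m w = 0" using AB.representsD(3)[OF \<Psi> wm] by simp
    moreover have "signed ?M k \<zero>\<^bsub>?M\<^esub> = \<zero>\<^bsub>?M\<^esub>" for k
    proof -
      interpret M: module R ?M by (rule BC.B.T_module)
      show ?thesis by (simp add: signed_def)
    qed
    ultimately show ?thesis using True by (simp add: opc_def m_def[symmetric] BC.B.ev_zero)
  next
    case False
    define q2 where "q2 = deg e2 q (sum_list m)"
    have q2: "int q2 = int q + int (sum_list m) + e2" using False by (simp add: q2_def deg_def)
    have pos2: "0 \<le> int q2 + int (sum_list (rd mss)) + e1" using pos sums by (simp add: q2)
    have Q: "deg e1 q2 (sum_list (rd mss)) = Q"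
      using sums by (simp add: Q_def deg_def q2 flip: sums)
    define s where "s = rsign e2 (gl 0 m) (csum ns) q"
    define s' where "s' = rsign e1 (gl 0 (rd mss)) (length m) q2"
    have v1: "\<Psi> (gl 0 m) (csum ns) q (AB.A.ev (csum ns) q (frag_of w)) =
        AB.B.ev (length m) q2 (if even s then \<psi> m w else - \<psi> m w)"
      using AB.representsD(5)[OF \<Psi> wm] False
      by (simp add: cm q2_def[symmetric] s_def[symmetric] AB.B.signed_ev)
    have "Poly_Mapping.keys (\<psi> m w) \<subseteq> words B (length m) q2"
      using AB.representsD(4)[OF \<Psi> wm] False by (simp add: q2_def)
    then have keys: "Poly_Mapping.keys (if even s then \<psi> m w else - \<psi> m w) \<subseteq> words B (length m) q2" by simp
    have \<Phi>l: "\<Phi> (gl 0 (rd mss)) (length m) q2 \<in> lin_maps R (AB.B.T (length m) q2) ?M"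
      using BC.representsD(1)[OF \<Phi> index_tuples_gl(1), of "rd mss" q2] rd Q csum_eq[of "rd mss"] by simp
    have v2: "\<Phi> (gl 0 (rd mss)) (length m) q2 (AB.B.ev (length m) q2 (frag_of v)) =
        BC.B.ev (length ns) Q (if even s' then \<phi> (rd mss) v else - \<phi> (rd mss) v)"
      if "v \<in> words B (length m) q2" for v
    proof -
      have "v \<in> words B (csum (rd mss)) q2" using that by (simp only: rd)
      from BC.representsD(5)[OF \<Phi> this pos2] show ?thesis
        by (simp only: rd Q s'_def[symmetric] BC.B.signed_ev)
    qed
    have v: "\<Phi> (gl 0 (rd mss)) (length m) q2 (\<Psi> (gl 0 m) (csum ns) q (AB.A.ev (csum ns) q (frag_of w))) =
        BC.B.ev (length ns) Q (if even (s + s') then frag_extend (\<phi> (rd mss)) (\<psi> m w)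
          else - frag_extend (\<phi> (rd mss)) (\<psi> m w))"
      unfolding v1 by (subst BC.lin_ev[OF \<Phi>l keys v2])
        (auto simp: frag_extend_minus frag_extend_fun_minus)
    have par: "even (int (sum_list (gl 0 ns) + sum_list (gl 0 (rd mss)) + sum_list (gl 0 m)) + e + (s + s')
        + (rsign (e1 + e2) (gl 0 ns) (csum ns) q + e))"
      unfolding s_def s'_def
      by (rule rsign_compose) (use sums lenm q2 csum_eq[of m] cm in simp_all)
    have opc: "opc ?M e2 \<Phi> \<Psi> (csum ns) q (AB.A.ev (csum ns) q (frag_of w)) (gl 0 (rd mss)) (gl 0 m) =
      BC.B.ev (length ns) Q (if even (s + s') then frag_extend (\<phi> (rd mss)) (\<psi> m w)
          else - frag_extend (\<phi> (rd mss)) (\<psi> m w))"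
      unfolding v[symmetric] using False by (simp only: opc_def length_gl lenm q2_def if_False)
    show ?thesis
      unfolding m_def[symmetric] opc BC.B.signed_ev if_parity[OF par] ..
  qed
qed

text \<open>Since the sign no longer depends on the refinement, it can be pulled out, and the sum
  over subsets is \<open>conv\<close>.\<close>

lemma sum_opc_word:
  assumes \<Psi>: "AB.represents e2 \<psi> \<Psi>" and \<Phi>: "BC.represents e1 \<phi> \<Phi>"
    and pos: "0 \<le> int q + int (sum_list ns) + e1 + e2"
    and w: "w \<in> words A (csum ns) q"
  defines "M \<equiv> BC.B.T (length ns) (deg (e1 + e2) q (sum_list ns))"
  shows "(\<Oplus>\<^bsub>M\<^esub>L\<in>Pow (set (gl 0 ns)). split_term (gl 0 ns) M e
      (opc M e2 \<Phi> \<Psi> (csum ns) q (AB.A.ev (csum ns) q (frag_of w))) L) =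
    signed M (rsign (e1 + e2) (gl 0 ns) (csum ns) q + e)
      (BC.B.ev (length ns) (deg (e1 + e2) q (sum_list ns)) (conv \<phi> \<psi> ns w))"
proof -
  interpret M: module R M unfolding M_def by (rule BC.B.T_module)
  let ?opc = "opc M e2 \<Phi> \<Psi> (csum ns) q (AB.A.ev (csum ns) q (frag_of w))"
  let ?s = "\<lambda>p :: 'c frag. if even (rsign (e1 + e2) (gl 0 ns) (csum ns) q + e) then p else - p"
  have cl: "?opc (gl 0 (rd mss)) (gl 0 (concat mss)) \<in> carrier M" if "mss \<in> refine ns" for mss
  proof -
    have sub: "set (gl 0 (concat mss)) \<subseteq> set (gl 0 ns)"
      using bij_betwE[OF refine_gl_bij[of 0 ns]] that by blast
    have "csum ns - sum_list ns = length ns" by (simp add: csum_eq)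
    then have "(\<lambda>x. opc M e2 \<Phi> \<Psi> (csum ns) q x (gl 0 (rd mss)) (gl 0 (concat mss)))
        \<in> lin_maps R (AB.A.T (csum ns) q) M"
      using opc_lin[OF \<Psi> \<Phi> index_tuples_gl(1) sub, of q] pos
      by (simp add: M_def lft_gl[OF that] sorted_list_of_set_gl)
    from lin_maps_closed[OF this AB.A.ev_closed] show ?thesis .
  qed
  have "(\<Oplus>\<^bsub>M\<^esub>L\<in>Pow (set (gl 0 ns)). split_term (gl 0 ns) M e ?opc L) =
    (\<Oplus>\<^bsub>M\<^esub>mss\<in>refine ns. signed M
       (int (sum_list (gl 0 ns) + sum_list (gl 0 (rd mss)) + sum_list (gl 0 (concat mss))) + e)
       (?opc (gl 0 (rd mss)) (gl 0 (concat mss))))"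
    by (rule finsum_split_terms[OF M.abelian_group_axioms]) (rule cl)
  also have "\<dots> = (\<Oplus>\<^bsub>M\<^esub>mss\<in>refine ns. BC.B.ev (length ns) (deg (e1 + e2) q (sum_list ns))
      (?s (frag_extend (\<phi> (rd mss)) (\<psi> (concat mss) w))))"
    by (rule M.finsum_cong')
      (auto simp only: M_def opc_word[OF \<Psi> \<Phi> pos w] intro!: BC.B.ev_closed)
  also have "\<dots> = BC.B.ev (length ns) (deg (e1 + e2) q (sum_list ns))
      (\<Sum>mss\<in>refine ns. ?s (frag_extend (\<phi> (rd mss)) (\<psi> (concat mss) w)))"
    unfolding M_def by (rule BC.B.ev_sum[symmetric])
  also have "(\<Sum>mss\<in>refine ns. ?s (frag_extend (\<phi> (rd mss)) (\<psi> (concat mss) w))) = ?s (conv \<phi> \<psi> ns w)"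
    by (simp add: conv_def sum_negf)
  finally show ?thesis unfolding M_def BC.B.signed_ev .
qed

lemma opc_outside:
  assumes \<Psi>: "AB.represents e2 \<psi> \<Psi>" and \<Phi>: "BC.represents e1 \<phi> \<Phi>"
    and I: "I \<in> index_tuples n" "\<not> set I \<subseteq> {1..<n}" and pos: "0 \<le> int q + int (length I) + e1 + e2"
    and x: "x \<in> carrier (AB.A.T n q)" and L: "L \<subseteq> set I"
  defines "M \<equiv> BC.B.T (n - length I) (deg (e1 + e2) q (length I))"
  shows "opc M e2 \<Phi> \<Psi> n q x (lft I L) (rgt L) = \<zero>\<^bsub>M\<^esub>"
proof (cases "int q + int (card L) + e2 < 0")
  case True
  then show ?thesis by (simp add: opc_def)
next
  case False
  have fin: "finite L" using L finite_subset by auto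
  note tup = lft_index_tuples[OF I(1) L]
  have I': "sorted_wrt (<) I" "set I \<subseteq> {0..n}" using I(1) by (auto simp: index_tuples_def)
  have len: "length (lft I L) + card L = length I" by (rule length_lft) (fact I' L)+
  let ?q = "deg e2 q (card L)" and ?n = "n - card L"
  have N: "?n - length (lft I L) = n - length I" using len by simp
  have Q: "deg e1 ?q (length (lft I L)) = deg (e1 + e2) q (length I)"
    using False len by (simp add: deg_def algebra_simps)
  note \<Psi>l = AB.representsD(1)[OF \<Psi> tup(2), of q, simplified]
  note \<Phi>l = BC.representsD(1)[OF \<Phi> tup(1), of ?q, unfolded N Q]
  have opc: "opc M e2 \<Phi> \<Psi> n q x (lft I L) (rgt L) = \<Phi> (lft I L) ?n ?q (\<Psi> (rgt L) n q x)"
    using False by (simp add: opc_def)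
  consider "\<not> L \<subseteq> {1..<n}" | "\<not> set (lft I L) \<subseteq> {1..<n - card L}"
    using split_outside[OF I' I(2) L] by blast
  then show ?thesis
  proof cases
    case 1
    then have "\<Psi> (rgt L) n q x = \<zero>\<^bsub>AB.B.T ?n ?q\<^esub>"
      using AB.representsD(2)[OF \<Psi> tup(2) _ x] fin by simp
    then show ?thesis
      unfolding opc by (simp only: lin_maps_zero[OF \<Phi>l AB.B.T_module BC.B.T_module] M_def)
  next
    case 2
    show ?thesis
      unfolding opc
      using BC.representsD(2)[OF \<Phi> tup(1) 2 lin_maps_closed[OF \<Psi>l x]] by (simp only: N Q M_def)
  qed
qed

end

section \<open>The tensor functor in terms of the bar construction\<close>

text \<open>The argument c counts the single letters since the last long block; the pairs are those
  of \<open>block_data\<close>, computed from the decomposition instead of the tuple.\<close>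

fun runs :: "nat \<Rightarrow> nat list \<Rightarrow> (nat \<times> nat) list" where
  "runs c [] = []"
| "runs c (a # ns) = (if a = 0 then runs (Suc c) ns else (Suc c, a) # runs 0 ns)"

text \<open>A strict gap after the run keeps \<open>blocks\<close> from joining it to what
  follows.\<close>

lemma blocks_run:
  "a \<noteq> 0 \<Longrightarrow> (\<And>x. x \<in> set I \<Longrightarrow> k + a < x) \<Longrightarrow> blocks ([k..<k + a] @ I) = [k..<k + a] # blocks I"
proof (induction a arbitrary: k)
  case (Suc a)
  show ?case
  proof (cases "a = 0")
    case True
    then show ?thesis using Suc.prems(2) by (cases I) auto
  next
    case False
    then have run: "[k..<k + Suc a] = k # [Suc k..<Suc k + a]" "[Suc k..<Suc k + a] = Suc k # [Suc (Suc k)..<Suc k + a]"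
      by (simp_all add: upt_conv_Cons del: upt_Suc)
    have IH: "blocks ([Suc k..<Suc k + a] @ I) = [Suc k..<Suc k + a] # blocks I"
      by (rule Suc.IH[OF False]) (use Suc.prems(2) in simp)
    have "blocks (k # Suc k # ([Suc (Suc k)..<Suc k + a] @ I)) =
        (k # hd (blocks (Suc k # ([Suc (Suc k)..<Suc k + a] @ I)))) # tl (blocks (Suc k # ([Suc (Suc k)..<Suc k + a] @ I)))"
      by (simp only: blocks.simps if_True refl)
    also have "Suc k # ([Suc (Suc k)..<Suc k + a] @ I) = [Suc k..<Suc k + a] @ I"
      unfolding run(2) by simp
    finally show ?thesis unfolding IH using run by (simp del: upt_Suc)
  qed
qed simp

text \<open>A single letter contributes no gap and only widens the distance to the next run. The
  hypothesis that the preceding run ended c letters before is carried by the offset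
  \<open>k + c\<close>.\<close>

lemma block_data_gl: "block_data k (blocks (gl (k + c) ns)) = runs c ns"
proof (induction ns arbitrary: k c)
  case (Cons a ns)
  show ?case
  proof (cases "a = 0")
    case True
    then show ?thesis using Cons[of k "Suc c"] by simp
  next
    case False
    have "blocks ([Suc (k + c)..<Suc (k + c) + a] @ gl (Suc (k + c + a)) ns) =
        [Suc (k + c)..<Suc (k + c) + a] # blocks (gl (Suc (k + c + a)) ns)"
      by (rule blocks_run[OF False]) (use set_gl[of "Suc (k + c + a)" ns] in auto)
    then have "block_data k (blocks (gl (k + c) (a # ns))) =
        (Suc c, a) # block_data (Suc (k + c + a)) (blocks (gl (Suc (k + c + a)) ns))"
      using False by (simp add: hd_upt last_upt del: upt_Suc)
    then show ?thesis using False Cons[of "Suc (k + c + a)" 0] by simp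
  qed
qed simp

text \<open>The copies of f_0 written between and after the long factors are the factors of the
  single letters, so the tensor product in the functor is the list of components indexed by
  \<open>ns\<close>.\<close>

lemma concat_runs:
  "concat (map (\<lambda>(ki, ni). replicate (ki - 1) (x 0) @ [x ni]) (runs c ns)) @
    replicate (c + length ns - sum_list (map fst (runs c ns))) (x 0) = replicate c (x 0) @ map x ns"
proof (induction ns arbitrary: c)
  case (Cons a ns)
  show ?case
  proof (cases "a = 0")
    case True
    then show ?thesis using Cons[of "Suc c"] by (simp add: replicate_app_Cons_same)
  next
    case False
    then show ?thesis using Cons[of 0] by simp
  qed
qed simp

lemma snd_runs: "map snd (runs c ns) = filter ((<) 0) ns"
  by (induction ns arbitrary: c) auto

section \<open>The sign of the functor on morphisms\<close>

fun cross :: "nat list \<Rightarrow> nat" where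
  "cross [] = 0"
| "cross (a # ns) = a * sum_list ns + cross ns"

lemma cross_eq: "(\<Sum>i<length ns - 1. ns ! i * sum_list (drop (i + 1) ns)) = cross ns"
proof (induction ns)
  case (Cons a ns)
  show ?case
  proof (cases ns)
    case (Cons b ms)
    then have "(\<Sum>i<length (a # ns) - 1. (a # ns) ! i * sum_list (drop (i + 1) (a # ns))) =
        (\<Sum>i<Suc (length ns - 1). (a # ns) ! i * sum_list (drop (i + 1) (a # ns)))" by simp
    also have "\<dots> = a * sum_list ns + (\<Sum>i<length ns - 1. ns ! i * sum_list (drop (i + 1) ns))"
      by (subst sum.lessThan_Suc_shift) simp
    finally show ?thesis using Cons.IH by simp
  qed simp
qed simp

lemma sum_list_filter_nonzero: "sum_list (filter ((<) 0) ns) = sum_list (ns :: nat list)"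
  by (induction ns) auto

lemma cross_filter: "cross (filter ((<) 0) ns) = cross ns"
  by (induction ns) (auto simp: sum_list_filter_nonzero)

lemma sum_gl_shift: "sum_list (gl k ns) = k * sum_list ns + sum_list (gl 0 ns)"
proof (induction ns arbitrary: k)
  case (Cons a ns)
  have "sum_list [Suc k..<Suc (k + a)] = k * a + sum_list [Suc 0..<Suc a]"
    by (induction a) simp_all
  then show ?case using Cons[of "Suc (k + a)"] Cons[of "Suc a"] by (simp add: algebra_simps del: upt_Suc)
qed simp

lemma choose_2_add: "(j + l choose 2) = (j choose 2) + (l choose 2) + j * l"
  by (induction l) (simp_all add: numeral_2_eq_2 algebra_simps)

lemma sum_upt_choose: "sum_list [Suc 0..<Suc a] = (a choose 2) + a"
  by (induction a) (simp_all add: numeral_2_eq_2)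

text \<open>Compares the functor's exponent k(q - 1) + \<gamma> and the shift \<epsilon> with
  \<open>rsign\<close> for degree 0. In the induction, prepending a block of a + 1 letters raises
  every later gap by a + 1, which matches the change of \<epsilon>, \<gamma> and the binomial
  coefficient.\<close>

lemma mor_parity: "even (sum_list ns + cross ns + eps ns + sum_list (gl 0 ns) + (sum_list ns choose 2))"
proof (induction ns)
  case (Cons a ns)
  have eq: "sum_list (a # ns) + cross (a # ns) + eps (a # ns) + sum_list (gl 0 (a # ns)) + (sum_list (a # ns) choose 2)
    = 2 * (a + a * sum_list ns + (a + 1) * sum_list ns + (a choose 2))
      + (sum_list ns + cross ns + eps ns + sum_list (gl 0 ns) + (sum_list ns choose 2))"
    using sum_gl_shift[of "Suc a" ns] sum_upt_choose[of a]
    by (simp add: eps_Cons choose_2_add algebra_simps del: upt_Suc)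
  show ?case unfolding eq by (rule dvd_add[OF dvd_triv_left Cons])
qed (simp add: eps_def numeral_2_eq_2)

lemma outside_iff:
  assumes "I \<in> index_tuples n"
  shows "\<not> set I \<subseteq> {1..<n} \<longleftrightarrow> I \<noteq> [] \<and> (hd I = 0 \<or> last I = n)"
proof (cases "I = []")
  case False
  have s: "sorted_wrt (<) I" and n: "set I \<subseteq> {0..n}" using assms by (auto simp: index_tuples_def)
  have "hd I \<le> i \<and> i \<le> last I" if "i \<in> set I" for i
    using s that
  proof (induction I)
    case (Cons a I)
    then show ?case by (cases I) (auto simp: less_imp_le)
  qed simp
  moreover have "hd I \<in> set I" "last I \<in> set I" using False by simp_all
  ultimately show ?thesis using n False by fastforce
qed simp

context ainf_pair
begin

lemma tensor_functor_mor_gl: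
  "tensor_functor_mor R A B f (gl 0 ns) (csum ns) q =
    (\<lambda>x. signed (B.T (length ns) (q + sum_list ns))
      (int (sum_list ns) * (int q - 1) + int (cross ns))
      (tensor_maps R (a_mod A) (a_mod B) (map (mor_m f) ns) q x))"
proof -
  have no: "\<not> (gl 0 ns \<noteq> [] \<and> (hd (gl 0 ns) = 0 \<or> last (gl 0 ns) = csum ns))"
    using outside_iff[OF index_tuples_gl(1)] index_tuples_gl(2) by blast
  have n: "csum ns - sum_list ns = length ns" by (simp add: csum_eq)
  have bd: "block_data 0 (blocks (gl 0 ns)) = runs 0 ns" using block_data_gl[of 0 0 ns] by simp
  have "csum ns - (s + sum_list ns) = 0 + length ns - s" for s by (simp add: csum_eq)
  with concat_runs[of "mor_m f" 0 ns] have us: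
    "concat (map (\<lambda>(ki, ni). replicate (ki - 1) (mor_m f 0) @ [mor_m f ni]) (runs 0 ns)) @
      replicate (csum ns - (sum_list (map fst (runs 0 ns)) + sum_list ns)) (mor_m f 0) = map (mor_m f) ns"
    by simp
  show ?thesis
    unfolding fun_eq_iff tensor_functor_mor_def Let_def bd length_gl snd_runs cross_eq cross_filter n us if_not_P[OF no]
    by simp
qed

text \<open>On words this is \<open>tensor_maps_ev\<close> with \<open>kexp\<close> congruent to
  \<epsilon>; the two parity lemmas convert the sign of the functor into
  \<open>rsign\<close>.\<close>

lemma mor_represents:
  assumes f: "mor_ok f"
  shows "represents 0 (Fs (fb f)) (tensor_functor_mor R A B f)"
  unfolding represents_def
proof (intro conjI allI ballI impI)
  fix n q I assume I: "I \<in> index_tuples n"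
  have lin: "\<forall>m\<in>set (map (mor_m f) ns). multi_lin m" for ns using mor_ok_lin[OF f] by auto
  show "tensor_functor_mor R A B f I n q \<in> lin_maps R (A.T n q) (B.T (n - length I) (deg 0 q (length I)))"
  proof (cases "set I \<subseteq> {1..<n}")
    case True
    with I obtain ns where ns: "n = csum ns" "I = gl 0 ns" by (rule index_tuples_cases)
    have "n - length I = length ns" by (simp add: ns csum_eq)
    moreover have "deg 0 q (length I) = q + sum_list ns" by (simp add: deg_def ns nat_int_add)
    ultimately show ?thesis
      unfolding ns tensor_functor_mor_gl
      by (auto simp: ns intro!: lin_maps_signed_fun B.T_module tensor_maps_lin lin[rule_format])
  next
    case False
    then have "tensor_functor_mor R A B f I n q = (\<lambda>x. \<zero>\<^bsub>B.T (n - length I) (q + length I)\<^esub>)"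
      using outside_iff[OF I] by (simp add: tensor_functor_mor_def Let_def fun_eq_iff)
    then show ?thesis by (simp add: deg_def nat_int_add lin_maps_const_zero B.T_module)
  qed
  show "tensor_functor_mor R A B f I n q x = \<zero>\<^bsub>B.T (n - length I) (deg 0 q (length I))\<^esub>"
    if "\<not> set I \<subseteq> {1..<n}" for x
    using that outside_iff[OF I] by (simp add: tensor_functor_mor_def Let_def deg_def nat_int_add)
next
  fix ns q w assume w: "w \<in> words (a_mod A) (csum ns) q"
  have lin: "\<forall>m\<in>set (map (mor_m f) ns). multi_lin m" for ns using mor_ok_lin[OF f] by auto
  have Q: "deg 0 q (sum_list ns) = q + sum_list ns" by (simp add: deg_def nat_int_add)
  have len: "length w = csum ns" using w by (simp add: words_iff)
  have keys: "Poly_Mapping.keys (Fs (fb f) ns w) \<subseteq> words (a_mod B) (length ns) (q + sum_list ns)"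
  proof
    fix v assume "v \<in> Poly_Mapping.keys (Fs (fb f) ns w)"
    from Fs_homog[OF mor_ok_homog[OF f] this len] w
    show "v \<in> words (a_mod B) (length ns) (q + sum_list ns)"
      by (auto simp: words_iff sdeg_def csum_eq)
  qed
  have val: "tensor_functor_mor R A B f (gl 0 ns) (csum ns) q (A.ev (csum ns) q (frag_of w)) =
      signed (B.T (length ns) (q + sum_list ns)) (rsign 0 (gl 0 ns) (csum ns) q)
        (B.ev (length ns) (q + sum_list ns) (Fs (fb f) ns w))"
  proof -
    let ?E = "int (sum_list ns) * (int q - 1) + int (cross ns)"
    have tm: "tensor_maps R (a_mod A) (a_mod B) (map (mor_m f) ns) q (A.ev (csum ns) q (frag_of w)) =
        signed (B.T (length ns) (q + sum_list ns)) (int (kexp (map (mor_m f) ns)))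
          (B.ev (length ns) (q + sum_list ns) (Fs (fb f) ns w))"
      unfolding Fs_Bs[OF len] by (rule tensor_maps_ev[OF lin w]) simp_all
    have "even (int (sum_list ns + cross ns + eps ns + sum_list (gl 0 ns) + (sum_list ns choose 2)) +
        int (kexp (map (mor_m f) ns) + eps ns) + 2 * (int (sum_list ns) * int q - int (sum_list ns) - int (eps ns)))"
      using mor_parity[of ns] kexp_mor[of f ns] by presburger
    also have "int (sum_list ns + cross ns + eps ns + sum_list (gl 0 ns) + (sum_list ns choose 2)) +
        int (kexp (map (mor_m f) ns) + eps ns) + 2 * (int (sum_list ns) * int q - int (sum_list ns) - int (eps ns)) =
        ?E + int (kexp (map (mor_m f) ns)) + rsign 0 (gl 0 ns) (csum ns) q"
      by (simp add: rsign_def algebra_simps)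
    finally have par: "even (?E + int (kexp (map (mor_m f) ns)) + rsign 0 (gl 0 ns) (csum ns) q)" .
    show ?thesis
      unfolding tensor_functor_mor_gl tm signed_signed[OF B.T_module B.ev_closed] signed_cong[OF par] ..
  qed
  show "if int q + int (sum_list ns) + 0 < 0 then Fs (fb f) ns w = 0
    else Poly_Mapping.keys (Fs (fb f) ns w) \<subseteq> words (a_mod B) (length ns) (deg 0 q (sum_list ns)) \<and>
      tensor_functor_mor R A B f (gl 0 ns) (csum ns) q (A.ev (csum ns) q (frag_of w)) =
      signed (B.T (length ns) (deg 0 q (sum_list ns))) (rsign 0 (gl 0 ns) (csum ns) q)
        (B.ev (length ns) (deg 0 q (sum_list ns)) (Fs (fb f) ns w))"
    unfolding Q using keys val by simp
qed

section \<open>The homotopy on tensor powers\<close>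

definition hty_us :: "(nat \<Rightarrow> nat \<Rightarrow> ('k, 'a) tensor \<Rightarrow> 'b) \<Rightarrow> (nat \<Rightarrow> nat \<Rightarrow> ('k, 'a) tensor \<Rightarrow> 'b) \<Rightarrow>
    (nat \<Rightarrow> nat \<Rightarrow> ('k, 'a) tensor \<Rightarrow> 'b) \<Rightarrow> nat list \<Rightarrow> nat \<Rightarrow> ('k, 'a, 'b) multi_map list" where
  "hty_us f g h ns i = map (mor_m g) (take i ns) @ [hty_m h (ns ! i)] @ map (mor_m f) (drop (i + 1) ns)"

text \<open>The signs are chosen such that this family corresponds to \<^const>\<open>Hs\<close> in the bar construction.\<close>

definition tensor_hty :: "(nat \<Rightarrow> nat \<Rightarrow> ('k, 'a) tensor \<Rightarrow> 'b) \<Rightarrow> (nat \<Rightarrow> nat \<Rightarrow> ('k, 'a) tensor \<Rightarrow> 'b) \<Rightarrow>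
    (nat \<Rightarrow> nat \<Rightarrow> ('k, 'a) tensor \<Rightarrow> 'b) \<Rightarrow> nat list \<Rightarrow> nat \<Rightarrow> nat \<Rightarrow> ('k, 'a) tensor \<Rightarrow> ('k, 'b) tensor" where
  "tensor_hty f g h I n q x =
     (let M = B.T (n - length I) (q + length I + 1);
          ns = (THE ns. csum ns = n \<and> gl 0 ns = I) in
       if set I \<subseteq> {1..<n} then \<Oplus>\<^bsub>M\<^esub>i\<in>{..<length ns}. signed M (rsign 1 I n q + int (kexp (hty_us f g h ns i)))
         (tensor_maps R (a_mod A) (a_mod B) (hty_us f g h ns i) q x)
       else \<zero>\<^bsub>M\<^esub>)"

lemma tensor_hty_gl:
  "tensor_hty f g h (gl 0 ns) (csum ns) q =
    (\<lambda>x. \<Oplus>\<^bsub>B.T (length ns) (q + sum_list ns + 1)\<^esub>i\<in>{..<length ns}.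
      signed (B.T (length ns) (q + sum_list ns + 1))
        (rsign 1 (gl 0 ns) (csum ns) q + int (kexp (hty_us f g h ns i)))
        (tensor_maps R (a_mod A) (a_mod B) (hty_us f g h ns i) q x))"
proof -
  have "(THE ms. csum ms = csum ns \<and> gl 0 ms = gl 0 ns) = ns"
    by (rule the_equality) (auto intro: gl_inj[of 0])
  moreover have "csum ns - sum_list ns = length ns" by (simp add: csum_eq)
  ultimately show ?thesis
    using index_tuples_gl(2) by (simp add: tensor_hty_def Let_def fun_eq_iff)
qed

lemma hty_us_simps:
  assumes "i < length ns"
  shows "arity (hty_us f g h ns i) = csum ns" "degree (hty_us f g h ns i) = sum_list ns + 1"
    "length (hty_us f g h ns i) = length ns"
proof -
  have ns: "ns = take i ns @ ns ! i # drop (i + 1) ns" using id_take_nth_drop[OF assms] by simp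
  have "csum ns = csum (take i ns) + (Suc (ns ! i) + csum (drop (i + 1) ns))"
    by (subst ns) (simp only: csum_simps)
  then show "arity (hty_us f g h ns i) = csum ns" by (simp add: hty_us_def hty_m_def)
  have "sum_list ns = sum_list (take i ns) + (ns ! i + sum_list (drop (i + 1) ns))"
    by (subst ns) (simp only: sum_list_append sum_list.Cons)
  then show "degree (hty_us f g h ns i) = sum_list ns + 1" by (simp add: hty_us_def hty_m_def)
  show "length (hty_us f g h ns i) = length ns" using assms by (simp add: hty_us_def)
qed

text \<open>The sign in \<open>tensor_hty\<close> contains \<open>kexp\<close>, which cancels the
  one from \<open>tensor_maps_ev\<close>; the terms then add up to \<open>Hs\<close> by
  \<open>Hs_Bs\<close>.\<close>

lemma hty_represents:
  assumes f: "mor_ok f" and g: "mor_ok g" and h: "\<And>n. multi_lin (hty_m h n)"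
  shows "represents 1 (Hs (fb f) (fb g) (hb h)) (tensor_hty f g h)"
  unfolding represents_def
proof (intro conjI allI ballI impI)
  have lin: "\<forall>m\<in>set (hty_us f g h ns i). multi_lin m" for ns i
    using mor_ok_lin[OF f] mor_ok_lin[OF g] h by (auto simp: hty_us_def)
  fix n q I assume I: "I \<in> index_tuples n"
  have Q: "deg 1 q (length I) = q + length I + 1" by (simp add: deg_def nat_int_add)
  show "tensor_hty f g h I n q \<in> lin_maps R (A.T n q) (B.T (n - length I) (deg 1 q (length I)))"
  proof (cases "set I \<subseteq> {1..<n}")
    case True
    with I obtain ns where ns: "n = csum ns" "I = gl 0 ns" by (rule index_tuples_cases)
    have "n - length I = length ns" by (simp add: ns csum_eq)
    then show ?thesis
      unfolding Q unfolding ns tensor_hty_gl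
      by (auto simp: hty_us_simps
        intro!: lin_maps_finsum lin_maps_signed_fun B.T_module A.T_module tensor_maps_lin lin[rule_format])
  next
    case False
    then have "tensor_hty f g h I n q = (\<lambda>x. \<zero>\<^bsub>B.T (n - length I) (q + length I + 1)\<^esub>)"
      by (simp add: tensor_hty_def Let_def fun_eq_iff)
    then show ?thesis unfolding Q by (simp only: lin_maps_const_zero[OF B.T_module])
  qed
  show "tensor_hty f g h I n q x = \<zero>\<^bsub>B.T (n - length I) (deg 1 q (length I))\<^esub>"
    if "\<not> set I \<subseteq> {1..<n}" for x
    unfolding Q using that by (simp add: tensor_hty_def Let_def)
next
  have lin: "\<forall>m\<in>set (hty_us f g h ns i). multi_lin m" for ns i
    using mor_ok_lin[OF f] mor_ok_lin[OF g] h by (auto simp: hty_us_def)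
  fix ns q w assume w: "w \<in> words (a_mod A) (csum ns) q"
  have Q: "deg 1 q (sum_list ns) = q + sum_list ns + 1" by (simp add: deg_def nat_int_add)
  have len: "length w = csum ns" using w by (simp add: words_iff)
  let ?M = "B.T (length ns) (q + sum_list ns + 1)" and ?s = "rsign 1 (gl 0 ns) (csum ns) q"
  let ?Bs = "\<lambda>i. Bs R (a_mod A) (hty_us f g h ns i) w"
  have Hs: "Hs (fb f) (fb g) (hb h) ns w = (\<Sum>i<length ns. ?Bs i)"
    unfolding hty_us_def by (rule Hs_Bs[OF len])
  have keys: "Poly_Mapping.keys (Hs (fb f) (fb g) (hb h) ns w) \<subseteq> words (a_mod B) (length ns) (q + sum_list ns + 1)"
  proof
    fix v assume "v \<in> Poly_Mapping.keys (Hs (fb f) (fb g) (hb h) ns w)"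
    from Hs_homog[OF mor_ok_homog[OF f] mor_ok_homog[OF g] hbar_homog[OF h] this len] w
    show "v \<in> words (a_mod B) (length ns) (q + sum_list ns + 1)"
      by (auto simp: words_iff sdeg_def csum_eq)
  qed
  interpret M: module R ?M by (rule B.T_module)
  have val: "tensor_hty f g h (gl 0 ns) (csum ns) q (A.ev (csum ns) q (frag_of w)) =
      signed ?M ?s (B.ev (length ns) (q + sum_list ns + 1) (Hs (fb f) (fb g) (hb h) ns w))"
  proof -
    have tm: "signed ?M (?s + int (kexp (hty_us f g h ns i)))
        (tensor_maps R (a_mod A) (a_mod B) (hty_us f g h ns i) q (A.ev (csum ns) q (frag_of w))) =
        B.ev (length ns) (q + sum_list ns + 1) (if even ?s then ?Bs i else - ?Bs i)" if i: "i < length ns" for i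
    proof -
      have "tensor_maps R (a_mod A) (a_mod B) (hty_us f g h ns i) q (A.ev (csum ns) q (frag_of w)) =
        signed ?M (int (kexp (hty_us f g h ns i))) (B.ev (length ns) (q + sum_list ns + 1) (?Bs i))"
        by (rule tensor_maps_ev[OF lin w]) (simp_all add: hty_us_simps[OF i])
      moreover have "even (?s + int (kexp (hty_us f g h ns i)) + int (kexp (hty_us f g h ns i)) + ?s)"
        by simp
      ultimately show ?thesis
        by (simp only: signed_signed[OF B.T_module B.ev_closed] signed_cong B.signed_ev[symmetric])
    qed
    have "tensor_hty f g h (gl 0 ns) (csum ns) q (A.ev (csum ns) q (frag_of w)) =
        (\<Oplus>\<^bsub>?M\<^esub>i\<in>{..<length ns}. B.ev (length ns) (q + sum_list ns + 1) (if even ?s then ?Bs i else - ?Bs i))"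
      unfolding tensor_hty_gl
      by (rule M.finsum_cong') (simp_all only: tm lessThan_iff, auto intro: B.ev_closed)
    also have "\<dots> = B.ev (length ns) (q + sum_list ns + 1) (\<Sum>i<length ns. if even ?s then ?Bs i else - ?Bs i)"
      by (rule B.ev_sum[symmetric])
    also have "(\<Sum>i<length ns. if even ?s then ?Bs i else - ?Bs i) =
        (if even ?s then \<Sum>i<length ns. ?Bs i else - (\<Sum>i<length ns. ?Bs i))"
      by (simp add: sum_negf)
    finally show ?thesis unfolding B.signed_ev Hs .
  qed
  show "if int q + int (sum_list ns) + 1 < 0 then Hs (fb f) (fb g) (hb h) ns w = 0
    else Poly_Mapping.keys (Hs (fb f) (fb g) (hb h) ns w) \<subseteq> words (a_mod B) (length ns) (deg 1 q (sum_list ns)) \<and>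
      tensor_hty f g h (gl 0 ns) (csum ns) q (A.ev (csum ns) q (frag_of w)) =
      signed (B.T (length ns) (deg 1 q (sum_list ns))) ?s
        (B.ev (length ns) (deg 1 q (sum_list ns)) (Hs (fb f) (fb g) (hb h) ns w))"
    unfolding Q using keys val by simp
qed

end

section \<open>Faces and differential as one family\<close>

context ainf_alg
begin

definition face :: "nat list \<Rightarrow> nat \<Rightarrow> nat \<Rightarrow> ('k, 'a) tensor \<Rightarrow> ('k, 'a) tensor" where
  "face I n q = (if I = [] then dT n q else tensor_face R A I n q)"

lemma gl_single: "gl 0 (single i k c) = [Suc i..<Suc i + k]"
proof -
  have z: "gl l (replicate c 0) = []" for l c by (induction c arbitrary: l) simp_all
  have "gl 0 (replicate i 0 @ ns) = gl i ns" for i ns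
    using gl_append[of 0 "replicate i 0" ns] z by (simp add: csum_eq sum_list_replicate)
  then show ?thesis by (simp add: single_def z)
qed

abbreviation face_us :: "nat \<Rightarrow> nat \<Rightarrow> nat \<Rightarrow> ('k, 'a, 'a) multi_map list" where
  "face_us i k c \<equiv> replicate i (one_m R (a_mod A)) @ [op_m A (k - 1)] @ replicate c (one_m R (a_mod A))"

lemma face_single:
  assumes "k \<noteq> 0"
  shows "face (gl 0 (single i k c)) (csum (single i k c)) q =
    (\<lambda>x. signed (T (i + Suc c) (q + k - 1)) (int k * (int q - 1)) (tensor_maps R (a_mod A) (a_mod A) (face_us i k c) q x))"
proof -
  have "hd [Suc i..<Suc i + k] = Suc i" using assms by (simp add: upt_conv_Cons del: upt_Suc)
  moreover have "[Suc i..<Suc i + k] \<noteq> []" using assms by simp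
  ultimately show ?thesis
    using assms unfolding gl_single face_def
    by (simp add: fun_eq_iff tensor_face_def Let_def del: upt_Suc)
qed

text \<open>The runs j, ..., j + k - 1 with j from 1 to n - k are exactly the gap lists of
  decompositions with one long block, j - 1 single letters before it and n - k - j after it.\<close>

lemma face_zero:
  assumes I: "I \<in> index_tuples n" "I \<noteq> []" and no: "\<And>i k c. k \<noteq> 0 \<Longrightarrow> n = csum (single i k c) \<Longrightarrow> I \<noteq> gl 0 (single i k c)"
  shows "face I n q = (\<lambda>x. \<zero>\<^bsub>T (n - length I) (q + length I - 1)\<^esub>)"
proof -
  have no': "\<not> (I \<noteq> [] \<and> I = [hd I..<hd I + length I] \<and> 1 \<le> hd I \<and> hd I \<le> n - length I)"
  proof
    assume "I \<noteq> [] \<and> I = [hd I..<hd I + length I] \<and> 1 \<le> hd I \<and> hd I \<le> n - length I"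
    then have c: "I = [hd I..<hd I + length I] \<and> 1 \<le> hd I \<and> hd I \<le> n - length I" by (rule conjunct2)
    define i c where "i = hd I - 1" and "c = n - length I - hd I"
    have i: "hd I = Suc i" using c by (simp add: i_def)
    have "Suc i \<le> n - length I" using c by (simp only: i)
    then have "n = csum (single i (length I) c)" unfolding csum_single c_def i by linarith
    moreover have "I = gl 0 (single i (length I) c)" using c unfolding gl_single i by blast
    ultimately show False using no[of "length I" i c] I(2) by simp
  qed
  show ?thesis
    unfolding fun_eq_iff face_def if_not_P[OF I(2)] tensor_face_def Let_def if_not_P[OF no'] by simp
qed

lemma face_us_lin: "\<forall>m\<in>set (face_us i k c). self.multi_lin m"
  using op_lin one_lin by auto

text \<open>The number of long blocks decides: without one the family is the differential, with one
  it is a face, with more both the face and the cochain vanish.\<close>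

lemma face_represents: "self.represents (- 1) D face"
  unfolding self.represents_def
proof (intro conjI allI ballI impI)
  fix n q I assume I: "I \<in> index_tuples n"
  have Q: "deg (- 1) q (length I) = q + length I - 1" by (simp add: deg_def)
  have "face I n q \<in> lin_maps R (T n q) (T (n - length I) (q + length I - 1)) \<and>
    (\<not> set I \<subseteq> {1..<n} \<longrightarrow> (\<forall>x. face I n q x = \<zero>\<^bsub>T (n - length I) (q + length I - 1)\<^esub>))"
  proof (cases "I = []")
    case True
    then show ?thesis using tensor_diff_lin by (simp add: face_def)
  next
    case False
    show ?thesis
    proof (cases "\<exists>i k c. k \<noteq> 0 \<and> n = csum (single i k c) \<and> I = gl 0 (single i k c)")
      case True
      then obtain i k c where k: "k \<noteq> 0" and n: "n = csum (single i k c)" and Ig: "I = gl 0 (single i k c)" by blast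
      have len: "length I = k" "n - k = i + Suc c" by (simp_all add: Ig n gl_single)
      have "face I n q \<in> lin_maps R (T n q) (T (i + Suc c) (q + k - 1))"
        unfolding Ig n face_single[OF k] using k
        by (intro lin_maps_signed_fun T_module self.tensor_maps_lin face_us_lin) (simp_all add: op_m_def)
      moreover have "set I \<subseteq> {1..<n}" unfolding Ig n by (rule index_tuples_gl(2))
      ultimately show ?thesis unfolding len by blast
    next
      case no: False
      have "face I n q = (\<lambda>x. \<zero>\<^bsub>T (n - length I) (q + length I - 1)\<^esub>)"
        by (rule face_zero[OF I False]) (use no in blast)
      then show ?thesis by (simp only: lin_maps_const_zero[OF T_module] simp_thms)
    qed
  qed
  then show "face I n q \<in> lin_maps R (T n q) (T (n - length I) (deg (- 1) q (length I)))"
    "\<not> set I \<subseteq> {1..<n} \<Longrightarrow> face I n q x = \<zero>\<^bsub>T (n - length I) (deg (- 1) q (length I))\<^esub>" for x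
    unfolding Q by blast+
next
  fix ns q w assume w: "w \<in> words (a_mod A) (csum ns) q"
  let ?n = "csum ns" and ?k = "sum_list ns"
  have Q: "deg (- 1) q ?k = q + ?k - 1" by (simp add: deg_def)
  have len: "length w = csum ns" and valid: "valid (a_mod A) w" using w by (simp_all add: words_iff)
  have keys: "Poly_Mapping.keys (D ns w) \<subseteq> words (a_mod A) (length ns) (q + ?k - 1)" if "0 < q + ?k"
    by (rule D_words[OF w refl]) (use that in \<open>simp add: csum_eq\<close>)
  have val: "face (gl 0 ns) ?n q (ev ?n q (frag_of w)) = signed (T (length ns) (q + ?k - 1)) (rsign (- 1) (gl 0 ns) ?n q)
        (ev (length ns) (q + ?k - 1) (D ns w))"
  proof -
    consider "nonzeros ns = 0" | "nonzeros ns = 1" | "nonzeros ns \<ge> 2" by linarith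
    then show ?thesis
    proof cases
      case 1
      then have ns: "ns = replicate (length ns) 0" by (simp add: nonzeros_eq_0_iff replicate_length_same subset_iff)
      then have k: "?k = 0" by (metis mult_0_right sum_list_replicate)
      have g: "gl 0 ns = []" using length_gl[of 0 ns] unfolding k by (simp only: length_0_conv)
      have n: "?n = length ns" using k by (simp add: csum_eq)
      \<comment> \<open>The exponent n + 1 of the tensor differential is what fixes the summand
        \<open>e * (n + 1)\<close> in \<open>rsign\<close>.\<close>
      have "even (int (length ns + 1) + rsign (- 1) (gl 0 ns) ?n q)" unfolding g n by (simp add: rsign_def numeral_2_eq_2)
      from signed_cong[OF this] show ?thesis
        unfolding g using tensor_diff_ev[OF w] ns by (simp add: face_def n k)
    next
      case 2
      then obtain i k c where ns: "ns = single i k c" and k: "k \<noteq> 0" by (rule nonzeros_1E)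
      have sk: "?k = k" by (simp add: ns single_def sum_list_replicate)
      have D: "D ns w = Bs R (a_mod A) (face_us i k c) w"
        unfolding ns by (rule Ds_single[OF _ valid _ k]) (use len in \<open>simp_all add: ns graded_module_axioms\<close>)
      have tm: "tensor_maps R (a_mod A) (a_mod A) (face_us i k c) q (ev ?n q (frag_of w)) =
          signed (T (length ns) (q + k - 1)) (int (kexp (face_us i k c))) (ev (length ns) (q + k - 1) (D ns w))"
        unfolding D by (rule self.tensor_maps_ev[OF face_us_lin w]) (use k in \<open>simp_all add: ns op_m_def\<close>)
      have sg: "sum_list (gl 0 ns) = i * k + (k choose 2) + k"
        using sum_gl_shift[of i "[k]"] sum_upt_choose[of k] unfolding ns gl_single by (simp del: upt_Suc)
      have par: "even (int k * (int q - 1) + int (kexp (face_us i k c)) + rsign (- 1) (gl 0 ns) ?n q)"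
      proof -
        have rs: "rsign (- 1) (gl 0 ns) ?n q = int (i * k + (k choose 2) + k) - int (i + Suc k + c) - 1
            + int k * (int q - 1) + int (k choose 2)"
          unfolding rsign_def sg length_gl sk by (simp add: ns)
        have S: "int (i * (k - 1)) = int i * int k - int i" using k by (simp add: of_nat_diff algebra_simps)
        have "even (int (kexp (face_us i k c) + i * (k - 1) + c))"
          using kexp_op[OF k, of i R "a_mod A" A c] by (simp only: even_of_nat)
        then have ev: "even (int (kexp (face_us i k c)) + int (i * (k - 1)) + int c)"
          by (simp only: of_nat_add)
        have "int k * (int q - 1) + K + rsign (- 1) (gl 0 ns) ?n q =
            2 * (int k * (int q - 1) + int (k choose 2) - 1 - int c) + (K + int (i * (k - 1)) + int c)" for K
          unfolding rs S by (simp add: algebra_simps)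
        then show ?thesis by (simp only: dvd_add[OF dvd_triv_left ev])
      qed
      have "face (gl 0 ns) ?n q (ev ?n q (frag_of w)) = signed (T (i + Suc c) (q + k - 1)) (int k * (int q - 1))
          (tensor_maps R (a_mod A) (a_mod A) (face_us i k c) q (ev ?n q (frag_of w)))"
        unfolding ns face_single[OF k] ..
      also have "i + Suc c = length ns" by (simp add: ns)
      finally show ?thesis unfolding tm signed_signed[OF T_module ev_closed] signed_cong[OF par] sk .
    next
      case 3
      have D: "D ns w = 0" by (rule Ds_zero[OF valid len 3])
      \<comment> \<open>Equal gap lists force equal decompositions, so a tuple with two long blocks
        is no run of consecutive integers.\<close>
      have "gl 0 ns \<noteq> gl 0 (single i k c)" if "k \<noteq> 0" "csum ns = csum (single i k c)" for i k c
      proof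
        assume "gl 0 ns = gl 0 (single i k c)"
        then have "ns = single i k c" using gl_inj[of 0 ns] that(2) by simp
        then show False using nonzeros_single[OF that(1)] 3 by simp
      qed
      moreover have "?k \<noteq> 0"
      proof
        assume "?k = 0"
        then have "nonzeros ns = 0" by (auto simp: nonzeros_eq_0_iff)
        then show False using 3 by simp
      qed
      then have "gl 0 ns \<noteq> []" using length_gl[of 0 ns] by (metis list.size(3))
      ultimately have "face (gl 0 ns) ?n q = (\<lambda>x. \<zero>\<^bsub>T (?n - ?k) (q + ?k - 1)\<^esub>)"
        using face_zero[OF index_tuples_gl(1), of ns q] by simp
      moreover have "?n - ?k = length ns" by (simp add: csum_eq)
      ultimately show ?thesis
        unfolding D signed_ev by (simp add: ev_zero)
    qed
  qed
  \<comment> \<open>Only the differential on degree 0 has negative target degree.\<close>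
  have neg: "D ns w = 0" if "\<not> 0 < q + ?k"
  proof -
    have ns: "ns = replicate (length ns) 0"
      using that by (intro replicate_length_same[symmetric]) auto
    have "?n = length ns" using that by (simp add: csum_eq)
    then show ?thesis using D_zeros_0[of w "length ns"] w that ns by simp
  qed
  show "if int q + int (sum_list ns) + - 1 < 0 then D ns w = 0
    else Poly_Mapping.keys (D ns w) \<subseteq> words (a_mod A) (length ns) (deg (- 1) q (sum_list ns)) \<and>
      face (gl 0 ns) (csum ns) q (ev (csum ns) q (frag_of w)) =
      signed (T (length ns) (deg (- 1) q (sum_list ns))) (rsign (- 1) (gl 0 ns) (csum ns) q)
        (ev (length ns) (deg (- 1) q (sum_list ns)) (D ns w))"
  proof (cases "0 < q + ?k")
    case True
    then have "\<not> int q + int ?k + - 1 < 0" by linarith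
    then show ?thesis unfolding Q using keys[OF True] val by (simp only: if_False simp_thms)
  next
    case False
    then have "int q + int ?k + - 1 < 0" by linarith
    then show ?thesis using neg[OF False] by (simp only: if_True)
  qed
qed

end

section \<open>Sums over splittings as linear maps\<close>

lemma (in graded_module) tensor_ext_ev:
  assumes u: "u \<in> lin_maps R (T n q) M" and v: "v \<in> lin_maps R (T n q) M" and M: "module R M"
    and eq: "\<And>w. w \<in> words A n q \<Longrightarrow> u (ev n q (frag_of w)) = v (ev n q (frag_of w))" and z: "z \<in> carrier (T n q)"
  shows "u z = v z"
proof (rule tensor_ext[OF u v M _ z])
  fix w assume w: "w \<in> words A n q"
  have "even (int (theta w) + int (theta w) + 0)" by simp
  then have "signed (T n q) (int (theta w)) (ev n q (frag_of w)) = signed (T n q) 0 (pure w)"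
    using w by (simp only: ev_of ev_word_def if_True signed_signed[OF T_module pure_closed[OF w]] signed_cong)
  then have p: "pure w = signed (T n q) (int (theta w)) (ev n q (frag_of w))" by (simp add: signed_def)
  show "u (pure w) = v (pure w)"
    unfolding p lin_maps_signed[OF u T_module M ev_closed] lin_maps_signed[OF v T_module M ev_closed] eq[OF w] ..
qed

text \<open>A tuple either has an extreme index or is a gap list, so two linear maps are compared
  either by their vanishing or on words of a known decomposition.\<close>

lemma (in graded_modules) family_ext:
  assumes I: "I \<in> index_tuples n"
    and u: "u \<in> lin_maps R (A.T n q) M" and v: "v \<in> lin_maps R (A.T n q) M" and M: "module R M"
    and outside: "\<And>x. \<not> set I \<subseteq> {1..<n} \<Longrightarrow> x \<in> carrier (A.T n q) \<Longrightarrow> u x = v x"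
    and words: "\<And>ns w. n = csum ns \<Longrightarrow> I = gl 0 ns \<Longrightarrow> w \<in> words A n q \<Longrightarrow>
      u (A.ev n q (frag_of w)) = v (A.ev n q (frag_of w))"
    and x: "x \<in> carrier (A.T n q)"
  shows "u x = v x"
proof (cases "set I \<subseteq> {1..<n}")
  case True
  with I obtain ns where "n = csum ns" "I = gl 0 ns" by (rule index_tuples_cases)
  then show ?thesis using words by (intro A.tensor_ext_ev[OF u v M _ x]) blast
qed (rule outside[OF _ x])

context graded_triple
begin

abbreviation target :: "int \<Rightarrow> int \<Rightarrow> nat list \<Rightarrow> nat \<Rightarrow> nat \<Rightarrow> ('k, ('k, 'c) tensor) module" where
  "target e1 e2 I n q \<equiv> BC.B.T (n - length I) (deg (e1 + e2) q (length I))"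

text \<open>The sum over all subsets, trivial ones included. Relations between cochains transfer to
  it directly, while the definitions use the inner sum with the end terms written out.\<close>

definition total :: "int \<Rightarrow> int \<Rightarrow> int \<Rightarrow> (nat list \<Rightarrow> nat \<Rightarrow> nat \<Rightarrow> ('k, 'b) tensor \<Rightarrow> ('k, 'c) tensor) \<Rightarrow>
    (nat list \<Rightarrow> nat \<Rightarrow> nat \<Rightarrow> ('k, 'a) tensor \<Rightarrow> ('k, 'b) tensor) \<Rightarrow>
    nat list \<Rightarrow> nat \<Rightarrow> nat \<Rightarrow> ('k, 'a) tensor \<Rightarrow> ('k, 'c) tensor" where
  "total e1 e2 e \<Phi> \<Psi> I n q x = (\<Oplus>\<^bsub>target e1 e2 I n q\<^esub>L\<in>Pow (set I).
     split_term I (target e1 e2 I n q) e (opc (target e1 e2 I n q) e2 \<Phi> \<Psi> n q x) L)"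

context
  fixes e1 e2 \<phi> \<Phi> \<psi> \<Psi>
  assumes \<Phi>: "BC.represents e1 \<phi> \<Phi>" and \<Psi>: "AB.represents e2 \<psi> \<Psi>"
begin

lemma opc_closed:
  assumes "I \<in> index_tuples n" "L \<subseteq> set I" "0 \<le> int q + int (length I) + e1 + e2" "x \<in> carrier (AB.A.T n q)"
  shows "opc (target e1 e2 I n q) e2 \<Phi> \<Psi> n q x (lft I L) (rgt L) \<in> carrier (target e1 e2 I n q)"
  by (rule lin_maps_closed[OF opc_lin[OF \<Psi> \<Phi> assms(1-3)] assms(4)])

lemma total_lin:
  assumes I: "I \<in> index_tuples n" and pos: "0 \<le> int q + int (length I) + e1 + e2"
  shows "total e1 e2 e \<Phi> \<Psi> I n q \<in> lin_maps R (AB.A.T n q) (target e1 e2 I n q)"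
proof -
  have s: "sorted_wrt (<) I" using I by (simp add: index_tuples_def)
  have "(\<lambda>x. \<Oplus>\<^bsub>target e1 e2 I n q\<^esub>L\<in>Pow (set I).
     split_term I (target e1 e2 I n q) e (opc (target e1 e2 I n q) e2 \<Phi> \<Psi> n q x) L)
     \<in> lin_maps R (AB.A.T n q) (target e1 e2 I n q)"
    unfolding split_term_def[OF s]
    by (rule lin_maps_finsum[OF BC.B.T_module AB.A.T_module], rule lin_maps_signed_fun[OF BC.B.T_module],
      rule opc_lin[OF \<Psi> \<Phi> I _ pos]) (rule PowD)
  then show ?thesis by (simp only: total_def[abs_def])
qed

lemma total_word:
  assumes pos: "0 \<le> int q + int (sum_list ns) + e1 + e2" and w: "w \<in> words A (csum ns) q"
  shows "total e1 e2 e \<Phi> \<Psi> (gl 0 ns) (csum ns) q (AB.A.ev (csum ns) q (frag_of w)) =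
    BC.B.ev (length ns) (deg (e1 + e2) q (sum_list ns))
      (if even (rsign (e1 + e2) (gl 0 ns) (csum ns) q + e) then conv \<phi> \<psi> ns w else - conv \<phi> \<psi> ns w)"
proof -
  have "csum ns - sum_list ns = length ns" by (simp add: csum_eq)
  then show ?thesis
    unfolding total_def length_gl
    by (simp only: sum_opc_word[OF \<Psi> \<Phi> pos w] BC.B.signed_ev)
qed

lemma total_outside:
  assumes I: "I \<in> index_tuples n" "\<not> set I \<subseteq> {1..<n}" and pos: "0 \<le> int q + int (length I) + e1 + e2"
    and x: "x \<in> carrier (AB.A.T n q)"
  shows "total e1 e2 e \<Phi> \<Psi> I n q x = \<zero>\<^bsub>target e1 e2 I n q\<^esub>"
proof -
  interpret M: module R "target e1 e2 I n q" by (rule BC.B.T_module)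
  have s: "sorted_wrt (<) I" using I by (simp add: index_tuples_def)
  have "split_term I (target e1 e2 I n q) e (opc (target e1 e2 I n q) e2 \<Phi> \<Psi> n q x) L = \<zero>\<^bsub>target e1 e2 I n q\<^esub>"
    if "L \<in> Pow (set I)" for L
    using opc_outside[OF \<Psi> \<Phi> I pos x, of L] that by (simp add: split_term_def[OF s] signed_def)
  then have "total e1 e2 e \<Phi> \<Psi> I n q x = (\<Oplus>\<^bsub>target e1 e2 I n q\<^esub>L\<in>Pow (set I). \<zero>\<^bsub>target e1 e2 I n q\<^esub>)"
    unfolding total_def by (intro M.finsum_cong') auto
  then show ?thesis by simp
qed

text \<open>The empty tuple has one splitting. This case yields d d = 0 and the relations for the
  components with empty index.\<close>

lemma total_Nil:
  "0 \<le> int q + e1 + e2 \<Longrightarrow> x \<in> carrier (AB.A.T n q) \<Longrightarrow> total e1 e2 e \<Phi> \<Psi> [] n q x =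
    signed (BC.B.T n (deg (e1 + e2) q 0)) e (opc (BC.B.T n (deg (e1 + e2) q 0)) e2 \<Phi> \<Psi> n q x [] [])"
proof -
  assume a: "0 \<le> int q + e1 + e2" "x \<in> carrier (AB.A.T n q)"
  have I: "[] \<in> index_tuples n" by (simp add: index_tuples_def)
  interpret M: module R "BC.B.T n (deg (e1 + e2) q 0)" by (rule BC.B.T_module)
  have lft: "lft [] {} = []" by (simp add: lft_def)
  have "opc (BC.B.T n (deg (e1 + e2) q 0)) e2 \<Phi> \<Psi> n q x [] [] \<in> carrier (BC.B.T n (deg (e1 + e2) q 0))"
    using opc_closed[OF I, of "{}" q x] a by (simp add: lft)
  then show ?thesis
    by (simp add: total_def split_term_def lft signed_def)
qed

end

end

text \<open>For an inner splitting both tuples are nonempty, so families that differ only at the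
  empty tuple, such as the faces with and without the differential, give the same sum.\<close>

lemma split_sum_cong:
  assumes I: "sorted_wrt (<) I" and M: "abelian_group M"
    and eq: "\<And>L. L \<subseteq> set I \<Longrightarrow> L \<noteq> {} \<Longrightarrow> L \<noteq> set I \<Longrightarrow> \<phi> (lft I L) (rgt L) = \<phi>' (lft I L) (rgt L)"
    and cl: "\<And>L. L \<subseteq> set I \<Longrightarrow> \<phi> (lft I L) (rgt L) \<in> carrier M"
  shows "split_sum M e (inner_splits I) I \<phi> = split_sum M e (inner_splits I) I \<phi>'"
proof -
  interpret M: abelian_group M by (fact M)
  have parts: "take m (hats (permute_list \<sigma> I)) = lft I L \<and> drop m (hats (permute_list \<sigma> I)) = rgt L \<and>
      L \<subseteq> set I \<and> L \<noteq> {} \<and> L \<noteq> set I"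
    if "(\<sigma>, m) \<in> inner_splits I" "L = set (drop m (permute_list \<sigma> I))" for \<sigma> m L
  proof -
    have a: "(\<sigma>, m) \<in> all_splits I" "1 \<le> m" "m < length I" using that(1) by (auto simp: inner_splits_def)
    note P = all_splits_parts[OF I a(1), folded that(2)]
    have "length I = card (set I)" using I by (simp add: distinct_card strict_sorted_iff)
    then show ?thesis using P a(2,3) by auto
  qed
  show ?thesis
    unfolding split_sum_def
  proof (rule M.finsum_cong')
    show "(\<lambda>(\<sigma>, m). signed M ((if evenperm \<sigma> then 0 else 1) + e)
       (\<phi>' (take m (hats (permute_list \<sigma> I))) (drop m (hats (permute_list \<sigma> I))))) \<in> inner_splits I \<rightarrow> carrier M"
    proof
      fix x assume "x \<in> inner_splits I"
      moreover obtain \<sigma> m where x: "x = (\<sigma>, m)" by (cases x)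
      ultimately have p: "take m (hats (permute_list \<sigma> I)) = lft I (set (drop m (permute_list \<sigma> I))) \<and>
          drop m (hats (permute_list \<sigma> I)) = rgt (set (drop m (permute_list \<sigma> I))) \<and>
          set (drop m (permute_list \<sigma> I)) \<subseteq> set I \<and> set (drop m (permute_list \<sigma> I)) \<noteq> {} \<and> set (drop m (permute_list \<sigma> I)) \<noteq> set I"
        using parts by blast
      then have "\<phi>' (take m (hats (permute_list \<sigma> I))) (drop m (hats (permute_list \<sigma> I))) \<in> carrier M"
        using cl eq by (metis)
      then show "(case x of (\<sigma>, m) \<Rightarrow> signed M ((if evenperm \<sigma> then 0 else 1) + e)
         (\<phi>' (take m (hats (permute_list \<sigma> I))) (drop m (hats (permute_list \<sigma> I))))) \<in> carrier M"
        by (simp add: x signed_def)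
    qed
    fix x assume "x \<in> inner_splits I"
    moreover obtain \<sigma> m where x: "x = (\<sigma>, m)" by (cases x)
    ultimately have "\<phi> (take m (hats (permute_list \<sigma> I))) (drop m (hats (permute_list \<sigma> I))) =
        \<phi>' (take m (hats (permute_list \<sigma> I))) (drop m (hats (permute_list \<sigma> I)))"
      using parts eq by metis
    then show "(case x of (\<sigma>, m) \<Rightarrow> signed M ((if evenperm \<sigma> then 0 else 1) + e)
         (\<phi> (take m (hats (permute_list \<sigma> I))) (drop m (hats (permute_list \<sigma> I))))) =
        (case x of (\<sigma>, m) \<Rightarrow> signed M ((if evenperm \<sigma> then 0 else 1) + e)
         (\<phi>' (take m (hats (permute_list \<sigma> I))) (drop m (hats (permute_list \<sigma> I)))))"
      by (simp add: x)
  qed simp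
qed

section \<open>From subset sums to the form of the definitions\<close>

lemma (in abelian_group) eq_minusI:
  "d \<in> carrier G \<Longrightarrow> b \<in> carrier G \<Longrightarrow> d \<oplus> b = a \<Longrightarrow> d = a \<ominus> b"
  by (auto simp: a_minus_def a_assoc r_neg)

lemma split_terms_add:
  assumes I: "sorted_wrt (<) I" and M: "abelian_group M"
    and cl: "\<And>L. L \<subseteq> set I \<Longrightarrow> \<phi> (lft I L) (rgt L) \<in> carrier M" "\<And>L. L \<subseteq> set I \<Longrightarrow> \<phi>' (lft I L) (rgt L) \<in> carrier M"
  shows "(\<Oplus>\<^bsub>M\<^esub>L\<in>Pow (set I). split_term I M e (\<lambda>J L. \<phi> J L \<oplus>\<^bsub>M\<^esub> \<phi>' J L) L) =
    (\<Oplus>\<^bsub>M\<^esub>L\<in>Pow (set I). split_term I M e \<phi> L) \<oplus>\<^bsub>M\<^esub> (\<Oplus>\<^bsub>M\<^esub>L\<in>Pow (set I). split_term I M e \<phi>' L)"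
    and "(\<Oplus>\<^bsub>M\<^esub>L\<in>Pow (set I). split_term I M e (\<lambda>J L. \<phi> J L \<ominus>\<^bsub>M\<^esub> \<phi>' J L) L) =
    (\<Oplus>\<^bsub>M\<^esub>L\<in>Pow (set I). split_term I M e \<phi> L) \<ominus>\<^bsub>M\<^esub> (\<Oplus>\<^bsub>M\<^esub>L\<in>Pow (set I). split_term I M e \<phi>' L)"
proof -
  interpret M: abelian_group M by (fact M)
  note st = split_term_def[OF I]
  have c: "split_term I M e \<phi> \<in> Pow (set I) \<rightarrow> carrier M" "split_term I M e \<phi>' \<in> Pow (set I) \<rightarrow> carrier M" for e
    using cl by (auto simp: st signed_def)
  show "(\<Oplus>\<^bsub>M\<^esub>L\<in>Pow (set I). split_term I M e (\<lambda>J L. \<phi> J L \<oplus>\<^bsub>M\<^esub> \<phi>' J L) L) =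
    (\<Oplus>\<^bsub>M\<^esub>L\<in>Pow (set I). split_term I M e \<phi> L) \<oplus>\<^bsub>M\<^esub> (\<Oplus>\<^bsub>M\<^esub>L\<in>Pow (set I). split_term I M e \<phi>' L)"
    unfolding M.finsum_addf[OF c(1) c(2), symmetric]
    by (rule M.finsum_cong') (use c cl in \<open>auto simp: st signed_def M.minus_add Pi_iff\<close>)
  let ?\<delta> = "split_term I M e (\<lambda>J L. \<phi> J L \<ominus>\<^bsub>M\<^esub> \<phi>' J L)"
  have d: "?\<delta> \<in> Pow (set I) \<rightarrow> carrier M" using cl by (auto simp: st signed_def)
  have "(\<Oplus>\<^bsub>M\<^esub>L\<in>Pow (set I). ?\<delta> L) \<oplus>\<^bsub>M\<^esub> (\<Oplus>\<^bsub>M\<^esub>L\<in>Pow (set I). split_term I M e \<phi>' L) =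
      (\<Oplus>\<^bsub>M\<^esub>L\<in>Pow (set I). ?\<delta> L \<oplus>\<^bsub>M\<^esub> split_term I M e \<phi>' L)"
    by (rule M.finsum_addf[OF d c(2), symmetric])
  also have "\<dots> = (\<Oplus>\<^bsub>M\<^esub>L\<in>Pow (set I). split_term I M e \<phi> L)"
    by (rule M.finsum_cong')
      (use cl in \<open>auto simp: st signed_def M.minus_add a_minus_def M.a_assoc M.l_neg M.r_neg\<close>)
  finally have sum: "(\<Oplus>\<^bsub>M\<^esub>L\<in>Pow (set I). ?\<delta> L) \<oplus>\<^bsub>M\<^esub> (\<Oplus>\<^bsub>M\<^esub>L\<in>Pow (set I). split_term I M e \<phi>' L) =
      (\<Oplus>\<^bsub>M\<^esub>L\<in>Pow (set I). split_term I M e \<phi> L)" .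
  show "(\<Oplus>\<^bsub>M\<^esub>L\<in>Pow (set I). ?\<delta> L) =
    (\<Oplus>\<^bsub>M\<^esub>L\<in>Pow (set I). split_term I M e \<phi> L) \<ominus>\<^bsub>M\<^esub> (\<Oplus>\<^bsub>M\<^esub>L\<in>Pow (set I). split_term I M e \<phi>' L)"
    by (rule M.eq_minusI[OF M.finsum_closed[OF d] M.finsum_closed[OF c(2)] sum])
qed

text \<open>The omitted summand in degree 0 becomes an explicit zero, which is the value that
  \<open>opc\<close> assigns to the end term through the differential.\<close>

lemma hom_diff_eq:
  assumes "abelian_group M" "dY (u q x) \<in> carrier M"
  shows "hom_diff M e dY u dX q x = dY (u q x) \<ominus>\<^bsub>M\<^esub> signed M e (if q = 0 then \<zero>\<^bsub>M\<^esub> else u (q - 1) (dX q x))"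
proof -
  interpret M: abelian_group M by fact
  show ?thesis
  proof (cases "q = 0")
    case True
    then have "dY (u 0 x) \<in> carrier M" using assms(2) by simp
    then show ?thesis by (simp add: True hom_diff_def signed_def a_minus_def M.add.inv_one)
  qed (simp add: hom_diff_def)
qed

context abelian_group
begin

lemma move_inner:
  assumes "i \<in> carrier G" "a \<in> carrier G" "b \<in> carrier G" and "\<zero> = i \<oplus> \<ominus> a \<oplus> \<ominus> b"
  shows "i = a \<oplus> b"
proof -
  have "i \<ominus> (a \<oplus> b) = \<zero>" using assms by (simp add: a_minus_def minus_add a_assoc)
  then show ?thesis using assms(1-3) by (simp only: minus_eq_zero_iff a_closed)
qed

text \<open>Here a and z are the end terms with the full tuple on the left, d and f those with it on
  the right, and i is the inner sum.\<close>

lemma move_inner_mor: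
  assumes cl: "i \<in> carrier G" "a \<in> carrier G" "z \<in> carrier G" "d \<in> carrier G" "f \<in> carrier G"
    and "\<zero> = i \<oplus> \<ominus> (a \<ominus> z) \<oplus> \<ominus> (d \<ominus> f)"
  shows "d \<ominus> z = (\<ominus> a) \<oplus> f \<oplus> i"
proof -
  have "i = (a \<ominus> z) \<oplus> (d \<ominus> f)" by (rule move_inner) (use assms in auto)
  also have "\<dots> = (a \<oplus> \<ominus> f) \<oplus> (d \<ominus> z)" using cl by (simp add: a_minus_def a_ac)
  finally have i: "i = (a \<oplus> \<ominus> f) \<oplus> (d \<ominus> z)" .
  have "(\<ominus> a) \<oplus> f = \<ominus> (a \<oplus> \<ominus> f)" using cl by (simp add: minus_add)
  then show ?thesis unfolding i using cl by (simp add: r_neg1)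
qed

lemma move_inner_hty:
  assumes cl: "i \<in> carrier G" "a \<in> carrier G" "z \<in> carrier G" "d \<in> carrier G" "p \<in> carrier G" "f \<in> carrier G" "g \<in> carrier G"
    and "\<ominus> (f \<ominus> g) = i \<oplus> \<ominus> (a \<oplus> z) \<oplus> \<ominus> (d \<oplus> p)"
  shows "d \<oplus> z = (f \<ominus> g \<ominus> a \<ominus> p) \<oplus> i"
proof -
  have "\<zero> = (f \<ominus> g) \<oplus> \<ominus> (f \<ominus> g)" using cl by (simp add: r_neg)
  also have "\<dots> = (f \<ominus> g \<oplus> i) \<oplus> \<ominus> (a \<oplus> z) \<oplus> \<ominus> (d \<oplus> p)"
    unfolding assms(8) using cl by (simp add: a_assoc)
  finally have "(f \<ominus> g) \<oplus> i = (a \<oplus> z) \<oplus> (d \<oplus> p)" by (rule move_inner[rotated 3]) (use cl in auto)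
  also have "\<dots> = (a \<oplus> p) \<oplus> (d \<oplus> z)" using cl by (simp add: a_ac)
  finally have "(f \<ominus> g) \<oplus> i = (a \<oplus> p) \<oplus> (d \<oplus> z)" .
  moreover have "(f \<ominus> g \<ominus> a \<ominus> p) \<oplus> i = \<ominus> (a \<oplus> p) \<oplus> ((f \<ominus> g) \<oplus> i)"
    using cl by (simp add: a_minus_def minus_add a_ac)
  ultimately show ?thesis using cl by (simp add: r_neg1)
qed

end

section \<open>The tensor functor on homotopy equivalent algebras\<close>

lemma deg_simps [simp]:
  "deg (- 1) q k = q + k - 1" "deg 0 q k = q + k" "deg 1 q k = q + k + 1" "deg (- 2) q k = q + k - 2"
  by (simp_all add: deg_def nat_int_add)

lemma nonempty_parts:
  assumes "sorted_wrt (<) I" "L \<subseteq> set I" "L \<noteq> {}" "L \<noteq> set I"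
  shows "lft I L \<noteq> []" "rgt L \<noteq> []" "0 < card L"
proof -
  have fin: "finite L" using assms(2) finite_subset by auto
  show "rgt L \<noteq> []" "0 < card L" using fin assms(3) by (simp_all add: card_gt_0_iff)
  have "card (set I) = length I" using assms(1) by (simp add: distinct_card strict_sorted_iff)
  moreover have "card L < card (set I)" using assms(2,4) by (intro psubset_card_mono) auto
  ultimately show "lft I L \<noteq> []" using length_lft[OF assms(1,2)] by auto
qed

lemma index_tuples_Nil [simp]: "[] \<in> index_tuples n"
  by (simp add: index_tuples_def)

section \<open>The tensor functor on objects\<close>

context ainf_alg
begin

text \<open>On words of degree 0 the differential would lower the degree below 0, so its cochain
  vanishes.\<close>

lemma dT_0:
  assumes "x \<in> carrier (T n 0)"
  shows "dT n 0 x = \<zero>\<^bsub>T n 0\<^esub>"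
proof (rule tensor_ext_ev[where u = "dT n 0" and v = "\<lambda>x. \<zero>\<^bsub>T n 0\<^esub>" and M = "T n 0"])
  show "dT n 0 \<in> lin_maps R (T n 0) (T n 0)" using tensor_diff_lin[of n 0] by simp
  fix w assume w: "w \<in> words (a_mod A) n 0"
  interpret M: module R "T n 0" by (rule T_module)
  show "dT n 0 (ev n 0 (frag_of w)) = \<zero>\<^bsub>T n 0\<^esub>"
    using tensor_diff_ev[OF w] by (simp add: D_zeros_0[OF w] ev_zero signed_def M.add.inv_one)
qed (auto intro: T_module lin_maps_const_zero assms)

lemma b_cochain': "cochain (a_mod A) 1 b"
  by (rule homog_cochain[OF bbar_homog]) simp

lemma face_closed: "x \<in> carrier (T n q) \<Longrightarrow> I \<in> index_tuples n \<Longrightarrow> face I n q x \<in> carrier (T (n - length I) (q + length I - 1))"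
  using lin_maps_closed[OF self.representsD(1)[OF face_represents]] by simp

lemma tensor_functor_isf: "is_isf R (tensor_functor R A)"
proof -
  interpret t: graded_triple R "a_mod A" "a_mod A" "a_mod A" by unfold_locales
  note rep = face_represents face_represents
  \<comment> \<open>The bound on q + k keeps the target degree q + k - 2 from being
    truncated.\<close>
  have zero: "t.total (- 1) (- 1) e face face I n q x = \<zero>\<^bsub>T (n - length I) (q + length I - 2)\<^esub>"
    if I: "I \<in> index_tuples n" and pos: "2 \<le> q + length I" and x: "x \<in> carrier (T n q)" for e I n q x
  proof -
    have p: "0 \<le> int q + int (length I) + - 1 + - 1" using pos by simp
    show ?thesis
    proof (rule self.family_ext[OF I _ _ T_module, where u = "t.total (- 1) (- 1) e face face I n q" and v = "\<lambda>x. \<zero>\<^bsub>T (n - length I) (q + length I - 2)\<^esub>"])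
      show "t.total (- 1) (- 1) e face face I n q \<in> lin_maps R (T n q) (T (n - length I) (q + length I - 2))"
        using t.total_lin[OF rep I p] by simp
      show "t.total (- 1) (- 1) e face face I n q x = \<zero>\<^bsub>T (n - length I) (q + length I - 2)\<^esub>"
        if "\<not> set I \<subseteq> {1..<n}" "x \<in> carrier (T n q)" for x
        using t.total_outside[OF rep I that(1) p that(2)] by simp
      fix ns w assume n: "n = csum ns" and Ig: "I = gl 0 ns" and w: "w \<in> words (a_mod A) n q"
      have p': "0 \<le> int q + int (sum_list ns) + - 1 + - 1" using p by (simp add: Ig)
      have "eqv (a_mod A) (conv D D ns w) 0"
        by (rule conv_D_D[OF b_cochain' b_b]) (use w in \<open>auto simp: words_iff n\<close>)
      from ev_eqv[OF this] eqv_minus[OF this, THEN ev_eqv]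
      have z: "ev r s (if c then conv D D ns w else - conv D D ns w) = \<zero>\<^bsub>T r s\<^esub>" for r s c
        by (simp add: ev_zero)
      have len: "csum ns - sum_list ns = length ns" by (simp add: csum_eq)
      show "t.total (- 1) (- 1) e face face I n q (ev n q (frag_of w)) = \<zero>\<^bsub>T (n - length I) (q + length I - 2)\<^esub>"
        unfolding n Ig t.total_word[OF rep p' w[unfolded n]] z length_gl len by simp
    qed (auto intro: T_module lin_maps_const_zero x)
  qed
  have dd: "dT n (q - 1) (dT n q x) = \<zero>\<^bsub>T n (q - 1 - 1)\<^esub>" if x: "x \<in> carrier (T n q)" for n q x
  proof (cases "2 \<le> q")
    case True
    then have p: "0 \<le> int q + - 1 + - 1" by simp
    have "dT n (q - 1) (dT n q x) = \<zero>\<^bsub>T n (q - 2)\<^esub>"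
      using zero[OF index_tuples_Nil _ x, of 0] True
      unfolding t.total_Nil[OF rep p x] by (simp add: signed_def opc_def face_def)
    moreover have "q - 1 - 1 = q - 2" by simp
    ultimately show ?thesis by (simp only:)
  next
    case False
    then have q: "q - 1 = 0" by simp
    have "dT n q x \<in> carrier (T n 0)" using lin_maps_closed[OF tensor_diff_lin x] by (simp only: q)
    from dT_0[OF this] show ?thesis unfolding q by simp
  qed
  have faces: "hom_diff (T (n - length I) (q + length I - 2)) (- 1) (dT (n - length I) (q + length I - 1)) (tensor_face R A I n) (dT n) q x =
      split_sum (T (n - length I) (q + length I - 2)) 1 (inner_splits I) I
        (\<lambda>J L. tensor_face R A J (n - length L) (q + length L - 1) (tensor_face R A L n q x))"
    if I: "I \<in> index_tuples n" "I \<noteq> []" and x: "x \<in> carrier (T n q)" for n q I x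
  proof -
    let ?M = "T (n - length I) (q + length I - 2)"
    interpret M: module R ?M by (rule T_module)
    have s: "sorted_wrt (<) I" using I(1) by (simp add: index_tuples_def)
    have fI: "tensor_face R A I n q x = face I n q x" for q x using I(2) by (simp add: face_def)
    have fx: "face I n q x \<in> carrier (T (n - length I) (q + length I - 1))" by (rule face_closed[OF x I(1)])
    have d: "dT (n - length I) (q + length I - 1) (face I n q x) \<in> carrier ?M"
    proof -
      have "q + length I - 1 - 1 = q + length I - 2" by simp
      with lin_maps_closed[OF tensor_diff_lin fx] show ?thesis by (simp only:)
    qed
    show ?thesis
    proof (cases "2 \<le> q + length I")
      \<comment> \<open>The remaining case is a face of length one on degree 0: there is no inner
        splitting, and the differential of an element of degree 0 is 0.\<close>
      case False
      moreover have "length I \<noteq> 0" using I(2) by simp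
      ultimately have q: "q = 0" "length I = 1" by linarith+
      have "\<not> (1 \<le> m \<and> m < length I)" for m using q(2) by linarith
      then have "inner_splits I = {}" unfolding inner_splits_def by blast
      then have sum: "split_sum ?M 1 (inner_splits I) I \<phi> = \<zero>\<^bsub>?M\<^esub>" for \<phi>
        by (simp only: split_sum_def M.finsum_empty)
      have z: "q + length I - 1 = 0" "q + length I - 2 = 0" using q by simp_all
      have "face I n q x \<in> carrier (T (n - length I) 0)" using fx by (simp only: z)
      from dT_0[OF this] show ?thesis
        unfolding sum unfolding hom_diff_def if_P[OF q(1)] fI z .
    next
      case True
      then have p: "0 \<le> int q + int (length I) + - 1 + - 1" by simp
      let ?\<phi> = "opc ?M (- 1) face face n q x"
      have cl: "?\<phi> (lft I L) (rgt L) \<in> carrier ?M" if "L \<subseteq> set I" for L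
        using t.opc_closed[OF rep I(1) that p x] by simp
      note inner = split_sum_inner[OF s M.abelian_group_axioms, of ?\<phi>, OF cl I(2)]
      have tot: "t.total (- 1) (- 1) 1 face face I n q x = (\<Oplus>\<^bsub>?M\<^esub>L\<in>Pow (set I). split_term I ?M 1 ?\<phi> L)"
        by (simp add: t.total_def)
      \<comment> \<open>With e = 1 both end terms enter negatively. They are the two composites of
        the face with the differential, so solving for the inner sum gives the required
        equation.\<close>
      have rel: "\<zero>\<^bsub>?M\<^esub> = split_sum ?M 1 (inner_splits I) I ?\<phi> \<oplus>\<^bsub>?M\<^esub> \<ominus>\<^bsub>?M\<^esub> ?\<phi> I [] \<oplus>\<^bsub>?M\<^esub> \<ominus>\<^bsub>?M\<^esub> ?\<phi> [] I"
        using inner(1)[of 1] tot zero[OF I(1) True x, of 1] by (simp add: signed_def)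
      have ecl: "?\<phi> I [] \<in> carrier ?M" "?\<phi> [] I \<in> carrier ?M"
        using cl[OF empty_subsetI] cl[OF order_refl]
        by (simp_all only: lft_empty[OF s] lft_full[OF s] rgt_full[OF s] sorted_list_of_set_empty)
      have sum: "split_sum ?M 1 (inner_splits I) I ?\<phi> = ?\<phi> I [] \<oplus>\<^bsub>?M\<^esub> ?\<phi> [] I"
        by (rule M.move_inner[OF inner(2) ecl rel])
      have ends: "?\<phi> [] I = dT (n - length I) (q + length I - 1) (face I n q x)"
        "?\<phi> I [] = (if q = 0 then \<zero>\<^bsub>?M\<^esub> else face I n (q - 1) (dT n q x))"
        using I(2) True by (simp_all add: opc_def face_def)
      have inn: "split_sum ?M 1 (inner_splits I) I ?\<phi> = split_sum ?M 1 (inner_splits I) I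
          (\<lambda>J L. tensor_face R A J (n - length L) (q + length L - 1) (tensor_face R A L n q x))"
        (is "_ = split_sum _ _ _ _ ?\<psi>")
        proof (rule split_sum_cong[OF s M.abelian_group_axioms])
        fix L assume L: "L \<subseteq> set I" "L \<noteq> {}" "L \<noteq> set I"
        have ne: "(lft I L = []) = False" "(rgt L = []) = False" "(int q + int (card L) + - 1 < 0) = False"
          "(int q + int (card L) + 0 < 0) = False" "(int q + int (card L) + 1 < 0) = False"
          using nonempty_parts[OF s L] by simp_all
        show "?\<phi> (lft I L) (rgt L) = ?\<psi> (lft I L) (rgt L)"
          by (simp only: opc_def face_def ne if_False deg_simps length_sorted_list_of_set)
      qed (rule cl)
      have u: "tensor_face R A I n = face I n" using I(2) by (simp add: fun_eq_iff face_def)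
      have "hom_diff ?M (- 1) (dT (n - length I) (q + length I - 1)) (face I n) (dT n) q x =
          ?\<phi> [] I \<ominus>\<^bsub>?M\<^esub> signed ?M (- 1) (?\<phi> I [])"
        unfolding ends by (rule hom_diff_eq[OF M.abelian_group_axioms]) (rule d)
      also have "\<dots> = ?\<phi> I [] \<oplus>\<^bsub>?M\<^esub> ?\<phi> [] I"
        using ecl by (simp only: signed_def a_minus_def M.minus_minus M.a_comm even_minus odd_one if_False)
      finally show ?thesis by (simp only: u sum[symmetric] inn)
    qed
  qed
  have lin: "tensor_face R A I n q \<in> lin_maps R (T n q) (T (n - length I) (q + length I - 1))"
    if "I \<in> index_tuples n" "I \<noteq> []" for I n q
    using self.representsD(1)[OF face_represents that(1), of q] that(2) by (simp add: face_def)
  show ?thesis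
    unfolding is_isf_def diff_module_def tensor_functor_def
    using T_module tensor_diff_lin dT_0 dd faces lin by (simp add: Let_def)
qed

end

lemma (in abelian_group) neg_zero: "\<ominus> \<zero> = \<zero>"
  by (metis r_neg l_zero a_inv_closed zero_closed)

section \<open>The tensor functor on morphisms and homotopies\<close>

context ainf_pair
begin

abbreviation "TM \<equiv> tensor_functor_mor R A B"

lemma TM_closed: "mor_ok f \<Longrightarrow> I \<in> index_tuples n \<Longrightarrow> x \<in> carrier (A.T n q) \<Longrightarrow>
    TM f I n q x \<in> carrier (B.T (n - length I) (q + length I))"
  using lin_maps_closed[OF representsD(1)[OF mor_represents]] by simp

lemma tensor_functor_morphism:
  assumes f: "mor_ok f"
  shows "isf_morphism R (tensor_functor R A) (tensor_functor R B) (TM f)"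
proof -
  interpret s: graded_triple R "a_mod A" "a_mod B" "a_mod B" by unfold_locales
  interpret t: graded_triple R "a_mod A" "a_mod A" "a_mod B" by unfold_locales
  note srep = B.face_represents mor_represents[OF f] and trep = mor_represents[OF f] A.face_represents
  \<comment> \<open>Both orders of composing with the faces have the same total, including the
    differential; the difference of the two subset sums therefore vanishes, and its end terms are
    those of the definition.\<close>
  have eq: "s.total (- 1) 0 e B.face (TM f) I n q x = t.total 0 (- 1) e (TM f) A.face I n q x"
    if I: "I \<in> index_tuples n" and pos: "1 \<le> q + length I" and x: "x \<in> carrier (A.T n q)" for e I n q x
  proof -
    have p: "0 \<le> int q + int (length I) + - 1 + 0" "0 \<le> int q + int (length I) + 0 + - 1" using pos by simp_all
    show ?thesis
    proof (rule family_ext[OF I _ _ B.T_module, where u = "s.total (- 1) 0 e B.face (TM f) I n q"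
          and v = "t.total 0 (- 1) e (TM f) A.face I n q"])
      show "s.total (- 1) 0 e B.face (TM f) I n q \<in> lin_maps R (A.T n q) (B.T (n - length I) (q + length I - 1))"
        using s.total_lin[OF srep I p(1)] by simp
      show "t.total 0 (- 1) e (TM f) A.face I n q \<in> lin_maps R (A.T n q) (B.T (n - length I) (q + length I - 1))"
        using t.total_lin[OF trep I p(2)] by simp
      show "s.total (- 1) 0 e B.face (TM f) I n q x = t.total 0 (- 1) e (TM f) A.face I n q x"
        if "\<not> set I \<subseteq> {1..<n}" "x \<in> carrier (A.T n q)" for x
        using s.total_outside[OF srep I that(1) p(1) that(2)] t.total_outside[OF trep I that(1) p(2) that(2)] by simp
      fix ns w assume n: "n = csum ns" and Ig: "I = gl 0 ns" and w: "w \<in> words (a_mod A) n q"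
      have p': "0 \<le> int q + int (sum_list ns) + - 1 + 0" "0 \<le> int q + int (sum_list ns) + 0 + - 1"
        using p by (simp_all add: Ig)
      have e: "eqv (a_mod B) (conv B.D (Fs (fb f)) ns w) (conv (Fs (fb f)) A.D ns w)"
        by (rule conv_D_Fs[OF A.b_cochain' mor_ok_cochain[OF f] mor_ok_eqv[OF f]])
          (use w in \<open>simp_all add: words_iff n\<close>)
      have ev: "B.ev r s (if c then conv B.D (Fs (fb f)) ns w else - conv B.D (Fs (fb f)) ns w) =
          B.ev r s (if c then conv (Fs (fb f)) A.D ns w else - conv (Fs (fb f)) A.D ns w)" for r s c
        using B.ev_eqv[OF e] B.ev_eqv[OF eqv_minus[OF e]] by simp
      show "s.total (- 1) 0 e B.face (TM f) I n q (A.ev n q (frag_of w)) =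
          t.total 0 (- 1) e (TM f) A.face I n q (A.ev n q (frag_of w))"
        unfolding n Ig s.total_word[OF srep p'(1) w[unfolded n]] t.total_word[OF trep p'(2) w[unfolded n]] ev
        by simp
    qed (rule x)
  qed
  have base: "hom_diff (B.T n (q - 1)) 0 (B.dT n q) (TM f [] n) (A.dT n) q x = \<zero>\<^bsub>B.T n (q - 1)\<^esub>"
    if x: "x \<in> carrier (A.T n q)" for n q x
  proof -
    have fx: "TM f [] n q x \<in> carrier (B.T n q)" using TM_closed[OF f index_tuples_Nil x] by simp
    interpret M: module R "B.T n (q - 1)" by (rule B.T_module)
    show ?thesis
    proof (cases "q = 0")
      case True
      then show ?thesis using B.dT_0 fx by (simp add: hom_diff_def)
    next
      \<comment> \<open>In positive degree the empty tuple says that the zeroth component commutes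
        with the differential.\<close>
      case False
      then have p: "0 \<le> int q + - 1 + 0" "0 \<le> int q + 0 + - 1" by simp_all
      have "B.dT n q (TM f [] n q x) = TM f [] n (q - 1) (A.dT n q x)"
        using eq[OF index_tuples_Nil _ x, of 0] False
        unfolding s.total_Nil[OF srep p(1) x] t.total_Nil[OF trep p(2) x]
        by (simp add: signed_def opc_def A.face_def B.face_def)
      then show ?thesis
        using False lin_maps_closed[OF B.tensor_diff_lin fx]
        by (simp add: hom_diff_def signed_def a_minus_def M.r_neg del: One_nat_def)
    qed
  qed
  have faces: "hom_diff (B.T (n - length I) (q + length I - 1)) 0 (B.dT (n - length I) (q + length I)) (TM f I n) (A.dT n) q x =
      (\<ominus>\<^bsub>B.T (n - length I) (q + length I - 1)\<^esub> (tensor_face R B I n q (TM f [] n q x)))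
      \<oplus>\<^bsub>B.T (n - length I) (q + length I - 1)\<^esub> TM f [] (n - length I) (q + length I - 1) (tensor_face R A I n q x)
      \<oplus>\<^bsub>B.T (n - length I) (q + length I - 1)\<^esub> split_sum (B.T (n - length I) (q + length I - 1)) 1 (inner_splits I) I
        (\<lambda>J L. tensor_face R B J (n - length L) (q + length L) (TM f L n q x)
          \<ominus>\<^bsub>B.T (n - length I) (q + length I - 1)\<^esub> TM f J (n - length L) (q + length L - 1) (tensor_face R A L n q x))"
    if I: "I \<in> index_tuples n" "I \<noteq> []" and x: "x \<in> carrier (A.T n q)" for n q I x
  proof -
    let ?M = "B.T (n - length I) (q + length I - 1)"
    interpret M: module R ?M by (rule B.T_module)
    have s: "sorted_wrt (<) I" using I(1) by (simp add: index_tuples_def)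
    have pos: "1 \<le> q + length I" using I(2) by (cases I) simp_all
    then have p: "0 \<le> int q + int (length I) + - 1 + 0" "0 \<le> int q + int (length I) + 0 + - 1" by simp_all
    let ?\<phi>1 = "opc ?M 0 B.face (TM f) n q x" and ?\<phi>2 = "opc ?M (- 1) (TM f) A.face n q x"
    let ?\<phi> = "\<lambda>J L. ?\<phi>1 J L \<ominus>\<^bsub>?M\<^esub> ?\<phi>2 J L"
    have cl1: "?\<phi>1 (lft I L) (rgt L) \<in> carrier ?M" if "L \<subseteq> set I" for L
      using s.opc_closed[OF srep I(1) that p(1) x] by simp
    have cl2: "?\<phi>2 (lft I L) (rgt L) \<in> carrier ?M" if "L \<subseteq> set I" for L
      using t.opc_closed[OF trep I(1) that p(2) x] by simp
    have cl: "?\<phi> (lft I L) (rgt L) \<in> carrier ?M" if "L \<subseteq> set I" for L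
      by (rule abelian_group.minus_closed[OF M.abelian_group_axioms cl1[OF that] cl2[OF that]])
    note inner = split_sum_inner[OF s M.abelian_group_axioms, of ?\<phi>, OF cl I(2)]
    have "(\<Oplus>\<^bsub>?M\<^esub>L\<in>Pow (set I). split_term I ?M 1 ?\<phi> L) =
        s.total (- 1) 0 1 B.face (TM f) I n q x \<ominus>\<^bsub>?M\<^esub> t.total 0 (- 1) 1 (TM f) A.face I n q x"
      unfolding s.total_def t.total_def
      using split_terms_add(2)[OF s M.abelian_group_axioms, of ?\<phi>1 ?\<phi>2, OF cl1 cl2] by simp
    also have "t.total 0 (- 1) 1 (TM f) A.face I n q x = s.total (- 1) 0 1 B.face (TM f) I n q x"
      by (rule eq[OF I(1) pos x, symmetric])
    also have "s.total (- 1) 0 1 B.face (TM f) I n q x \<ominus>\<^bsub>?M\<^esub> s.total (- 1) 0 1 B.face (TM f) I n q x = \<zero>\<^bsub>?M\<^esub>"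
      using lin_maps_closed[OF s.total_lin[OF srep I(1) p(1)] x]
      by (simp add: a_minus_def M.r_neg del: One_nat_def)
    finally have zero: "\<zero>\<^bsub>?M\<^esub> = split_sum ?M 1 (inner_splits I) I ?\<phi> \<oplus>\<^bsub>?M\<^esub> \<ominus>\<^bsub>?M\<^esub> ?\<phi> I [] \<oplus>\<^bsub>?M\<^esub> \<ominus>\<^bsub>?M\<^esub> ?\<phi> [] I"
      using inner(1)[of 1] by (simp add: signed_def)
    have ends: "?\<phi>1 I [] = tensor_face R B I n q (TM f [] n q x)"
      "?\<phi>2 I [] = (if q = 0 then \<zero>\<^bsub>?M\<^esub> else TM f I n (q - 1) (A.dT n q x))"
      "?\<phi>1 [] I = B.dT (n - length I) (q + length I) (TM f I n q x)"
      "?\<phi>2 [] I = TM f [] (n - length I) (q + length I - 1) (tensor_face R A I n q x)"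
      using I(2) pos by (simp_all add: opc_def A.face_def B.face_def)
    have ecl: "?\<phi>1 I [] \<in> carrier ?M" "?\<phi>2 I [] \<in> carrier ?M" "?\<phi>1 [] I \<in> carrier ?M" "?\<phi>2 [] I \<in> carrier ?M"
      using cl1[OF empty_subsetI] cl1[OF order_refl] cl2[OF empty_subsetI] cl2[OF order_refl]
      by (simp_all only: lft_empty[OF s] lft_full[OF s] rgt_full[OF s] sorted_list_of_set_empty)
    have "?\<phi>1 [] I \<ominus>\<^bsub>?M\<^esub> ?\<phi>2 I [] = (\<ominus>\<^bsub>?M\<^esub> ?\<phi>1 I []) \<oplus>\<^bsub>?M\<^esub> ?\<phi>2 [] I \<oplus>\<^bsub>?M\<^esub> split_sum ?M 1 (inner_splits I) I ?\<phi>"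
      by (rule M.move_inner_mor[OF inner(2) ecl zero])
    moreover have "split_sum ?M 1 (inner_splits I) I ?\<phi> = split_sum ?M 1 (inner_splits I) I
        (\<lambda>J L. tensor_face R B J (n - length L) (q + length L) (TM f L n q x)
          \<ominus>\<^bsub>?M\<^esub> TM f J (n - length L) (q + length L - 1) (tensor_face R A L n q x))"
        (is "_ = split_sum _ _ _ _ ?\<psi>")
      proof (rule split_sum_cong[OF s M.abelian_group_axioms])
        fix L assume L: "L \<subseteq> set I" "L \<noteq> {}" "L \<noteq> set I"
        have ne: "(lft I L = []) = False" "(rgt L = []) = False" "(int q + int (card L) + - 1 < 0) = False"
          "(int q + int (card L) + 0 < 0) = False" "(int q + int (card L) + 1 < 0) = False"
          using nonempty_parts[OF s L] by simp_all
        show "?\<phi> (lft I L) (rgt L) = ?\<psi> (lft I L) (rgt L)"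
          by (simp only: opc_def A.face_def B.face_def ne if_False deg_simps length_sorted_list_of_set)
      qed (rule cl)
    moreover have "hom_diff ?M 0 (B.dT (n - length I) (q + length I)) (TM f I n) (A.dT n) q x = ?\<phi>1 [] I \<ominus>\<^bsub>?M\<^esub> ?\<phi>2 I []"
      using hom_diff_eq[OF M.abelian_group_axioms, where dY = "B.dT (n - length I) (q + length I)" and u = "TM f I n" and q = q and x = x and e = 0 and dX = "A.dT n"]
        ecl(3) unfolding ends by (simp add: signed_def)
    ultimately show ?thesis by (simp only: ends)
  qed
  have lin: "TM f I n q \<in> lin_maps R (A.T n q) (B.T (n - length I) (q + length I))"
    if "I \<in> index_tuples n" for I n q
    using representsD(1)[OF mor_represents[OF f] that, of q] by simp
  show ?thesis
    unfolding isf_morphism_def tensor_functor_def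
    using base faces lin by (simp add: Let_def)
qed

lemma tensor_functor_homotopy:
  assumes f: "mor_ok f" and g: "mor_ok g" and h: "ainf_homotopy R A B f g h"
  shows "isf_homotopy R (tensor_functor R A) (tensor_functor R B) (TM f) (TM g) (tensor_hty f g h)"
proof -
  interpret s: graded_triple R "a_mod A" "a_mod B" "a_mod B" by unfold_locales
  interpret t: graded_triple R "a_mod A" "a_mod A" "a_mod B" by unfold_locales
  note hlin = homotopy_lin[OF h]
  note hrep = hty_represents[OF f g hlin]
  note srep = B.face_represents hrep and trep = hrep A.face_represents
  note frep = mor_represents[OF f] and grep = mor_represents[OF g]
  let ?H = "tensor_hty f g h"
  have Hcl: "?H I n q x \<in> carrier (B.T (n - length I) (q + length I + 1))" if "I \<in> index_tuples n" "x \<in> carrier (A.T n q)" for I n q x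
    using lin_maps_closed[OF representsD(1)[OF hrep that(1)] that(2)] by simp
  \<comment> \<open>The sign of e stands on the right because the splitting sums carry it while the
    components of f and g do not.\<close>
  have eq: "s.total (- 1) 1 e B.face ?H I n q x \<oplus>\<^bsub>B.T (n - length I) (q + length I)\<^esub> t.total 1 (- 1) e ?H A.face I n q x =
      signed (B.T (n - length I) (q + length I)) e (TM f I n q x \<ominus>\<^bsub>B.T (n - length I) (q + length I)\<^esub> TM g I n q x)"
    if I: "I \<in> index_tuples n" and x: "x \<in> carrier (A.T n q)" for e I n q x
  proof -
    let ?M = "B.T (n - length I) (q + length I)"
    interpret M: module R ?M by (rule B.T_module)
    have p: "0 \<le> int q + int (length I) + - 1 + 1" "0 \<le> int q + int (length I) + 1 + - 1" by simp_all
    note l1 = s.total_lin[OF srep I p(1), of e, simplified] and l2 = t.total_lin[OF trep I p(2), of e, simplified]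
    note fl = representsD(1)[OF frep I, of q, simplified] and gl' = representsD(1)[OF grep I, of q, simplified]
    show ?thesis
    proof (rule family_ext[OF I _ _ B.T_module, where
          u = "\<lambda>x. s.total (- 1) 1 e B.face ?H I n q x \<oplus>\<^bsub>?M\<^esub> t.total 1 (- 1) e ?H A.face I n q x"
          and v = "\<lambda>x. signed ?M e (TM f I n q x \<ominus>\<^bsub>?M\<^esub> TM g I n q x)"])
      show "(\<lambda>x. s.total (- 1) 1 e B.face ?H I n q x \<oplus>\<^bsub>?M\<^esub> t.total 1 (- 1) e ?H A.face I n q x) \<in> lin_maps R (A.T n q) ?M"
        by (rule lin_maps_plus[OF B.T_module l1 l2])
      show "(\<lambda>x. signed ?M e (TM f I n q x \<ominus>\<^bsub>?M\<^esub> TM g I n q x)) \<in> lin_maps R (A.T n q) ?M"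
        by (rule lin_maps_signed_fun[OF B.T_module lin_maps_diff[OF B.T_module fl gl']])
      show "s.total (- 1) 1 e B.face ?H I n q x \<oplus>\<^bsub>?M\<^esub> t.total 1 (- 1) e ?H A.face I n q x =
          signed ?M e (TM f I n q x \<ominus>\<^bsub>?M\<^esub> TM g I n q x)"
        if o: "\<not> set I \<subseteq> {1..<n}" "x \<in> carrier (A.T n q)" for x
        using s.total_outside[OF srep I o(1) p(1) o(2)] t.total_outside[OF trep I o(1) p(2) o(2)]
          representsD(2)[OF frep I o] representsD(2)[OF grep I o]
        by (simp add: signed_def a_minus_def abelian_group.neg_zero[OF M.abelian_group_axioms])
      fix ns w assume n: "n = csum ns" and Ig: "I = gl 0 ns" and w: "w \<in> words (a_mod A) n q"
      have p': "0 \<le> int q + int (sum_list ns) + - 1 + 1" "0 \<le> int q + int (sum_list ns) + 1 + - 1"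
        "0 \<le> int q + int (sum_list ns) + 0" by simp_all
      have v: "valid (a_mod A) w" "length w = csum ns" using w by (simp_all add: words_iff n)
      define F G X Y where "F = Fs (fb f) ns w" and "G = Fs (fb g) ns w"
        and "X = conv B.D (Hs (fb f) (fb g) (hb h)) ns w" and "Y = conv (Hs (fb f) (fb g) (hb h)) A.D ns w"
      have e: "eqv (a_mod B) (X + Y) (F - G)"
        unfolding F_def G_def X_def Y_def
        by (rule conv_D_Hs[OF A.b_cochain' mor_ok_cochain[OF f] mor_ok_cochain[OF g]
              homog_cochain[OF hbar_homog[OF hlin]] mor_ok_eqv[OF f] mor_ok_eqv[OF g]
              homotopy_relation[OF h mor_ok_lin[OF f] mor_ok_lin[OF g]] v]) simp_all
      have z: "- 1 + 1 = (0 :: int)" "1 + - 1 = (0 :: int)" by simp_all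
      let ?c = "rsign 0 (gl 0 ns) (csum ns) q"
      let ?ev = "B.ev (length ns) (q + sum_list ns)"
      have len: "csum ns - sum_list ns = length ns" by (simp add: csum_eq)
      have "?ev (if even (?c + e) then X else - X) \<oplus>\<^bsub>B.T (length ns) (q + sum_list ns)\<^esub> ?ev (if even (?c + e) then Y else - Y) =
          ?ev (if even (?c + e) then X + Y else - (X + Y))"
        unfolding B.ev_add[symmetric] by simp
      also have "\<dots> = ?ev (if even (?c + e) then F - G else - (F - G))"
        using B.ev_eqv[OF e] B.ev_eqv[OF eqv_minus[OF e]] by simp
      also have "\<dots> = ?ev (if even e then (if even ?c then F else - F) - (if even ?c then G else - G)
          else - ((if even ?c then F else - F) - (if even ?c then G else - G)))"
        by (intro arg_cong[where f = ?ev]) auto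
      finally have val: "?ev (if even (?c + e) then X else - X) \<oplus>\<^bsub>B.T (length ns) (q + sum_list ns)\<^esub> ?ev (if even (?c + e) then Y else - Y) =
        signed (B.T (length ns) (q + sum_list ns)) e (?ev (if even ?c then F else - F) \<ominus>\<^bsub>B.T (length ns) (q + sum_list ns)\<^esub> ?ev (if even ?c then G else - G))"
        unfolding B.ev_diff[symmetric] B.signed_ev .
      show "s.total (- 1) 1 e B.face ?H I n q (A.ev n q (frag_of w)) \<oplus>\<^bsub>?M\<^esub> t.total 1 (- 1) e ?H A.face I n q (A.ev n q (frag_of w)) =
          signed ?M e (TM f I n q (A.ev n q (frag_of w)) \<ominus>\<^bsub>?M\<^esub> TM g I n q (A.ev n q (frag_of w)))"
        unfolding n Ig s.total_word[OF srep p'(1) w[unfolded n]] t.total_word[OF trep p'(2) w[unfolded n]]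
          representsD(5)[OF frep w[unfolded n] p'(3)] representsD(5)[OF grep w[unfolded n] p'(3)] length_gl len z deg_simps B.signed_ev
          X_def[symmetric] Y_def[symmetric] F_def[symmetric] G_def[symmetric]
        by (rule val)
    qed (rule x)
  qed
  have base: "hom_diff (B.T n q) 1 (B.dT n (q + 1)) (?H [] n) (A.dT n) q x = TM f [] n q x \<ominus>\<^bsub>B.T n q\<^esub> TM g [] n q x"
    if x: "x \<in> carrier (A.T n q)" for n q x
  proof -
    interpret M: module R "B.T n q" by (rule B.T_module)
    have p: "0 \<le> int q + - 1 + 1" "0 \<le> int q + 1 + - 1" by simp_all
    have hx: "B.dT n (q + 1) (?H [] n q x) \<in> carrier (B.T n q)"
      using lin_maps_closed[OF B.tensor_diff_lin Hcl[OF index_tuples_Nil x]] by simp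
    have "B.dT n (q + 1) (?H [] n q x) \<oplus>\<^bsub>B.T n q\<^esub> (if q = 0 then \<zero>\<^bsub>B.T n q\<^esub> else ?H [] n (q - 1) (A.dT n q x)) =
        TM f [] n q x \<ominus>\<^bsub>B.T n q\<^esub> TM g [] n q x"
      using eq[OF index_tuples_Nil x, of 0]
      unfolding s.total_Nil[OF srep p(1) x] t.total_Nil[OF trep p(2) x]
      by (cases "q = 0") (simp_all add: signed_def opc_def A.face_def B.face_def)
    moreover have "(if q = 0 then \<zero>\<^bsub>B.T n q\<^esub> else ?H [] n (q - 1) (A.dT n q x)) \<in> carrier (B.T n q)"
      using Hcl[OF index_tuples_Nil lin_maps_closed[OF A.tensor_diff_lin x]]
        B.ev_closed[of n 0 0, unfolded B.ev_zero] by auto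
    ultimately show ?thesis
      using hx by (simp add: hom_diff_eq[OF M.abelian_group_axioms] signed_def a_minus_def)
  qed
  have faces: "hom_diff (B.T (n - length I) (q + length I)) 1 (B.dT (n - length I) (q + length I + 1)) (?H I n) (A.dT n) q x =
      (TM f I n q x \<ominus>\<^bsub>B.T (n - length I) (q + length I)\<^esub> TM g I n q x
        \<ominus>\<^bsub>B.T (n - length I) (q + length I)\<^esub> tensor_face R B I n (q + 1) (?H [] n q x)
        \<ominus>\<^bsub>B.T (n - length I) (q + length I)\<^esub> ?H [] (n - length I) (q + length I - 1) (tensor_face R A I n q x))
      \<oplus>\<^bsub>B.T (n - length I) (q + length I)\<^esub> split_sum (B.T (n - length I) (q + length I)) 1 (inner_splits I) I
        (\<lambda>J L. tensor_face R B J (n - length L) (q + length L + 1) (?H L n q x)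
          \<oplus>\<^bsub>B.T (n - length I) (q + length I)\<^esub> ?H J (n - length L) (q + length L - 1) (tensor_face R A L n q x))"
    if I: "I \<in> index_tuples n" "I \<noteq> []" and x: "x \<in> carrier (A.T n q)" for n q I x
  proof -
    let ?M = "B.T (n - length I) (q + length I)"
    interpret M: module R ?M by (rule B.T_module)
    have s: "sorted_wrt (<) I" using I(1) by (simp add: index_tuples_def)
    have pos: "1 \<le> q + length I" using I(2) by (cases I) simp_all
    have p: "0 \<le> int q + int (length I) + - 1 + 1" "0 \<le> int q + int (length I) + 1 + - 1" by simp_all
    let ?\<phi>1 = "opc ?M 1 B.face ?H n q x" and ?\<phi>2 = "opc ?M (- 1) ?H A.face n q x"
    let ?\<phi> = "\<lambda>J L. ?\<phi>1 J L \<oplus>\<^bsub>?M\<^esub> ?\<phi>2 J L"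
    have cl1: "?\<phi>1 (lft I L) (rgt L) \<in> carrier ?M" if "L \<subseteq> set I" for L
      using s.opc_closed[OF srep I(1) that p(1) x] by simp
    have cl2: "?\<phi>2 (lft I L) (rgt L) \<in> carrier ?M" if "L \<subseteq> set I" for L
      using t.opc_closed[OF trep I(1) that p(2) x] by simp
    have cl: "?\<phi> (lft I L) (rgt L) \<in> carrier ?M" if "L \<subseteq> set I" for L
      using cl1[OF that] cl2[OF that] by simp
    note inner = split_sum_inner[OF s M.abelian_group_axioms, of ?\<phi>, OF cl I(2)]
    have "(\<Oplus>\<^bsub>?M\<^esub>L\<in>Pow (set I). split_term I ?M 1 ?\<phi> L) =
        s.total (- 1) 1 1 B.face ?H I n q x \<oplus>\<^bsub>?M\<^esub> t.total 1 (- 1) 1 ?H A.face I n q x"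
      unfolding s.total_def t.total_def
      using split_terms_add(1)[OF s M.abelian_group_axioms, of ?\<phi>1 ?\<phi>2, OF cl1 cl2] by simp
    \<comment> \<open>With e = 1 the right side is -(f - g), and \<open>move_inner_hty\<close>
      solves for the terms with d.\<close>
    also have "\<dots> = \<ominus>\<^bsub>?M\<^esub> (TM f I n q x \<ominus>\<^bsub>?M\<^esub> TM g I n q x)"
      unfolding eq[OF I(1) x] by (simp add: signed_def)
    finally have sum: "\<ominus>\<^bsub>?M\<^esub> (TM f I n q x \<ominus>\<^bsub>?M\<^esub> TM g I n q x) =
        split_sum ?M 1 (inner_splits I) I ?\<phi> \<oplus>\<^bsub>?M\<^esub> \<ominus>\<^bsub>?M\<^esub> ?\<phi> I [] \<oplus>\<^bsub>?M\<^esub> \<ominus>\<^bsub>?M\<^esub> ?\<phi> [] I"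
      using inner(1)[of 1] by (simp add: signed_def)
    have ends: "?\<phi>1 I [] = tensor_face R B I n (q + 1) (?H [] n q x)"
      "?\<phi>2 I [] = (if q = 0 then \<zero>\<^bsub>?M\<^esub> else ?H I n (q - 1) (A.dT n q x))"
      "?\<phi>1 [] I = B.dT (n - length I) (q + length I + 1) (?H I n q x)"
      "?\<phi>2 [] I = ?H [] (n - length I) (q + length I - 1) (tensor_face R A I n q x)"
      using I(2) pos by (simp_all add: opc_def A.face_def B.face_def)
    have ecl: "?\<phi>1 I [] \<in> carrier ?M" "?\<phi>2 I [] \<in> carrier ?M" "?\<phi>1 [] I \<in> carrier ?M" "?\<phi>2 [] I \<in> carrier ?M"
      using cl1[OF empty_subsetI] cl1[OF order_refl] cl2[OF empty_subsetI] cl2[OF order_refl]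
      by (simp_all only: lft_empty[OF s] lft_full[OF s] rgt_full[OF s] sorted_list_of_set_empty)
    have "?\<phi>1 [] I \<oplus>\<^bsub>?M\<^esub> ?\<phi>2 I [] = (TM f I n q x \<ominus>\<^bsub>?M\<^esub> TM g I n q x \<ominus>\<^bsub>?M\<^esub> ?\<phi>1 I [] \<ominus>\<^bsub>?M\<^esub> ?\<phi>2 [] I)
        \<oplus>\<^bsub>?M\<^esub> split_sum ?M 1 (inner_splits I) I ?\<phi>"
      by (rule M.move_inner_hty[OF inner(2) ecl TM_closed[OF f I(1) x] TM_closed[OF g I(1) x] sum])
    moreover have "split_sum ?M 1 (inner_splits I) I ?\<phi> = split_sum ?M 1 (inner_splits I) I
        (\<lambda>J L. tensor_face R B J (n - length L) (q + length L + 1) (?H L n q x)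
          \<oplus>\<^bsub>?M\<^esub> ?H J (n - length L) (q + length L - 1) (tensor_face R A L n q x))"
        (is "_ = split_sum _ _ _ _ ?\<psi>")
      proof (rule split_sum_cong[OF s M.abelian_group_axioms])
        fix L assume L: "L \<subseteq> set I" "L \<noteq> {}" "L \<noteq> set I"
        have ne: "(lft I L = []) = False" "(rgt L = []) = False" "(int q + int (card L) + - 1 < 0) = False"
          "(int q + int (card L) + 0 < 0) = False" "(int q + int (card L) + 1 < 0) = False"
          using nonempty_parts[OF s L] by simp_all
        show "?\<phi> (lft I L) (rgt L) = ?\<psi> (lft I L) (rgt L)"
          by (simp only: opc_def A.face_def B.face_def ne if_False deg_simps length_sorted_list_of_set)
      qed (rule cl)
    moreover have "hom_diff ?M 1 (B.dT (n - length I) (q + length I + 1)) (?H I n) (A.dT n) q x = ?\<phi>1 [] I \<oplus>\<^bsub>?M\<^esub> ?\<phi>2 I []"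
      using hom_diff_eq[OF M.abelian_group_axioms, where dY = "B.dT (n - length I) (q + length I + 1)" and u = "?H I n" and q = q and x = x and e = 1 and dX = "A.dT n"]
        ecl(2,3) unfolding ends by (simp add: signed_def a_minus_def)
    ultimately show ?thesis by (simp only: ends)
  qed
  have lin: "?H I n q \<in> lin_maps R (A.T n q) (B.T (n - length I) (q + length I + 1))"
    if "I \<in> index_tuples n" for I n q
    using representsD(1)[OF hrep that, of q] by simp
  show ?thesis
    unfolding isf_homotopy_def tensor_functor_def
    using base faces lin by (simp add: Let_def)
qed

end

section \<open>Functoriality and the homotopy equivalence\<close>

lemma isf_homotopy_cong:
  assumes "isf_homotopy R X Y f g h"
    and "\<And>I n q x. I \<in> index_tuples n \<Longrightarrow> x \<in> carrier (s_mod X n q) \<Longrightarrow> f' I n q x = f I n q x"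
    and "\<And>I n q x. I \<in> index_tuples n \<Longrightarrow> x \<in> carrier (s_mod X n q) \<Longrightarrow> g' I n q x = g I n q x"
  shows "isf_homotopy R X Y f' g' h"
  using assms(1) unfolding isf_homotopy_def by (simp add: assms(2,3) Let_def)

text \<open>The composition formula is a full subset sum with e = 0, hence a composition of
  blockwise families, and \<open>conv_Fs_Fs\<close> identifies that with the blockwise family of the
  composite.\<close>

lemma (in ainf_triple) tensor_functor_comp:
  assumes f: "AB.mor_ok f" and g: "BC.mor_ok g" and I: "I \<in> index_tuples n" and x: "x \<in> carrier (AB.A.T n q)"
  shows "isf_comp (tensor_functor R C) (tensor_functor_mor R B C g) (tensor_functor_mor R A B f) I n q x =
    tensor_functor_mor R A C (ainf_comp R A B C g f) I n q x"
proof -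
  interpret t: graded_triple R "a_mod A" "a_mod B" "a_mod C" by unfold_locales
  note rep = BC.mor_represents[OF g] AB.mor_represents[OF f]
  note crep = AC.mor_represents[OF comp_ok[OF f g]]
  let ?G = "tensor_functor_mor R B C g" and ?F = "tensor_functor_mor R A B f"
    and ?H = "tensor_functor_mor R A C (ainf_comp R A B C g f)" and ?M = "BC.B.T (n - length I) (q + length I)"
  have s: "sorted_wrt (<) I" using I by (simp add: index_tuples_def)
  have p: "0 \<le> int q + int (length I) + 0 + 0" by simp
  have opc: "opc ?M 0 ?G ?F n q x = (\<lambda>J L. ?G J (n - length L) (q + length L) (?F L n q x))"
    by (simp add: fun_eq_iff opc_def)
  have "split_sum ?M 0 (all_splits I) I (opc ?M 0 ?G ?F n q x) =
      (\<Oplus>\<^bsub>?M\<^esub>L\<in>Pow (set I). split_term I ?M 0 (opc ?M 0 ?G ?F n q x) L)"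
    by (rule split_sum_all[OF s module.axioms(2)[OF BC.B.T_module]])
      (use t.opc_closed[OF rep I _ p x] in simp)
  then have "isf_comp (tensor_functor R C) ?G ?F I n q x = t.total 0 0 0 ?G ?F I n q x"
    by (simp add: isf_comp_def tensor_functor_def t.total_def opc)
  also have "\<dots> = ?H I n q x"
  proof (rule AC.family_ext[OF I _ _ BC.B.T_module, where u = "t.total 0 0 0 ?G ?F I n q" and v = "?H I n q"])
    show "t.total 0 0 0 ?G ?F I n q \<in> lin_maps R (AB.A.T n q) ?M" using t.total_lin[OF rep I p] by simp
    show "?H I n q \<in> lin_maps R (AB.A.T n q) ?M" using AC.representsD(1)[OF crep I, of q] by simp
    show "t.total 0 0 0 ?G ?F I n q x = ?H I n q x"
      if o: "\<not> set I \<subseteq> {1..<n}" "x \<in> carrier (AB.A.T n q)" for x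
      using t.total_outside[OF rep I o(1) p o(2)] AC.representsD(2)[OF crep I o] by simp
    fix ns w assume n: "n = csum ns" and Ig: "I = gl 0 ns" and w: "w \<in> words (a_mod A) n q"
    have p': "0 \<le> int q + int (sum_list ns) + 0 + 0" "0 \<le> int q + int (sum_list ns) + 0" by simp_all
    have v: "valid (a_mod A) w" "length w = csum ns" using w by (simp_all add: words_iff n)
    have "eqv (a_mod C) (Fs (AC.fb (ainf_comp R A B C g f)) ns w) (Fs (comp (BC.fb g) (Fs (AB.fb f))) ns w)"
      by (rule eqv_Fs[OF comp_fbar[OF f g] v])
    also have "Fs (comp (BC.fb g) (Fs (AB.fb f))) ns w = conv (Fs (BC.fb g)) (Fs (AB.fb f)) ns w"
      by (rule conv_Fs_Fs[OF cochain_shifts[OF AB.mor_ok_cochain[OF f]] v(2), symmetric])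
    finally have e: "eqv (a_mod C) (conv (Fs (BC.fb g)) (Fs (AB.fb f)) ns w) (Fs (AC.fb (ainf_comp R A B C g f)) ns w)"
      by (rule eqv_sym)
    show "t.total 0 0 0 ?G ?F I n q (AB.A.ev n q (frag_of w)) = ?H I n q (AB.A.ev n q (frag_of w))"
      unfolding n Ig t.total_word[OF rep p'(1) w[unfolded n]] AC.representsD(5)[OF crep w[unfolded n] p'(2)] BC.B.signed_ev
      using BC.B.ev_eqv[OF e] BC.B.ev_eqv[OF eqv_minus[OF e]] by simp
  qed (rule x)
  finally show ?thesis .
qed

text \<open>A nonempty gap list means that some block is long, and there the blockwise identity
  vanishes; for the empty list it returns the word, and \<open>rsign\<close> is even.\<close>

lemma (in ainf_alg) tensor_functor_id:
  assumes I: "I \<in> index_tuples n" and x: "x \<in> carrier (T n q)"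
  shows "isf_id (tensor_functor R A) I n q x = tensor_functor_mor R A A (ainf_id R A) I n q x"
proof -
  interpret P: ainf_pair R A A by unfold_locales
  note rep = P.mor_represents[OF id_ok]
  let ?H = "tensor_functor_mor R A A (ainf_id R A)" and ?M = "T (n - length I) (q + length I)"
  let ?id = "\<lambda>x. if I = [] then x else \<zero>\<^bsub>?M\<^esub>"
  have "?id x = ?H I n q x"
  proof (rule self.family_ext[OF I _ _ T_module, where u = ?id and v = "?H I n q"])
    show "?id \<in> lin_maps R (T n q) ?M"
      by (cases "I = []") (simp_all add: lin_maps_id lin_maps_const_zero[OF T_module])
    show "?H I n q \<in> lin_maps R (T n q) ?M" using self.representsD(1)[OF rep I, of q] by simp
    show "?id x = ?H I n q x" if o: "\<not> set I \<subseteq> {1..<n}" "x \<in> carrier (T n q)" for x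
      using self.representsD(2)[OF rep I o] o(1) by auto
    fix ns w assume n: "n = csum ns" and Ig: "I = gl 0 ns" and w: "w \<in> words (a_mod A) n q"
    have p: "0 \<le> int q + int (sum_list ns) + 0" by simp
    have v: "valid (a_mod A) w" "length w = csum ns" using w by (simp_all add: words_iff n)
    have "eqv (a_mod A) (Fs (P.fb (ainf_id R A)) ns w) (Fs (idc (a_mod A)) ns w)"
      by (rule eqv_Fs[OF id_fbar v])
    also have "Fs (idc (a_mod A)) ns w = (if set ns \<subseteq> {0} then frag_of w else 0)" by (rule Fs_idc[OF v])
    finally have e: "eqv (a_mod A) (Fs (P.fb (ainf_id R A)) ns w) (if set ns \<subseteq> {0} then frag_of w else 0)" .
    have z: "set ns \<subseteq> {0} \<longleftrightarrow> sum_list ns = 0" by auto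
    have empty: "gl 0 ns = [] \<longleftrightarrow> sum_list ns = 0" using length_gl[of 0 ns] by (metis length_0_conv)
    have len: "csum ns - sum_list ns = length ns" by (simp add: csum_eq)
    note val = self.representsD(5)[OF rep w[unfolded n] p]
    show "?id (ev n q (frag_of w)) = ?H I n q (ev n q (frag_of w))"
    proof (cases "sum_list ns = 0")
      case True
      then have g: "gl 0 ns = []" and zt: "set ns \<subseteq> {0}" using empty z by blast+
      have c: "even (rsign 0 (gl 0 ns) (csum ns) q)" unfolding g by (simp add: rsign_def numeral_2_eq_2)
      have cn: "csum ns = length ns" using True by (simp add: csum_eq)
      show ?thesis
        unfolding n Ig val signed_ev if_P[OF c] if_P[OF g] ev_eqv[OF e[unfolded if_P[OF zt]]]
        by (simp add: cn True)
    next
      case False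
      have g: "gl 0 ns \<noteq> []" using False by (simp only: empty not_False_eq_True)
      have zf: "\<not> set ns \<subseteq> {0}" using False by (simp only: z not_False_eq_True)
      note e0 = e[unfolded if_not_P[OF zf]]
      show ?thesis
        unfolding n Ig val signed_ev if_not_P[OF g] using len
        by (simp add: ev_eqv[OF e0] ev_eqv[OF eqv_minus[OF e0]] ev_zero)
    qed
  qed (rule x)
  then show ?thesis by (cases "I = []") (simp_all add: isf_id_def tensor_functor_def)
qed

lemma (in ainf_triple) tensor_functor_homotopy_id:
  assumes f: "AB.mor_ok f" and g: "ainf_pair.mor_ok R B A g"
    and h: "ainf_homotopy R A A (ainf_comp R A B A g f) (ainf_id R A) h"
  shows "\<exists>h'. isf_homotopy R (tensor_functor R A) (tensor_functor R A)
    (isf_comp (tensor_functor R A) (tensor_functor_mor R B A g) (tensor_functor_mor R A B f))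
    (isf_id (tensor_functor R A)) h'"
proof -
  interpret t: ainf_triple R A B A by unfold_locales
  have mod: "s_mod (tensor_functor R A) = tensor_power R (a_mod A)" by (simp add: tensor_functor_def)
  have "isf_homotopy R (tensor_functor R A) (tensor_functor R A)
    (isf_comp (tensor_functor R A) (tensor_functor_mor R B A g) (tensor_functor_mor R A B f))
    (isf_id (tensor_functor R A)) (ainf_pair.tensor_hty R A A (ainf_comp R A B A g f) (ainf_id R A) h)"
    \<comment> \<open>The composite and the identity agree with the images under the functor only on
      carriers and admissible tuples, so the homotopy is transferred by congruence.\<close>
    by (rule isf_homotopy_cong[OF t.AC.tensor_functor_homotopy[OF t.comp_ok[OF f g] AB.A.id_ok h]])
      (simp_all only: mod t.tensor_functor_comp[OF f g] AB.A.tensor_functor_id)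
  then show ?thesis by blast
qed

theorem corollary3p1:
  fixes R :: "('k, 'r) ring_scheme"
    and A :: "('k, 'a) ainf"
    and A' :: "('k, 'b) ainf"
  assumes "cring R"
    and "is_ainf R A" and "is_ainf R A'"
    and "ainf_homotopy_equivalent R A A'"
  shows "is_isf R (tensor_functor R A) \<and> is_isf R (tensor_functor R A') \<and>
         isf_homotopy_equivalent R (tensor_functor R A) (tensor_functor R A')"
proof -
  interpret P: ainf_pair R A A' by (intro ainf_pair.intro ainf_alg.intro) (fact assms)+
  interpret Q: ainf_pair R A' A by (intro ainf_pair.intro ainf_alg.intro) (fact assms)+
  interpret PQ: ainf_triple R A A' A by (intro ainf_triple.intro) unfold_locales
  interpret QP: ainf_triple R A' A A' by (intro ainf_triple.intro) unfold_locales
  obtain f g h h' where f: "ainf_morphism R A A' f" and g: "ainf_morphism R A' A g"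
    and h: "ainf_homotopy R A A (ainf_comp R A A' A g f) (ainf_id R A) h"
    and h': "ainf_homotopy R A' A' (ainf_comp R A' A A' f g) (ainf_id R A') h'"
    using assms(4) unfolding ainf_homotopy_equivalent_def by blast
  note f_ok = P.morphism_ok[OF f] and g_ok = Q.morphism_ok[OF g]
  \<comment> \<open>The second homotopy is the first construction with the roles of A and A'
    exchanged.\<close>
  have "isf_homotopy_equivalent R (tensor_functor R A) (tensor_functor R A')"
    unfolding isf_homotopy_equivalent_def
    using P.tensor_functor_morphism[OF f_ok] Q.tensor_functor_morphism[OF g_ok]
      PQ.tensor_functor_homotopy_id[OF f_ok g_ok h] QP.tensor_functor_homotopy_id[OF g_ok f_ok h'] by blast
  then show ?thesis using P.A.tensor_functor_isf P.B.tensor_functor_isf by blast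
qed

end
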